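(* Assume the full setting of the context (stationary ergodic environment, $\alpha\in(0,2)$, the assumptions on $\tilde\mu$ and $\mu$, and the assumptions on $\tilde b$ and its stream functions $\tilde H_{jl}$). Let $f\in C_c^1(\mathbb{R}^d)$ and $\lambda>0$. Then for $\mathbb{P}$-a.s. $\omega\in\Omega$ the following holds. Let $(u^{\varepsilon,\omega}_{\lambda,f})_{\varepsilon\in(0,1)}$ be a family with $u^{\varepsilon,\omega}_{\lambda,f}\in\mathcal{F}_0^{\varepsilon,\omega}$ such that for every $\varepsilon\in(0,1)$ $$\mathcal{E}^{\varepsilon,\omega}(u^{\varepsilon,\omega}_{\lambda,f},g)+\lambda\int_{\mathbb{R}^d}u^{\varepsilon,\omega}_{\lambda,f}(x)g(x)\,dx=\int_{\mathbb{R}^d}f(x)g(x)\,dx\qquad\text{for all } g\in C_c^1(\mathbb{R}^d),$$ and such that $$\sup_{\varepsilon\in(0,1)}\|u^{\varepsilon,\omega}_{\lambda,f}\|_{L^2(\mathbb{R}^d)}<\infty,\quad \sup_{\varepsilon\in(0,1)}\|u^{\varepsilon,\omega}_{\lambda,f}\|_{W^{\alpha/2,2}(\mathbb{R}^d)}<\infty,\quad \sup_{\varepsilon\in(0,1)}\mathcal{E}_0^{\varepsilon,\omega}(u^{\varepsilon,\omega}_{\lambda,f},u^{\varepsilon,\omega}_{\lambda,f})<\infty .$$ Then for every bounded (measurable) subset $O\subset\mathbb{R}^d$, $$\lim_{\varepsilon\to0}\int_O|u^{\varepsilon,\omega}_{\lambda,f}(x)-\bar u_{\lambda,f}(x)|^2\,dx=0,$$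 where $\bar u_{\lambda,f}$ is the unique solution in $L^2(\mathbb{R}^d)$ of $$\lambda\bar u_{\lambda,f}(x)-\bar L\bar u_{\lambda,f}(x)=f(x),\quad x\in\mathbb{R}^d,$$ with $$\bar L g(x):=\mathrm{p.v.}\int_{\mathbb{R}^d}\big(g(x+z)-g(x)\big)\frac{(\mathbb{E}[\tilde\mu])^2}{|z|^{d+\alpha}}\,dz,\quad g\in C_c^2(\mathbb{R}^d).$$
   Context: Environment. Let $d\ge1$ and let $(\Omega,\mathcal{F},\mathbb{P})$ be a probability space with expectation $\mathbb{E}$, endowed with a group of measurable maps $\tau_x:\Omega\to\Omega$, $x\in\mathbb{R}^d$, such that $\tau_0=\mathrm{id}$ and $\tau_x\circ\tau_y=\tau_{x+y}$; $\mathbb{P}(\tau_xA)=\mathbb{P}(A)$ for all $A\in\mathcal{F}$, $x\in\mathbb{R}^d$ (stationarity); if $A\in\mathcal{F}$ and $\tau_xA=A$ for all $x$, then $\mathbb{P}(A)\in\{0,1\}$ (ergodicity); and $(x,\omega)\mapsto\tau_x\omega$ is $\mathscr{B}(\mathbb{R}^d)\times\mathcal{F}$-measurable. Derivatives on $\Omega$. For $F\in L^2(\Omega;\mathbb{P})$ let $T_xF(\omega)=F(\tau_{-x}\omega)$ and $D_jF:=\lim_{\varepsilon\downarrow0}\varepsilon^{-1}(T_{\varepsilon e_j}F-F)$ (limit in $L^2(\Omega;\mathbb{P})$, when it exists), where $(e_j)$ is the canonical basis of $\mathbb{R}^d$. Thus, when $D_jF$ exists, $D_jF(\tau_x\omega)=-\partial_{x_j}[F(\tau_x\omega)]$.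 Let $\mathscr{D}$ be the set of $F\in L^\infty(\Omega;\mathbb{P})$ such that $D_jF$ and $D_kD_jF$ exist and belong to $L^\infty(\Omega;\mathbb{P})$ for all $1\le j,k\le d$. Let $\mathcal{H}_1$ be the closure of $\mathscr{D}$ under the norm given by $\|F\|_{\mathcal{H}_1}^2=\mathbb{E}[F^2]+\sum_{j=1}^d\mathbb{E}[|D_jF|^2]$; the $D_j$ extend to $\mathcal{H}_1$. Assumptions on $\mu$. Fix $\alpha\in(0,2)$. $\tilde\mu:\Omega\to(0,\infty)$ is a random variable with $\inf_{\omega\in\Omega}\tilde\mu(\omega)\ge\theta_0>0$ for some constant $\theta_0$ and $\mathbb{E}[\tilde\mu^2]<\infty$. Put $\mu(x;\omega):=\tilde\mu(\tau_x\omega)$. It is assumed that for $\mathbb{P}$-a.e. $\omega$ the function $x\mapsto\int_{\mathbb{R}^d}(1\wedge|z|^2)\frac{\mu(x;\omega)\mu(x+z;\omega)}{|z|^{d+\alpha}}\,dz$ is in $L^1_{loc}(\mathbb{R}^d;dx)$. Assumptions on the drift. $\tilde b=(\tilde b_1,\dots,\tilde b_d):\Omega\to\mathbb{R}^d$ is a random vector for which there exist stream functions $\tilde H_{jl}:\Omega\to\mathbb{R}$, $1\le j,l\le d$, with: (i) $\tilde H_{jl}\in\mathcal{H}_1$; (ii) $\tilde H_{jl}=-\tilde H_{lj}$; (iii) $\tilde b_j=\sum_{l=1}^dD_l\tilde H_{jl}$ for every $j$; (iv) for a.s. $\omega$ and all $j,l$, $x\mapsto D_l\tilde H_{jl}(\tau_x\omega)$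 is continuous. Put $b_j(x;\omega):=\tilde b_j(\tau_x\omega)$. Forms. For $\varepsilon\in(0,1)$, $$\mathcal{E}_0^{\varepsilon,\omega}(f,g):=\frac12\iint_{x\ne y}(f(x)-f(y))(g(x)-g(y))\frac{\mu(x/\varepsilon;\omega)\mu(y/\varepsilon;\omega)}{|x-y|^{d+\alpha}}\,dx\,dy,$$ and $\mathcal{F}_0^{\varepsilon,\omega}$ is the closure of $C_c^1(\mathbb{R}^d)$ (compactly supported $C^1$ functions) with respect to $\|f\|_{\mathcal{E}_0^{\varepsilon,\omega}}=(\mathcal{E}_0^{\varepsilon,\omega}(f,f)+\|f\|_{L^2(\mathbb{R}^d)}^2)^{1/2}$. For $f\in\mathcal{F}_0^{\varepsilon,\omega}$ and $g\in C_c^1(\mathbb{R}^d)$, $$\mathcal{E}^{\varepsilon,\omega}(f,g):=\mathcal{E}_0^{\varepsilon,\omega}(f,g)-\varepsilon^{-(\alpha-1)}\sum_{j=1}^d\int_{\mathbb{R}^d}b_j\!\left(\frac{x}{\varepsilon};\omega\right)\frac{\partial g(x)}{\partial x_j}f(x)\,dx.$$ $W^{\alpha/2,2}(\mathbb{R}^d)$ is the fractional Sobolev space with squared norm (up to equivalence) $\iint\frac{(g(x+z)-g(x))^2}{|z|^{d+\alpha}}dz\,dx+\|g\|_{L^2}^2$. Limit equation. A function $u\in L^2(\mathbb{R}^d)$ solves $\lambda u-\bar Lu=f$ in the weak sense: $\lambda\int u g\,dx-\int u\,\bar Lg\,dx=\int fg\,dx$ for all $g\in C_c^2(\mathbb{R}^d)$.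 *)

theory Defs
  imports "HOL-Probability.Probability"
begin

text \<open>
  Elements of \<open>L\<^sup>2\<close> and \<open>L\<^sup>\<infinity>\<close> are represented by measurable functions (not by equivalence
  classes); identities between them are stated almost everywhere.
\<close>

definition L2_space :: "'a measure \<Rightarrow> ('a \<Rightarrow> real) set" where
  "L2_space M = {f \<in> borel_measurable M. integrable M (\<lambda>x. (f x)\<^sup>2)}"

definition L2_norm :: "'a measure \<Rightarrow> ('a \<Rightarrow> real) \<Rightarrow> real" where
  "L2_norm M f = sqrt (LINT x|M. (f x)\<^sup>2)"

definition Linf_space :: "'a measure \<Rightarrow> ('a \<Rightarrow> real) set" where
  "Linf_space M = {f \<in> borel_measurable M. \<exists>C. AE x in M. \<bar>f x\<bar> \<le> C}"

definition partial :: "'n::finite \<Rightarrow> (real^'n \<Rightarrow> real) \<Rightarrow> real^'n \<Rightarrow> real" where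
  "partial j g x = frechet_derivative g (at x) (axis j 1)"

primrec C_k :: "nat \<Rightarrow> (real^'n::finite \<Rightarrow> real) \<Rightarrow> bool" where
  "C_k 0 g \<longleftrightarrow> continuous_on UNIV g"
| "C_k (Suc k) g \<longleftrightarrow> (\<forall>x. g differentiable (at x)) \<and> (\<forall>j. C_k k (partial j g))"

definition Cc_k :: "nat \<Rightarrow> (real^'n::finite \<Rightarrow> real) set" where
  "Cc_k k = {g. C_k k g \<and> compact (closure {x. g x \<noteq> 0})}"

definition frac_kernel :: "real \<Rightarrow> real^'n::finite \<Rightarrow> real" where
  "frac_kernel \<alpha> z = 1 / norm z powr (real CARD('n) + \<alpha>)"

definition frac_sobolev_space :: "real \<Rightarrow> (real^'n::finite \<Rightarrow> real) set" where
  "frac_sobolev_space \<alpha> = {g \<in> L2_space lborel.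
     integrable (lborel \<Otimes>\<^sub>M lborel) (\<lambda>(x, z). (g (x + z) - g x)\<^sup>2 * frac_kernel \<alpha> z)}"

definition frac_sobolev_norm :: "real \<Rightarrow> (real^'n::finite \<Rightarrow> real) \<Rightarrow> real" where
  "frac_sobolev_norm \<alpha> g =
     sqrt ((LINT (x, z)|(lborel \<Otimes>\<^sub>M lborel). (g (x + z) - g x)\<^sup>2 * frac_kernel \<alpha> z)
           + (L2_norm lborel g)\<^sup>2)"

locale stationary_ergodic_environment = prob_space M
  for M :: "'w measure" and \<tau> :: "real^'n::finite \<Rightarrow> 'w \<Rightarrow> 'w" +
  assumes shift_measurable: "\<And>x. \<tau> x \<in> M \<rightarrow>\<^sub>M M"
    and shift_zero: "\<And>\<omega>. \<omega> \<in> space M \<Longrightarrow> \<tau> 0 \<omega> = \<omega>"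
    and shift_add: "\<And>x y \<omega>. \<omega> \<in> space M \<Longrightarrow> \<tau> x (\<tau> y \<omega>) = \<tau> (x + y) \<omega>"
    and stationary: "\<And>x A. A \<in> sets M \<Longrightarrow> measure M (\<tau> x ` A) = measure M A"
    and ergodic: "\<And>A. \<lbrakk>A \<in> sets M; \<And>x. \<tau> x ` A = A\<rbrakk> \<Longrightarrow> measure M A \<in> {0, 1}"
    and jointly_measurable: "(\<lambda>(x, \<omega>). \<tau> x \<omega>) \<in> borel \<Otimes>\<^sub>M M \<rightarrow>\<^sub>M M"

text \<open>\<open>has_D M \<tau> j F G\<close>: \<open>G\<close> is a version of \<open>D\<^sub>j F\<close>, the limit being taken in \<open>L\<^sup>2\<close>.\<close>

definition has_D ::
  "'w measure \<Rightarrow> (real^'n::finite \<Rightarrow> 'w \<Rightarrow> 'w) \<Rightarrow> 'n \<Rightarrow> ('w \<Rightarrow> real) \<Rightarrow> ('w \<Rightarrow> real) \<Rightarrow> bool" where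
  "has_D M \<tau> j F G \<longleftrightarrow> F \<in> L2_space M \<and> G \<in> L2_space M \<and>
     ((\<lambda>\<epsilon>. L2_norm M (\<lambda>\<omega>. (F (\<tau> (- (\<epsilon> *\<^sub>R axis j 1)) \<omega>) - F \<omega>) / \<epsilon> - G \<omega>)) \<longlongrightarrow> 0) (at_right 0)"

definition D_core :: "'w measure \<Rightarrow> (real^'n::finite \<Rightarrow> 'w \<Rightarrow> 'w) \<Rightarrow> ('w \<Rightarrow> real) set" where
  "D_core M \<tau> = {F \<in> Linf_space M. \<forall>j. \<exists>G \<in> Linf_space M. has_D M \<tau> j F G \<and>
                   (\<forall>k. \<exists>K \<in> Linf_space M. has_D M \<tau> k G K)}"

text \<open>
  \<open>has_H1_grad M \<tau> F G\<close>: \<open>F\<close> lies in the closure \<open>\<H>\<^sub>1\<close> of \<open>D_core\<close> and, for every \<open>j\<close>, \<open>G j\<close> is a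
  version of the extended derivative \<open>D\<^sub>j F\<close>, i.e. \<open>F\<close> and the \<open>G j\<close> are the \<open>L\<^sup>2\<close> limits of
  \<open>\<Phi> n\<close> and \<open>D\<^sub>j (\<Phi> n)\<close> along an approximating sequence.
\<close>

definition has_H1_grad ::
  "'w measure \<Rightarrow> (real^'n::finite \<Rightarrow> 'w \<Rightarrow> 'w) \<Rightarrow> ('w \<Rightarrow> real) \<Rightarrow> ('n \<Rightarrow> 'w \<Rightarrow> real) \<Rightarrow> bool" where
  "has_H1_grad M \<tau> F G \<longleftrightarrow> F \<in> L2_space M \<and> (\<forall>j. G j \<in> L2_space M) \<and>
     (\<exists>\<Phi> \<Gamma>. (\<forall>n. \<Phi> n \<in> D_core M \<tau>) \<and> (\<forall>n j. has_D M \<tau> j (\<Phi> n) (\<Gamma> n j)) \<and>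
        (\<lambda>n::nat. sqrt ((LINT \<omega>|M. (\<Phi> n \<omega> - F \<omega>)\<^sup>2)
                   + (\<Sum>j\<in>UNIV. LINT \<omega>|M. (\<Gamma> n j \<omega> - G j \<omega>)\<^sup>2))) \<longlonglongrightarrow> 0)"

definition H1_space :: "'w measure \<Rightarrow> (real^'n::finite \<Rightarrow> 'w \<Rightarrow> 'w) \<Rightarrow> ('w \<Rightarrow> real) set" where
  "H1_space M \<tau> = {F. \<exists>G. has_H1_grad M \<tau> F G}"

text \<open>
  In \<open>is_stream_matrix\<close>, \<open>D j l k\<close> is a version of \<open>D\<^sub>k H\<^sub>j\<^sub>l\<close>; since such derivatives are only
  determined almost surely, the continuity of \<open>x \<mapsto> D\<^sub>l H\<^sub>j\<^sub>l (\<tau>\<^sub>x \<omega>)\<close> is a condition on a suitable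
  version.
\<close>

definition is_stream_matrix ::
  "'w measure \<Rightarrow> (real^'n::finite \<Rightarrow> 'w \<Rightarrow> 'w) \<Rightarrow> ('w \<Rightarrow> real^'n) \<Rightarrow> ('n \<Rightarrow> 'n \<Rightarrow> 'w \<Rightarrow> real) \<Rightarrow> bool"
where
  "is_stream_matrix M \<tau> b H \<longleftrightarrow>
     (\<forall>j l. H j l \<in> H1_space M \<tau>) \<and>
     (\<forall>j l. AE \<omega> in M. H j l \<omega> = - H l j \<omega>) \<and>
     (\<exists>D. (\<forall>j l. has_H1_grad M \<tau> (H j l) (D j l)) \<and>
          (\<forall>j. AE \<omega> in M. b \<omega> $ j = (\<Sum>l\<in>UNIV. D j l l \<omega>)) \<and>
          (AE \<omega> in M. \<forall>j l. continuous_on UNIV (\<lambda>x. D j l l (\<tau> x \<omega>))))"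

text \<open>
  Below, \<open>m\<close> and \<open>v\<close> stand for the realisations \<open>\<mu>(\<cdot>;\<omega>)\<close> and \<open>b(\<cdot>;\<omega>)\<close> at a fixed \<open>\<omega>\<close>; the scaling
  \<open>x/\<epsilon>\<close> is part of the forms.
\<close>

definition E0_density ::
  "real \<Rightarrow> (real^'n::finite \<Rightarrow> real) \<Rightarrow> real \<Rightarrow> (real^'n \<Rightarrow> real) \<Rightarrow> (real^'n \<Rightarrow> real) \<Rightarrow>
   (real^'n) \<times> (real^'n) \<Rightarrow> real" where
  "E0_density \<alpha> m \<epsilon> f g = (\<lambda>(x, y). (f x - f y) * (g x - g y) *
     (m (x /\<^sub>R \<epsilon>) * m (y /\<^sub>R \<epsilon>) * frac_kernel \<alpha> (x - y)))"

definition E0_form ::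
  "real \<Rightarrow> (real^'n::finite \<Rightarrow> real) \<Rightarrow> real \<Rightarrow> (real^'n \<Rightarrow> real) \<Rightarrow> (real^'n \<Rightarrow> real) \<Rightarrow> real" where
  "E0_form \<alpha> m \<epsilon> f g =
     1 / 2 * (LINT p:{(x, y). x \<noteq> y}|(lborel \<Otimes>\<^sub>M lborel). E0_density \<alpha> m \<epsilon> f g p)"

definition E0_finite ::
  "real \<Rightarrow> (real^'n::finite \<Rightarrow> real) \<Rightarrow> real \<Rightarrow> (real^'n \<Rightarrow> real) set" where
  "E0_finite \<alpha> m \<epsilon> = {f \<in> L2_space lborel.
     set_integrable (lborel \<Otimes>\<^sub>M lborel) {(x, y). x \<noteq> y} (E0_density \<alpha> m \<epsilon> f f)}"

definition E0_norm ::
  "real \<Rightarrow> (real^'n::finite \<Rightarrow> real) \<Rightarrow> real \<Rightarrow> (real^'n \<Rightarrow> real) \<Rightarrow> real" where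
  "E0_norm \<alpha> m \<epsilon> f = sqrt (E0_form \<alpha> m \<epsilon> f f + (L2_norm lborel f)\<^sup>2)"

text \<open>
  The closure of \<open>C\<^sub>c\<^sup>1\<close>. The intersection with \<open>E0_finite\<close> keeps all occurring Bochner integrals
  meaningful; it removes nothing for those \<open>m\<close> for which \<open>C\<^sub>c\<^sup>1\<close> functions have finite energy,
  which is ensured almost surely by the local integrability assumption on \<open>\<mu>\<close>.
\<close>

definition F0_space ::
  "real \<Rightarrow> (real^'n::finite \<Rightarrow> real) \<Rightarrow> real \<Rightarrow> (real^'n \<Rightarrow> real) set" where
  "F0_space \<alpha> m \<epsilon> = {f \<in> E0_finite \<alpha> m \<epsilon>.
     \<exists>\<phi>. (\<forall>n. \<phi> n \<in> Cc_k 1 \<inter> E0_finite \<alpha> m \<epsilon>) \<and>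
         (\<lambda>n::nat. E0_norm \<alpha> m \<epsilon> (\<lambda>x. \<phi> n x - f x)) \<longlonglongrightarrow> 0}"

definition E_form ::
  "real \<Rightarrow> (real^'n::finite \<Rightarrow> real) \<Rightarrow> (real^'n \<Rightarrow> real^'n) \<Rightarrow> real \<Rightarrow>
   (real^'n \<Rightarrow> real) \<Rightarrow> (real^'n \<Rightarrow> real) \<Rightarrow> real" where
  "E_form \<alpha> m v \<epsilon> f g = E0_form \<alpha> m \<epsilon> f g -
     \<epsilon> powr (- (\<alpha> - 1)) * (\<Sum>j\<in>UNIV. LINT x|lborel. v (x /\<^sub>R \<epsilon>) $ j * partial j g x * f x)"

definition L_bar :: "real \<Rightarrow> real \<Rightarrow> (real^'n::finite \<Rightarrow> real) \<Rightarrow> real^'n \<Rightarrow> real" where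
  "L_bar \<alpha> c g x =
     Lim (at_right 0) (\<lambda>\<delta>. LINT z:{z. norm z > \<delta>}|lborel. (g (x + z) - g x) * (c * frac_kernel \<alpha> z))"

definition weak_solution ::
  "real \<Rightarrow> real \<Rightarrow> real \<Rightarrow> (real^'n::finite \<Rightarrow> real) \<Rightarrow> (real^'n \<Rightarrow> real) \<Rightarrow> bool" where
  "weak_solution \<alpha> c lam f u \<longleftrightarrow> u \<in> L2_space lborel \<and>
     (\<forall>g \<in> Cc_k 2. lam * (LINT x|lborel. u x * g x) - (LINT x|lborel. u x * L_bar \<alpha> c g x)
                   = (LINT x|lborel. f x * g x))"

end

theory Submission
 imports Defs
begin

text \<open>
 Fix a realisation of the medium, write \<open>m\<close> and \<open>v\<close> for the weight and the drift seen along the orbit, and let \<open>u\<close> solve the equation at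
 scale \<open>eps\<close>. Everything rests on the claim that, for a fixed test function \<open>g\<close> of class \<open>C\<^sup>2\<close> with compact support, the equation
 tested with \<open>g\<close> becomes \<open>\<integral> u (lam g - L_bar g) = \<integral> f g\<close> up to an error that vanishes with \<open>eps\<close>, uniformly over the functions \<open>u\<close>
 with bounded norms and energy (\<open>equation_limit\<close>).

 From the probability space only two facts are needed, both valid for almost every realisation. The averages of \<open>m\<close>, of its square
 and of the squares of the stream functions and their derivatives over large balls are bounded; this is a maximal inequality, obtained
 from Vitali's covering lemma and transferred to the probability space by stationarity. And the averages of \<open>m\<close> over balls of a large
 but fixed radius differ from the expectation by a function whose averages over large balls are small (\<open>pointwise_ergodic\<close>, from the
 mean ergodic theorem and the maximal inequality). The second fact makes \<open>m (x / eps)\<close> converge weakly to its expectation, uniformly over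
 equicontinuous families of test functions (\<open>homogenisesI\<close>).

 The drift disappears because it is the divergence of an antisymmetric matrix. Mollify \<open>u\<close> at scale \<open>eps\<close>: the fractional Sobolev
 bound makes the error of order \<open>eps\<^bsup>\<alpha>/2\<^esup>\<close> and the gradient of the mollification of order \<open>eps\<^bsup>\<alpha>/2 - 1\<^esup>\<close>. After an integration
 by parts, in which antisymmetry removes the second derivatives of \<open>g\<close>, the drift term is of order \<open>eps\<^bsup>1 - \<alpha>/2\<^esup>\<close>, which vanishes
 since \<open>\<alpha> < 2\<close> (\<open>drift_bound\<close>).

 In the jump part the kernel is split into a continuous part with compact support and a remainder. The remainder is controlled by the
 energy of \<open>u\<close> and the averages of \<open>m\<^sup>2\<close>. In the continuous part both weights can be replaced by their expectation one after the other,
 after \<open>u\<close> has been mollified at a fixed scale (\<open>jump_form_limit\<close>).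

 It remains to invert the limit equation. The range of \<open>lam - L_bar\<close> on the test functions is dense in \<open>L\<^sup>2\<close>
 (\<open>resolvent_range_dense\<close>), which together with the dissipativity of \<open>L_bar\<close> yields existence and uniqueness of \<open>ubar\<close> as well as weak
 convergence of \<open>u\<close> to \<open>ubar\<close>. Weak convergence becomes locally uniform after mollification, and the fractional bound makes the
 mollification error small uniformly in \<open>eps\<close>; hence the convergence is strong on bounded sets (\<open>strong_convergence\<close>).
\<close>


section \<open>Square integrable functions and averages\<close>

abbreviation (input) L2n :: "('a::euclidean_space => real) => real" where "L2n == L2_norm lborel"
abbreviation (input) L2s :: "('a::euclidean_space => real) set" where "L2s == L2_space lborel"
abbreviation (input) borel_fun :: "('a::topological_space => 'b::topological_space) set" where "borel_fun == borel_measurable borel"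
abbreviation (input) nn_lborel :: "('a::euclidean_space => ennreal) => ennreal" (binder "NBINT " 10) where
 "nn_lborel f == integral\<^sup>N lborel f"

lemmas lint_cong = Bochner_Integration.integral_cong
 and lint_bound = Bochner_Integration.integrable_bound
 and lint_add = Bochner_Integration.integral_add
 and lint_diff = Bochner_Integration.integral_diff

lemma L2_spaceD:
 assumes "f \<in> L2_space M"
 shows "f \<in> borel_measurable M" "integrable M (%x. (f x)^2)"
 using assms by (auto simp: L2_space_def)

lemma L2_norm_nonneg [simp]: "0 <= L2_norm M f"
 by (simp add: L2_norm_def)

lemma L2_norm_square: "(L2_norm M f)^2 = (LINT x|M. (f x)^2)"
 by (simp add: L2_norm_def)

lemma L2_prod_integrable:
 assumes "f \<in> L2_space M" "g \<in> L2_space M"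
 shows "integrable M (%x. f x * g x)"
proof (rule lint_bound)
 show "integrable M (%x. (f x)^2 + (g x)^2)"
  using assms by (auto dest: L2_spaceD)
 show "(%x. f x * g x) \<in> borel_measurable M"
  using assms by (rule borel_measurable_times[OF L2_spaceD(1) L2_spaceD(1)])
 have "\<bar>a * b\<bar> <= a^2 + b^2" for a b :: real
  using sum_squares_bound[of "\<bar>a\<bar>" "\<bar>b\<bar>"] mult_nonneg_nonneg[of "\<bar>a\<bar>" "\<bar>b\<bar>"]
  unfolding abs_mult power2_abs by linarith
 then show "AE x in M. norm (f x * g x) <= norm ((f x)^2 + (g x)^2)"
  by auto
qed

lemma L2_Cauchy_Schwarz:
 assumes "f \<in> L2_space M" "g \<in> L2_space M"
 shows "\<bar>LINT x|M. f x * g x\<bar> <= L2_norm M f * L2_norm M g"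
proof -
 define a b c where "a = (LINT x|M. (f x)^2)" "b = (LINT x|M. f x * g x)" "c = (LINT x|M. (g x)^2)"
 note i = L2_spaceD(2)[OF assms(1)] L2_spaceD(2)[OF assms(2)] L2_prod_integrable[OF assms]
 have q: "0 <= s^2 * a + 2 * s * t * b + t^2 * c" for s t
 proof -
  have "0 <= (LINT x|M. (s * f x + t * g x)^2)" by simp
  also have "... = (LINT x|M. s^2 * (f x)^2 + 2 * s * t * (f x * g x) + t^2 * (g x)^2)"
   by (rule lint_cong) (auto simp: power2_eq_square algebra_simps)
  also have "... = s^2 * a + 2 * s * t * b + t^2 * c"
   using i by (simp add: a_b_c_def)
  finally show ?thesis .
 qed
 have "b^2 <= a * c"
 proof (cases "c = 0")
  case True
  have "b = 0"
  proof (rule ccontr)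
   assume "b \<noteq> 0"
   then have "1 * a + 2 * 1 * (-(a + 1) / (2 * b)) * b = -1" by (simp add: field_simps)
   then show False using q[of 1 "-(a + 1) / (2 * b)"] True by simp
  qed
  then show ?thesis using True by simp
 next
  case False
  have "0 <= c" by (simp add: a_b_c_def)
  then have "0 < c" using False by simp
  have "0 <= c^2 * a + 2 * c * (-b) * b + (-b)^2 * c" by (rule q)
  then have "0 <= c * (a * c - b^2)" by (simp add: power2_eq_square algebra_simps)
  then show ?thesis using \<open>0 < c\<close> by (simp add: zero_le_mult_iff)
 qed
 then have "sqrt (b^2) <= sqrt (a * c)" by (rule real_sqrt_le_mono)
 then show ?thesis by (simp add: a_b_c_def L2_norm_def real_sqrt_mult)
qed

lemma L2_add:
 assumes "f \<in> L2_space M" "g \<in> L2_space M"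
 shows "(%x. f x + g x) \<in> L2_space M"
proof -
 have "(%x. (f x + g x)^2) = (%x. (f x)^2 + 2 * (f x * g x) + (g x)^2)"
  by (auto simp: power2_eq_square algebra_simps)
 then show ?thesis
  using assms L2_prod_integrable[OF assms] by (auto simp: L2_space_def)
qed

lemma L2_cmult: "f \<in> L2_space M ==> (%x. c * f x) \<in> L2_space M"
 by (auto simp: L2_space_def power_mult_distrib)

lemma L2_diff:
 assumes "f \<in> L2_space M" "g \<in> L2_space M"
 shows "(%x. f x - g x) \<in> L2_space M"
 using L2_add[OF assms(1) L2_cmult[OF assms(2), of "-1"]] by simp

lemma L2_norm_triangle:
 assumes "f \<in> L2_space M" "g \<in> L2_space M"
 shows "L2_norm M (%x. f x + g x) <= L2_norm M f + L2_norm M g"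
proof -
 have "(L2_norm M (%x. f x + g x))^2 = (LINT x|M. (f x)^2 + 2 * (f x * g x) + (g x)^2)"
  unfolding L2_norm_square
  by (rule lint_cong) (auto simp: power2_eq_square algebra_simps)
 also have "... = (L2_norm M f)^2 + 2 * (LINT x|M. f x * g x) + (L2_norm M g)^2"
  using assms[THEN L2_spaceD(2)] L2_prod_integrable[OF assms] by (simp add: L2_norm_square)
 also have "... <= (L2_norm M f + L2_norm M g)^2"
  using L2_Cauchy_Schwarz[OF assms] by (simp add: power2_sum)
 finally show ?thesis by (simp add: power2_le_iff_abs_le)
qed

lemma L2_norm_cmult: "L2_norm M (%x. c * f x) = \<bar>c\<bar> * L2_norm M f"
 by (simp add: L2_norm_def power_mult_distrib real_sqrt_mult)

lemma L2_norm_minus_commute: "L2_norm M (%x. f x - g x) = L2_norm M (%x. g x - f x)"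
 by (simp add: L2_norm_def power2_commute)

lemma L2_norm_triangle_diff:
 assumes "f \<in> L2_space M" "g \<in> L2_space M" "h \<in> L2_space M"
 shows "L2_norm M (%x. f x - h x) <= L2_norm M (%x. f x - g x) + L2_norm M (%x. g x - h x)"
 using L2_norm_triangle[OF L2_diff[OF assms(1,2)] L2_diff[OF assms(2,3)]] by simp

lemma L2_norm_diff_le:
 assumes "f \<in> L2_space M" "g \<in> L2_space M"
 shows "L2_norm M (%x. f x - g x) <= L2_norm M f + L2_norm M g"
 using L2_norm_triangle[OF assms(1) L2_cmult[OF assms(2), of "-1"]] L2_norm_cmult[of M "-1" g] by simp

lemma L2_norm_cong_AE:
 assumes "f \<in> borel_measurable M" "g \<in> borel_measurable M" "AE x in M. f x = g x"
 shows "L2_norm M f = L2_norm M g"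
 unfolding L2_norm_def using assms by (intro arg_cong[where f=sqrt] integral_cong_AE) auto

text \<open>
 In the next two rules the energy is bounded by an extended nonnegative integral, which is the form
 in which Tonelli's theorem and Fatou's lemma deliver it.
\<close>

lemma L2_spaceI_nn:
 assumes "f \<in> borel_measurable M" "(\<integral>\<^sup>+x. ennreal ((f x)^2) \<partial>M) <= ennreal B"
 shows "f \<in> L2_space M"
 using assms by (auto simp: L2_space_def intro!: integrableI_nonneg simp: order_le_less_trans[OF _ ennreal_less_top])

lemma L2_norm_le_nn:
 assumes "f \<in> borel_measurable M" "(\<integral>\<^sup>+x. ennreal ((f x)^2) \<partial>M) <= ennreal (B^2)" "0 <= B"
 shows "L2_norm M f <= B"
proof -
 have "(LINT x|M. (f x)^2) = enn2real (\<integral>\<^sup>+x. ennreal ((f x)^2) \<partial>M)"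
  using assms by (intro integral_eq_nn_integral) auto
 also have "... <= B^2" using assms(2) by (intro enn2real_leI) auto
 finally show ?thesis using assms(3) unfolding L2_norm_def by (intro real_le_lsqrt) auto
qed

lemma nn_integral_L2:
 assumes "f \<in> L2_space M"
 shows "(\<integral>\<^sup>+x. ennreal ((f x)^2) \<partial>M) = ennreal ((L2_norm M f)^2)"
 using L2_spaceD[OF assms] by (simp add: nn_integral_eq_integral L2_norm_square)

text \<open>
 A sequence whose increments decay geometrically in \<open>L\<^sup>2\<close> converges almost everywhere, because
 \<open>\<Sum>n. 2\<^sup>n |f (n + 1) - f n|\<^sup>2\<close> has a finite integral; Fatou's lemma turns the pointwise limit
 into an \<open>L\<^sup>2\<close> limit.
\<close>

lemma L2_geometric_limit:
 fixes f :: "nat => 'a => real"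
 assumes f: "!!n. f n \<in> L2_space M"
  and dec: "!!n. L2_norm M (%x. f (Suc n) x - f n x) <= (1 / 2) ^ n"
 obtains g where "g \<in> L2_space M" "(%n. L2_norm M (%x. f n x - g x)) \<longlonglongrightarrow> 0"
  "AE x in M. (%n. f n x) \<longlonglongrightarrow> g x"
proof -
 have [measurable]: "f n \<in> borel_measurable M" for n using f L2_spaceD by auto
 define D where "D = (%n x. f (Suc n) x - f n x)"
 have [measurable]: "D n \<in> borel_measurable M" for n by (simp add: D_def)
 have D: "(\<integral>\<^sup>+x. ennreal ((D n x)^2) \<partial>M) <= ennreal ((1 / 4) ^ n)" for n
 proof -
  have "(\<integral>\<^sup>+x. ennreal ((D n x)^2) \<partial>M) = ennreal ((L2_norm M (D n))^2)"
   unfolding D_def using f by (intro nn_integral_L2 L2_diff)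
  also have "... <= ennreal (((1 / 2) ^ n)^2)"
   using dec[of n] by (intro ennreal_leI power_mono) (auto simp: D_def)
  also have "((1 / 2) ^ n)^2 = ((1 / 4::real) ^ n)"
   by (simp add: power2_eq_square flip: power_mult_distrib)
  finally show ?thesis .
 qed
 have "(\<integral>\<^sup>+x. (\<Sum>n. ennreal (2 ^ n * (D n x)^2)) \<partial>M) = (\<Sum>n. \<integral>\<^sup>+x. ennreal (2 ^ n * (D n x)^2) \<partial>M)"
  by (rule nn_integral_suminf) measurable
 also have "... <= (\<Sum>n. ennreal ((1 / 2) ^ n))"
 proof (intro suminf_le allI)
  fix n
  have "(\<integral>\<^sup>+x. ennreal (2 ^ n * (D n x)^2) \<partial>M) = ennreal (2 ^ n) * (\<integral>\<^sup>+x. ennreal ((D n x)^2) \<partial>M)"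
   by (simp add: ennreal_mult nn_integral_cmult)
  also have "... <= ennreal (2 ^ n) * ennreal ((1 / 4) ^ n)" by (intro mult_left_mono D) auto
  also have "... = ennreal ((1 / 2) ^ n)"
   by (simp add: ennreal_mult[symmetric] power_mult_distrib[symmetric] del: ennreal_power)
  finally show "(\<integral>\<^sup>+x. ennreal (2 ^ n * (D n x)^2) \<partial>M) <= ennreal ((1 / 2) ^ n)" .
 qed auto
 also have "... = ennreal (\<Sum>n. (1 / 2) ^ n)"
  by (rule suminf_ennreal2) (auto intro: summable_geometric)
 also have "... < \<infinity>" by simp
 finally have "AE x in M. (\<Sum>n. ennreal (2 ^ n * (D n x)^2)) \<noteq> \<infinity>"
  by (intro nn_integral_PInf_AE) (auto simp: less_top)
 then have conv: "AE x in M. convergent (%n. f n x)"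
 proof eventually_elim
  case (elim x)
  then have sm: "summable (%n. 2 ^ n * (D n x)^2)" by (intro summable_suminf_not_top) auto
  have "summable (%n. D n x)"
  proof (rule summable_comparison_test')
   show "summable (%n. 2 ^ n * (D n x)^2 + (1 / 2) ^ n)"
    using sm by (intro summable_add summable_geometric) auto
   fix n
   have "2 * (\<bar>D n x\<bar>) = 2 * (sqrt (2 ^ n) * \<bar>D n x\<bar>) * (1 / sqrt (2 ^ n))" by simp
   also have "... <= (sqrt (2 ^ n) * \<bar>D n x\<bar>)^2 + (1 / sqrt (2 ^ n))^2"
    using sum_squares_bound[of "sqrt (2 ^ n) * \<bar>D n x\<bar>" "1 / sqrt (2 ^ n)"] by simp
   also have "... = 2 ^ n * (D n x)^2 + (1 / 2) ^ n"
    by (simp add: power_mult_distrib power_divide)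
   finally have "2 * \<bar>D n x\<bar> <= 2 ^ n * (D n x)^2 + (1 / 2) ^ n" .
   then show "norm (D n x) <= 2 ^ n * (D n x)^2 + (1 / 2) ^ n" by simp
  qed
  then have "convergent (%n. \<Sum>i<n. D i x)" by (simp add: summable_iff_convergent)
  moreover have "(\<Sum>i<n. D i x) = f n x - f 0 x" for n
   unfolding D_def by (rule sum_lessThan_telescope)
  ultimately have "convergent (%n. f n x - f 0 x)" by simp
  then show ?case using convergent_add[OF _ convergent_const[of "f 0 x"]] by fastforce
 qed
 define g where "g = (%x. lim (%n. f n x))"
 have [measurable]: "g \<in> borel_measurable M" unfolding g_def by measurable
 have lim: "AE x in M. (%n. f n x) \<longlonglongrightarrow> g x"
  using conv by (auto simp: g_def convergent_LIMSEQ_iff)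
 have tail: "L2_norm M (%x. f n x - f (n + k) x) <= 2 * (1 / 2) ^ n" for n k
 proof -
  have "L2_norm M (%x. f n x - f (n + k) x) <= (\<Sum>i<k. (1 / 2) ^ (n + i))"
  proof (induction k)
   case 0
   then show ?case by (simp add: L2_norm_def)
  next
   case (Suc k)
   have "L2_norm M (%x. f n x - f (n + Suc k) x)
     <= L2_norm M (%x. f n x - f (n + k) x) + L2_norm M (%x. f (n + k) x - f (n + Suc k) x)"
    by (intro L2_norm_triangle_diff f)
   also have "... <= (\<Sum>i<k. (1 / 2) ^ (n + i)) + (1 / 2) ^ (n + k)"
    using Suc dec[of "n + k"] by (subst (2) L2_norm_minus_commute) auto
   finally show ?case by simp
  qed
  also have "... = (1 / 2) ^ n * (\<Sum>i<k. (1 / 2) ^ i)" by (simp add: power_add sum_distrib_left)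
  also have "(\<Sum>i<k. (1 / 2::real) ^ i) <= 2"
   by (subst geometric_sum) (auto simp: field_simps)
  finally show ?thesis by simp
 qed
 have fg: "(\<integral>\<^sup>+x. ennreal ((f n x - g x)^2) \<partial>M) <= ennreal ((2 * (1 / 2) ^ n)^2)" for n
 proof -
  have "(\<integral>\<^sup>+x. ennreal ((f n x - g x)^2) \<partial>M)
    = (\<integral>\<^sup>+x. liminf (%k. ennreal ((f n x - f (n + k) x)^2)) \<partial>M)"
  proof (intro nn_integral_cong_AE, use lim in eventually_elim)
   case (elim x)
   have "(%k. f (n + k) x) \<longlonglongrightarrow> g x" using LIMSEQ_ignore_initial_segment[OF elim, of n] by (simp add: add.commute)
   then have "(%k. ennreal ((f n x - f (n + k) x)^2)) \<longlonglongrightarrow> ennreal ((f n x - g x)^2)"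
    by (intro tendsto_ennrealI tendsto_intros)
   then show ?case by (intro lim_imp_Liminf[symmetric]) auto
  qed
  also have "... <= liminf (%k. \<integral>\<^sup>+x. ennreal ((f n x - f (n + k) x)^2) \<partial>M)"
   by (rule nn_integral_liminf) measurable
  also have "... <= liminf (%k. ennreal ((2 * (1 / 2) ^ n)^2))"
  proof (intro Liminf_mono always_eventually allI)
   fix k
   have "(\<integral>\<^sup>+x. ennreal ((f n x - f (n + k) x)^2) \<partial>M) = ennreal ((L2_norm M (%x. f n x - f (n + k) x))^2)"
    by (intro nn_integral_L2 L2_diff f)
   also have "... <= ennreal ((2 * (1 / 2) ^ n)^2)" by (intro ennreal_leI power_mono tail) auto
   finally show "(\<integral>\<^sup>+x. ennreal ((f n x - f (n + k) x)^2) \<partial>M) <= ennreal ((2 * (1 / 2) ^ n)^2)" .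
  qed
  also have "... = ennreal ((2 * (1 / 2) ^ n)^2)" by (intro Liminf_const) simp
  finally show ?thesis .
 qed
 have "(%x. f 0 x - g x) \<in> L2_space M" by (rule L2_spaceI_nn[OF _ fg]) measurable
 then have gL: "g \<in> L2_space M" using L2_diff[OF f[of 0]] by fastforce
 have "L2_norm M (%x. f n x - g x) <= 2 * (1 / 2) ^ n" for n
  by (rule L2_norm_le_nn[OF _ fg]) auto
 moreover have "(%n. 2 * (1 / 2::real) ^ n) \<longlonglongrightarrow> 0" by (intro tendsto_mult_right_zero LIMSEQ_realpow_zero) auto
 ultimately have "(%n. L2_norm M (%x. f n x - g x)) \<longlonglongrightarrow> 0"
  by (intro tendsto_sandwich[of "%_. 0" "%n. L2_norm M (%x. f n x - g x)" sequentially "%n. 2 * (1 / 2::real) ^ n"]) auto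
 then show thesis using that gL lim by blast
qed

lemma L2_complete:
 fixes f :: "nat => 'a => real"
 assumes f: "!!n. f n \<in> L2_space M"
  and cauchy: "!!e. 0 < e ==> \<exists>N. \<forall>m\<ge>N. \<forall>n\<ge>N. L2_norm M (%x. f m x - f n x) < e"
 obtains g where "g \<in> L2_space M" "(%n. L2_norm M (%x. f n x - g x)) \<longlonglongrightarrow> 0"
proof -
 have "\<exists>N. \<forall>k. N k < N (Suc k) \<and> (\<forall>m\<ge>N k. \<forall>n\<ge>N k. L2_norm M (%x. f m x - f n x) < (1 / 2) ^ k)"
 proof -
  have "\<exists>N. \<forall>k. (\<forall>m\<ge>N k. \<forall>n\<ge>N k. L2_norm M (%x. f m x - f n x) < (1 / 2) ^ k) \<and> N k < N (Suc k)"
  proof (rule dependent_nat_choice)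
   show "\<exists>x. \<forall>m\<ge>x. \<forall>n\<ge>x. L2_norm M (%x. f m x - f n x) < (1 / 2) ^ 0" using cauchy[of 1] by simp
   fix x k
   obtain N where "\<forall>m\<ge>N. \<forall>n\<ge>N. L2_norm M (%x. f m x - f n x) < (1 / 2) ^ Suc k"
    using cauchy[of "(1 / 2) ^ Suc k"] by auto
   then show "\<exists>y. (\<forall>m\<ge>y. \<forall>n\<ge>y. L2_norm M (%x. f m x - f n x) < (1 / 2) ^ Suc k) \<and> x < y"
    by (intro exI[of _ "max N (Suc x)"]) auto
  qed
  then show ?thesis by blast
 qed
 then obtain N where N: "!!k. N k < N (Suc k)"
  "!!k m n. m \<ge> N k ==> n \<ge> N k ==> L2_norm M (%x. f m x - f n x) < (1 / 2) ^ k" by blast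
 have sm: "strict_mono N" using N(1) by (simp add: strict_mono_Suc_iff)
 obtain g where g: "g \<in> L2_space M" "(%k. L2_norm M (%x. f (N k) x - g x)) \<longlonglongrightarrow> 0"
 proof (rule L2_geometric_limit[of "%k. f (N k)" M])
  show "L2_norm M (%x. f (N (Suc n)) x - f (N n) x) <= (1 / 2) ^ n" for n
   using N(2)[of n "N (Suc n)" "N n"] N(1)[of n] by auto
 qed (use f that in auto)
 have "(%n. L2_norm M (%x. f n x - g x)) \<longlonglongrightarrow> 0"
 proof (rule LIMSEQ_I)
  fix r :: real assume "0 < r"
  obtain A where A: "!!m n. m \<ge> A ==> n \<ge> A ==> L2_norm M (%x. f m x - f n x) < r / 2"
   using cauchy[of "r / 2"] \<open>0 < r\<close> by auto
  obtain B where B: "!!k. k \<ge> B ==> L2_norm M (%x. f (N k) x - g x) < r / 2"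
   using LIMSEQ_D[OF g(2), of "r / 2"] \<open>0 < r\<close> by auto
  show "\<exists>no. \<forall>n\<ge>no. norm (L2_norm M (%x. f n x - g x) - 0) < r"
  proof (intro exI[of _ A] allI impI)
   fix n assume "A <= n"
   have "N (max A B) \<ge> A" using seq_suble[OF sm, of "max A B"] by auto
   then have "L2_norm M (%x. f n x - g x) < r / 2 + r / 2"
    using L2_norm_triangle_diff[OF f f g(1), of n "N (max A B)"] A[OF \<open>A <= n\<close>, of "N (max A B)"]
     B[of "max A B"] by auto
   then show "norm (L2_norm M (%x. f n x - g x) - 0) < r" by simp
  qed
 qed
 then show thesis using that g(1) by blast
qed

text \<open>
 By the Cauchy-Schwarz inequality an average with total weight at most \<open>W\<close> multiplies \<open>L\<^sup>2\<close> energies by at most \<open>W\<close>.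
 This replaces Minkowski's integral inequality for all convolution-type operators below.
\<close>

lemma weighted_average_pointwise:
 fixes s w :: "'b => real"
 assumes [measurable]: "s \<in> borel_measurable N" "w \<in> borel_measurable N"
  and w: "!!z. 0 <= w z" and W: "(\<integral>\<^sup>+z. ennreal (w z) \<partial>N) <= ennreal W" "0 <= W"
 shows "ennreal ((LINT z|N. s z * w z)^2) <= ennreal W * (\<integral>\<^sup>+z. ennreal ((s z)^2 * w z) \<partial>N)"
proof (cases "(\<integral>\<^sup>+z. ennreal ((s z)^2 * w z) \<partial>N) = \<infinity>")
 case True
 show ?thesis
 proof (cases "W = 0")
  case True
  then have "AE z in N. ennreal (w z) = 0" using W by (simp add: nn_integral_0_iff_AE)
  then have "AE z in N. s z * w z = 0" using w by (auto simp: ennreal_eq_0_iff order.antisym)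
  then have "(LINT z|N. s z * w z) = 0" by (rule integral_eq_zero_AE)
  then show ?thesis by simp
 next
  case False
  then show ?thesis using True W by (simp add: ennreal_mult_top)
 qed
next
 case False
 let ?a = "%z. s z * sqrt (w z)" and ?b = "%z. sqrt (w z)"
 have sq: "(?a z)^2 = (s z)^2 * w z" "(?b z)^2 = w z" for z
  using w by (auto simp: power_mult_distrib)
 have "?b \<in> L2_space N" by (rule L2_spaceI_nn[of _ _ W]) (use W sq in auto)
 moreover have "?a \<in> L2_space N"
  by (rule L2_spaceI_nn[of _ _ "enn2real (\<integral>\<^sup>+z. ennreal ((s z)^2 * w z) \<partial>N)"])
   (use False sq in \<open>auto simp: ennreal_enn2real_if less_top\<close>)
 ultimately have "\<bar>LINT z|N. ?a z * ?b z\<bar> <= L2_norm N ?a * L2_norm N ?b"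
  by (rule L2_Cauchy_Schwarz[rotated])
 moreover have "?a z * ?b z = s z * w z" for z using w[of z] by (simp add: mult.assoc)
 ultimately have "\<bar>LINT z|N. s z * w z\<bar>^2 <= (L2_norm N ?a * L2_norm N ?b)^2"
  by (intro power_mono) auto
 then have "ennreal ((LINT z|N. s z * w z)^2) <= ennreal ((L2_norm N ?a)^2) * ennreal ((L2_norm N ?b)^2)"
  by (simp add: power_mult_distrib flip: ennreal_mult)
 also have "... = (\<integral>\<^sup>+z. ennreal ((s z)^2 * w z) \<partial>N) * (\<integral>\<^sup>+z. ennreal (w z) \<partial>N)"
  using nn_integral_L2[OF \<open>?a \<in> L2_space N\<close>] nn_integral_L2[OF \<open>?b \<in> L2_space N\<close>] unfolding sq by simp
 also have "... <= (\<integral>\<^sup>+z. ennreal ((s z)^2 * w z) \<partial>N) * ennreal W"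
  using W by (intro mult_left_mono) auto
 finally show ?thesis by (simp add: mult.commute)
qed

lemma weighted_average_L2:
 fixes s :: "'a => 'b => real" and w :: "'b => real"
 assumes "sigma_finite_measure M" "sigma_finite_measure N"
  and s[measurable]: "case_prod s \<in> borel_measurable (M \<Otimes>\<^sub>M N)" and [measurable]: "w \<in> borel_measurable N"
  and w: "!!z. 0 <= w z" and W: "(\<integral>\<^sup>+z. ennreal (w z) \<partial>N) <= ennreal W" "0 <= W"
  and Q: "!!z. z \<in> space N ==> (\<integral>\<^sup>+x. ennreal ((s x z)^2 * w z) \<partial>M) <= ennreal (q z * w z)"
  and [measurable]: "q \<in> borel_measurable N" and q: "(\<integral>\<^sup>+z. ennreal (q z * w z) \<partial>N) <= ennreal B" "0 <= B"
 shows "(%x. LINT z|N. s x z * w z) \<in> L2_space M"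
  and "L2_norm M (%x. LINT z|N. s x z * w z) <= sqrt (W * B)"
proof -
 interpret M: sigma_finite_measure M by fact
 interpret N: sigma_finite_measure N by fact
 interpret pair_sigma_finite M N ..
 have m[measurable]: "(%x. LINT z|N. s x z * w z) \<in> borel_measurable M" by measurable
 have [measurable]: "s x \<in> borel_measurable N" if "x \<in> space M" for x
  using measurable_compose[OF measurable_Pair1'[OF that] s] by simp
 have "(\<integral>\<^sup>+x. ennreal ((LINT z|N. s x z * w z)^2) \<partial>M)
   <= (\<integral>\<^sup>+x. ennreal W * (\<integral>\<^sup>+z. ennreal ((s x z)^2 * w z) \<partial>N) \<partial>M)"
  using w W by (intro nn_integral_mono weighted_average_pointwise) auto
 also have "... = ennreal W * (\<integral>\<^sup>+x. (\<integral>\<^sup>+z. ennreal ((s x z)^2 * w z) \<partial>N) \<partial>M)"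
  by (rule nn_integral_cmult) measurable
 also have "(\<integral>\<^sup>+x. (\<integral>\<^sup>+z. ennreal ((s x z)^2 * w z) \<partial>N) \<partial>M)
   = (\<integral>\<^sup>+z. (\<integral>\<^sup>+x. ennreal ((s x z)^2 * w z) \<partial>M) \<partial>N)"
  by (rule Fubini'[symmetric]) measurable
 also have "ennreal W * ... <= ennreal W * ennreal B"
  using Q by (intro mult_left_mono order_trans[OF nn_integral_mono q(1)]) auto
 also have "... = ennreal ((sqrt (W * B))^2)" using W q by (simp add: ennreal_mult)
 finally have *: "(\<integral>\<^sup>+x. ennreal ((LINT z|N. s x z * w z)^2) \<partial>M) <= ennreal ((sqrt (W * B))^2)" .
 show "(%x. LINT z|N. s x z * w z) \<in> L2_space M" by (rule L2_spaceI_nn[OF m *])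
 show "L2_norm M (%x. LINT z|N. s x z * w z) <= sqrt (W * B)"
  by (rule L2_norm_le_nn[OF m *]) (use W q in auto)
qed

section \<open>Affine changes of variables\<close>

lemma nn_integral_lborel_affine:
 fixes f :: "'a::euclidean_space => ennreal"
 assumes [measurable]: "f \<in> borel_fun" and "c \<noteq> 0"
 shows "(NBINT x. f (t + c *\<^sub>R x)) = ennreal ((1 / \<bar>c\<bar>) ^ DIM('a)) * (NBINT x. f x)"
proof -
 have "(NBINT x. f x) = ennreal (\<bar>c\<bar> ^ DIM('a)) * (NBINT x. f (t + c *\<^sub>R x))"
  by (subst lborel_affine[OF \<open>c \<noteq> 0\<close>, of t])
   (simp add: nn_integral_density nn_integral_distr nn_integral_cmult)
 moreover have "ennreal ((1 / \<bar>c\<bar>) ^ DIM('a)) * ennreal (\<bar>c\<bar> ^ DIM('a)) = 1"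
  using \<open>c \<noteq> 0\<close> by (simp add: ennreal_mult[symmetric] power_mult_distrib[symmetric] del: ennreal_power)
 ultimately show ?thesis by (simp add: mult.assoc[symmetric])
qed

lemma integral_lborel_affine:
 fixes f :: "'a::euclidean_space => real"
 assumes [measurable]: "f \<in> borel_fun" and "c \<noteq> 0"
 shows "(LBINT x. f (t + c *\<^sub>R x)) = (1 / \<bar>c\<bar>) ^ DIM('a) * (LBINT x. f x)"
proof -
 have "(LBINT x. f x) = \<bar>c\<bar> ^ DIM('a) * (LBINT x. f (t + c *\<^sub>R x))"
  by (subst lborel_affine[OF \<open>c \<noteq> 0\<close>, of t])
   (simp add: integral_density integral_distr)
 then show ?thesis using \<open>c \<noteq> 0\<close> by (simp add: power_divide)
qed

lemma integrable_lborel_affine: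
 fixes f :: "'a::euclidean_space => real"
 assumes "integrable lborel f" and "c \<noteq> 0"
 shows "integrable lborel (%x. f (t + c *\<^sub>R x))"
proof -
 have [measurable]: "f \<in> borel_fun" using assms(1) by auto
 have "integrable (density (distr lborel borel (%x. t + c *\<^sub>R x)) (%_. ennreal (\<bar>c\<bar> ^ DIM('a)))) f"
  using assms(1) lborel_affine[OF \<open>c \<noteq> 0\<close>, of t] by simp
 then show ?thesis using \<open>c \<noteq> 0\<close> by (simp add: integrable_density integrable_distr_eq)
qed

lemma
 fixes f :: "'a::euclidean_space => real"
 assumes [measurable]: "f \<in> borel_fun"
 shows integral_lborel_translate: "(LBINT x. f (x + a)) = (LBINT x. f x)"
  and integral_lborel_reflect: "(LBINT x. f (a - x)) = (LBINT x. f x)"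
 using integral_lborel_affine[of f 1 a] integral_lborel_affine[of f "-1" a] by (simp_all add: add.commute)

lemma
 fixes f :: "'a::euclidean_space => ennreal"
 assumes [measurable]: "f \<in> borel_fun"
 shows nn_integral_lborel_translate: "(NBINT x. f (x + a)) = (NBINT x. f x)"
  and nn_integral_lborel_reflect: "(NBINT x. f (a - x)) = (NBINT x. f x)"
 using nn_integral_lborel_affine[of f 1 a] nn_integral_lborel_affine[of f "-1" a] by (simp_all add: add.commute)

lemma
 fixes f :: "'a::euclidean_space => real"
 assumes "integrable lborel f"
 shows integrable_lborel_translate: "integrable lborel (%x. f (x + a))"
  and integrable_lborel_reflect: "integrable lborel (%x. f (a - x))"
 using integrable_lborel_affine[OF assms, of 1 a] integrable_lborel_affine[OF assms, of "-1" a] by (simp_all add: add.commute)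

lemma L2_translate:
 fixes f :: "'a::euclidean_space => real"
 assumes "f \<in> L2s"
 shows "(%x. f (x + a)) \<in> L2s" "L2n (%x. f (x + a)) = L2n f"
proof -
 have [measurable]: "f \<in> borel_fun" using L2_spaceD(1)[OF assms] by simp
 show "(%x. f (x + a)) \<in> L2s"
  using integrable_lborel_translate[OF L2_spaceD(2)[OF assms], of a] by (auto simp: L2_space_def)
 show "L2n (%x. f (x + a)) = L2n f"
  using integral_lborel_translate[of "%x. (f x)^2" a] by (simp add: L2_norm_def)
qed

section \<open>Functions with bounded averages over large balls\<close>

lemma cball_measurable [measurable]: "cball (a::'a::euclidean_space) r \<in> sets borel"
 by (rule borel_closed) simp

text \<open>
 Only large radii matter: after the rescaling \<open>x \<mapsto> x / eps\<close> with \<open>eps < 1\<close> every ball of radius at least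
 one becomes a larger one, so the bound survives the rescaling with the same constant.
\<close>

definition avg_bdd :: "('a::euclidean_space => real) => real => bool" where
 "avg_bdd p S \<longleftrightarrow> p \<in> borel_fun \<and> 0 <= S \<and>
   (\<forall>r\<ge>1. (NBINT x. ennreal \<bar>p x\<bar> * indicator (cball 0 r) x) <= ennreal (S * r ^ DIM('a)))"

lemma avg_bdd_integrable:
 fixes p :: "'a::euclidean_space => real"
 assumes "avg_bdd p S"
 shows "integrable lborel (%x. p x * indicator (cball 0 r) x)"
proof -
 have [measurable]: "p \<in> borel_fun" using assms by (simp add: avg_bdd_def)
 have "(NBINT x. ennreal (norm (p x * indicator (cball 0 r) x)))
   <= (NBINT x. ennreal \<bar>p x\<bar> * indicator (cball 0 (max 1 r)) x)"
  by (intro nn_integral_mono) (auto simp: indicator_def)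
 also have "... <= ennreal (S * (max 1 r) ^ DIM('a))" using assms by (simp add: avg_bdd_def)
 finally show ?thesis by (intro integrableI_bounded) (auto simp: order_le_less_trans)
qed

lemma avg_bdd_mono:
 fixes p :: "'a::euclidean_space => real"
 assumes "avg_bdd p S" "S <= T"
 shows "avg_bdd p T"
 unfolding avg_bdd_def
proof (intro conjI allI impI)
 fix r :: real assume r: "1 <= r"
 have "(NBINT x. ennreal \<bar>p x\<bar> * indicator (cball 0 r) x) <= ennreal (S * r ^ DIM('a))"
  using assms(1) r by (simp add: avg_bdd_def)
 also have "... <= ennreal (T * r ^ DIM('a))"
  using assms(2) r by (intro ennreal_leI mult_right_mono) auto
 finally show "(NBINT x. ennreal \<bar>p x\<bar> * indicator (cball 0 r) x) <= ennreal (T * r ^ DIM('a))" .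
qed (use assms in \<open>auto simp: avg_bdd_def\<close>)

lemma avg_bdd_integral:
 fixes p :: "'a::euclidean_space => real"
 assumes "avg_bdd p S" "1 <= r"
 shows "(LBINT x. \<bar>p x\<bar> * indicator (cball 0 r) x) <= S * r ^ DIM('a)"
proof -
 have [measurable]: "p \<in> borel_fun" using assms by (simp add: avg_bdd_def)
 have "(LBINT x. \<bar>p x\<bar> * indicator (cball 0 r) x)
   = enn2real (NBINT x. ennreal (\<bar>p x\<bar> * indicator (cball 0 r) x))"
  by (intro integral_eq_nn_integral) auto
 also have "(NBINT x. ennreal (\<bar>p x\<bar> * indicator (cball 0 r) x))
   = (NBINT x. ennreal \<bar>p x\<bar> * indicator (cball 0 r) x)"
  by (intro nn_integral_cong) (auto simp: indicator_def)
 also have "enn2real ... <= S * r ^ DIM('a)"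
  using assms by (intro enn2real_leI) (auto simp: avg_bdd_def)
 finally show ?thesis .
qed

lemma avg_bdd_scale:
 fixes p :: "'a::euclidean_space => real"
 assumes "avg_bdd p S" "0 < eps" "eps <= 1"
 shows "avg_bdd (%x. p (x /\<^sub>R eps)) S"
proof -
 have [measurable]: "p \<in> borel_fun" using assms by (simp add: avg_bdd_def)
 have "(NBINT x. ennreal \<bar>p (x /\<^sub>R eps)\<bar> * indicator (cball 0 r) x) <= ennreal (S * r ^ DIM('a))" if "1 <= r" for r
 proof -
  have "(NBINT x. ennreal \<bar>p (x /\<^sub>R eps)\<bar> * indicator (cball 0 r) x)
    = (NBINT x. ennreal \<bar>p (0 + (1 / eps) *\<^sub>R x)\<bar> * indicator (cball 0 (r / eps)) (0 + (1 / eps) *\<^sub>R x))"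
  proof (intro nn_integral_cong)
   fix x :: 'a
   have "norm x / eps <= r / eps \<longleftrightarrow> norm x <= r" using \<open>0 < eps\<close> by (simp add: divide_le_cancel)
   then show "ennreal \<bar>p (x /\<^sub>R eps)\<bar> * indicator (cball 0 r) x
     = ennreal \<bar>p (0 + (1 / eps) *\<^sub>R x)\<bar> * indicator (cball 0 (r / eps)) (0 + (1 / eps) *\<^sub>R x)"
    using \<open>0 < eps\<close> by (simp add: indicator_def inverse_eq_divide)
  qed
  also have "... = ennreal (eps ^ DIM('a)) * (NBINT x. ennreal \<bar>p x\<bar> * indicator (cball 0 (r / eps)) x)"
   using \<open>0 < eps\<close> by (subst nn_integral_lborel_affine[of "%x. ennreal \<bar>p x\<bar> * indicator (cball 0 (r / eps)) x"]) auto
  also have "... <= ennreal (eps ^ DIM('a)) * ennreal (S * (r / eps) ^ DIM('a))"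
  proof -
   have "1 <= r / eps" using assms that by (simp add: field_simps)
   then show ?thesis using assms(1) unfolding avg_bdd_def by (intro mult_left_mono) auto
  qed
  also have "... = ennreal (S * r ^ DIM('a))"
   using assms(2) that by (subst ennreal_mult'[symmetric]) (auto simp: power_divide)
  finally show ?thesis .
 qed
 then show ?thesis using assms by (simp add: avg_bdd_def)
qed

definition loc_int :: "('a::euclidean_space => real) => bool" where
 "loc_int k \<longleftrightarrow> k \<in> borel_fun \<and> (\<forall>R. integrable lborel (%y. k y * indicator (cball 0 R) y))"

lemma loc_int_avg_bdd: "avg_bdd p S ==> loc_int p"
 by (auto simp: loc_int_def avg_bdd_integrable) (simp add: avg_bdd_def)

lemma loc_int_abs_integral:
 assumes "loc_int k"
 shows "integrable lborel (%y. \<bar>k y\<bar> * indicator (cball 0 R) y)"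
proof -
 have "(%y. \<bar>k y\<bar> * indicator (cball 0 R) y) = (%y. \<bar>k y * indicator (cball 0 R) y\<bar>)"
  by (auto simp: indicator_def)
 then show ?thesis using assms by (auto simp: loc_int_def)
qed

lemma integrable_shifted_product:
 fixes q f w :: "'a::euclidean_space => real"
 assumes q: "loc_int q" and [measurable]: "f \<in> borel_fun" "w \<in> borel_fun"
  and f: "!!x. R < norm x ==> f x = 0" "!!x. \<bar>f x\<bar> <= A"
  and w: "!!z. S < norm z ==> w z = 0" "!!z. \<bar>w z\<bar> <= B" and c: "\<bar>c\<bar> <= 1"
 shows "integrable (lborel \<Otimes>\<^sub>M lborel) (%(z, x). f x * q (x + c *\<^sub>R z) * w z)"
proof -
 have [measurable]: "q \<in> borel_fun" using q by (simp add: loc_int_def)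
 have AB: "0 <= A" "0 <= B" using f(2)[of 0] w(2)[of 0] by auto
 let ?J = "%x. ennreal \<bar>q x\<bar> * indicator (cball 0 (R + S)) x"
 have "(\<integral>\<^sup>+zx. ennreal (norm ((%(z, x). f x * q (x + c *\<^sub>R z) * w z) zx)) \<partial>(lborel \<Otimes>\<^sub>M lborel))
   = (NBINT z. (NBINT x. ennreal (norm (f x * q (x + c *\<^sub>R z) * w z))))"
  by (subst lborel.nn_integral_fst[symmetric]) auto
 also have "... <= (NBINT z. ennreal (A * B) * (NBINT x. ?J (x + c *\<^sub>R z)) * indicator (cball 0 S) z)"
 proof (intro nn_integral_mono)
  fix z :: 'a
  show "(NBINT x. ennreal (norm (f x * q (x + c *\<^sub>R z) * w z)))
    <= ennreal (A * B) * (NBINT x. ?J (x + c *\<^sub>R z)) * indicator (cball 0 S) z"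
  proof (cases "norm z <= S")
   case False
   then show ?thesis using w by (simp add: not_le)
  next
   case True
   have "(NBINT x. ennreal (norm (f x * q (x + c *\<^sub>R z) * w z))) <= (NBINT x. ennreal (A * B) * ?J (x + c *\<^sub>R z))"
   proof (intro nn_integral_mono)
    fix x :: 'a
    show "ennreal (norm (f x * q (x + c *\<^sub>R z) * w z)) <= ennreal (A * B) * ?J (x + c *\<^sub>R z)"
    proof (cases "norm x <= R")
     case False
     then show ?thesis using f by (simp add: not_le)
    next
     case x: True
     have "norm (c *\<^sub>R z) <= norm z" using c by (simp add: mult_left_le_one_le)
     then have "norm (x + c *\<^sub>R z) <= R + S" using x True norm_triangle_ineq[of x "c *\<^sub>R z"] by linarith
     moreover have "\<bar>f x\<bar> * \<bar>w z\<bar> <= A * B" using f(2)[of x] w(2)[of z] AB by (intro mult_mono) auto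
     then have "(\<bar>f x\<bar> * \<bar>w z\<bar>) * \<bar>q (x + c *\<^sub>R z)\<bar> <= (A * B) * \<bar>q (x + c *\<^sub>R z)\<bar>" by (intro mult_right_mono) auto
     ultimately show ?thesis using AB
      by (simp add: abs_mult mult_ac ennreal_mult[symmetric] del: ennreal_mult' ennreal_mult'')
    qed
   qed
   also have "... = ennreal (A * B) * (NBINT x. ?J (x + c *\<^sub>R z))" by (rule nn_integral_cmult) measurable
   finally show ?thesis using True by simp
  qed
 qed
 also have "... = (NBINT z. ennreal (A * B) * (NBINT x. ?J x) * indicator (cball (0::'a) S) z)"
  by (intro nn_integral_cong arg_cong2[where f="(*)"] refl nn_integral_lborel_translate) measurable
 also have "... = ennreal (A * B) * (NBINT x. ?J x) * emeasure lborel (cball (0::'a) S)"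
  by (rule nn_integral_cmult_indicator) auto
 also have "(NBINT x. ?J x) = (NBINT x. ennreal (norm (\<bar>q x\<bar> * indicator (cball 0 (R + S)) x)))"
  by (intro nn_integral_cong) (auto simp: indicator_def)
 also have "ennreal (A * B) * ... * emeasure lborel (cball (0::'a) S) < \<infinity>"
  using loc_int_abs_integral[OF q, of "R + S"] emeasure_bounded_finite[OF bounded_cball[of "0::'a" S]]
  by (simp add: integrable_iff_bounded ennreal_mult_less_top)
 finally show ?thesis by (intro integrableI_bounded) auto
qed

text \<open>
 Vitali's covering lemma bounds the set of centres around which some average of \<open>p\<close> exceeds \<open>t\<close>:
 disjoint balls of large average carry the mass, and their fivefold enlargements cover the set.
\<close>

lemma Vitali_maximal_estimate:
 fixes p :: "'a::euclidean_space => ennreal"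
 assumes [measurable]: "p \<in> borel_fun" and "0 < t"
  and E[measurable]: "E \<in> sets lborel" and EL: "E \<subseteq> cball 0 L"
  and large: "!!x. x \<in> E ==> \<exists>n\<in>{1..N::nat}. ennreal (t * real n ^ DIM('a))
    < (NBINT y. p y * indicator (cball x (real n)) y)"
 shows "ennreal t * emeasure lborel E <= ennreal (5 ^ DIM('a) * unit_ball_vol (real DIM('a))) *
   (NBINT y. p y * indicator (cball 0 (L + real N)) y)"
proof -
 let ?V = "unit_ball_vol (real DIM('a))" and ?D = "DIM('a)"
 have V: "0 < ?V" by simp
 obtain n where n: "!!x. x \<in> E ==> n x \<in> {1..N}"
  "!!x. x \<in> E ==> ennreal (t * real (n x) ^ ?D) < (NBINT y. p y * indicator (cball x (real (n x))) y)"
  using large by metis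
 obtain C where C: "countable C" "C \<subseteq> E"
  "pairwise (%i j. disjnt (cball i (real (n i))) (cball j (real (n j)))) C"
  "E \<subseteq> (\<Union>i\<in>C. cball i (5 * real (n i)))"
 proof (rule Vitali_covering_lemma_cballs[of E "%x. x" "%x. real (n x)" E "real N"])
  show "E \<subseteq> (\<Union>i\<in>E. cball i (real (n i)))" by auto
  show "0 < real (n i) \<and> real (n i) <= real N" if "i \<in> E" for i using n(1)[OF that] by auto
 qed (use that in auto)
 have "emeasure lborel E = (NBINT x. indicator E x)" using E by simp
 also have "... <= (NBINT x. (\<integral>\<^sup>+i. indicator (cball i (5 * real (n i))) x \<partial>count_space C))"
 proof (intro nn_integral_mono)
  fix x
  show "indicator E x <= (\<integral>\<^sup>+i. indicator (cball i (5 * real (n i))) x \<partial>count_space C :: ennreal)"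
  proof (cases "x \<in> E")
   case True
   then obtain i where "i \<in> C" "x \<in> cball i (5 * real (n i))" using C(4) by auto
   then have "(indicator (cball i (5 * real (n i))) x :: ennreal) = 1" by simp
   moreover have "indicator (cball i (5 * real (n i))) x <= (\<integral>\<^sup>+i. indicator (cball i (5 * real (n i))) x \<partial>count_space C :: ennreal)"
    by (rule nn_integral_ge_point[OF \<open>i \<in> C\<close>])
   ultimately show ?thesis using True by simp
  qed simp
 qed
 also have "... = (\<integral>\<^sup>+i. (NBINT x. indicator (cball i (5 * real (n i))) x) \<partial>count_space C)"
  by (rule nn_integral_count_space_nn_integral) (use C in auto)
 also have "... = (\<integral>\<^sup>+i. ennreal (5 ^ ?D * ?V) * ennreal (real (n i) ^ ?D) \<partial>count_space C)"
 proof (intro nn_integral_cong)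
  fix i
  have "?V * (5 * real (n i)) ^ ?D = (5 ^ ?D * ?V) * real (n i) ^ ?D" by (simp add: power_mult_distrib)
  then show "(NBINT x. indicator (cball i (5 * real (n i))) x) = ennreal (5 ^ ?D * ?V) * ennreal (real (n i) ^ ?D)"
   using V by (simp add: emeasure_cball ennreal_mult[symmetric] del: ennreal_power)
 qed
 also have "... = ennreal (5 ^ ?D * ?V) * (\<integral>\<^sup>+i. ennreal (real (n i) ^ ?D) \<partial>count_space C)"
  by (rule nn_integral_cmult) auto
 finally have "ennreal t * emeasure lborel E
   <= ennreal t * (ennreal (5 ^ ?D * ?V) * (\<integral>\<^sup>+i. ennreal (real (n i) ^ ?D) \<partial>count_space C))"
  by (intro mult_left_mono) auto
 also have "... = ennreal (5 ^ ?D * ?V) * (\<integral>\<^sup>+i. ennreal t * ennreal (real (n i) ^ ?D) \<partial>count_space C)"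
  by (subst nn_integral_cmult) (auto simp: mult_ac)
 also have "(\<integral>\<^sup>+i. ennreal t * ennreal (real (n i) ^ ?D) \<partial>count_space C)
   <= (\<integral>\<^sup>+i. emeasure (density lborel p) (cball i (real (n i))) \<partial>count_space C)"
 proof (intro nn_integral_mono)
  fix i assume "i \<in> space (count_space C)"
  then have "i \<in> E" using C by auto
  then show "ennreal t * ennreal (real (n i) ^ ?D) <= emeasure (density lborel p) (cball i (real (n i)))"
   using n(2)[of i] \<open>0 < t\<close> by (simp add: emeasure_density ennreal_mult less_imp_le del: ennreal_power)
 qed
 also have "... = emeasure (density lborel p) (\<Union>i\<in>C. cball i (real (n i)))"
  by (rule emeasure_UN_countable[symmetric])
   (use C in \<open>auto simp: disjoint_family_on_def pairwise_def disjnt_def\<close>)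
 also have "... <= emeasure (density lborel p) (cball 0 (L + real N))"
 proof (intro emeasure_mono)
  show "(\<Union>i\<in>C. cball i (real (n i))) \<subseteq> cball 0 (L + real N)"
  proof
   fix x assume "x \<in> (\<Union>i\<in>C. cball i (real (n i)))"
   then obtain i where i: "i \<in> C" "dist i x <= real (n i)" by auto
   then have "i \<in> E" using C by auto
   then have "norm i <= L" "n i <= N" using EL n(1)[of i] by auto
   then show "x \<in> cball 0 (L + real N)"
    using i norm_triangle_sub[of x i] by (auto simp: dist_norm norm_minus_commute)
  qed
 qed auto
 also have "... = (NBINT y. p y * indicator (cball 0 (L + real N)) y)"
  by (simp add: emeasure_density)
 finally show ?thesis by (simp add: mult_left_mono)
qed

section \<open>The multi-parameter ergodic theorem\<close>

definition ball_weight :: "real => 'a::euclidean_space => real" where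
 "ball_weight R z = indicator (cball 0 R) z / measure lborel (cball (0::'a) R)"

lemma ball_weight_measurable [measurable]: "ball_weight R \<in> borel_fun"
 unfolding ball_weight_def[abs_def] by measurable

lemma ball_weight_nonneg [simp]: "0 <= ball_weight R z"
 by (simp add: ball_weight_def)

lemma measure_cball_pos: "0 < R ==> 0 < measure lborel (cball (a::'a::euclidean_space) R)"
 by (simp add: content_cball)

lemma ball_weight_nn_integral:
 "0 < R ==> (NBINT z. ennreal (ball_weight R (z::'a::euclidean_space))) = 1"
proof -
 assume R: "0 < R"
 let ?m = "measure lborel (cball (0::'a) R)"
 have "(NBINT z. ennreal (ball_weight R (z::'a))) = (NBINT z. ennreal (1 / ?m) * indicator (cball (0::'a) R) z)"
  by (intro nn_integral_cong) (auto simp: ball_weight_def indicator_def)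
 also have "... = ennreal (1 / ?m) * emeasure lborel (cball (0::'a) R)" by (rule nn_integral_cmult_indicator) auto
 also have "emeasure lborel (cball (0::'a) R) = ennreal ?m"
  by (rule emeasure_eq_ennreal_measure) (simp add: emeasure_cball R less_imp_le)
 finally show ?thesis using measure_cball_pos[OF R, of "0::'a"] by (simp add: ennreal_mult[symmetric])
qed

lemma ball_weight_integral:
 "0 < R ==> integrable lborel (ball_weight R :: 'a::euclidean_space => real)"
 "0 < R ==> (LBINT z. ball_weight R (z::'a::euclidean_space)) = 1"
proof -
 assume R: "0 < R"
 show "integrable lborel (ball_weight R :: 'a => real)"
  using ball_weight_nn_integral[OF R, where 'a='a] by (intro integrableI_nonneg) auto
 show "(LBINT z. ball_weight R (z::'a)) = 1"
  using ball_weight_nn_integral[OF R, where 'a='a] by (subst integral_eq_nn_integral) auto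
qed

definition shell_ratio :: "nat => real => real => real" where
 "shell_ratio D R S = ((S + R) ^ D - (S - R) ^ D) / S ^ D"

lemma shell_ratio_tendsto: "((%n. shell_ratio D R (real n)) \<longlonglongrightarrow> 0)"
proof -
 have "(%n. (1 + R / real n) ^ D - (1 - R / real n) ^ D) \<longlonglongrightarrow> (1 + 0) ^ D - (1 - 0) ^ D"
  by (intro tendsto_intros tendsto_divide_0[OF tendsto_const] filterlim_real_sequentially
    filterlim_at_infinity_imp_norm_at_top filterlim_at_top_imp_at_infinity)
 moreover have "\<forall>\<^sub>F n in sequentially. (1 + R / real n) ^ D - (1 - R / real n) ^ D = shell_ratio D R (real n)"
  using eventually_gt_at_top[of 0]
 proof eventually_elim
  case (elim n)
  have "1 + R / real n = (real n + R) / real n" "1 - R / real n = (real n - R) / real n"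
   using elim by (auto simp: field_simps)
  then show ?case by (simp only: shell_ratio_def power_divide diff_divide_distrib[of "(real n + R) ^ D"])
 qed
 ultimately show ?thesis by (simp add: filterlim_cong)
qed

text \<open>
 Balls of large radius are almost invariant under translations of bounded length: the symmetric
 difference lies in a thin shell.
\<close>

lemma ball_weight_translate_diff:
 fixes z :: "'a::euclidean_space"
 assumes "norm z <= R" "R <= S" "0 < S"
 shows "(NBINT y. ennreal \<bar>ball_weight S (y - z) - ball_weight S y\<bar>) <= ennreal (shell_ratio DIM('a) R S)"
proof -
 let ?m = "measure lborel (cball (0::'a) S)" and ?V = "unit_ball_vol (real DIM('a))"
 have R: "0 <= R" using assms(1) norm_ge_zero[of z] by linarith
 have V: "0 < ?V" by simp
 have m: "?m = ?V * S ^ DIM('a)" "0 < ?m" using assms by (auto simp: content_cball measure_cball_pos)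
 have "(NBINT y. ennreal \<bar>ball_weight S (y - z) - ball_weight S y\<bar>)
   <= (NBINT y. ennreal (1 / ?m) * indicator (cball (0::'a) (S + R) - cball 0 (S - R)) y)"
 proof (intro nn_integral_mono)
  fix y :: 'a
  have "ball_weight S (y - z) = ball_weight S y" if "y \<notin> cball 0 (S + R) - cball 0 (S - R)"
  proof -
   have "norm (y - z) <= norm y + norm z" "norm y <= norm (y - z) + norm z"
    using norm_triangle_ineq4[of y z] norm_triangle_sub[of y z] by (auto simp: add.commute)
   then show ?thesis using that assms R by (auto simp: ball_weight_def indicator_def)
  qed
  moreover have "\<bar>ball_weight S (y - z) - ball_weight S y\<bar> <= 1 / ?m"
   by (auto simp: ball_weight_def indicator_def)
  ultimately show "ennreal \<bar>ball_weight S (y - z) - ball_weight S y\<bar>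
    <= ennreal (1 / ?m) * indicator (cball (0::'a) (S + R) - cball 0 (S - R)) y"
   by (cases "y \<in> cball 0 (S + R) - cball 0 (S - R)") (auto intro: ennreal_leI)
 qed
 also have "... = ennreal (1 / ?m) * emeasure lborel (cball (0::'a) (S + R) - cball 0 (S - R))"
  by (rule nn_integral_cmult_indicator) auto
 also have "emeasure lborel (cball (0::'a) (S + R) - cball 0 (S - R))
   = emeasure lborel (cball (0::'a) (S + R)) - emeasure lborel (cball (0::'a) (S - R))"
  using assms R by (intro emeasure_Diff) (auto simp: emeasure_cball)
 also have "... = ennreal (?V * (S + R) ^ DIM('a) - ?V * (S - R) ^ DIM('a))"
  using assms R V by (simp add: emeasure_cball ennreal_minus)
 also have "ennreal (1 / ?m) * ... = ennreal (shell_ratio DIM('a) R S)"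
 proof -
  have "1 / ?m * (?V * (S + R) ^ DIM('a) - ?V * (S - R) ^ DIM('a)) = shell_ratio DIM('a) R S"
   using V assms less_imp_neq[OF V] by (simp add: m(1) shell_ratio_def right_diff_distrib[symmetric] del: times_divide_eq_right)
  then show ?thesis using m by (subst ennreal_mult'[symmetric]) auto
 qed
 finally show ?thesis .
qed

context stationary_ergodic_environment
begin

lemma shift_in_space [simp]: "om \<in> space M ==> \<tau> x om \<in> space M"
 by (rule measurable_space[OF shift_measurable])

lemma orbit_pair_measurable [measurable (raw)]:
 assumes "f \<in> K \<rightarrow>\<^sub>M borel" "g \<in> K \<rightarrow>\<^sub>M M"
 shows "(%x. \<tau> (f x) (g x)) \<in> K \<rightarrow>\<^sub>M M"
proof -
 have "(%x. (f x, g x)) \<in> K \<rightarrow>\<^sub>M borel \<Otimes>\<^sub>M M" using assms by auto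
 from measurable_compose[OF this jointly_measurable] show ?thesis by simp
qed

lemma orbit_measurable:
 assumes "F \<in> borel_measurable M" "om \<in> space M"
 shows "(%x. F (\<tau> x om)) \<in> borel_fun"
 using assms by measurable

lemma distr_shift: "distr M M (\<tau> x) = M"
proof (rule measure_eqI)
 fix A assume "A \<in> sets (distr M M (\<tau> x))"
 then have A: "A \<in> sets M" by simp
 have "\<tau> x -` A \<inter> space M = \<tau> (- x) ` A"
 proof (intro set_eqI iffI)
  fix om assume w: "om \<in> \<tau> x -` A \<inter> space M"
  then have "\<tau> (- x) (\<tau> x om) = om" by (simp add: shift_add shift_zero)
  then show "om \<in> \<tau> (- x) ` A" using w by (intro image_eqI[of _ _ "\<tau> x om"]) auto
 next
  fix om assume "om \<in> \<tau> (- x) ` A"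
  then obtain om' where w: "om = \<tau> (- x) om'" "om' \<in> A" by auto
  have "om' \<in> space M" using w A sets.sets_into_space by blast
  then have "\<tau> x (\<tau> (- x) om') = om'" "\<tau> (- x) om' \<in> space M" by (simp_all add: shift_add shift_zero)
  then show "om \<in> \<tau> x -` A \<inter> space M" using w by simp
 qed
 then show "emeasure (distr M M (\<tau> x)) A = emeasure M A"
  using stationary[OF A, of "- x"] A shift_measurable by (simp add: emeasure_distr emeasure_eq_measure)
qed simp

lemma nn_integral_shift:
 assumes [measurable]: "F \<in> borel_measurable M"
 shows "(\<integral>\<^sup>+om. F (\<tau> x om) \<partial>M) = (\<integral>\<^sup>+om. F om \<partial>M)"
 using nn_integral_distr[OF shift_measurable[of x], of F] by (simp add: distr_shift)

lemma
 fixes F :: "'w => real"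
 assumes [measurable]: "F \<in> borel_measurable M"
 shows integral_shift: "(LINT om|M. F (\<tau> x om)) = (LINT om|M. F om)"
  and integrable_shift: "integrable M (%om. F (\<tau> x om)) \<longleftrightarrow> integrable M F"
 using integral_distr[OF shift_measurable[of x], of F] integrable_distr_eq[OF shift_measurable[of x], of F]
 by (simp_all add: distr_shift)

lemma L2_shift:
 assumes "F \<in> L2_space M"
 shows "(%om. F (\<tau> x om)) \<in> L2_space M" "L2_norm M (%om. F (\<tau> x om)) = L2_norm M F"
proof -
 have [measurable]: "F \<in> borel_measurable M" using L2_spaceD assms by auto
 show "(%om. F (\<tau> x om)) \<in> L2_space M"
  using integrable_shift[of "%om. (F om)^2" x] assms by (simp add: L2_space_def)
 show "L2_norm M (%om. F (\<tau> x om)) = L2_norm M F"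
  using integral_shift[of "%om. (F om)^2" x] by (simp add: L2_norm_def)
qed

lemma pair_sigma_finite_lborel_M: "pair_sigma_finite (lborel :: (real^'n) measure) M"
 by (intro pair_sigma_finite.intro sigma_finite_lborel sigma_finite_measure_axioms)

lemma nn_integral_orbit:
 assumes [measurable]: "F \<in> borel_measurable M" "\<phi> \<in> borel_fun"
 shows "(\<integral>\<^sup>+om. (NBINT x. \<phi> x * F (\<tau> x om)) \<partial>M) = (NBINT x. \<phi> x) * (\<integral>\<^sup>+om. F om \<partial>M)"
proof -
 interpret pair_sigma_finite "lborel :: (real^'n) measure" M by (rule pair_sigma_finite_lborel_M)
 have "(\<integral>\<^sup>+om. (NBINT x. \<phi> x * F (\<tau> x om)) \<partial>M) = (NBINT x. (\<integral>\<^sup>+om. \<phi> x * F (\<tau> x om) \<partial>M))"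
  by (rule Fubini') measurable
 also have "... = (NBINT x. \<phi> x * (\<integral>\<^sup>+om. F om \<partial>M))"
  by (intro nn_integral_cong) (simp add: nn_integral_cmult nn_integral_shift)
 also have "... = (NBINT x. \<phi> x) * (\<integral>\<^sup>+om. F om \<partial>M)"
  by (rule nn_integral_multc) measurable
 finally show ?thesis .
qed

lemma AE_orbit:
 assumes "AE om in M. P om"
 shows "AE om in M. AE x in lborel. P (\<tau> x om)"
proof -
 obtain N where N: "{om\<in>space M. \<not> P om} \<subseteq> N" "N \<in> null_sets M"
  using assms by (auto simp: eventually_ae_filter)
 have [measurable]: "N \<in> sets M" using N by auto
 have "(\<integral>\<^sup>+om. (NBINT x. 1 * indicator N (\<tau> x om)) \<partial>M) = 0"
  using N by (subst nn_integral_orbit) auto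
 then have "AE om in M. (NBINT x. indicator N (\<tau> x om)) = 0"
  by (subst (asm) nn_integral_0_iff_AE) auto
 then show ?thesis using AE_space
 proof eventually_elim
  case (elim om)
  then have "AE x in lborel. indicator N (\<tau> x om) = (0::ennreal)"
   by (subst (asm) nn_integral_0_iff_AE) auto
  then show ?case
  proof eventually_elim
   case (elim x)
   have "\<tau> x om \<in> space M" using \<open>om \<in> space M\<close> by simp
   moreover have "\<tau> x om \<notin> N" using elim by (simp add: indicator_def split: if_splits)
   ultimately show ?case using N(1) by blast
  qed
 qed
qed

text \<open>
 The maximal inequality is transferred from \<open>\<real>\<^sup>d\<close> to the probability space: the
 estimate along an orbit is integrated over \<open>om\<close>, and stationarity makes every point of the orbit
 equally distributed.
\<close>

lemma maximal_inequality:
 assumes F: "integrable M F" and t: "0 < t"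
 obtains E where "E \<in> sets M"
  "t * measure M E <= 10 ^ CARD('n) * unit_ball_vol (real CARD('n)) * (LINT om|M. \<bar>F om\<bar>)"
  "!!om. om \<in> space M - E ==> avg_bdd (%x. F (\<tau> x om)) (2 ^ CARD('n) * t)"
proof -
 let ?D = "CARD('n)" and ?V = "unit_ball_vol (real CARD('n))"
 have V: "0 < ?V" by simp
 have [measurable]: "F \<in> borel_measurable M" using F by auto
 define Q where "Q = (%n::nat. %om. NBINT y. ennreal \<bar>F (\<tau> y om)\<bar> * indicator (cball 0 (real n)) y)"
 have [measurable]: "Q n \<in> borel_measurable M" for n unfolding Q_def by measurable
 define E where "E = (%N::nat. {om\<in>space M. \<exists>n\<in>{1..N}. ennreal (t * real n ^ ?D) < Q n om})"
 have [measurable]: "E N \<in> sets M" for N unfolding E_def by measurable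
 let ?I = "LINT om|M. \<bar>F om\<bar>"
 have I: "(\<integral>\<^sup>+om. ennreal \<bar>F om\<bar> \<partial>M) = ennreal ?I"
  using F by (intro nn_integral_eq_integral) auto
 have EN: "t * measure M (E N) <= 10 ^ ?D * ?V * ?I" if "0 < N" for N
 proof -
  have "ennreal t * (ennreal (?V * real N ^ ?D) * ennreal (measure M (E N)))
    = ennreal t * (\<integral>\<^sup>+om. (NBINT x. indicator (cball 0 (real N)) x * indicator (E N) (\<tau> x om)) \<partial>M)"
   using nn_integral_orbit[of "indicator (E N)" "indicator (cball 0 (real N))"]
   by (simp add: emeasure_cball emeasure_eq_measure)
  also have "... = (\<integral>\<^sup>+om. ennreal t * (NBINT x. indicator (cball 0 (real N)) x * indicator (E N) (\<tau> x om)) \<partial>M)"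
   by (rule nn_integral_cmult[symmetric]) measurable
  also have "... <= (\<integral>\<^sup>+om. ennreal (5 ^ ?D * ?V) *
    (NBINT y. indicator (cball 0 (real N + real N)) y * ennreal \<bar>F (\<tau> y om)\<bar>) \<partial>M)"
  proof (intro nn_integral_mono)
   fix om assume w: "om \<in> space M"
   define B where "B = {x \<in> space (lborel::(real^'n) measure). x \<in> cball 0 (real N) \<and> \<tau> x om \<in> E N}"
   have Bm[measurable]: "B \<in> sets borel"
   proof -
    have "{x \<in> space (lborel::(real^'n) measure). x \<in> cball 0 (real N) \<and> \<tau> x om \<in> E N} \<in> sets lborel"
     using w by measurable
    then show ?thesis by (simp add: B_def)
   qed
   have m[measurable]: "(%y. ennreal \<bar>F (\<tau> y om)\<bar>) \<in> borel_fun" using w by measurable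
   have "ennreal t * emeasure lborel B <= ennreal (5 ^ DIM(real^'n) * unit_ball_vol (real DIM(real^'n))) *
     (NBINT y. ennreal \<bar>F (\<tau> y om)\<bar> * indicator (cball 0 (real N + real N)) y)"
   proof (rule Vitali_maximal_estimate[OF m t])
    show "B \<in> sets lborel" "B \<subseteq> cball 0 (real N)" using Bm by (auto simp: B_def)
    fix x assume "x \<in> B"
    then obtain n where n: "n \<in> {1..N}" "ennreal (t * real n ^ ?D) < Q n (\<tau> x om)"
     by (auto simp: B_def E_def)
    have "Q n (\<tau> x om) = (NBINT y. ennreal \<bar>F (\<tau> (y + x) om)\<bar> * indicator (cball x (real n)) (y + x))"
     using shift_add[OF w] unfolding Q_def
     by (intro nn_integral_cong) (auto simp: indicator_def dist_norm norm_minus_commute)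
    also have "... = (NBINT y. ennreal \<bar>F (\<tau> y om)\<bar> * indicator (cball x (real n)) y)"
     by (intro nn_integral_lborel_translate[of "%y. ennreal \<bar>F (\<tau> y om)\<bar> * indicator (cball x (real n)) y"]) measurable
    finally show "\<exists>n\<in>{1..N}. ennreal (t * real n ^ DIM(real^'n))
      < (NBINT y. ennreal \<bar>F (\<tau> y om)\<bar> * indicator (cball x (real n)) y)"
     using n by auto
   qed
   moreover have "emeasure lborel B = (NBINT x. indicator (cball 0 (real N)) x * indicator (E N) (\<tau> x om))"
   proof -
    have "emeasure lborel B = (NBINT x. indicator B x)" using Bm by simp
    also have "... = (NBINT x. indicator (cball 0 (real N)) x * indicator (E N) (\<tau> x om))"
     by (intro nn_integral_cong) (auto simp: B_def indicator_def)
    finally show ?thesis .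
   qed
   ultimately show "ennreal t * (NBINT x. indicator (cball 0 (real N)) x * indicator (E N) (\<tau> x om))
     <= ennreal (5 ^ ?D * ?V) * (NBINT y. indicator (cball 0 (real N + real N)) y * ennreal \<bar>F (\<tau> y om)\<bar>)"
    by (simp add: mult.commute)
  qed
  also have "... = ennreal (5 ^ ?D * ?V) * (ennreal (?V * (real N + real N) ^ ?D) * ennreal ?I)"
   using nn_integral_orbit[of "%om. ennreal \<bar>F om\<bar>" "indicator (cball 0 (real N + real N))"] I
   by (subst nn_integral_cmult) (auto simp: emeasure_cball)
  finally have "ennreal (t * (?V * real N ^ ?D * measure M (E N)))
    <= ennreal (5 ^ ?D * ?V * (?V * (real N + real N) ^ ?D * ?I))"
   using t V by (simp add: ennreal_mult[symmetric] del: ennreal_power)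
  then have "t * (?V * real N ^ ?D * measure M (E N)) <= 5 ^ ?D * ?V * (?V * (real N + real N) ^ ?D * ?I)"
   using V by (subst (asm) ennreal_le_iff) auto
  also have "(real N + real N) ^ ?D = 2 ^ ?D * real N ^ ?D" unfolding power_mult_distrib[symmetric] mult_2 ..
  also have "5 ^ ?D * ?V * (?V * (2 ^ ?D * real N ^ ?D) * ?I) = (?V * real N ^ ?D) * ((5 * 2) ^ ?D * ?V * ?I)"
   unfolding power_mult_distrib by (simp add: mult_ac)
  finally have "(?V * real N ^ ?D) * (t * measure M (E N)) <= (?V * real N ^ ?D) * (10 ^ ?D * ?V * ?I)"
   by (simp add: mult_ac)
  then show ?thesis using V that by (subst (asm) mult_le_cancel_left_pos) auto
 qed
 show thesis
 proof (rule that[of "\<Union>N. E N"])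
  show "(\<Union>N. E N) \<in> sets M" by measurable
  have "incseq E" by (auto simp: incseq_def E_def)
  then have "(%N. measure M (E N)) \<longlonglongrightarrow> measure M (\<Union>N. E N)"
   by (intro finite_Lim_measure_incseq) auto
  then have "(%N. t * measure M (E N)) \<longlonglongrightarrow> t * measure M (\<Union>N. E N)" by (intro tendsto_intros)
  moreover have "\<forall>\<^sub>F N in sequentially. t * measure M (E N) <= 10 ^ ?D * ?V * ?I"
   using eventually_gt_at_top[of 0] by eventually_elim (rule EN)
  ultimately show "t * measure M (\<Union>N. E N) <= 10 ^ ?D * ?V * ?I"
   by (intro tendsto_upperbound[of _ _ sequentially]) auto
 next
  fix om assume w: "om \<in> space M - (\<Union>N. E N)"
  have Q: "Q n om <= ennreal (t * real n ^ ?D)" if "1 <= n" for n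
  proof -
   have "om \<notin> E n" using w by auto
   then show ?thesis using w that by (auto simp: E_def not_less)
  qed
  show "avg_bdd (%x. F (\<tau> x om)) (2 ^ ?D * t)"
   unfolding avg_bdd_def
  proof (intro conjI allI impI)
   show "(%x. F (\<tau> x om)) \<in> borel_fun" using w by (intro orbit_measurable) auto
   fix r :: real assume "1 <= r"
   define n where "n = nat \<lceil>r\<rceil>"
   have n: "r <= real n" "real n <= 2 * r" "1 <= n" using \<open>1 <= r\<close> unfolding n_def by linarith+
   have "(NBINT x. ennreal \<bar>F (\<tau> x om)\<bar> * indicator (cball 0 r) x) <= Q n om"
    unfolding Q_def using n by (intro nn_integral_mono) (auto simp: indicator_def)
   also have "... <= ennreal (t * real n ^ ?D)" by (rule Q[OF n(3)])
   also have "... <= ennreal (2 ^ ?D * t * r ^ ?D)"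
   proof (intro ennreal_leI)
    have "real n ^ ?D <= (2 * r) ^ ?D" using n by (intro power_mono) auto
    then show "t * real n ^ ?D <= 2 ^ ?D * t * r ^ ?D" using t by (simp add: power_mult_distrib)
   qed
   finally show "(NBINT x. ennreal \<bar>F (\<tau> x om)\<bar> * indicator (cball 0 r) x) <= ennreal (2 ^ ?D * t * r ^ DIM(real^'n))"
    by simp
  qed (use t in auto)
 qed
qed

lemma AE_avg_bdd:
 assumes F: "integrable M F"
 shows "AE om in M. \<exists>S. avg_bdd (%x. F (\<tau> x om)) S"
proof -
 let ?C = "10 ^ CARD('n) * unit_ball_vol (real CARD('n)) * (LINT om|M. \<bar>F om\<bar>)"
 have "\<exists>E. E \<in> sets M \<and> real (Suc k) * measure M E <= ?C \<and>
   (\<forall>om. om \<in> space M - E \<longrightarrow> avg_bdd (%x. F (\<tau> x om)) (2 ^ CARD('n) * real (Suc k)))" for k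
  using maximal_inequality[OF F, of "real (Suc k)"] by (metis of_nat_0_less_iff zero_less_Suc)
 then obtain E where E: "!!k. E k \<in> sets M" "!!k. real (Suc k) * measure M (E k) <= ?C"
   "!!k om. om \<in> space M - E k ==> avg_bdd (%x. F (\<tau> x om)) (2 ^ CARD('n) * real (Suc k))"
  by metis
 have [measurable]: "(\<Inter>k. E k) \<in> sets M" using E(1) by auto
 have "measure M (\<Inter>k. E k) <= ?C / real (Suc k)" for k
 proof -
  have "measure M (\<Inter>k. E k) <= measure M (E k)" using E(1) by (intro finite_measure_mono) auto
  also have "... <= ?C / real (Suc k)" using E(2)[of k] by (simp add: field_simps)
  finally show ?thesis .
 qed
 moreover have "(%k. ?C / real (Suc k)) \<longlonglongrightarrow> 0" by (intro LIMSEQ_Suc[of "%k. _ / real k"] lim_const_over_n)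
 ultimately have "measure M (\<Inter>k. E k) <= 0" by (intro LIMSEQ_le_const[of _ 0]) auto
 then have "(\<Inter>k. E k) \<in> null_sets M" by (auto simp: null_sets_def emeasure_eq_measure measure_le_0_iff)
 then show ?thesis
  by (rule AE_I'[of _ M]) (use E(3) in blast)
qed

end

lemma double_ball_average:
 fixes p :: "'a::euclidean_space => real"
 assumes p: "avg_bdd p C" and RS: "0 < R" "0 < S"
 shows "integrable lborel (%z. (LBINT x. p (x + z) * ball_weight S x) * ball_weight R z)"
  and "(LBINT x. (LBINT z. p (z + x) * ball_weight R z) * ball_weight S x)
   = (LBINT z. (LBINT x. p (x + z) * ball_weight S x) * ball_weight R z)"
proof -
 let ?f = "%z x. ball_weight S x * p (x + 1 *\<^sub>R z) * ball_weight R z"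
 have le: "\<bar>ball_weight Q (x::'a)\<bar> <= 1 / measure lborel (cball (0::'a) Q)" for Q x
  by (auto simp: ball_weight_def indicator_def)
 have i: "integrable (lborel \<Otimes>\<^sub>M lborel) (case_prod ?f)"
  by (rule integrable_shifted_product[where R=S and S=R, OF loc_int_avg_bdd[OF p] _ _ _ le _ le]) (auto simp: ball_weight_def)
 from lborel_pair.integrable_fst'[OF i]
 show "integrable lborel (%z. (LBINT x. p (x + z) * ball_weight S x) * ball_weight R z)" by (simp add: mult.commute)
 have e1: "(LBINT z. ?f z x) = (LBINT z. p (z + x) * ball_weight R z) * ball_weight S x" for x
  by (subst integral_mult_left_zero[symmetric]) (simp add: mult_ac add.commute)
 have e2: "(LBINT x. ?f z x) = (LBINT x. p (x + z) * ball_weight S x) * ball_weight R z" for z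
  by (subst integral_mult_left_zero[symmetric]) (simp add: mult_ac)
 from lborel_pair.Fubini_integral[OF i]
 have "(LBINT x. (LBINT z. ?f z x)) = (LBINT z. (LBINT x. ?f z x))" .
 then show "(LBINT x. (LBINT z. p (z + x) * ball_weight R z) * ball_weight S x)
   = (LBINT z. (LBINT x. p (x + z) * ball_weight S x) * ball_weight R z)" unfolding e1 e2 .
qed

context stationary_ergodic_environment
begin

definition wavg :: "(real^'n => real) => ('w => real) => 'w => real" where
 "wavg w F om = (LBINT z. F (\<tau> z om) * w z)"

abbreviation bavg :: "real => ('w => real) => 'w => real" where
 "bavg R \<equiv> wavg (ball_weight R)"

lemma wavg_measurable [measurable]:
 assumes [measurable]: "F \<in> borel_measurable M" "w \<in> borel_fun"
 shows "wavg w F \<in> borel_measurable M"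
proof -
 interpret pair_sigma_finite "lborel :: (real^'n) measure" M by (rule pair_sigma_finite_lborel_M)
 show ?thesis unfolding wavg_def by measurable
qed

lemma wavg_L2:
 assumes F: "F \<in> L2_space M" and [measurable]: "w \<in> borel_fun"
  and w: "(NBINT z. ennreal \<bar>w z\<bar>) <= ennreal W" "0 <= W"
 shows "wavg w F \<in> L2_space M" "L2_norm M (wavg w F) <= W * L2_norm M F"
proof -
 have [measurable]: "F \<in> borel_measurable M" using L2_spaceD F by auto
 define s where "s = (%om z. F (\<tau> z om) * (if w z < 0 then -1 else 1))"
 have eq: "wavg w F = (%om. LBINT z. s om z * \<bar>w z\<bar>)"
  unfolding wavg_def s_def by (intro ext lint_cong) auto
 have sm: "case_prod s \<in> borel_measurable (M \<Otimes>\<^sub>M lborel)"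
  unfolding s_def by measurable
 have Q: "(\<integral>\<^sup>+om. ennreal ((s om z)^2 * \<bar>w z\<bar>) \<partial>M) <= ennreal ((L2_norm M F)^2 * \<bar>w z\<bar>)" for z
 proof -
  have "(\<integral>\<^sup>+om. ennreal ((s om z)^2 * \<bar>w z\<bar>) \<partial>M) = (\<integral>\<^sup>+om. ennreal ((F (\<tau> z om))^2) * ennreal \<bar>w z\<bar> \<partial>M)"
   by (intro nn_integral_cong) (auto simp: s_def ennreal_mult power_mult_distrib)
  also have "... = (\<integral>\<^sup>+om. ennreal ((F (\<tau> z om))^2) \<partial>M) * ennreal \<bar>w z\<bar>"
   by (rule nn_integral_multc) measurable
  also have "(\<integral>\<^sup>+om. ennreal ((F (\<tau> z om))^2) \<partial>M) = ennreal ((L2_norm M F)^2)"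
   using nn_integral_L2[OF L2_shift(1)[OF F, of z]] by (simp add: L2_shift(2)[OF F])
  finally show ?thesis by (simp add: ennreal_mult)
 qed
 have B: "(NBINT z. ennreal ((L2_norm M F)^2 * \<bar>w z\<bar>)) <= ennreal ((L2_norm M F)^2 * W)"
 proof -
  have "(NBINT z. ennreal ((L2_norm M F)^2 * \<bar>w z\<bar>)) = ennreal ((L2_norm M F)^2) * (NBINT z. ennreal \<bar>w z\<bar>)"
   by (subst nn_integral_cmult[symmetric]) (auto simp: ennreal_mult)
  also have "... <= ennreal ((L2_norm M F)^2) * ennreal W" by (intro mult_left_mono w) auto
  finally show ?thesis using w by (simp add: ennreal_mult)
 qed
 note * = weighted_average_L2[OF sigma_finite_measure_axioms sigma_finite_lborel sm _ _ w(1) w(2) Q _ B]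
 show "wavg w F \<in> L2_space M" unfolding eq by (rule *(1)) (use w in auto)
 have "L2_norm M (wavg w F) <= sqrt (W * ((L2_norm M F)^2 * W))" unfolding eq by (rule *(2)) (use w in auto)
 also have "... = sqrt ((W * L2_norm M F)^2)" by (simp add: power2_eq_square mult_ac)
 also have "... = W * L2_norm M F" using w by simp
 finally show "L2_norm M (wavg w F) <= W * L2_norm M F" .
qed

lemma bavg_L2:
 assumes "F \<in> L2_space M" "0 < R"
 shows "bavg R F \<in> L2_space M" "L2_norm M (bavg R F) <= L2_norm M F"
 using wavg_L2[OF assms(1) ball_weight_measurable, of R 1] ball_weight_nn_integral[OF assms(2), where 'a="real^'n"] by auto

lemma L2_integrable: "F \<in> L2_space M ==> integrable M F"
 using L2_prod_integrable[of F M "%_. 1"] by (simp add: L2_space_def)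

lemma L2_mean_le: "F \<in> L2_space M ==> (LINT om|M. \<bar>F om\<bar>) <= L2_norm M F"
 using L2_Cauchy_Schwarz[of "%om. \<bar>F om\<bar>" M "%_. 1"]
 by (auto simp: L2_space_def L2_norm_def prob_space)

lemma bavg_orbit:
 assumes "om \<in> space M"
 shows "bavg R F (\<tau> x om) = (LBINT z. F (\<tau> (z + x) om) * ball_weight R z)"
 using shift_add[OF assms] by (simp add: wavg_def)

lemma bavg_translate_L2:
 assumes F: "F \<in> L2_space M" and zR: "norm z <= R" "R <= S" "0 < S"
 shows "L2_norm M (%om. bavg S F (\<tau> z om) - bavg S F om) <= shell_ratio CARD('n) R S * L2_norm M F"
proof -
 have [measurable]: "F \<in> borel_measurable M" using L2_spaceD F by auto
 let ?w = "%y. ball_weight S (y - z) - ball_weight S y"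
 have R: "0 <= R" using zR(1) norm_ge_zero[of z] by linarith
 have "L2_norm M (%om. bavg S F (\<tau> z om) - bavg S F om) = L2_norm M (wavg ?w F)"
 proof (rule L2_norm_cong_AE)
  show "AE om in M. bavg S F (\<tau> z om) - bavg S F om = wavg ?w F om"
   using AE_avg_bdd[OF L2_integrable[OF F]] AE_space
  proof eventually_elim
   case (elim om)
   then obtain C where C: "avg_bdd (%x. F (\<tau> x om)) C" by auto
   have [measurable]: "(%x. F (\<tau> x om)) \<in> borel_fun" using C by (simp add: avg_bdd_def)
   have i: "integrable lborel (%y. F (\<tau> y om) * ball_weight S (y - a))" if "norm a <= R" for a
   proof (rule lint_bound)
    show "integrable lborel (%y. (F (\<tau> y om) * indicator (cball 0 (S + R)) y) / measure lborel (cball (0::real^'n) S))"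
     using avg_bdd_integrable[OF C] by simp
    have "norm y <= S + R" if "norm (y - a) <= S" for y
     using that \<open>norm a <= R\<close> norm_triangle_sub[of y a] by auto
    then show "AE y in lborel. norm (F (\<tau> y om) * ball_weight S (y - a))
      <= norm ((F (\<tau> y om) * indicator (cball 0 (S + R)) y) / measure lborel (cball (0::real^'n) S))"
     by (auto simp: ball_weight_def indicator_def abs_mult)
   qed measurable
   have "bavg S F (\<tau> z om) = (LBINT y. F (\<tau> (y + z) om) * ball_weight S ((y + z) - z))"
    using elim by (simp add: bavg_orbit)
   also have "... = (LBINT y. F (\<tau> y om) * ball_weight S (y - z))"
    by (rule integral_lborel_translate[of "%y. F (\<tau> y om) * ball_weight S (y - z)" z]) measurable
   finally show ?case using i[OF zR(1)] i[of 0] R by (simp add: wavg_def right_diff_distrib)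
  qed
 qed measurable
 also have "... <= shell_ratio CARD('n) R S * L2_norm M F"
 proof (rule wavg_L2(2)[OF F])
  show "(NBINT y. ennreal \<bar>?w y\<bar>) <= ennreal (shell_ratio CARD('n) R S)"
   using ball_weight_translate_diff[OF zR] by simp
  show "0 <= shell_ratio CARD('n) R S"
   unfolding shell_ratio_def using zR R by (intro divide_nonneg_nonneg) (auto intro!: power_mono)
 qed measurable
 finally show ?thesis .
qed

lemma bavg_bavg_L2:
 assumes F: "F \<in> L2_space M" and RS: "0 < R" "R <= S"
 shows "L2_norm M (%om. bavg S (bavg R F) om - bavg S F om) <= shell_ratio CARD('n) R S * L2_norm M F"
proof -
 have [measurable]: "F \<in> borel_measurable M" using L2_spaceD F by auto
 have S: "0 < S" using RS by simp
 let ?\<sigma> = "shell_ratio CARD('n) R S"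
 have \<sigma>: "0 <= ?\<sigma>"
  unfolding shell_ratio_def using RS by (intro divide_nonneg_nonneg) (auto intro!: power_mono)
 define s where "s = (%om z. bavg S F (\<tau> z om) - bavg S F om)"
 have sm: "case_prod s \<in> borel_measurable (M \<Otimes>\<^sub>M lborel)" unfolding s_def by measurable
 have "L2_norm M (%om. bavg S (bavg R F) om - bavg S F om) = L2_norm M (%om. LBINT z. s om z * ball_weight R z)"
 proof (rule L2_norm_cong_AE)
  show "AE om in M. bavg S (bavg R F) om - bavg S F om = (LBINT z. s om z * ball_weight R z)"
   using AE_avg_bdd[OF L2_integrable[OF F]] AE_space
  proof eventually_elim
   case (elim om)
   then obtain C where C: "avg_bdd (%x. F (\<tau> x om)) C" by auto
   note d = double_ball_average[OF C RS(1) S]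
   have "bavg S (bavg R F) om = (LBINT x. (LBINT z. F (\<tau> (z + x) om) * ball_weight R z) * ball_weight S x)"
    using elim by (simp add: wavg_def[of "ball_weight S"] bavg_orbit)
   also have "... = (LBINT z. bavg S F (\<tau> z om) * ball_weight R z)"
    unfolding d(2) using elim by (simp add: bavg_orbit)
   finally have "bavg S (bavg R F) om = (LBINT z. bavg S F (\<tau> z om) * ball_weight R z)" .
   moreover have "integrable lborel (%z. bavg S F (\<tau> z om) * ball_weight R z)"
    using d(1) elim by (simp add: bavg_orbit)
   ultimately show ?case using ball_weight_integral[OF RS(1), where 'a="real^'n"]
    by (simp add: s_def left_diff_distrib)
  qed
  show "(%om. LBINT z. s om z * ball_weight R z) \<in> borel_measurable M"
   unfolding s_def by measurable
 qed measurable
 also have "... <= sqrt (1 * (?\<sigma> * L2_norm M F)^2)"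
 proof (rule weighted_average_L2(2)[OF sigma_finite_measure_axioms sigma_finite_lborel sm])
  show "(NBINT z. ennreal (ball_weight R (z::real^'n))) <= ennreal 1"
   using ball_weight_nn_integral[OF RS(1), where 'a="real^'n"] by simp
  show "(NBINT z. ennreal ((?\<sigma> * L2_norm M F)^2 * ball_weight R (z::real^'n))) <= ennreal ((?\<sigma> * L2_norm M F)^2)"
  proof -
   have "(NBINT z. ennreal ((?\<sigma> * L2_norm M F)^2 * ball_weight R (z::real^'n)))
    = ennreal ((?\<sigma> * L2_norm M F)^2) * (NBINT z. ennreal (ball_weight R (z::real^'n)))"
    by (subst nn_integral_cmult[symmetric]) (auto simp: ennreal_mult)
   then show ?thesis using ball_weight_nn_integral[OF RS(1), where 'a="real^'n"] by simp
  qed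
  fix z :: "real^'n"
  show "(\<integral>\<^sup>+om. ennreal ((s om z)^2 * ball_weight R z) \<partial>M) <= ennreal ((?\<sigma> * L2_norm M F)^2 * ball_weight R z)"
  proof (cases "norm z <= R")
   case False
   then show ?thesis by (simp add: ball_weight_def)
  next
   case True
   have sL: "(%om. s om z) \<in> L2_space M"
    unfolding s_def by (intro L2_diff L2_shift bavg_L2 F S)
   have [measurable]: "(%om. s om z) \<in> borel_measurable M" using L2_spaceD sL by auto
   have "(\<integral>\<^sup>+om. ennreal ((s om z)^2 * ball_weight R z) \<partial>M) = (\<integral>\<^sup>+om. ennreal ((s om z)^2) \<partial>M) * ennreal (ball_weight R z)"
    by (subst nn_integral_multc[symmetric]) (auto simp: ennreal_mult)
   also have "... = ennreal ((L2_norm M (%om. s om z))^2 * ball_weight R z)"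
    unfolding nn_integral_L2[OF sL] by (simp add: ennreal_mult)
   also have "... <= ennreal ((?\<sigma> * L2_norm M F)^2 * ball_weight R z)"
    using bavg_translate_L2[OF F True RS(2) S] unfolding s_def
    by (intro ennreal_leI mult_right_mono power_mono) auto
   finally show ?thesis .
  qed
 qed auto
 also have "... = ?\<sigma> * L2_norm M F" using \<sigma> by simp
 finally show ?thesis .
qed

text \<open>
 An almost everywhere invariant function is constant. The level sets are invariant only up to null sets
 which may depend on the shift; they are replaced by the set of those \<open>om\<close> whose orbit lies in the level set
 for Lebesgue almost every shift, which is strictly invariant.
\<close>

lemma invariant_imp_constant:
 fixes G :: "'w => real"
 assumes G: "integrable M G" and inv: "!!y. AE om in M. G (\<tau> y om) = G om"
 shows "AE om in M. G om = (LINT om|M. G om)"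
proof -
 have [measurable]: "G \<in> borel_measurable M" using G by auto
 let ?c = "LINT om|M. G om"
 define A where "A = {om\<in>space M. ?c < G om}"
 have [measurable]: "A \<in> sets M" unfolding A_def by measurable
 interpret pair_sigma_finite "lborel :: (real^'n) measure" M by (rule pair_sigma_finite_lborel_M)
 define A' where "A' = {om\<in>space M. AE x in lborel. \<tau> x om \<in> A}"
 have A'_eq: "A' = {om\<in>space M. (NBINT x. indicator (space M - A) (\<tau> x om)) = 0}"
 proof -
  have "(AE x in lborel. \<tau> x om \<in> A) \<longleftrightarrow> (NBINT x. indicator (space M - A) (\<tau> x om)) = 0"
   if w: "om \<in> space M" for om
  proof -
   have "(NBINT x. indicator (space M - A) (\<tau> x om)) = 0
     \<longleftrightarrow> (AE x in lborel. indicator (space M - A) (\<tau> x om) = (0::ennreal))"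
    using w by (intro nn_integral_0_iff_AE) measurable
   also have "... \<longleftrightarrow> (AE x in lborel. \<tau> x om \<in> A)"
    using w by (intro AE_cong) (auto simp: indicator_def)
   finally show ?thesis ..
  qed
  then show ?thesis by (auto simp: A'_def)
 qed
 have [measurable]: "A' \<in> sets M" unfolding A'_eq by measurable
 have sub: "\<tau> y ` A' \<subseteq> A'" for y
 proof safe
  fix om assume w: "om \<in> A'"
  then have ws: "om \<in> space M" by (simp add: A'_def)
  have "(NBINT x. indicator (space M - A) (\<tau> x (\<tau> y om))) = (NBINT x. indicator (space M - A) (\<tau> (x + y) om))"
   using ws by (simp add: shift_add)
  also have "... = (NBINT x. indicator (space M - A) (\<tau> x om))"
   using ws by (intro nn_integral_lborel_translate[of "%x. indicator (space M - A) (\<tau> x om)"]) measurable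
  also have "... = 0" using w by (simp add: A'_eq)
  finally show "\<tau> y om \<in> A'" using ws by (simp add: A'_eq)
 qed
 have "\<tau> y ` A' = A'" for y
 proof
  show "A' \<subseteq> \<tau> y ` A'"
  proof
   fix om assume w: "om \<in> A'"
   then have "om \<in> space M" by (simp add: A'_def)
   then have "\<tau> y (\<tau> (- y) om) = om" by (simp add: shift_add shift_zero)
   moreover have "\<tau> (- y) om \<in> A'" using sub w by auto
   ultimately show "om \<in> \<tau> y ` A'" by (metis imageI)
  qed
 qed (rule sub)
 then have "measure M A' \<in> {0, 1}" by (intro ergodic) auto
 moreover have "measure M A' = measure M A"
 proof (rule measure_eq_AE)
  have "AE x in lborel. AE om in M. G (\<tau> x om) = G om" using inv by simp
  then have "AE om in M. AE x in lborel. G (\<tau> x om) = G om"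
   by (subst AE_commute[symmetric]) measurable
  then show "AE om in M. (om \<in> A') = (om \<in> A)" using AE_space
  proof eventually_elim
   case (elim om)
   have "(AE x in lborel. \<tau> x om \<in> A) \<longleftrightarrow> (AE x in (lborel::(real^'n) measure). om \<in> A)"
   proof
    assume "AE x in lborel. \<tau> x om \<in> A"
    then show "AE x in (lborel::(real^'n) measure). om \<in> A"
     using elim(1) by eventually_elim (use elim(2) in \<open>auto simp: A_def\<close>)
   next
    assume "AE x in (lborel::(real^'n) measure). om \<in> A"
    then show "AE x in lborel. \<tau> x om \<in> A"
     using elim(1) by eventually_elim (use elim(2) in \<open>auto simp: A_def\<close>)
   qed
   moreover have "(AE x in (lborel::(real^'n) measure). om \<in> A) \<longleftrightarrow> om \<in> A"
    by (cases "om \<in> A") (auto simp: eventually_False ae_filter_eq_bot_iff)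
   ultimately show ?case using elim by (simp add: A'_def)
  qed
 qed auto
 ultimately have PA: "measure M A = 0 \<or> measure M A = 1" by auto
 have mean: "(LINT om|M. G om - ?c) = 0" using G by (simp add: prob_space)
 have "measure M A \<noteq> 1"
 proof
  assume "measure M A = 1"
  then have ae: "AE om in M. ?c < G om" using prob_Collect_eq_1[of "%om. ?c < G om"] by (simp add: A_def)
  have "AE om in M. G om - ?c = 0"
   using mean G ae by (subst (asm) integral_nonneg_eq_0_iff_AE) (auto elim!: eventually_mono)
  with ae have "AE om in M. False" by eventually_elim auto
  then show False by (simp add: AE_False)
 qed
 then have "measure M A = 0" using PA by simp
 then have "AE om in M. \<not> ?c < G om" using prob_Collect_eq_0[of "%om. ?c < G om"] by (simp add: A_def)
 moreover have "(LINT om|M. ?c - G om) = 0" using G by (simp add: prob_space)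
 ultimately have "AE om in M. ?c - G om = 0"
  using G by (subst (asm) integral_nonneg_eq_0_iff_AE) (auto elim!: eventually_mono)
 then show ?thesis by eventually_elim simp
qed


lemma L2_norm_invariance_bound:
 assumes F: "F \<in> L2_space M" and G: "G \<in> L2_space M" "0 < S"
 shows "L2_norm M (%om. G (\<tau> y om) - G om)
   <= 2 * L2_norm M (%om. bavg S F om - G om) + L2_norm M (%om. bavg S F (\<tau> y om) - bavg S F om)"
proof -
 note B = bavg_L2(1)[OF F \<open>0 < S\<close>]
 have "L2_norm M (%om. G (\<tau> y om) - G om)
   <= L2_norm M (%om. G (\<tau> y om) - bavg S F (\<tau> y om)) + L2_norm M (%om. bavg S F (\<tau> y om) - G om)"
  by (intro L2_norm_triangle_diff L2_shift B G)
 also have "L2_norm M (%om. G (\<tau> y om) - bavg S F (\<tau> y om)) = L2_norm M (%om. bavg S F om - G om)"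
  using L2_shift(2)[OF L2_diff[OF G(1) B], of y] by (simp add: L2_norm_minus_commute)
 also have "L2_norm M (%om. bavg S F (\<tau> y om) - G om)
   <= L2_norm M (%om. bavg S F (\<tau> y om) - bavg S F om) + L2_norm M (%om. bavg S F om - G om)"
  by (intro L2_norm_triangle_diff L2_shift B G)
 finally show ?thesis by simp
qed

lemma integral_wavg:
 assumes F: "integrable M F" and w: "integrable lborel w"
 shows "(LINT om|M. wavg w F om) = (LBINT z. w z) * (LINT om|M. F om)"
proof -
 have [measurable]: "F \<in> borel_measurable M" "w \<in> borel_fun" using F w by auto
 note sfM = sigma_finite_measure_axioms
 interpret pair_sigma_finite "lborel :: (real^'n) measure" M by (rule pair_sigma_finite_lborel_M)
 let ?f = "%z om. F (\<tau> z om) * w z"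
 have "(\<integral>\<^sup>+p. ennreal (norm (case_prod ?f p)) \<partial>(lborel \<Otimes>\<^sub>M M)) = (NBINT z. (\<integral>\<^sup>+om. ennreal (norm (?f z om)) \<partial>M))"
 proof -
  have "(%p. ennreal (norm (case_prod ?f p))) \<in> borel_measurable (lborel \<Otimes>\<^sub>M M)" by measurable
  from sigma_finite_measure.nn_integral_fst[OF sfM this] show ?thesis by simp
 qed
 also have "... = (\<integral>\<^sup>+om. (NBINT z. ennreal \<bar>w z\<bar> * ennreal \<bar>F (\<tau> z om)\<bar>) \<partial>M)"
  by (subst Fubini'[symmetric]) (auto simp: abs_mult ennreal_mult mult.commute)
 also have "... = (NBINT z. ennreal \<bar>w z\<bar>) * (\<integral>\<^sup>+om. ennreal \<bar>F om\<bar> \<partial>M)"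
  by (rule nn_integral_orbit[of "%om. ennreal \<bar>F om\<bar>" "%z. ennreal \<bar>w z\<bar>"]) measurable
 also have "... < \<infinity>"
  using F w by (simp add: integrable_iff_bounded ennreal_mult_less_top)
 finally have i: "integrable (lborel \<Otimes>\<^sub>M M) (case_prod ?f)"
  by (intro integrableI_bounded) auto
 have "(LINT om|M. wavg w F om) = (LBINT z. (LINT om|M. ?f z om))"
  unfolding wavg_def by (rule Fubini_integral[OF i])
 then show ?thesis by (simp add: integral_shift)
qed

text \<open>
 The norms of the ball averages converge to their infimum \<open>m\<close>, and the
 midpoint of two averages cannot have norm below \<open>m\<close>, since averaging it once more over a huge ball nearly
 gives a ball average again; the parallelogram identity then makes the averages a Cauchy sequence. The limit
 is invariant, hence constant.
\<close>

theorem mean_ergodic: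
 assumes F: "F \<in> L2_space M"
 shows "(%n. L2_norm M (%om. bavg (real n) F om - (LINT om|M. F om))) \<longlonglongrightarrow> 0"
proof -
 let ?\<sigma> = "%R n. shell_ratio CARD('n) R (real n) * L2_norm M F"
 have \<sigma>: "(%n. ?\<sigma> R n) \<longlonglongrightarrow> 0" for R by (intro tendsto_mult_left_zero shell_ratio_tendsto)
 define A where "A = (%n. bavg (real (Suc n)) F)"
 define a where "a = (%n. L2_norm M (A n))"
 have AL: "A n \<in> L2_space M" for n unfolding A_def by (rule bavg_L2[OF F]) simp
 have big: "\<forall>\<^sub>F n in sequentially. 0 < real n \<and> R <= real n" for R
  using eventually_gt_at_top[of 0] eventually_ge_at_top[of "nat \<lceil>R\<rceil>"]
  by eventually_elim linarith
 define m where "m = Inf (range a)"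
 have bdd: "bdd_below (range a)" by (rule bdd_belowI[of _ 0]) (auto simp: a_def)
 have m: "m <= a n" "0 <= m" for n
  unfolding m_def using bdd by (auto intro!: cInf_lower cInf_greatest simp: a_def)
 have mS: "m <= L2_norm M (bavg (real n) F)" if "0 < n" for n
  using m(1)[of "n - 1"] that by (simp add: a_def A_def)
 have lim_a: "a \<longlonglongrightarrow> m"
 proof (rule LIMSEQ_I)
  fix e :: real assume e: "0 < e"
  obtain k where k: "a k < m + e / 2"
   using cInf_lessD[of "range a" "m + e / 2"] e unfolding m_def by auto
  have "\<forall>\<^sub>F n in sequentially. ?\<sigma> (real (Suc k)) n < e / 2"
   using order_tendstoD(2)[OF \<sigma>, of "e / 2"] e by simp
  then have "\<forall>\<^sub>F n in sequentially. L2_norm M (bavg (real n) F) < m + e"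
   using big[of "real (Suc k)"]
  proof eventually_elim
   case (elim n)
   have L: "bavg (real n) (A k) \<in> L2_space M" "bavg (real n) F \<in> L2_space M"
    using elim by (intro bavg_L2 AL F; simp)+
   have "L2_norm M (%om. bavg (real n) F om)
     <= L2_norm M (%om. bavg (real n) F om - bavg (real n) (A k) om) + L2_norm M (%om. bavg (real n) (A k) om)"
    using L2_norm_triangle[OF L2_diff[OF L(2,1)] L(1)] by simp
   also have "L2_norm M (%om. bavg (real n) F om - bavg (real n) (A k) om) <= ?\<sigma> (real (Suc k)) n"
    using bavg_bavg_L2[OF F, of "real (Suc k)" "real n"] elim
    by (subst L2_norm_minus_commute) (simp add: A_def)
   also have "L2_norm M (%om. bavg (real n) (A k) om) <= a k"
    unfolding a_def using bavg_L2(2)[OF AL] elim by auto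
   finally show ?case using elim k by simp
  qed
  then obtain N where N: "!!n. n \<ge> N ==> L2_norm M (bavg (real n) F) < m + e"
   by (auto simp: eventually_sequentially)
  show "\<exists>no. \<forall>n\<ge>no. norm (a n - m) < e"
  proof (intro exI[of _ N] allI impI)
   fix n assume "N <= n"
   then have "a n < m + e" using N[of "Suc n"] by (simp add: a_def A_def)
   then show "norm (a n - m) < e" using m(1)[of n] by simp
  qed
 qed
 have mid: "2 * m <= L2_norm M (%om. A i om + A j om)" for i j
 proof -
  let ?P = "%om. A i om + A j om"
  have PL: "?P \<in> L2_space M" by (intro L2_add AL)
  have "\<forall>\<^sub>F n in sequentially. 2 * m - (?\<sigma> (real (Suc i)) n + ?\<sigma> (real (Suc j)) n) <= L2_norm M ?P"
   using big[of "real (Suc i)"] big[of "real (Suc j)"]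
  proof eventually_elim
   case (elim n)
   have L: "bavg (real n) (A i) \<in> L2_space M" "bavg (real n) (A j) \<in> L2_space M" "bavg (real n) F \<in> L2_space M"
    using elim by (intro bavg_L2 AL F; simp)+
   let ?B = "bavg (real n) F" and ?Bi = "bavg (real n) (A i)" and ?Bj = "bavg (real n) (A j)"
   have eq: "L2_norm M (bavg (real n) ?P) = L2_norm M (%om. ?Bi om + ?Bj om)"
   proof (rule L2_norm_cong_AE)
    have int: "integrable lborel (%z. A k (\<tau> z om) * ball_weight (real n) z)" if "avg_bdd (%x. A k (\<tau> x om)) C" for k om C
     using integrable_divide[OF avg_bdd_integrable[OF that, of "real n"], of "measure lborel (cball (0::real^'n) (real n))"]
     by (simp add: ball_weight_def[abs_def])
    show "AE om in M. bavg (real n) ?P om = ?Bi om + ?Bj om"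
     using AE_avg_bdd[OF L2_integrable[OF AL[of i]]] AE_avg_bdd[OF L2_integrable[OF AL[of j]]]
    proof eventually_elim
     case (elim om)
     then show ?case using int by (auto simp: wavg_def distrib_right)
    qed
    show "bavg (real n) ?P \<in> borel_measurable M" using PL elim by (intro L2_spaceD(1) bavg_L2) auto
    show "(%om. ?Bi om + ?Bj om) \<in> borel_measurable M" by (intro L2_spaceD(1) L2_add L)
   qed
   have "2 * m <= 2 * L2_norm M ?B" using mS elim by simp
   also have "... = L2_norm M (%om. 2 * ?B om)" by (simp add: L2_norm_cmult)
   also have "... <= L2_norm M (%om. 2 * ?B om - (?Bi om + ?Bj om)) + L2_norm M (%om. ?Bi om + ?Bj om)"
    using L2_norm_triangle[OF L2_diff[OF L2_cmult[OF L(3), of 2] L2_add[OF L(1,2)]] L2_add[OF L(1,2)]] by simp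
   also have "L2_norm M (%om. ?Bi om + ?Bj om) <= L2_norm M ?P"
    using bavg_L2(2)[OF PL] elim by (simp flip: eq)
   also have "L2_norm M (%om. 2 * ?B om - (?Bi om + ?Bj om))
     <= L2_norm M (%om. ?B om - ?Bi om) + L2_norm M (%om. ?B om - ?Bj om)"
    using L2_norm_triangle[OF L2_diff[OF L(3,1)] L2_diff[OF L(3,2)]] by (simp add: algebra_simps)
   also have "L2_norm M (%om. ?B om - ?Bi om) <= ?\<sigma> (real (Suc i)) n"
    using bavg_bavg_L2[OF F, of "real (Suc i)" "real n"] elim by (subst L2_norm_minus_commute) (simp add: A_def)
   also have "L2_norm M (%om. ?B om - ?Bj om) <= ?\<sigma> (real (Suc j)) n"
    using bavg_bavg_L2[OF F, of "real (Suc j)" "real n"] elim by (subst L2_norm_minus_commute) (simp add: A_def)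
   finally show ?case by simp
  qed
  moreover have "(%n. 2 * m - (?\<sigma> (real (Suc i)) n + ?\<sigma> (real (Suc j)) n)) \<longlonglongrightarrow> 2 * m - (0 + 0)"
   by (intro tendsto_diff tendsto_const tendsto_add \<sigma>)
  ultimately show ?thesis by (intro tendsto_upperbound[of _ "2 * m"]) auto
 qed
 have para: "(L2_norm M (%om. A i om - A j om))^2 <= 2 * (a i)^2 + 2 * (a j)^2 - 4 * m^2" for i j
 proof -
  have "(L2_norm M (%om. A i om - A j om))^2 + (L2_norm M (%om. A i om + A j om))^2
    = (LINT om|M. (A i om - A j om)^2 + (A i om + A j om)^2)"
   using L2_diff[OF AL[of i] AL[of j]] L2_add[OF AL[of i] AL[of j]]
   unfolding L2_norm_square by (subst lint_add) (auto dest: L2_spaceD)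
  also have "... = (LINT om|M. 2 * (A i om)^2 + 2 * (A j om)^2)"
   by (intro lint_cong) (auto simp: power2_eq_square algebra_simps)
  also have "... = 2 * (a i)^2 + 2 * (a j)^2"
   using AL[THEN L2_spaceD(2)] by (simp add: a_def L2_norm_square)
  finally have "(L2_norm M (%om. A i om - A j om))^2 + (L2_norm M (%om. A i om + A j om))^2 = 2 * (a i)^2 + 2 * (a j)^2" .
  moreover have "(2 * m)^2 <= (L2_norm M (%om. A i om + A j om))^2"
   using mid m by (intro power_mono) auto
  ultimately show ?thesis by (simp add: power_mult_distrib)
 qed
 obtain G where G: "G \<in> L2_space M" "(%n. L2_norm M (%om. A n om - G om)) \<longlonglongrightarrow> 0"
 proof (rule L2_complete[of A M])
  fix e :: real assume e: "0 < e"
  have "(%n. (a n)^2) \<longlonglongrightarrow> m^2" by (intro tendsto_power lim_a)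
  then have "\<forall>\<^sub>F n in sequentially. (a n)^2 < m^2 + e^2 / 4"
   using e by (intro order_tendstoD) auto
  then obtain N where N: "!!n. n \<ge> N ==> (a n)^2 < m^2 + e^2 / 4" by (auto simp: eventually_sequentially)
  have "L2_norm M (%x. A i x - A j x) < e" if "i \<ge> N" "j \<ge> N" for i j
  proof -
   have "(L2_norm M (%x. A i x - A j x))^2 < e^2"
    using para[of i j] N[OF that(1)] N[OF that(2)] by simp
   then show ?thesis using e by (simp add: power_less_imp_less_base)
  qed
  then show "\<exists>N. \<forall>m\<ge>N. \<forall>n\<ge>N. L2_norm M (%x. A m x - A n x) < e" by blast
 qed (use AL that in auto)
 have inv: "AE om in M. G (\<tau> y om) = G om" for y
 proof -
  have DL: "(%om. G (\<tau> y om) - G om) \<in> L2_space M" by (intro L2_diff L2_shift G)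
  have "\<forall>\<^sub>F n in sequentially. norm y + 1 <= real (Suc n)"
   using eventually_ge_at_top[of "nat \<lceil>norm y + 1\<rceil>"] by eventually_elim linarith
  then have "\<forall>\<^sub>F n in sequentially. L2_norm M (%om. G (\<tau> y om) - G om)
    <= 2 * L2_norm M (%om. A n om - G om) + ?\<sigma> (norm y) (Suc n)"
  proof eventually_elim
   case (elim n)
   have "L2_norm M (%om. G (\<tau> y om) - G om) <= 2 * L2_norm M (%om. bavg (real (Suc n)) F om - G om)
     + L2_norm M (%om. bavg (real (Suc n)) F (\<tau> y om) - bavg (real (Suc n)) F om)"
    by (rule L2_norm_invariance_bound[OF F G(1)]) simp
   also have "L2_norm M (%om. bavg (real (Suc n)) F (\<tau> y om) - bavg (real (Suc n)) F om) <= ?\<sigma> (norm y) (Suc n)"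
    using elim by (intro bavg_translate_L2 F) auto
   finally show ?case by (simp add: A_def)
  qed
  moreover have "(%n. 2 * L2_norm M (%om. A n om - G om) + ?\<sigma> (norm y) (Suc n)) \<longlonglongrightarrow> 2 * 0 + 0"
   by (intro tendsto_add tendsto_mult tendsto_const G LIMSEQ_Suc[OF \<sigma>])
  ultimately have "L2_norm M (%om. G (\<tau> y om) - G om) <= 2 * 0 + 0"
   by (intro tendsto_lowerbound) auto
  then have "(L2_norm M (%om. G (\<tau> y om) - G om))^2 = 0"
   using L2_norm_nonneg[of M "%om. G (\<tau> y om) - G om"] by (simp del: L2_norm_nonneg)
  then have "(LINT om|M. (G (\<tau> y om) - G om)^2) = 0" by (simp add: L2_norm_square)
  then have "AE om in M. (G (\<tau> y om) - G om)^2 = 0"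
   using L2_spaceD(2)[OF DL] by (subst (asm) integral_nonneg_eq_0_iff_AE) auto
  then show ?thesis by eventually_elim simp
 qed
 note Gi = L2_integrable[OF G(1)] and Fi = L2_integrable[OF F]
 have const: "AE om in M. G om = (LINT om|M. G om)" by (rule invariant_imp_constant[OF Gi inv])
 have "(LINT om|M. G om) = (LINT om|M. F om)"
 proof -
  have "\<bar>(LINT om|M. F om) - (LINT om|M. G om)\<bar> <= L2_norm M (%om. A n om - G om)" for n
  proof -
   have "(LINT om|M. F om) = (LINT om|M. A n om)"
    unfolding A_def using integral_wavg[OF Fi, of "ball_weight (real (Suc n))"]
     ball_weight_integral[of "real (Suc n)", where 'a="real^'n"] by simp
   then have "\<bar>(LINT om|M. F om) - (LINT om|M. G om)\<bar> = \<bar>LINT om|M. A n om - G om\<bar>"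
    using L2_integrable[OF AL] Gi by simp
   also have "... <= (LINT om|M. \<bar>A n om - G om\<bar>)" by (rule integral_abs_bound)
   also have "... <= L2_norm M (%om. A n om - G om)" by (intro L2_mean_le L2_diff AL G)
   finally show ?thesis .
  qed
  then have "\<bar>(LINT om|M. F om) - (LINT om|M. G om)\<bar> <= 0"
   by (intro LIMSEQ_le_const[OF G(2)]) auto
  then show ?thesis by simp
 qed
 with const have eq: "AE om in M. G om = (LINT om|M. F om)" by simp
 have "L2_norm M (%om. A n om - G om) = L2_norm M (%om. A n om - (LINT om|M. F om))" for n
 proof (rule L2_norm_cong_AE)
  show "AE x in M. A n x - G x = A n x - integral\<^sup>L M F" using eq by eventually_elim simp
 qed (use L2_spaceD(1)[OF AL] L2_spaceD(1)[OF G(1)] in auto)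
 then have "(%n. L2_norm M (%om. A n om - (LINT om|M. F om))) \<longlonglongrightarrow> 0" using G(2) by simp
 then show ?thesis unfolding A_def by (rule LIMSEQ_imp_Suc)
qed

text \<open>
 Combining the maximal inequality for \<open>bavg R F - \<E> F\<close> with the mean ergodic theorem and the
 Borel-Cantelli lemma: almost surely, averaging a realisation over balls of a suitable fixed radius
 makes it uniformly close, on the scale of large balls, to the expectation.
\<close>

theorem pointwise_ergodic:
 assumes F: "F \<in> L2_space M"
 shows "AE om in M. \<forall>s>0. \<exists>R>0. avg_bdd (%x. (LBINT z. F (\<tau> (z + x) om) * ball_weight R z) - (LINT om|M. F om)) s"
proof -
 let ?m = "LINT om|M. F om" and ?C = "10 ^ CARD('n) * unit_ball_vol (real CARD('n))"
 have "\<exists>n>0. L2_norm M (%om. bavg (real n) F om - ?m) < (1 / 4) ^ k" for k :: nat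
 proof -
  have "\<forall>\<^sub>F n in sequentially. L2_norm M (%om. bavg (real n) F om - ?m) < (1 / 4) ^ k"
   by (rule order_tendstoD[OF mean_ergodic[OF F]]) simp
  then have "\<forall>\<^sub>F n in sequentially. 0 < n \<and> L2_norm M (%om. bavg (real n) F om - ?m) < (1 / 4) ^ k"
   using eventually_gt_at_top[of 0] by eventually_elim auto
  then show ?thesis by (auto simp: eventually_sequentially)
 qed
 then obtain n where n: "!!k. 0 < n k" "!!k. L2_norm M (%om. bavg (real (n k)) F om - ?m) < (1 / 4) ^ k" by metis
 define X where "X = (%k om. bavg (real (n k)) F om - ?m)"
 have XL: "X k \<in> L2_space M" for k
  unfolding X_def using n by (intro L2_diff bavg_L2 F) (auto simp: L2_space_def)
 have "\<exists>E. E \<in> sets M \<and> (1 / 2) ^ k * measure M E <= ?C * (LINT om|M. \<bar>X k om\<bar>) \<and>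
   (\<forall>om. om \<in> space M - E \<longrightarrow> avg_bdd (%x. X k (\<tau> x om)) (2 ^ CARD('n) * (1 / 2) ^ k))" for k
  using maximal_inequality[OF L2_integrable[OF XL[of k]], of "(1 / 2) ^ k"] by (metis zero_less_power half_gt_zero_iff zero_less_one)
 then obtain E where E: "!!k. E k \<in> sets M" "!!k. (1 / 2) ^ k * measure M (E k) <= ?C * (LINT om|M. \<bar>X k om\<bar>)"
   "!!k om. om \<in> space M - E k ==> avg_bdd (%x. X k (\<tau> x om)) (2 ^ CARD('n) * (1 / 2) ^ k)"
  by metis
 have PE: "measure M (E k) <= ?C * (1 / 2) ^ k" for k
 proof -
  have "(1 / 2) ^ k * measure M (E k) <= ?C * (1 / 4) ^ k"
  proof -
   have "(LINT om|M. \<bar>X k om\<bar>) <= (1 / 4) ^ k"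
    using L2_mean_le[OF XL[of k]] n(2)[of k] by (simp add: X_def)
   then have "?C * (LINT om|M. \<bar>X k om\<bar>) <= ?C * (1 / 4) ^ k" by (intro mult_left_mono) auto
   then show ?thesis using E(2)[of k] by linarith
  qed
  also have "(1 / 4::real) ^ k = (1 / 2) ^ k * (1 / 2) ^ k" by (simp flip: power_mult_distrib)
  finally have "(1 / 2) ^ k * measure M (E k) <= (1 / 2) ^ k * (?C * (1 / 2) ^ k)" by (simp add: mult_ac)
  then show ?thesis by (subst (asm) mult_le_cancel_left_pos) auto
 qed
 have "AE om in M. \<forall>\<^sub>F k in sequentially. om \<in> space M - E k"
 proof (rule borel_cantelli_AE1)
  show "summable (%k. measure M (E k))"
   by (rule summable_comparison_test'[of "%k. ?C * (1 / 2) ^ k" 0]) (use PE in \<open>auto intro: summable_mult summable_geometric\<close>)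
 qed (use E in \<open>auto simp: emeasure_eq_measure\<close>)
 then show ?thesis using AE_space
 proof eventually_elim
  case (elim om)
  show ?case
  proof (intro allI impI)
   fix s :: real assume s: "0 < s"
   have "(%k. 2 ^ CARD('n) * (1 / 2::real) ^ k) \<longlonglongrightarrow> 0" by (intro tendsto_mult_right_zero LIMSEQ_realpow_zero) auto
   then have "\<forall>\<^sub>F k in sequentially. 2 ^ CARD('n) * (1 / 2::real) ^ k < s" using s by (rule order_tendstoD)
   then have "\<forall>\<^sub>F k in sequentially. 2 ^ CARD('n) * (1 / 2::real) ^ k < s \<and> om \<in> space M - E k"
    using elim(1) by eventually_elim auto
   then obtain k where k: "2 ^ CARD('n) * (1 / 2::real) ^ k < s" "om \<in> space M - E k"
    by (auto simp: eventually_sequentially)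
   have "avg_bdd (%x. X k (\<tau> x om)) s"
    by (rule avg_bdd_mono[OF E(3)[OF k(2)]]) (use k(1) in simp)
   then have "avg_bdd (%x. (LBINT z. F (\<tau> (z + x) om) * ball_weight (real (n k)) z) - ?m) s"
    using elim(2) by (simp add: X_def bavg_orbit)
   then show "\<exists>R>0. avg_bdd (%x. (LBINT z. F (\<tau> (z + x) om) * ball_weight R z) - ?m) s"
    using n(1)[of k] by (intro exI[of _ "real (n k)"]) auto
  qed
 qed
qed

end

section \<open>Compactly supported functions of class \<open>C\<^sup>k\<close>\<close>

lemma C_k_imp_continuous: "C_k k g ==> continuous_on UNIV g"
 by (cases k) (auto intro!: differentiable_imp_continuous_within continuous_at_imp_continuous_on)

lemma C_k_Suc_imp: "C_k (Suc k) g ==> C_k k g"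
proof (induction k arbitrary: g)
 case 0
 then show ?case using C_k_imp_continuous[OF 0] by simp
next
 case (Suc k)
 then show ?case by auto
qed

lemma C_k_mono: "j <= k ==> C_k k g ==> C_k j g"
 by (induction k rule: dec_induct) (auto dest: C_k_Suc_imp simp del: C_k.simps)

lemma C_k_has_derivative:
 fixes g :: "real^'n => real"
 assumes "C_k (Suc k) g"
 shows "(g has_derivative (%h. \<Sum>j\<in>UNIV. h $ j * partial j g x)) (at x)"
proof -
 have d: "(g has_derivative frechet_derivative g (at x)) (at x)"
  using assms frechet_derivative_works by auto
 then interpret bounded_linear "frechet_derivative g (at x)" by (rule has_derivative_bounded_linear)
 have "frechet_derivative g (at x) h = (\<Sum>j\<in>UNIV. h $ j * partial j g x)" for h
 proof -
  have "frechet_derivative g (at x) h = frechet_derivative g (at x) (\<Sum>j\<in>UNIV. h $ j *\<^sub>R axis j 1)"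
   using basis_expansion[of h] by (simp add: scalar_mult_eq_scaleR)
  then show ?thesis by (simp add: sum scaleR partial_def)
 qed
 then have "frechet_derivative g (at x) = (%h. \<Sum>j\<in>UNIV. h $ j * partial j g x)" by auto
 then show ?thesis using d by simp
qed

lemma partial_eqI:
 fixes g :: "real^'n => real"
 assumes "(g has_derivative (%h. \<Sum>j\<in>UNIV. h $ j * G j)) (at x)"
 shows "partial j g x = G j"
proof -
 have "frechet_derivative g (at x) = (%h. \<Sum>j\<in>UNIV. h $ j * G j)"
  using frechet_derivative_at[OF assms] by simp
 then have "partial j g x = (\<Sum>i\<in>UNIV. axis j 1 $ i * G i)" by (simp add: partial_def)
 also have "... = (\<Sum>i\<in>UNIV. if i = j then G i else 0)"
  by (intro sum.cong) (auto simp: axis_def)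
 finally show ?thesis by simp
qed

lemma C_k_SucI:
 fixes g :: "real^'n => real"
 assumes d: "!!x. (g has_derivative (%h. \<Sum>j\<in>UNIV. h $ j * G j x)) (at x)"
  and G: "!!j. C_k k (G j)"
 shows "C_k (Suc k) g" "partial j g = G j"
proof -
 have p: "partial j g = G j" for j using partial_eqI[OF d] by auto
 then show "C_k (Suc k) g" using d G by (auto simp: differentiable_def)
 show "partial j g = G j" by (rule p)
qed

lemma C_k_add:
 fixes f g :: "real^'n => real"
 shows "C_k k f ==> C_k k g ==> C_k k (%x. f x + g x)"
proof (induction k arbitrary: f g)
 case 0
 then show ?case by (auto intro: continuous_on_add)
next
 case (Suc k)
 show ?case
 proof (rule C_k_SucI(1)[where G = "%j x. partial j f x + partial j g x"])
  fix x
  show "((%x. f x + g x) has_derivative (%h. \<Sum>j\<in>UNIV. h $ j * (partial j f x + partial j g x))) (at x)"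
   using has_derivative_add[OF C_k_has_derivative[OF Suc.prems(1)] C_k_has_derivative[OF Suc.prems(2)], of x]
   by (simp add: sum.distrib distrib_left)
 qed (use Suc in auto)
qed

lemma partial_mult:
 fixes f g :: "real^'n => real"
 assumes "C_k (Suc 0) f" "C_k (Suc 0) g"
 shows "((%x. f x * g x) has_derivative (%h. \<Sum>j\<in>UNIV. h $ j * (f x * partial j g x + partial j f x * g x))) (at x)"
  and "partial j (%x. f x * g x) x = f x * partial j g x + partial j f x * g x"
proof -
 show d: "((%x. f x * g x) has_derivative (%h. \<Sum>j\<in>UNIV. h $ j * (f x * partial j g x + partial j f x * g x))) (at x)"
  using has_derivative_mult[OF C_k_has_derivative[OF assms(1)] C_k_has_derivative[OF assms(2)], of x]
  by (simp add: sum.distrib distrib_left sum_distrib_left sum_distrib_right mult_ac)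
 show "partial j (%x. f x * g x) x = f x * partial j g x + partial j f x * g x"
  by (rule partial_eqI[OF d])
qed

lemma C_k_mult:
 fixes f g :: "real^'n => real"
 shows "C_k k f ==> C_k k g ==> C_k k (%x. f x * g x)"
proof (induction k arbitrary: f g)
 case 0
 then show ?case by (auto intro: continuous_on_mult)
next
 case (Suc k)
 have 1: "C_k (Suc 0) f" "C_k (Suc 0) g" using Suc.prems C_k_mono[of "Suc 0" "Suc k"] by auto
 have 2: "C_k k f" "C_k k g" using Suc.prems by (auto dest: C_k_Suc_imp simp del: C_k.simps)
 show ?case
  by (rule C_k_SucI(1)[OF partial_mult(1)[OF 1]]) (use Suc 2 in \<open>auto intro!: C_k_add\<close>)
qed

lemma C_k_const: "C_k k (%x::real^'n. c)"
proof (induction k arbitrary: c)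
 case (Suc k)
 show ?case
  by (rule C_k_SucI(1)[where G = "%j x. 0"]) (use Suc in auto)
qed simp

lemma C_k_cmult: "C_k k f ==> C_k k (%x::real^'n. c * f x)"
 by (intro C_k_mult C_k_const)

lemma partial_cmult:
 fixes f :: "real^'n => real"
 assumes "C_k (Suc 0) f"
 shows "partial j (%x. c * f x) x = c * partial j f x"
proof -
 have "partial j (%x::real^'n. c) x = 0"
  by (rule partial_eqI[where G="%j. 0"]) simp
 then show ?thesis using partial_mult(2)[OF C_k_const assms, of j c x] by simp
qed

lemma C_k_reflect:
 fixes f :: "real^'n => real"
 shows "C_k k f ==> C_k k (%x. f (a - x))"
proof (induction k arbitrary: f)
 case 0
 then show ?case by (auto intro!: continuous_on_compose2[OF 0[simplified]] continuous_intros)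
next
 case (Suc k)
 show ?case
 proof (rule C_k_SucI(1)[where G = "%j x. (- 1) * partial j f (a - x)"])
  fix x
  have "((%x. a - x) has_derivative (%h. - h)) (at x)" by (auto intro!: derivative_eq_intros)
  from has_derivative_compose[OF this C_k_has_derivative[OF Suc.prems]]
  show "((%x. f (a - x)) has_derivative (%h. \<Sum>j\<in>UNIV. h $ j * ((- 1) * partial j f (a - x)))) (at x)"
   by (simp add: o_def)
 next
  fix j
  show "C_k k (%x. (- 1) * partial j f (a - x))"
   by (intro C_k_cmult Suc.IH) (use Suc.prems in auto)
 qed
qed

lemma Cc_k_iff: "g \<in> Cc_k k \<longleftrightarrow> C_k k g \<and> bounded {x. g x \<noteq> 0}"
 by (simp add: Cc_k_def compact_closure)

lemma Cc_k_I:
 assumes "C_k k g" "!!x. R < norm x ==> g x = 0"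
 shows "g \<in> Cc_k k"
 unfolding Cc_k_iff bounded_iff using assms by (auto intro!: exI[of _ R] simp: not_less[symmetric])

lemma Cc_k_support:
 assumes "g \<in> Cc_k k"
 obtains R where "0 < R" "!!x. R < norm x ==> g x = 0"
proof -
 obtain a where "\<forall>x\<in>{x. g x \<noteq> 0}. norm x <= a"
  using assms unfolding Cc_k_iff bounded_iff by blast
 then show thesis by (intro that[of "max 1 a"]) force+
qed

lemma Cc_k_mono: "j <= k ==> g \<in> Cc_k k ==> g \<in> Cc_k j"
 using C_k_mono by (auto simp: Cc_k_def)

lemma Cc_k_partial:
 fixes g :: "real^'n => real"
 assumes "g \<in> Cc_k (Suc k)"
 shows "partial j g \<in> Cc_k k"
proof -
 obtain R where R: "0 < R" "!!x. R < norm x ==> g x = 0" using Cc_k_support[OF assms] by blast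
 have "partial j g x = 0" if x: "R < norm x" for x
 proof (rule partial_eqI[where G="%j. 0"])
  have "open {x::real^'n. R < norm x}" by (intro open_Collect_less continuous_intros)
  then have "(g has_derivative (%h. 0)) (at x)"
   by (rule has_derivative_transform_within_open[OF has_derivative_const[of 0]]) (use R x in auto)
  then show "(g has_derivative (%h. \<Sum>j\<in>UNIV. h $ j * 0)) (at x)" by simp
 qed
 then show ?thesis using assms by (intro Cc_k_I[of _ _ R]) (auto simp: Cc_k_iff)
qed

lemma Cc_k_measurable: "g \<in> Cc_k k ==> g \<in> borel_fun"
 by (rule borel_measurable_continuous_onI[OF C_k_imp_continuous[of k]]) (simp add: Cc_k_def)

lemma Cc_k_add: "f \<in> Cc_k k ==> g \<in> Cc_k k ==> (%x::real^'n. f x + g x) \<in> Cc_k k"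
 unfolding Cc_k_iff by (auto intro: C_k_add bounded_subset[of "{x. f x \<noteq> 0} \<union> {x. g x \<noteq> 0}"])

lemma Cc_k_cmult: "f \<in> Cc_k k ==> (%x::real^'n. c * f x) \<in> Cc_k k"
 unfolding Cc_k_iff by (auto intro: C_k_cmult bounded_subset[of "{x. f x \<noteq> 0}"])

lemma Cc_k_mult: "f \<in> Cc_k k ==> C_k k g ==> (%x::real^'n. f x * g x) \<in> Cc_k k"
 unfolding Cc_k_iff by (auto intro: C_k_mult bounded_subset[of "{x. f x \<noteq> 0}"])

lemma Cc_k_zero: "(%x::real^'n. 0) \<in> Cc_k k"
 by (rule Cc_k_I[of _ _ 0]) (auto intro: C_k_const)

lemma Cc_k_reflect: "f \<in> Cc_k k ==> (%x::real^'n. f (a - x)) \<in> Cc_k k"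
proof -
 assume f: "f \<in> Cc_k k"
 obtain R where R: "0 < R" "!!x. R < norm x ==> f x = 0" using Cc_k_support[OF f] by blast
 show ?thesis
 proof (rule Cc_k_I[of _ _ "R + norm a"])
  show "C_k k (%x. f (a - x))" using f by (intro C_k_reflect) (simp add: Cc_k_def)
  fix x :: "real^'n" assume "R + norm a < norm x"
  then have "R < norm (a - x)" using norm_triangle_ineq2[of x a] by (simp add: norm_minus_commute)
  then show "f (a - x) = 0" by (rule R)
 qed
qed

lemma Cc_k_bounded:
 assumes "g \<in> Cc_k k"
 obtains B where "0 < B" "!!x. \<bar>g x\<bar> <= B"
proof -
 have "continuous_on (closure {x. g x \<noteq> 0}) g" "compact (closure {x. g x \<noteq> 0})"
  using assms continuous_on_subset[OF C_k_imp_continuous[of k g]] by (auto simp: Cc_k_def)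
 then have "bounded (g ` closure {x. g x \<noteq> 0})" by (intro compact_imp_bounded compact_continuous_image)
 then obtain B where "!!x. x \<in> closure {x. g x \<noteq> 0} ==> \<bar>g x\<bar> <= B" by (auto simp: bounded_iff)
 then have "\<bar>g x\<bar> <= max 1 B" for x
  using closure_subset[of "{x. g x \<noteq> 0}"] by (cases "g x = 0") force+
 then show thesis by (intro that[of "max 1 B"]) auto
qed

lemma Cc_k_uniformly_continuous:
 fixes g :: "real^'n => real"
 assumes g: "g \<in> Cc_k k" and e: "0 < e"
 obtains d where "0 < d" "!!x y. norm (x - y) < d ==> \<bar>g x - g y\<bar> < e"
proof -
 obtain R where R: "0 < R" "!!x. R < norm x ==> g x = 0" using Cc_k_support[OF g] by blast
 have "C_k k g" using g by (simp add: Cc_k_def)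
 then have "continuous_on (cball 0 (R + 1)) g" by (rule continuous_on_subset[OF C_k_imp_continuous]) simp
 then have "uniformly_continuous_on (cball 0 (R + 1)) g" by (intro compact_uniformly_continuous) auto
 then obtain d where d: "0 < d" "!!x y. norm x <= R + 1 ==> norm y <= R + 1 ==> norm (x - y) < d ==> \<bar>g x - g y\<bar> < e"
  using e unfolding uniformly_continuous_on_def by (metis dist_norm mem_cball_0 real_norm_def)
 show thesis
 proof (rule that[of "min d 1"])
  fix x y :: "real^'n" assume xy: "norm (x - y) < min d 1"
  show "\<bar>g x - g y\<bar> < e"
  proof (cases "norm x <= R + 1 \<and> norm y <= R + 1")
   case True
   then show ?thesis using d(2) xy by auto
  next
   case False
   have "R < norm x" "R < norm y"
    using False xy norm_triangle_ineq2[of x y] norm_triangle_ineq2[of y x] norm_minus_commute[of x y] by linarith+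
   then show ?thesis using R e by simp
  qed
 qed (use d in auto)
qed

lemma Cc_1_Lipschitz:
 fixes g :: "real^'n => real"
 assumes g: "g \<in> Cc_k (Suc k)"
 obtains L where "0 < L" "!!x y. \<bar>g x - g y\<bar> <= L * norm (x - y)"
proof -
 have "\<exists>B. 0 < B \<and> (\<forall>x. \<bar>partial j g x\<bar> <= B)" for j
  using Cc_k_bounded[OF Cc_k_partial[OF g, of j]] by blast
 then obtain B where B: "!!j. 0 < B j" "!!j x. \<bar>partial j g x\<bar> <= B j" by metis
 define L where "L = (\<Sum>j\<in>UNIV. B j)"
 have L: "0 < L" unfolding L_def by (intro sum_pos B) auto
 have "norm (g x - g y) <= L * norm (x - y)" for x y
 proof (rule differentiable_bound[of UNIV g "%x h. \<Sum>j\<in>UNIV. h $ j * partial j g x"])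
  fix z :: "real^'n"
  show "(g has_derivative (%h. \<Sum>j\<in>UNIV. h $ j * partial j g z)) (at z within UNIV)"
   using g C_k_has_derivative[of k g] by (simp add: Cc_k_def)
  show "onorm (%h. \<Sum>j\<in>UNIV. h $ j * partial j g z) <= L"
  proof (rule onorm_le)
   fix h :: "real^'n"
   have "norm (\<Sum>j\<in>UNIV. h $ j * partial j g z) <= (\<Sum>j\<in>UNIV. norm h * B j)"
    using B(2)[of _ z] component_le_norm_cart[of h]
    by (intro order_trans[OF norm_sum] sum_mono) (auto simp: abs_mult intro!: mult_mono)
   then show "norm (\<Sum>j\<in>UNIV. h $ j * partial j g z) <= L * norm h"
    by (simp add: L_def sum_distrib_left mult.commute)
  qed
 qed auto
 then show thesis using L by (intro that[of L]) auto
qed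

lemma Cc_2_second_difference:
 fixes g :: "real^'n => real"
 assumes g: "g \<in> Cc_k 2"
 obtains C where "0 < C" "!!x z. \<bar>g (x + z) + g (x - z) - 2 * g x\<bar> <= C * min 1 ((norm z)^2)"
proof -
 have g2: "g \<in> Cc_k (Suc (Suc 0))" using g by (simp add: numeral_2_eq_2)
 have "\<exists>L. 0 < L \<and> (\<forall>x y. \<bar>partial j g x - partial j g y\<bar> <= L * norm (x - y))" for j
  by (rule Cc_1_Lipschitz[OF Cc_k_partial[OF g2, of j]]) (rule exI, rule conjI, assumption, simp)
 then obtain L where L: "!!j. 0 < L j" "!!j x y. \<bar>partial j g x - partial j g y\<bar> <= L j * norm (x - y)" by metis
 define S where "S = 2 * (\<Sum>j\<in>UNIV. L j)"
 have S: "0 < S" unfolding S_def using sum_pos[of UNIV L] L by auto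
 have d: "(g has_derivative (%h. \<Sum>j\<in>UNIV. h $ j * partial j g x)) (at x)" for x
  using g2 C_k_has_derivative[of "Suc 0" g] by (simp add: Cc_k_def)
 have q: "\<bar>g (x + z) + g (x - z) - 2 * g x\<bar> <= S * (norm z)^2" for x z
 proof -
  let ?h = "%t. g (x + t *\<^sub>R z) + g (x - t *\<^sub>R z)"
  let ?h' = "%t. \<Sum>j\<in>UNIV. z $ j * (partial j g (x + t *\<^sub>R z) - partial j g (x - t *\<^sub>R z))"
  have D: "(?h has_real_derivative ?h' t) (at t)" for t
  proof -
   have 1: "((%t. x + t *\<^sub>R z) has_derivative (%s. s *\<^sub>R z)) (at t)" "((%t. x - t *\<^sub>R z) has_derivative (%s. - (s *\<^sub>R z))) (at t)"
    by (auto intro!: derivative_eq_intros)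
   show ?thesis
    using has_derivative_add[OF has_derivative_compose[OF 1(1) d] has_derivative_compose[OF 1(2) d]]
    unfolding has_field_derivative_def
    by (rule has_derivative_eq_rhs) (auto simp: fun_eq_iff algebra_simps sum_distrib_left sum_distrib_right sum_subtractf sum_negf)
  qed
  obtain t where t: "0 < t" "t < 1" "?h 1 - ?h 0 = (1 - 0) * ?h' t"
   using MVT2[of 0 1 ?h ?h'] D by auto
  have "\<bar>?h' t\<bar> <= (\<Sum>j\<in>UNIV. norm z * (L j * (2 * norm z)))"
  proof (intro order_trans[OF sum_abs] sum_mono)
   fix j
   have "\<bar>partial j g (x + t *\<^sub>R z) - partial j g (x - t *\<^sub>R z)\<bar> <= L j * norm ((x + t *\<^sub>R z) - (x - t *\<^sub>R z))"
    by (rule L)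
   also have "(x + t *\<^sub>R z) - (x - t *\<^sub>R z) = (2 * t) *\<^sub>R z"
    by (simp only: scaleR_add_left mult_2) simp
   also have "L j * norm ((2 * t) *\<^sub>R z) <= L j * (2 * norm z)"
    using t L(1)[of j] by (auto simp: mult_left_le_one_le mult_left_le intro!: mult_left_mono)
   finally show "\<bar>z $ j * (partial j g (x + t *\<^sub>R z) - partial j g (x - t *\<^sub>R z))\<bar> <= norm z * (L j * (2 * norm z))"
    using component_le_norm_cart[of z j] by (auto simp: abs_mult intro!: mult_mono)
  qed
  also have "... = S * (norm z)^2"
   by (simp add: S_def power2_eq_square sum_distrib_left sum_distrib_right mult_ac)
  finally show ?thesis using t(3) by simp
 qed
 obtain B where B: "0 < B" "!!x. \<bar>g x\<bar> <= B" using Cc_k_bounded[OF g] by blast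
 show thesis
 proof (rule that[of "max S (4 * B)"])
  fix x z
  have "\<bar>g (x + z) + g (x - z) - 2 * g x\<bar> <= max S (4 * B) * 1"
   using B(2)[of "x + z"] B(2)[of "x - z"] B(2)[of x] max.cobounded2[of "4 * B" S] by linarith
  moreover have "\<bar>g (x + z) + g (x - z) - 2 * g x\<bar> <= max S (4 * B) * (norm z)^2"
   by (rule order_trans[OF q]) (auto intro: mult_right_mono)
  ultimately show "\<bar>g (x + z) + g (x - z) - 2 * g x\<bar> <= max S (4 * B) * min 1 ((norm z)^2)"
   unfolding min_def by (auto split: if_splits)
 qed (use S in auto)
qed

lemma C_k_line_derivative:
 fixes g :: "real^'n => real"
 assumes "C_k (Suc k) g"
 shows "((%t. g (x + t *\<^sub>R axis j 1)) has_real_derivative partial j g (x + t *\<^sub>R axis j 1)) (at t)"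
proof -
 have 1: "((%t. x + t *\<^sub>R axis j 1) has_derivative (%s. s *\<^sub>R axis j 1)) (at t)"
  by (auto intro!: derivative_eq_intros)
 have "((%t. g (x + t *\<^sub>R axis j 1)) has_derivative (%s. \<Sum>i\<in>UNIV. (s *\<^sub>R axis j 1) $ i * partial i g (x + t *\<^sub>R axis j 1))) (at t)"
  using has_derivative_compose[OF 1 C_k_has_derivative[OF assms]] by simp
 moreover have "(\<Sum>i\<in>UNIV. (s *\<^sub>R axis j 1) $ i * partial i g y) = partial j g y * s" for s :: real and y
 proof -
  have "(\<Sum>i\<in>UNIV. (s *\<^sub>R axis j 1) $ i * partial i g y) = (\<Sum>i\<in>UNIV. if i = j then s * partial i g y else 0)"
   by (intro sum.cong) (auto simp: axis_def)
  then show ?thesis by simp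
 qed
 ultimately show ?thesis by (simp add: has_field_derivative_def)
qed

lemma C_k_difference_quotient:
 fixes g :: "real^'n => real"
 assumes "C_k (Suc k) g" "h \<longlonglongrightarrow> 0" "!!n. h n \<noteq> 0"
 shows "(%n. (g (x + h n *\<^sub>R axis j 1) - g x) / h n) \<longlonglongrightarrow> partial j g x"
proof -
 have "((%t. (g (x + t *\<^sub>R axis j 1) - g x) / t) \<longlongrightarrow> partial j g x) (at 0)"
  using C_k_line_derivative[OF assms(1), of x j 0] by (simp add: has_field_derivative_iff)
 then show ?thesis
  by (rule filterlim_compose) (use assms in \<open>auto simp: filterlim_at\<close>)
qed

lemma second_difference_mean_value:
 fixes g :: "real^'n => real"
 assumes g: "C_k (Suc (Suc k)) g" and t: "0 < t"
 obtains p where "norm (p - x) <= 2 * t"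
  "g (x + t *\<^sub>R axis l 1 + t *\<^sub>R axis j 1) - g (x + t *\<^sub>R axis j 1) - g (x + t *\<^sub>R axis l 1) + g x = t * (t * partial j (partial l g) p)"
proof -
 have pg: "C_k (Suc k) (partial l g)" using g by simp
 let ?h = "%s. g (x + t *\<^sub>R axis j 1 + s *\<^sub>R axis l 1) - g (x + s *\<^sub>R axis l 1)"
 let ?h' = "%s. partial l g (x + t *\<^sub>R axis j 1 + s *\<^sub>R axis l 1) - partial l g (x + s *\<^sub>R axis l 1)"
 have "(?h has_real_derivative ?h' s) (at s)" for s
  by (intro DERIV_diff C_k_line_derivative[OF g])
 then obtain s where s: "0 < s" "s < t" "?h t - ?h 0 = (t - 0) * ?h' s" using MVT2[of 0 t ?h ?h'] t by auto
 let ?y = "x + s *\<^sub>R axis l 1"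
 have "((%r. partial l g (?y + r *\<^sub>R axis j 1)) has_real_derivative partial j (partial l g) (?y + r *\<^sub>R axis j 1)) (at r)" for r
  by (rule C_k_line_derivative[OF pg])
 then obtain r where r: "0 < r" "r < t"
  "partial l g (?y + t *\<^sub>R axis j 1) - partial l g (?y + 0 *\<^sub>R axis j 1) = (t - 0) * partial j (partial l g) (?y + r *\<^sub>R axis j 1)"
  using MVT2[of 0 t "%r. partial l g (?y + r *\<^sub>R axis j 1)" "%r. partial j (partial l g) (?y + r *\<^sub>R axis j 1)"] t by auto
 show thesis
 proof (rule that[of "?y + r *\<^sub>R axis j 1"])
  have "norm (s *\<^sub>R axis l 1 + r *\<^sub>R (axis j 1 :: real^'n)) <= s + r"
   using s r by (intro order_trans[OF norm_triangle_ineq]) auto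
  then show "norm (?y + r *\<^sub>R axis j 1 - x) <= 2 * t" using s r by simp
  have "?h' s = t * partial j (partial l g) (?y + r *\<^sub>R axis j 1)" using r(3) by (simp add: add_ac)
  then show "g (x + t *\<^sub>R axis l 1 + t *\<^sub>R axis j 1) - g (x + t *\<^sub>R axis j 1) - g (x + t *\<^sub>R axis l 1) + g x
    = t * (t * partial j (partial l g) (?y + r *\<^sub>R axis j 1))"
   using s(3) by (simp add: add_ac)
 qed
qed

lemma partial_commute:
 fixes g :: "real^'n => real"
 assumes g: "C_k (Suc (Suc k)) g"
 shows "partial j (partial l g) x = partial l (partial j g) x"
proof (rule ccontr)
 assume ne: "partial j (partial l g) x \<noteq> partial l (partial j g) x"
 define e where "e = \<bar>partial j (partial l g) x - partial l (partial j g) x\<bar> / 2"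
 have e: "0 < e" using ne by (simp add: e_def)
 have c: "continuous_on UNIV (partial j (partial l g))" "continuous_on UNIV (partial l (partial j g))"
  using g by (simp_all add: C_k_imp_continuous[of k])
 obtain d1 where d1: "0 < d1" "!!p. norm (p - x) < d1 ==> \<bar>partial j (partial l g) p - partial j (partial l g) x\<bar> < e"
  using c(1) e unfolding continuous_on_iff by (metis UNIV_I dist_norm real_norm_def)
 obtain d2 where d2: "0 < d2" "!!p. norm (p - x) < d2 ==> \<bar>partial l (partial j g) p - partial l (partial j g) x\<bar> < e"
  using c(2) e unfolding continuous_on_iff by (metis UNIV_I dist_norm real_norm_def)
 define t where "t = min d1 d2 / 3"
 have t: "0 < t" "2 * t < d1" "2 * t < d2" using d1 d2 by (auto simp: t_def)
 obtain p where p: "norm (p - x) <= 2 * t"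
  "g (x + t *\<^sub>R axis l 1 + t *\<^sub>R axis j 1) - g (x + t *\<^sub>R axis j 1) - g (x + t *\<^sub>R axis l 1) + g x = t * (t * partial j (partial l g) p)"
  by (rule second_difference_mean_value[OF g t(1)])
 obtain q where q: "norm (q - x) <= 2 * t"
  "g (x + t *\<^sub>R axis j 1 + t *\<^sub>R axis l 1) - g (x + t *\<^sub>R axis l 1) - g (x + t *\<^sub>R axis j 1) + g x = t * (t * partial l (partial j g) q)"
  by (rule second_difference_mean_value[OF g t(1)])
 have "t * (t * partial j (partial l g) p) = t * (t * partial l (partial j g) q)"
  unfolding p(2)[symmetric] q(2)[symmetric] by (simp add: add_ac)
 then have "partial j (partial l g) p = partial l (partial j g) q" using t by simp
 moreover have "\<bar>partial j (partial l g) p - partial j (partial l g) x\<bar> < e" using p(1) t by (intro d1(2)) linarith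
 moreover have "\<bar>partial l (partial j g) q - partial l (partial j g) x\<bar> < e" using q(1) t by (intro d2(2)) linarith
 moreover have "\<bar>partial j (partial l g) x - partial l (partial j g) x\<bar> = 2 * e" by (simp add: e_def)
 ultimately show False by linarith
qed

lemma C_k_scale:
 fixes f :: "real^'n => real"
 assumes f: "C_k (Suc 0) f"
 shows "C_k (Suc 0) (%x. f (c *\<^sub>R x))" "partial j (%x. f (c *\<^sub>R x)) = (%x. c * partial j f (c *\<^sub>R x))"
proof -
 have d: "((%x. f (c *\<^sub>R x)) has_derivative (%h. \<Sum>j\<in>UNIV. h $ j * (c * partial j f (c *\<^sub>R x)))) (at x)" for x
 proof -
  have "((%x. c *\<^sub>R x) has_derivative (%h. c *\<^sub>R h)) (at x)" by (auto intro!: derivative_eq_intros)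
  from has_derivative_compose[OF this C_k_has_derivative[OF f]] show ?thesis by (simp add: mult_ac)
 qed
 have C: "C_k 0 (%x. c * partial j f (c *\<^sub>R x))" for j
 proof -
  have "continuous_on UNIV (partial j f)" using f by simp
  then have "continuous_on UNIV (%x. partial j f (c *\<^sub>R x))"
   by (rule continuous_on_compose2) (auto intro: continuous_intros)
  then show ?thesis by (simp add: continuous_on_mult_left)
 qed
 show "C_k (Suc 0) (%x. f (c *\<^sub>R x))" by (rule C_k_SucI(1)[OF d C])
 show "partial j (%x. f (c *\<^sub>R x)) = (%x. c * partial j f (c *\<^sub>R x))" by (rule C_k_SucI(2)[OF d C])
qed

lemma L2_of_bounded_support:
 fixes f :: "'a::euclidean_space => real"
 assumes [measurable]: "f \<in> borel_fun" and R: "0 <= R" "!!x. R < norm x ==> f x = 0"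
  and e: "0 <= e" "!!x. \<bar>f x\<bar> <= e"
 shows "f \<in> L2s" "L2n f <= e * sqrt (unit_ball_vol (real DIM('a)) * R ^ DIM('a))"
proof -
 let ?v = "unit_ball_vol (real DIM('a)) * R ^ DIM('a)"
 have v: "0 <= ?v" using R by simp
 have "(NBINT x. ennreal ((f x)^2)) <= (NBINT x. ennreal (e^2) * indicator (cball (0::'a) R) x)"
 proof (intro nn_integral_mono)
  fix x
  have "(f x)^2 <= e^2" using power_mono[OF e(2)[of x], of 2] by simp
  then show "ennreal ((f x)^2) <= ennreal (e^2) * indicator (cball 0 R) x"
   using R(2)[of x] by (cases "norm x <= R") (auto intro: ennreal_leI)
 qed
 also have "... = ennreal (e^2) * ennreal ?v"
  using R by (subst nn_integral_cmult_indicator) (auto simp: emeasure_cball)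
 also have "... = ennreal ((e * sqrt ?v)^2)" using v by (simp add: ennreal_mult[symmetric] power_mult_distrib)
 finally have *: "(NBINT x. ennreal ((f x)^2)) <= ennreal ((e * sqrt ?v)^2)" .
 show "f \<in> L2s" by (rule L2_spaceI_nn[OF _ *]) simp
 show "L2n f <= e * sqrt ?v" by (rule L2_norm_le_nn[OF _ *]) (use e v in auto)
qed

lemma Cc_k_L2: "g \<in> Cc_k k ==> g \<in> L2s"
proof -
 assume g: "g \<in> Cc_k k"
 obtain R B where "0 < R" "!!x. R < norm x ==> g x = 0" "0 < B" "!!x. \<bar>g x\<bar> <= B"
  using Cc_k_support[OF g] Cc_k_bounded[OF g] by metis
 then show ?thesis by (intro L2_of_bounded_support(1)[of g R B] Cc_k_measurable[OF g]) auto
qed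

section \<open>Convolution with locally integrable functions\<close>

definition conv :: "('a::euclidean_space => real) => ('a => real) => 'a => real" where
 "conv g k x = (LBINT y. g (x - y) * k y)"

lemma loc_int_L2:
 assumes "u \<in> L2s"
 shows "loc_int (u :: 'a::euclidean_space => real)"
 unfolding loc_int_def
proof (intro conjI allI)
 fix R :: real
 have "(indicator (cball 0 R) :: 'a => real) \<in> L2s"
  by (rule L2_of_bounded_support(1)[of _ "max 0 R" 1]) (auto simp: indicator_def)
 then show "integrable lborel (%y. u y * indicator (cball 0 R) y)" by (rule L2_prod_integrable[OF assms])
qed (use L2_spaceD[OF assms] in simp)

lemma loc_int_integrable: "integrable lborel k ==> loc_int k"
 by (auto simp: loc_int_def intro!: integrable_mult_indicator[of _ lborel k, simplified mult.commute real_scaleR_def])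

lemma loc_int_bounded_mult:
 assumes k: "loc_int k" and [measurable]: "g \<in> borel_fun"
  and g: "!!y. R < norm y ==> g y = 0" "!!y. \<bar>g y\<bar> <= B"
 shows "integrable lborel (%y. g y * k y)"
  and "\<bar>LBINT y. g y * k y\<bar> <= B * (LBINT y. \<bar>k y\<bar> * indicator (cball 0 R) y)"
proof -
 have [measurable]: "k \<in> borel_fun" using k by (simp add: loc_int_def)
 have i: "integrable lborel (%y. B * (\<bar>k y\<bar> * indicator (cball 0 R) y))"
  using loc_int_abs_integral[OF k] by simp
 have le: "norm (g y * k y) <= B * (\<bar>k y\<bar> * indicator (cball 0 R) y)" for y
  using g(1)[of y] g(2)[of y] by (auto simp: abs_mult indicator_def intro: mult_right_mono)
 show *: "integrable lborel (%y. g y * k y)"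
  by (rule lint_bound[OF i]) (measurable, intro AE_I2 order_trans[OF le], simp)
 have "\<bar>LBINT y. g y * k y\<bar> <= (LBINT y. \<bar>g y * k y\<bar>)" by (rule integral_abs_bound)
 also have "... <= (LBINT y. B * (\<bar>k y\<bar> * indicator (cball 0 R) y))"
  by (intro integral_mono integrable_abs * i) (use le in auto)
 finally show "\<bar>LBINT y. g y * k y\<bar> <= B * (LBINT y. \<bar>k y\<bar> * indicator (cball 0 R) y)" by simp
qed

lemma conv_integrable:
 fixes g :: "real^'n => real"
 assumes "g \<in> Cc_k n" "loc_int k"
 shows "integrable lborel (%y. g (x - y) * k y)"
proof -
 have r: "(%y. g (x - y)) \<in> Cc_k n" by (rule Cc_k_reflect[OF assms(1)])
 obtain R B where "!!y. R < norm y ==> g (x - y) = 0" "!!y. \<bar>g (x - y)\<bar> <= B"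
  using Cc_k_support[OF r] Cc_k_bounded[OF r] by metis
 then show ?thesis by (intro loc_int_bounded_mult(1)[OF assms(2) Cc_k_measurable[OF r]]) auto
qed

lemma conv_continuous:
 fixes g :: "real^'n => real"
 assumes g: "g \<in> Cc_k n" and k: "loc_int k"
 shows "continuous_on UNIV (conv g k)"
 unfolding continuous_on_iff
proof (intro ballI allI impI)
 fix x :: "real^'n" and e :: real assume e: "0 < e"
 obtain R where R: "0 < R" "!!x. R < norm x ==> g x = 0" using Cc_k_support[OF g] by blast
 define I where "I = (LBINT y. \<bar>k y\<bar> * indicator (cball 0 (R + norm x + 1)) y)"
 have I: "0 <= I" unfolding I_def by (intro integral_nonneg_AE) auto
 obtain d where d: "0 < d" "!!x y. norm (x - y) < d ==> \<bar>g x - g y\<bar> < e / (I + 1)"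
  using Cc_k_uniformly_continuous[OF g, of "e / (I + 1)"] e I by auto
 have [measurable]: "g \<in> borel_fun" by (rule Cc_k_measurable[OF g])
 show "\<exists>d>0. \<forall>x'\<in>UNIV. dist x' x < d \<longrightarrow> dist (conv g k x') (conv g k x) < e"
 proof (intro exI[of _ "min d 1"] conjI ballI impI)
  fix x' assume "dist x' x < min d 1"
  then have x': "norm (x' - x) < d" "norm (x' - x) < 1" by (auto simp: dist_norm)
  have "conv g k x' - conv g k x = (LBINT y. (g (x' - y) - g (x - y)) * k y)"
   unfolding conv_def using conv_integrable[OF g k] by (simp add: left_diff_distrib)
  also have "\<bar>...\<bar> <= (e / (I + 1)) * I"
   unfolding I_def
  proof (rule loc_int_bounded_mult(2)[OF k])
   fix y
   show "\<bar>g (x' - y) - g (x - y)\<bar> <= e / ((LBINT y. \<bar>k y\<bar> * indicator (cball 0 (R + norm x + 1)) y) + 1)"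
    using d(2)[of "x' - y" "x - y"] x' by (simp add: I_def)
   assume "R + norm x + 1 < norm y"
   then have "R < norm (x' - y)" "R < norm (x - y)"
    using x'(2) norm_triangle_ineq2[of y x] norm_triangle_ineq2[of y x'] norm_triangle_ineq2[of x' x]
    by (auto simp: norm_minus_commute)
   then show "g (x' - y) - g (x - y) = 0" using R by simp
  qed measurable
  also have "... < e" using e I by (simp add: field_simps)
  finally show "dist (conv g k x') (conv g k x) < e" by (simp add: dist_real_def)
 qed (use d in auto)
qed

lemma conv_has_derivative:
 fixes g :: "real^'n => real"
 assumes g: "g \<in> Cc_k (Suc n)" and k: "loc_int k"
 shows "(conv g k has_derivative (%h. \<Sum>j\<in>UNIV. h $ j * conv (partial j g) k x)) (at x)"
 unfolding has_derivative_at_alt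
proof (intro conjI allI impI)
 show "bounded_linear (%h. \<Sum>j\<in>UNIV. h $ j * conv (partial j g) k x)"
  by (intro bounded_linear_sum bounded_linear_mult_const bounded_linear_vec_nth)
 fix e :: real assume e: "0 < e"
 obtain R where R: "0 < R" "!!x. R < norm x ==> g x = 0" using Cc_k_support[OF g] by blast
 have p0: "partial j g x = 0" if "R < norm x" for j x
 proof (rule partial_eqI[where G="%j. 0"])
  have "open {x::real^'n. R < norm x}" by (intro open_Collect_less continuous_intros)
  then have "(g has_derivative (%h. 0)) (at x)"
   by (rule has_derivative_transform_within_open[OF has_derivative_const[of 0]]) (use R that in auto)
  then show "(g has_derivative (%h. \<Sum>j\<in>UNIV. h $ j * 0)) (at x)" by simp
 qed
 define I where "I = (LBINT y. \<bar>k y\<bar> * indicator (cball 0 (R + norm x + 1)) y)"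
 have I: "0 <= I" unfolding I_def by (intro integral_nonneg_AE) auto
 let ?N = "real CARD('n)"
 define e' where "e' = e / ((I + 1) * ?N)"
 have e': "0 < e'" using e I by (simp add: e'_def)
 have "\<exists>d>0. \<forall>x y. norm (x - y) < d \<longrightarrow> \<bar>partial j g x - partial j g y\<bar> < e'" for j
  using Cc_k_uniformly_continuous[OF Cc_k_partial[OF g, of j] e'] by metis
 then obtain D where D: "!!j. 0 < D j" "!!j x y. norm (x - y) < D j ==> \<bar>partial j g x - partial j g y\<bar> < e'" by metis
 define d where "d = min 1 (Min (range D))"
 have d: "0 < d" "d <= 1" "!!j. d <= D j" using D(1) by (auto simp: d_def min_le_iff_disj)
 have g1: "(g has_derivative (%h. \<Sum>j\<in>UNIV. h $ j * partial j g x)) (at x)" for x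
  using g C_k_has_derivative[of n g] by (simp add: Cc_k_def)
 have [measurable]: "g \<in> borel_fun" "partial j g \<in> borel_fun" for j
  by (rule Cc_k_measurable[OF g], rule Cc_k_measurable[OF Cc_k_partial[OF g]])
 have lin: "\<bar>g (a + h) - g a - (\<Sum>j\<in>UNIV. h $ j * partial j g a)\<bar> <= norm h * (?N * e')"
  if h: "norm h < d" for a h
 proof -
  have "norm (g (a + h) - g a - (\<Sum>j\<in>UNIV. (a + h - a) $ j * partial j g a)) <= norm (a + h - a) * (?N * e')"
  proof (rule differentiable_bound_linearization[of a "a + h" "ball a d" g "%x h. \<Sum>j\<in>UNIV. h $ j * partial j g x" a])
   show "a + t *\<^sub>R (a + h - a) \<in> ball a d" if "t \<in> {0..1}" for t
    using that h mult_left_le_one_le[of "norm h" "\<bar>t\<bar>"] by (auto simp: dist_norm)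
   fix y assume y: "y \<in> ball a d"
   show "(g has_derivative (%h. \<Sum>j\<in>UNIV. h $ j * partial j g y)) (at y within ball a d)"
    using g1 by (rule has_derivative_at_withinI)
   show "onorm ((%i. \<Sum>j\<in>UNIV. i $ j * partial j g y) - (%i. \<Sum>j\<in>UNIV. i $ j * partial j g a)) <= ?N * e'"
    unfolding fun_diff_def
   proof (rule onorm_le)
    fix i :: "real^'n"
    have "norm ((\<Sum>j\<in>UNIV. i $ j * partial j g y) - (\<Sum>j\<in>UNIV. i $ j * partial j g a))
      = norm (\<Sum>j\<in>UNIV. i $ j * (partial j g y - partial j g a))"
     by (simp add: sum_subtractf right_diff_distrib)
    also have "... <= (\<Sum>j\<in>(UNIV::'n set). norm i * e')"
    proof (intro order_trans[OF norm_sum] sum_mono)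
     fix j
     have "norm (y - a) < D j" using y d(3)[of j] by (simp add: dist_norm norm_minus_commute)
     then have "\<bar>partial j g y - partial j g a\<bar> <= e'" using D(2)[of y a j] by simp
     then show "norm (i $ j * (partial j g y - partial j g a)) <= norm i * e'"
      using component_le_norm_cart[of i j] by (auto simp: abs_mult intro!: mult_mono)
    qed
    finally show "norm ((\<Sum>j\<in>UNIV. i $ j * partial j g y) - (\<Sum>j\<in>UNIV. i $ j * partial j g a)) <= ?N * e' * norm i"
     by (simp add: mult_ac)
   qed
  qed (use d in auto)
  then show ?thesis by simp
 qed
 show "\<exists>d>0. \<forall>y. norm (y - x) < d \<longrightarrow>
   norm (conv g k y - conv g k x - (\<Sum>j\<in>UNIV. (y - x) $ j * conv (partial j g) k x)) <= e * norm (y - x)"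
 proof (intro exI[of _ d] conjI allI impI)
  fix x' assume x': "norm (x' - x) < d"
  define h where "h = x' - x"
  have h: "norm h < d" "norm h < 1" "x' = x + h" using x' d by (auto simp: h_def)
  let ?r = "%y. g (x - y + h) - g (x - y) - (\<Sum>j\<in>UNIV. h $ j * partial j g (x - y))"
  have ip: "integrable lborel (%y. partial j g (x - y) * k y)" for j
   by (rule conv_integrable[OF Cc_k_partial[OF g] k])
  have ig: "integrable lborel (%y. g (x - y + h) * k y)" "integrable lborel (%y. g (x - y) * k y)"
   using conv_integrable[OF g k, of x] conv_integrable[OF g k, of "x + h"] by (simp_all add: algebra_simps)
  have "conv g k x' - conv g k x - (\<Sum>j\<in>UNIV. (x' - x) $ j * conv (partial j g) k x)
    = (LBINT y. g (x - y + h) * k y) - (LBINT y. g (x - y) * k y) - (LBINT y. (\<Sum>j\<in>UNIV. h $ j * (partial j g (x - y) * k y)))"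
  proof -
   have "conv g k x' = (LBINT y. g (x - y + h) * k y)" unfolding conv_def h(3) by (simp add: algebra_simps)
   moreover have "(LBINT y. (\<Sum>j\<in>UNIV. h $ j * (partial j g (x - y) * k y))) = (\<Sum>j\<in>UNIV. h $ j * conv (partial j g) k x)"
    using ip by (subst Bochner_Integration.integral_sum) (auto simp: conv_def)
   ultimately show ?thesis by (simp add: conv_def h_def)
  qed
  also have "... = (LBINT y. ?r y * k y)"
  proof -
   have "(LBINT y. ?r y * k y) = (LBINT y. g (x - y + h) * k y - g (x - y) * k y - (\<Sum>j\<in>UNIV. h $ j * (partial j g (x - y) * k y)))"
    by (intro lint_cong) (auto simp: left_diff_distrib sum_distrib_right mult.assoc)
   also have "... = (LBINT y. g (x - y + h) * k y) - (LBINT y. g (x - y) * k y) - (LBINT y. (\<Sum>j\<in>UNIV. h $ j * (partial j g (x - y) * k y)))"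
    using ig ip by (subst lint_diff) (auto intro!: Bochner_Integration.integrable_sum)
   finally show ?thesis by simp
  qed
  also have "\<bar>...\<bar> <= (norm h * (?N * e')) * I"
   unfolding I_def
  proof (rule loc_int_bounded_mult(2)[OF k])
   fix y
   show "\<bar>?r y\<bar> <= norm h * (?N * e')" by (rule lin[OF h(1)])
   assume y: "R + norm x + 1 < norm y"
   have "norm y <= norm (x - y) + norm x" using norm_triangle_sub[of y x] by (simp add: norm_minus_commute)
   moreover have "norm (x - y) <= norm (x - y + h) + norm h" using norm_triangle_ineq4[of "x - y + h" h] by simp
   ultimately have "R < norm (x - y)" "R < norm (x - y + h)" using y h(2) by linarith+
   then show "?r y = 0" using R p0 by simp
  qed measurable
  also have "... = e * norm h * (I / (I + 1))" using I by (simp add: e'_def)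
  also have "... <= e * norm h * 1" using e I by (intro mult_left_mono) auto
  finally show "norm (conv g k x' - conv g k x - (\<Sum>j\<in>UNIV. (x' - x) $ j * conv (partial j g) k x)) <= e * norm (x' - x)"
   by (simp add: h_def)
 qed (use d in auto)
qed

lemma conv_C_k:
 fixes g :: "real^'n => real"
 assumes k: "loc_int k"
 shows "g \<in> Cc_k n ==> C_k n (conv g k)"
proof (induction n arbitrary: g)
 case 0
 then show ?case using conv_continuous[OF 0 k] by simp
next
 case (Suc n)
 show ?case
  by (rule C_k_SucI(1)[OF conv_has_derivative[OF Suc.prems k]]) (intro Suc.IH Cc_k_partial Suc.prems)
qed

lemma partial_conv:
 fixes g :: "real^'n => real"
 assumes "g \<in> Cc_k (Suc n)" "loc_int k"
 shows "partial j (conv g k) x = conv (partial j g) k x"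
 by (rule partial_eqI[OF conv_has_derivative[OF assms]])

lemma conv_Cc_k:
 fixes g :: "real^'n => real"
 assumes g: "g \<in> Cc_k n" and k: "loc_int k" "!!y. R < norm y ==> k y = 0"
 shows "conv g k \<in> Cc_k n"
proof -
 obtain Q where Q: "0 < Q" "!!x. Q < norm x ==> g x = 0" using Cc_k_support[OF g] by blast
 show ?thesis
 proof (rule Cc_k_I[OF conv_C_k[OF k(1) g]])
  fix x :: "real^'n" assume x: "Q + R < norm x"
  have 0: "g (x - y) * k y = 0" for y
   using Q(2)[of "x - y"] k(2)[of y] x norm_triangle_ineq2[of x y] by fastforce
  show "conv g k x = 0" unfolding conv_def 0 by simp
 qed
qed

text \<open>Young's inequality for the convolution with an integrable weight.\<close>

lemma conv_L2:
 fixes u w :: "'a::euclidean_space => real"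
 assumes u: "u \<in> L2s" and w[measurable]: "w \<in> borel_fun"
  and W: "(NBINT z. ennreal \<bar>w z\<bar>) <= ennreal W" "0 <= W"
 shows "conv u w \<in> L2s" "L2n (conv u w) <= W * L2n u"
proof -
 have [measurable]: "u \<in> borel_fun" using L2_spaceD(1)[OF u] by simp
 define s where "s = (%x z. u (x - z) * (if w z < 0 then -1 else 1))"
 have eq: "conv u w = (%x. LBINT z. s x z * \<bar>w z\<bar>)"
  unfolding conv_def[abs_def] s_def by (intro ext lint_cong) auto
 have sm: "case_prod s \<in> borel_measurable (lborel \<Otimes>\<^sub>M lborel)"
  unfolding s_def by measurable
 have Q: "(NBINT x. ennreal ((s x z)^2 * \<bar>w z\<bar>)) <= ennreal ((L2n u)^2 * \<bar>w z\<bar>)" for z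
 proof -
  have "(NBINT x. ennreal ((s x z)^2 * \<bar>w z\<bar>)) = (NBINT x. ennreal ((u (x + (- z)))^2) * ennreal \<bar>w z\<bar>)"
   by (intro nn_integral_cong) (auto simp: s_def ennreal_mult power_mult_distrib)
  also have "... = (NBINT x. ennreal ((u (x + (- z)))^2)) * ennreal \<bar>w z\<bar>"
   by (rule nn_integral_multc) measurable
  also have "(NBINT x. ennreal ((u (x + (- z)))^2)) = ennreal ((L2n u)^2)"
   using nn_integral_L2[OF L2_translate(1)[OF u, of "- z"]] L2_translate(2)[OF u, of "- z"] by simp
  finally show ?thesis by (simp add: ennreal_mult)
 qed
 have B: "(NBINT z. ennreal ((L2n u)^2 * \<bar>w z\<bar>)) <= ennreal ((L2n u)^2 * W)"
 proof -
  have "(NBINT z. ennreal ((L2n u)^2 * \<bar>w z\<bar>)) = ennreal ((L2n u)^2) * (NBINT z. ennreal \<bar>w z\<bar>)"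
   by (subst nn_integral_cmult[symmetric]) (auto simp: ennreal_mult)
  also have "... <= ennreal ((L2n u)^2) * ennreal W" by (intro mult_left_mono W) auto
  finally show ?thesis using W by (simp add: ennreal_mult)
 qed
 note * = weighted_average_L2[OF sigma_finite_lborel sigma_finite_lborel sm _ _ W(1) W(2) Q _ B]
 show "conv u w \<in> L2s" unfolding eq by (rule *(1)) (use W in auto)
 have "L2n (conv u w) <= sqrt (W * ((L2n u)^2 * W))" unfolding eq by (rule *(2)) (use W in auto)
 also have "... = sqrt ((W * L2n u)^2)" by (simp add: power2_eq_square mult_ac)
 also have "... = W * L2n u" using W by simp
 finally show "L2n (conv u w) <= W * L2n u" .
qed

lemma conv_commute:
 fixes g k :: "'a::euclidean_space => real"
 assumes [measurable]: "g \<in> borel_fun" "k \<in> borel_fun"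
 shows "conv g k = conv k g"
proof
 fix x
 have "conv g k x = (LBINT y. (%y. g y * k (x - y)) (x - y))" by (simp add: conv_def)
 also have "... = (LBINT y. g y * k (x - y))" by (rule integral_lborel_reflect) measurable
 finally show "conv g k x = conv k g x" by (simp add: conv_def mult.commute)
qed

section \<open>A mollifier of class \<open>C\<^sup>2\<close>\<close>

text \<open>
 The third power makes the bump twice continuously differentiable across the sphere of radius \<open>dl\<close>, which is all that
 test functions of class \<open>C\<^sup>2\<close> require, and keeps its derivatives explicit polynomials in the positive part.
\<close>

definition bump :: "real => real^'n => real" where
 "bump dl z = (max 0 (1 - (norm z)^2 / dl^2)) ^ 3"

definition mol :: "real => real^'n => real" where
 "mol dl z = bump dl z / (LBINT z. bump dl (z::real^'n))"

text \<open>
 The positive part itself need not be differentiable at the zeros of \<open>f\<close>, but a power of at least two is dominated there by the square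
 of the increment.
\<close>

lemma pos_part_power_derivative:
 fixes f :: "real^'n => real"
 assumes f: "(f has_derivative f') (at x)"
 shows "((%x. (max 0 (f x)) ^ Suc (Suc k)) has_derivative (%h. (real (Suc (Suc k)) * (max 0 (f x)) ^ Suc k) * f' h)) (at x)"
proof -
 have "((%t::real. (max 0 t) ^ Suc (Suc k)) has_real_derivative real (Suc (Suc k)) * (max 0 t) ^ Suc k) (at t)" for t
 proof (cases "t = 0")
  case False
  then consider "0 < t" | "t < 0" by linarith
  then show ?thesis
  proof cases
   case 1
   have "((%t::real. t ^ Suc (Suc k)) has_real_derivative real (Suc (Suc k)) * t ^ Suc k) (at t)"
    by (rule DERIV_cong[OF DERIV_pow]) simp
   then have "((%t::real. (max 0 t) ^ Suc (Suc k)) has_real_derivative real (Suc (Suc k)) * t ^ Suc k) (at t)"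
    by (rule DERIV_cong_ev[THEN iffD1, rotated -1, OF _ refl _ refl])
     (use 1 in \<open>auto intro!: eventually_mono[OF eventually_nhds_in_open[of "{0<..}" t]]\<close>)
   then show ?thesis using 1 by simp
  next
   case 2
   have "((%t::real. 0) has_real_derivative 0) (at t)" by simp
   then have "((%t::real. (max 0 t) ^ Suc (Suc k)) has_real_derivative 0) (at t)"
    by (rule DERIV_cong_ev[THEN iffD1, rotated -1, OF _ refl _ refl])
     (use 2 in \<open>auto intro!: eventually_mono[OF eventually_nhds_in_open[of "{..<0}" t]]\<close>)
   then show ?thesis using 2 by simp
  qed
 next
  case True
  have "((%h::real. ((max 0 (0 + h)) ^ Suc (Suc k) - (max 0 0) ^ Suc (Suc k)) / h) \<longlongrightarrow> 0) (at 0)"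
  proof (rule Lim_null_comparison[of _ "%h. \<bar>h\<bar> ^ Suc k"])
   have "((%h::real. \<bar>h\<bar> ^ Suc k) \<longlongrightarrow> \<bar>0\<bar> ^ Suc k) (at 0)" by (intro tendsto_intros)
   then show "((%h::real. \<bar>h\<bar> ^ Suc k) \<longlongrightarrow> 0) (at 0)" by simp
   have "norm (((max 0 (0 + h)) ^ Suc (Suc k) - (max 0 0) ^ Suc (Suc k)) / h) <= \<bar>h\<bar> ^ Suc k" if "h \<noteq> 0" for h :: real
   proof (cases "0 < h")
    case True
    then show ?thesis by (simp add: max_def)
   next
    case False
    then have "((max 0 (0 + h)) ^ Suc (Suc k) - (max 0 0) ^ Suc (Suc k)) / h = 0" by (simp add: max_def)
    then show ?thesis by (simp only: norm_zero zero_le_power abs_ge_zero)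
   qed
   then show "\<forall>\<^sub>F h in at 0. norm (((max 0 (0 + h)) ^ Suc (Suc k) - (max 0 0) ^ Suc (Suc k)) / h) <= \<bar>h::real\<bar> ^ Suc k"
    by (simp add: eventually_at_filter)
  qed
  then show ?thesis using True by (simp add: DERIV_def)
 qed
 then have "((%t::real. (max 0 t) ^ Suc (Suc k)) has_derivative (*) (real (Suc (Suc k)) * (max 0 (f x)) ^ Suc k)) (at (f x))"
  by (simp add: has_field_derivative_def)
 from has_derivative_compose[OF f this] show ?thesis by simp
qed

lemma paraboloid_derivative:
 "((%z::real^'n. 1 - (norm z)^2 / dl^2) has_derivative (%h. \<Sum>j\<in>UNIV. h $ j * (- 2 * x $ j / dl^2))) (at x)"
proof -
 have "((%z::real^'n. 1 - (z \<bullet> z) / dl^2) has_derivative (%h. - ((x \<bullet> h + h \<bullet> x) / dl^2))) (at x)"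
  unfolding divide_inverse by (auto intro!: derivative_eq_intros)
 moreover have "- ((x \<bullet> h + h \<bullet> x) / dl^2) = (\<Sum>j\<in>UNIV. h $ j * (- 2 * x $ j / dl^2))" for h
  by (simp add: inner_vec_def sum_divide_distrib sum_negf[symmetric] sum.distrib[symmetric] add_divide_distrib[symmetric] algebra_simps)
 ultimately show ?thesis by (simp add: power2_norm_eq_inner)
qed

lemma C_k_coordinate: "C_k (Suc 0) (%x::real^'n. x $ j)"
proof (rule C_k_SucI(1)[where G = "%i x. if i = j then 1 else 0"])
 fix x :: "real^'n"
 have "((%x::real^'n. x $ j) has_derivative (%h. h $ j)) (at x)"
  by (intro bounded_linear_imp_has_derivative bounded_linear_vec_nth)
 then show "((%x::real^'n. x $ j) has_derivative (%h. \<Sum>i\<in>UNIV. h $ i * (if i = j then 1 else 0))) (at x)"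
  by (simp add: if_distrib cong: if_cong)
qed simp

definition bump_d :: "'n => real => real^'n => real" where
 "bump_d j dl z = (- 6 / dl^2) * (z $ j * (max 0 (1 - (norm z)^2 / dl^2)) ^ 2)"

lemma bump_C_2: "C_k (Suc (Suc 0)) (bump dl :: real^'n => real)" "partial j (bump dl :: real^'n => real) = bump_d j dl"
proof -
 have d: "(bump dl has_derivative (%h. \<Sum>j\<in>UNIV. h $ j * bump_d j dl x)) (at x)" for x :: "real^'n"
 proof -
  have *: "(bump dl has_derivative (%h. (3 * (max 0 (1 - (norm x)^2 / dl^2)) ^ 2) * (\<Sum>j\<in>UNIV. h $ j * (- 2 * x $ j / dl^2)))) (at x)"
   using pos_part_power_derivative[OF paraboloid_derivative[of dl x], of "Suc 0"]
   by (simp add: bump_def[abs_def] numeral_3_eq_3 numeral_2_eq_2)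
  show ?thesis
   by (rule has_derivative_eq_rhs[OF *])
    (unfold bump_d_def sum_distrib_left, intro ext sum.cong refl, simp add: divide_inverse algebra_simps)
 qed
 have G: "C_k (Suc 0) (bump_d j dl)" for j :: 'n
  unfolding bump_d_def[abs_def]
 proof (intro C_k_cmult C_k_mult C_k_coordinate)
  show "C_k (Suc 0) (%x::real^'n. (max 0 (1 - (norm x)^2 / dl^2))^2)"
  proof (rule C_k_SucI(1)[where G = "%j x. (2 * (max 0 (1 - (norm x)^2 / dl^2))) * (- 2 * x $ j / dl^2)"])
   fix x :: "real^'n"
   have *: "((%x::real^'n. (max 0 (1 - (norm x)^2 / dl^2))^2) has_derivative
     (%h. (2 * (max 0 (1 - (norm x)^2 / dl^2))) * (\<Sum>j\<in>UNIV. h $ j * (- 2 * x $ j / dl^2)))) (at x)"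
    using pos_part_power_derivative[OF paraboloid_derivative[of dl x], of 0] by (simp add: numeral_2_eq_2)
   show "((%x::real^'n. (max 0 (1 - (norm x)^2 / dl^2))^2) has_derivative
     (%h. \<Sum>j\<in>UNIV. h $ j * ((2 * (max 0 (1 - (norm x)^2 / dl^2))) * (- 2 * x $ j / dl^2)))) (at x)"
    by (rule has_derivative_eq_rhs[OF *]) (auto simp: sum_distrib_left fun_eq_iff mult_ac intro!: sum.cong)
  next
   fix j
   show "C_k 0 (%x::real^'n. (2 * (max 0 (1 - (norm x)^2 / dl^2))) * (- 2 * x $ j / dl^2))"
    unfolding C_k.simps divide_inverse by (intro continuous_intros)
  qed
 qed
 show "C_k (Suc (Suc 0)) (bump dl :: real^'n => real)" by (rule C_k_SucI(1)[OF d G])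
 show "partial j (bump dl :: real^'n => real) = bump_d j dl" by (rule C_k_SucI(2)[OF d G])
qed

lemma pos_part_zero: "0 < dl ==> dl < norm z ==> max 0 (1 - (norm z)^2 / dl^2) = 0"
 using power_mono[of dl "norm z" 2] by (simp add: max_def field_simps)

lemma pos_part_le_1: "\<bar>max 0 (1 - (norm z)^2 / dl^2)\<bar> <= 1"
 by (auto simp: max_def)

lemma bump_Cc: "0 < dl ==> bump dl \<in> Cc_k 2"
 unfolding numeral_2_eq_2 by (rule Cc_k_I[of _ _ dl]) (auto intro: bump_C_2 simp: bump_def pos_part_zero simp del: C_k.simps)

definition mol_const :: "'n itself => real" where
 "mol_const _ = 3 * 2 ^ CARD('n) / unit_ball_vol (real CARD('n))"

lemma mol_const_pos: "0 < mol_const TYPE('n::finite)"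
 by (simp add: mol_const_def)

lemma Cc_k_integrable:
 fixes g :: "real^'n => real"
 assumes g: "g \<in> Cc_k k"
 shows "integrable lborel g"
proof -
 have "loc_int (%x::real^'n. 1::real)"
  using integrable_real_indicator[of "cball (0::real^'n) _" lborel] emeasure_bounded_finite[OF bounded_cball[of "0::real^'n"]]
  by (simp add: loc_int_def)
 from conv_integrable[OF Cc_k_reflect[OF g, of 0] this, of 0] show ?thesis by simp
qed

lemma bump_integral_lower:
 assumes "0 < dl"
 shows "1 <= (mol_const TYPE('n) / dl ^ CARD('n)) * (LBINT z. bump dl (z::real^'n))"
proof -
 let ?v = "unit_ball_vol (real CARD('n))"
 have v: "0 < ?v" by simp
 have m[measurable]: "bump dl \<in> borel_measurable (borel :: (real^'n) measure)" by (rule Cc_k_measurable[OF bump_Cc[OF assms]])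
 have i: "integrable lborel (bump dl :: real^'n => real)"
  by (rule Cc_k_integrable[OF bump_Cc[OF assms]])
 have "(27 / 64) * (?v * (dl / 2) ^ CARD('n)) = (LBINT z. (27 / 64) * indicator (cball (0::real^'n) (dl / 2)) z)"
  using assms by (simp add: content_cball)
 also have "... <= (LBINT z. bump dl (z::real^'n))"
 proof (intro integral_mono i)
  show "integrable lborel (%z. (27 / 64) * indicator (cball (0::real^'n) (dl / 2)) z :: real)"
   using assms by (intro integrable_mult_right integrable_real_indicator) (auto simp: emeasure_cball)
  fix z :: "real^'n"
  show "(27 / 64) * indicator (cball 0 (dl / 2)) z <= bump dl z"
  proof (cases "norm z <= dl / 2")
   case True
   then have "(norm z)^2 <= (dl / 2)^2" by (intro power_mono) auto
   then have "3 / 4 <= 1 - (norm z)^2 / dl^2" using assms by (simp add: field_simps power_divide)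
   then have "(3 / 4) ^ 3 <= (max 0 (1 - (norm z)^2 / dl^2)) ^ 3" by (intro power_mono) (auto simp only: le_max_iff_disj)
   then show ?thesis using True by (simp add: bump_def power3_eq_cube)
  qed (simp add: bump_def)
 qed
 finally have *: "(27 / 64) * (?v * (dl / 2) ^ CARD('n)) <= (LBINT z. bump dl (z::real^'n))" .
 have "1 <= (mol_const TYPE('n) / dl ^ CARD('n)) * ((27 / 64) * (?v * (dl / 2) ^ CARD('n)))"
  using v assms less_imp_neq[OF v] by (simp add: mol_const_def power_divide field_simps)
 also have "... <= (mol_const TYPE('n) / dl ^ CARD('n)) * (LBINT z. bump dl (z::real^'n))"
  using * mol_const_pos[where 'n='n] assms by (intro mult_left_mono) auto
 finally show ?thesis .
qed

lemma bump_integral_pos: "0 < dl ==> 0 < (LBINT z. bump dl (z::real^'n))"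
 using bump_integral_lower[where 'n='n, of dl] mol_const_pos[where 'n='n]
 by (metis (no_types, opaque_lifting) divide_pos_pos less_le_trans zero_less_mult_pos zero_less_one zero_less_power)

lemma mol_eq: "(mol dl :: real^'n => real) = (%z. (1 / (LBINT z. bump dl (z::real^'n))) * bump dl z)"
 by (simp add: mol_def fun_eq_iff)

lemma mol_Cc: "0 < dl ==> mol dl \<in> (Cc_k 2 :: (real^'n => real) set)"
 unfolding mol_eq by (intro Cc_k_cmult bump_Cc)

lemma mol_measurable: "0 < dl ==> mol dl \<in> borel_measurable (borel :: (real^'n) measure)"
 by (rule Cc_k_measurable[OF mol_Cc])

lemma mol_support: "0 < dl ==> dl < norm z ==> mol dl z = 0"
 by (simp add: mol_def bump_def pos_part_zero)

lemma mol_partial: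
 fixes z :: "real^'n"
 assumes "0 < dl"
 shows "partial j (mol dl) z = bump_d j dl z / (LBINT z. bump dl (z::real^'n))"
proof -
 have "C_k (Suc 0) (bump dl :: real^'n => real)" by (rule C_k_Suc_imp[OF bump_C_2(1)])
 from partial_cmult[OF this, of j "1 / (LBINT z. bump dl (z::real^'n))" z]
 show ?thesis by (simp add: mol_eq bump_C_2(2))
qed

lemma mol_partial_support: "0 < dl ==> dl < norm z ==> partial j (mol dl) z = 0"
 by (simp add: mol_partial bump_d_def pos_part_zero)

lemma mol_partial_odd: "0 < dl ==> partial j (mol dl) (- z) = - partial j (mol dl) z"
 by (simp add: mol_partial bump_d_def)

lemma mol_partial_Cc: "0 < dl ==> partial j (mol dl) \<in> Cc_k 1"
 using mol_Cc[of dl] by (intro Cc_k_partial) (simp add: numeral_2_eq_2)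

lemma mol_bound:
 fixes z :: "real^'n"
 assumes "0 < dl"
 shows "0 <= mol dl z" "mol dl z <= mol_const TYPE('n) / dl ^ CARD('n)"
  "\<bar>partial j (mol dl) z\<bar> <= 6 * mol_const TYPE('n) / dl ^ (CARD('n) + 1)"
proof -
 let ?I = "LBINT z. bump dl (z::real^'n)" and ?c = "mol_const TYPE('n) / dl ^ CARD('n)"
 have I: "0 < ?I" by (rule bump_integral_pos[OF assms])
 have inv: "1 / ?I <= ?c" using bump_integral_lower[OF assms, where 'n='n] I by (simp add: field_simps)
 have c: "0 <= ?c" using mol_const_pos[where 'n='n] assms by simp
 show "0 <= mol dl z" using I by (simp add: mol_def bump_def)
 have "bump dl z <= 1" using pos_part_le_1[of z dl] by (simp add: bump_def power_le_one)
 then have "mol dl z <= 1 / ?I" using I by (simp add: mol_def divide_right_mono)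
 then show "mol dl z <= ?c" using inv by simp
 show "\<bar>partial j (mol dl) z\<bar> <= 6 * mol_const TYPE('n) / dl ^ (CARD('n) + 1)"
 proof (cases "norm z <= dl")
  case False
  then show ?thesis using mol_partial_support[OF assms, of z j] c assms mol_const_pos[where 'n='n] by (simp add: not_le)
 next
  case True
  have 1: "\<bar>z $ j\<bar> <= dl" using component_le_norm_cart[of z j] True by simp
  have 2: "(max 0 (1 - (norm z)^2 / dl^2))^2 <= 1" by (rule power_le_one) (use pos_part_le_1[of z dl] in auto)
  have "\<bar>bump_d j dl z\<bar> = (6 / dl^2) * (\<bar>z $ j\<bar> * (max 0 (1 - (norm z)^2 / dl^2))^2)"
   by (simp add: bump_d_def abs_mult)
  also have "... <= (6 / dl^2) * (dl * 1)"
   using 1 2 assms by (intro mult_left_mono mult_mono) auto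
  also have "... = 6 / dl" using assms by (simp add: power2_eq_square)
  finally have "\<bar>bump_d j dl z\<bar> * (1 / ?I) <= (6 / dl) * ?c"
   using inv I assms by (intro mult_mono) auto
  then show ?thesis using I assms by (simp add: mol_partial[OF assms] abs_mult mult.commute)
 qed
qed

lemma mol_integral: "0 < dl ==> (LBINT z. mol dl (z::real^'n)) = 1"
 using bump_integral_pos[where 'n='n, of dl] by (simp add: mol_eq)

lemma mol_partial_integral: "0 < dl ==> (LBINT z. partial j (mol dl) (z::real^'n)) = 0"
proof -
 assume d: "0 < dl"
 have "(LBINT z. partial j (mol dl) (z::real^'n)) = (LBINT z. partial j (mol dl) (0 - z))"
  by (rule integral_lborel_reflect[symmetric]) (rule Cc_k_measurable[OF mol_partial_Cc[OF d]])
 also have "... = - (LBINT z. partial j (mol dl) (z::real^'n))" by (simp add: mol_partial_odd[OF d])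
 finally show ?thesis by simp
qed

lemma mol_nn_integral: "0 < dl ==> (NBINT z. ennreal \<bar>mol dl (z::real^'n)\<bar>) = ennreal 1"
 using mol_integral[where 'n='n, of dl] Cc_k_integrable[OF mol_Cc[of dl, where 'n='n]] mol_bound(1)[where 'n='n, of dl]
 by (simp add: nn_integral_eq_integral)

lemma conv_mol_L2:
 assumes "u \<in> L2s" "0 < dl"
 shows "conv (mol dl) u \<in> L2s" "L2n (conv (mol dl) u) <= L2n (u :: real^'n => real)"
proof -
 have "conv (mol dl) u = conv u (mol dl)"
  using assms L2_spaceD(1)[OF assms(1)] by (intro conv_commute mol_measurable) auto
 then show "conv (mol dl) u \<in> L2s" "L2n (conv (mol dl) u) <= L2n u"
  using conv_L2[OF assms(1) mol_measurable[OF assms(2)], of 1] mol_nn_integral[where 'n='n, OF assms(2)] by auto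
qed

text \<open>
 On the support of a weight \<open>\<theta>\<close> of radius \<open>dl\<close> the kernel \<open>|z|\<^sup>-\<^sup>d\<^sup>-\<^sup>\<alpha>\<close> is at least
 \<open>dl\<^sup>-\<^sup>d\<^sup>-\<^sup>\<alpha>\<close>; this is how the fractional seminorm controls averaged increments.
\<close>

lemma fractional_average:
 fixes u \<theta> :: "real^'n => real"
 assumes u: "u \<in> frac_sobolev_space \<alpha>" and \<alpha>: "0 < \<alpha>" and dl: "0 < dl"
  and \<theta>[measurable]: "\<theta> \<in> borel_fun"
  and supp: "!!z. dl < norm z ==> \<theta> z = 0" and b: "!!z. \<bar>\<theta> z\<bar> <= b"
 shows "(%x. LBINT z. \<theta> z * (u (x - z) - u x)) \<in> L2s"
  and "L2n (%x. LBINT z. \<theta> z * (u (x - z) - u x))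
    <= b * sqrt (unit_ball_vol (real CARD('n))) * dl powr (real CARD('n) + \<alpha> / 2) * frac_sobolev_norm \<alpha> u"
proof -
 let ?v = "unit_ball_vol (real CARD('n))" and ?p = "real CARD('n) + \<alpha>" and ?F = "frac_sobolev_norm \<alpha> u"
 have uL: "u \<in> L2s" and ui: "integrable (lborel \<Otimes>\<^sub>M lborel) (%(x, z). (u (x + z) - u x)^2 * frac_kernel \<alpha> z)"
  using u by (auto simp: frac_sobolev_space_def)
 have [measurable]: "u \<in> borel_fun" using L2_spaceD(1)[OF uL] by simp
 have b0: "0 <= b" using b[of 0] by simp
 have v: "0 < ?v" by simp
 define w where "w = (%z. \<bar>\<theta> (- z)\<bar>)"
 have [measurable]: "w \<in> borel_fun" unfolding w_def by measurable
 define s where "s = (%x z. (u (x + z) - u x) * (if \<theta> (- z) < 0 then - 1 else 1))"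
 have sm: "case_prod s \<in> borel_measurable (lborel \<Otimes>\<^sub>M lborel)" unfolding s_def by measurable
 define q where "q = (%z. LBINT x. (u (x + z) - u x)^2)"
 have [measurable]: "q \<in> borel_fun" unfolding q_def by measurable
 have K[measurable]: "(frac_kernel \<alpha> :: real^'n => real) \<in> borel_fun"
  unfolding frac_kernel_def[abs_def] by measurable
 have K0: "0 <= frac_kernel \<alpha> z" for z :: "real^'n" by (simp add: frac_kernel_def)
 have eq: "(%x. LBINT z. \<theta> z * (u (x - z) - u x)) = (%x. LBINT z. s x z * w z)"
 proof
  fix x
  have "(LBINT z. \<theta> z * (u (x - z) - u x)) = (LBINT z. \<theta> (0 - z) * (u (x - (0 - z)) - u x))"
   by (rule integral_lborel_reflect[symmetric]) measurable
  also have "... = (LBINT z. s x z * w z)"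
   by (intro lint_cong) (auto simp: s_def w_def)
  finally show "(LBINT z. \<theta> z * (u (x - z) - u x)) = (LBINT z. s x z * w z)" .
 qed
 have qnn: "(NBINT x. ennreal ((u (x + z) - u x)^2)) = ennreal (q z)" for z
  using nn_integral_L2[OF L2_diff[OF L2_translate(1)[OF uL, of z] uL]] by (simp add: q_def L2_norm_square)
 have q0: "0 <= q z" for z by (simp add: q_def)
 have W: "(NBINT z. ennreal (w z)) <= ennreal (b * (?v * dl ^ CARD('n)))"
 proof -
  have "(NBINT z. ennreal (w z)) <= (NBINT z. ennreal b * indicator (cball (0::real^'n) dl) z)"
   using supp b by (intro nn_integral_mono) (auto simp: w_def indicator_def not_le intro!: ennreal_leI)
  also have "... = ennreal (b * (?v * dl ^ CARD('n)))"
   using b0 v dl by (subst nn_integral_cmult_indicator) (auto simp: emeasure_cball ennreal_mult)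
  finally show ?thesis .
 qed
 have Q: "(NBINT x. ennreal ((s x z)^2 * w z)) <= ennreal (q z * w z)" for z
 proof -
  have "(NBINT x. ennreal ((s x z)^2 * w z)) = (NBINT x. ennreal ((u (x + z) - u x)^2) * ennreal (w z))"
   by (intro nn_integral_cong) (auto simp: s_def w_def ennreal_mult power_mult_distrib)
  also have "... = ennreal (q z) * ennreal (w z)" unfolding qnn[symmetric] by (rule nn_integral_multc) measurable
  finally show ?thesis using q0 by (simp add: ennreal_mult' w_def)
 qed
 have F2: "(LINT (x, z)|(lborel \<Otimes>\<^sub>M lborel). (u (x + z) - u x)^2 * frac_kernel \<alpha> z) <= ?F^2"
 proof -
  have "0 <= (LINT (x, z)|(lborel \<Otimes>\<^sub>M lborel). (u (x + z) - u x)^2 * frac_kernel \<alpha> z)"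
   using K0 by (intro integral_nonneg_AE) auto
  then show ?thesis by (simp add: frac_sobolev_norm_def)
 qed
 have B: "(NBINT z. ennreal (q z * w z)) <= ennreal (b * dl powr ?p * ?F^2)"
 proof -
  have le: "w z * q z <= (b * dl powr ?p) * (frac_kernel \<alpha> z * q z)" for z
  proof (cases "z = 0")
   case True
   then show ?thesis by (simp add: q_def)
  next
   case False
   have "w z <= b * dl powr ?p * frac_kernel \<alpha> z"
   proof (cases "norm z <= dl")
    case True
    have "norm z powr ?p <= dl powr ?p" using True \<alpha> by (intro powr_mono2) auto
    then have "1 <= dl powr ?p * frac_kernel \<alpha> z" using False by (simp add: frac_kernel_def field_simps)
    then have "b * 1 <= b * (dl powr ?p * frac_kernel \<alpha> z)" using b0 by (intro mult_left_mono)
    then show ?thesis using b[of "- z"] by (simp add: w_def mult_ac)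
   qed (use supp b0 K0 in \<open>auto simp: w_def\<close>)
   then show ?thesis using q0[of z] mult_right_mono by (fastforce simp: mult_ac)
  qed
  have "(NBINT z. ennreal (q z * w z)) <= (NBINT z. ennreal (b * dl powr ?p) * ennreal (frac_kernel \<alpha> z * q z))"
   using le b0 K0 q0 by (intro nn_integral_mono) (auto simp: mult_ac simp flip: ennreal_mult intro!: ennreal_leI)
  also have "... = ennreal (b * dl powr ?p) * (NBINT z. ennreal (frac_kernel \<alpha> z * q z))"
   by (rule nn_integral_cmult) measurable
  also have "(NBINT z. ennreal (frac_kernel \<alpha> z * q z))
    = (NBINT z. (NBINT x. ennreal ((u (x + z) - u x)^2 * frac_kernel \<alpha> z)))"
  proof (intro nn_integral_cong)
   fix z :: "real^'n"
   have "(NBINT x. ennreal ((u (x + z) - u x)^2 * frac_kernel \<alpha> z)) = (NBINT x. ennreal ((u (x + z) - u x)^2) * ennreal (frac_kernel \<alpha> z))"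
    using K0 by (intro nn_integral_cong) (simp add: ennreal_mult)
   also have "... = ennreal (q z) * ennreal (frac_kernel \<alpha> z)" unfolding qnn[symmetric] by (rule nn_integral_multc) measurable
   finally show "ennreal (frac_kernel \<alpha> z * q z) = (NBINT x. ennreal ((u (x + z) - u x)^2 * frac_kernel \<alpha> z))"
    using K0 q0 by (simp add: ennreal_mult mult.commute)
  qed
  also have "... = (NBINT x. (NBINT z. ennreal ((u (x + z) - u x)^2 * frac_kernel \<alpha> z)))"
   by (rule lborel_pair.Fubini') measurable
  also have "... = (\<integral>\<^sup>+xz. ennreal ((%(x, z). (u (x + z) - u x)^2 * frac_kernel \<alpha> z) xz) \<partial>(lborel \<Otimes>\<^sub>M lborel))"
   by (subst lborel.nn_integral_fst[symmetric]) auto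
  also have "... = ennreal (LINT (x, z)|(lborel \<Otimes>\<^sub>M lborel). (u (x + z) - u x)^2 * frac_kernel \<alpha> z)"
   using K0 by (intro nn_integral_eq_integral ui) auto
  also have "ennreal (b * dl powr ?p) * ... <= ennreal (b * dl powr ?p) * ennreal (?F^2)"
   by (intro mult_left_mono ennreal_leI F2) auto
  finally show ?thesis using b0 by (simp add: ennreal_mult)
 qed
 have W0: "0 <= b * (?v * dl ^ CARD('n))" "0 <= b * dl powr ?p * ?F^2" using b0 v dl by auto
 have w0: "0 <= w z" for z by (simp add: w_def)
 have qm: "q \<in> borel_measurable lborel" "w \<in> borel_measurable lborel" by simp_all
 note * = weighted_average_L2[OF sigma_finite_lborel sigma_finite_lborel sm qm(2) w0 W W0(1) Q qm(1) B W0(2)]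
 show "(%x. LBINT z. \<theta> z * (u (x - z) - u x)) \<in> L2s" unfolding eq by (rule *(1))
 have F0: "0 <= ?F" using K0 by (auto simp: frac_sobolev_norm_def intro!: add_nonneg_nonneg integral_nonneg_AE)
 have "L2n (%x. LBINT z. s x z * w z) <= sqrt (b * (?v * dl ^ CARD('n)) * (b * dl powr ?p * ?F^2))" by (rule *(2))
 also have "b * (?v * dl ^ CARD('n)) * (b * dl powr ?p * ?F^2) = (b * sqrt ?v * dl powr (real CARD('n) + \<alpha> / 2) * ?F)^2"
 proof -
  have "dl ^ CARD('n) * dl powr ?p = (dl powr (real CARD('n) + \<alpha> / 2))^2"
   using dl by (simp add: powr_realpow[symmetric] powr_add[symmetric] power2_eq_square)
  moreover have "(sqrt ?v)^2 = ?v" using v by simp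
  ultimately show ?thesis by (simp add: power_mult_distrib power2_eq_square mult_ac)
 qed
 also have "sqrt ... = b * sqrt ?v * dl powr (real CARD('n) + \<alpha> / 2) * ?F" using b0 v F0 by simp
 finally show "L2n (%x. LBINT z. \<theta> z * (u (x - z) - u x))
    <= b * sqrt ?v * dl powr (real CARD('n) + \<alpha> / 2) * ?F" unfolding eq .
qed

definition mol_rate :: "'n itself => real" where
 "mol_rate _ = 6 * mol_const TYPE('n) * sqrt (unit_ball_vol (real CARD('n)))"

lemma mol_rate_pos: "0 < mol_rate TYPE('n::finite)"
 using mol_const_pos[where 'n='n] by (simp add: mol_rate_def)

text \<open>
 The mollifier has integral one and its derivatives have integral zero, so both convolutions are averages of increments of \<open>u\<close> over
 distances at most \<open>dl\<close>. Each derivative costs a factor \<open>1 / dl\<close>.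
\<close>

lemma mollification_error:
 fixes u :: "real^'n => real"
 assumes u: "u \<in> frac_sobolev_space \<alpha>" and \<alpha>: "0 < \<alpha>" and dl: "0 < dl"
 shows "L2n (%x. conv (mol dl) u x - u x) <= mol_rate TYPE('n) * dl powr (\<alpha> / 2) * frac_sobolev_norm \<alpha> u"
  and "L2n (conv (partial j (mol dl)) u) <= mol_rate TYPE('n) * dl powr (\<alpha> / 2 - 1) * frac_sobolev_norm \<alpha> u"
  and "conv (partial j (mol dl)) u \<in> L2s"
proof -
 have uL: "u \<in> L2s" using u by (simp add: frac_sobolev_space_def)
 have [measurable]: "u \<in> borel_fun" using L2_spaceD(1)[OF uL] by simp
 have li: "loc_int u" by (rule loc_int_L2[OF uL])
 have F0: "0 <= frac_sobolev_norm \<alpha> u"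
  by (auto simp: frac_sobolev_norm_def frac_kernel_def intro!: add_nonneg_nonneg integral_nonneg_AE)
 let ?c = "mol_const TYPE('n)" and ?v = "unit_ball_vol (real CARD('n))"
 have c: "0 < ?c" by (rule mol_const_pos)
 have rep: "conv g u x - (LBINT z. g z) * u x = (LBINT z. g z * (u (x - z) - u x))" if g: "g \<in> Cc_k n" for g n x
 proof -
  have [measurable]: "g \<in> borel_fun" by (rule Cc_k_measurable[OF g])
  have "integrable lborel (%z. (%y. g (x - y) * u y) (x - z))"
   by (rule integrable_lborel_reflect[OF conv_integrable[OF g li]])
  then have i: "integrable lborel (%z. g z * u (x - z))" by simp
  have "conv g u x = conv u g x" by (subst conv_commute) auto
  also have "... = (LBINT z. g z * u (x - z))" by (simp add: conv_def mult.commute)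
  finally show ?thesis using i Cc_k_integrable[OF g] by (simp add: right_diff_distrib)
 qed
 have "(%x. conv (mol dl) u x - u x) = (%x. LBINT z. mol dl z * (u (x - z) - u x))"
  using rep[OF mol_Cc[OF dl]] mol_integral[OF dl, where 'n='n] by auto
 then have "L2n (%x. conv (mol dl) u x - u x)
   <= (?c / dl ^ CARD('n)) * sqrt ?v * dl powr (real CARD('n) + \<alpha> / 2) * frac_sobolev_norm \<alpha> u"
  using fractional_average(2)[OF u \<alpha> dl mol_measurable[OF dl] mol_support[OF dl], of "?c / dl ^ CARD('n)"] mol_bound[OF dl, where 'n='n] by simp
 also have "... = (?c * sqrt ?v) * dl powr (\<alpha> / 2) * frac_sobolev_norm \<alpha> u"
  using dl by (simp add: powr_add powr_realpow)
 also have "... <= mol_rate TYPE('n) * dl powr (\<alpha> / 2) * frac_sobolev_norm \<alpha> u"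
  using c F0 by (intro mult_right_mono) (auto simp: mol_rate_def)
 finally show "L2n (%x. conv (mol dl) u x - u x) <= mol_rate TYPE('n) * dl powr (\<alpha> / 2) * frac_sobolev_norm \<alpha> u" .
 have e: "conv (partial j (mol dl)) u = (%x. LBINT z. partial j (mol dl) z * (u (x - z) - u x))"
  using rep[OF mol_partial_Cc[OF dl, of j]] mol_partial_integral[OF dl, of j] by auto
 note fa = fractional_average[OF u \<alpha> dl Cc_k_measurable[OF mol_partial_Cc[OF dl, of j]] mol_partial_support[OF dl] mol_bound(3)[OF dl]]
 show "conv (partial j (mol dl)) u \<in> L2s" unfolding e by (rule fa(1))
 have "L2n (conv (partial j (mol dl)) u)
   <= (6 * ?c / dl ^ (CARD('n) + 1)) * sqrt ?v * dl powr (real CARD('n) + \<alpha> / 2) * frac_sobolev_norm \<alpha> u"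
  unfolding e by (rule fa(2))
 also have "... = mol_rate TYPE('n) * dl powr (\<alpha> / 2 - 1) * frac_sobolev_norm \<alpha> u"
  using dl by (simp add: powr_add powr_diff powr_realpow mol_rate_def)
 finally show "L2n (conv (partial j (mol dl)) u) <= mol_rate TYPE('n) * dl powr (\<alpha> / 2 - 1) * frac_sobolev_norm \<alpha> u" .
qed

lemma conv_mol_equicontinuous:
 assumes dl: "0 < dl"
 obtains L where "0 < L"
  "!!(u :: real^'n => real) x. u \<in> L2s ==> \<bar>conv (mol dl) u x\<bar> <= L * L2n u"
  "!!(u :: real^'n => real) x y. u \<in> L2s ==> norm (x - y) <= 1 ==>
    \<bar>conv (mol dl) u x - conv (mol dl) u y\<bar> <= L * L2n u * norm (x - y)"
proof -
 have m: "mol dl \<in> (Cc_k 2 :: (real^'n => real) set)" by (rule mol_Cc[OF dl])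
 have m1: "mol dl \<in> (Cc_k (Suc 0) :: (real^'n => real) set)" by (rule Cc_k_mono[OF _ m]) simp
 have [measurable]: "mol dl \<in> borel_measurable (borel :: (real^'n) measure)" by (rule Cc_k_measurable[OF m])
 obtain K where K: "0 < K" "!!x y::real^'n. \<bar>mol dl x - mol dl y\<bar> <= K * norm (x - y)" using Cc_1_Lipschitz[OF m1] by metis
 let ?V = "sqrt (unit_ball_vol (real CARD('n)) * (dl + 1) ^ CARD('n))"
 have V: "0 <= ?V" using dl by simp
 define A where "A = L2n (mol dl :: real^'n => real)"
 define L where "L = A + K * ?V + 1"
 have A: "0 <= A" by (simp add: A_def)
 have "0 <= K * ?V" using K V by (intro mult_nonneg_nonneg) auto
 then have L: "0 < L" "A <= L" "K * ?V <= L" using A unfolding L_def by linarith+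
 show thesis
 proof (rule that[OF L(1)])
  fix u :: "real^'n => real" and x y :: "real^'n" assume u: "u \<in> L2s"
  have mL: "(%y. mol dl (x - y)) \<in> L2s" for x :: "real^'n" by (rule Cc_k_L2[OF Cc_k_reflect[OF m]])
  have nA: "L2n (%y. mol dl (x - y)) = A" for x :: "real^'n"
   unfolding A_def L2_norm_def using integral_lborel_reflect[of "%z. (mol dl z)^2" x] by simp
  have "\<bar>conv (mol dl) u x\<bar> <= A * L2n u"
   using L2_Cauchy_Schwarz[OF mL u, of x] nA[of x] by (simp add: conv_def)
  also have "... <= L * L2n u" using L by (intro mult_right_mono) auto
  finally show "\<bar>conv (mol dl) u x\<bar> <= L * L2n u" .
  assume xy: "norm (x - y) <= 1"
  have "conv (mol dl) u x - conv (mol dl) u y = (LBINT z. (mol dl (x - z) - mol dl (y - z)) * u z)"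
   using conv_integrable[OF m loc_int_L2[OF u]] by (simp add: conv_def left_diff_distrib)
  also have "\<bar>...\<bar> <= L2n (%z. mol dl (x - z) - mol dl (y - z)) * L2n u"
   by (rule L2_Cauchy_Schwarz[OF L2_diff[OF mL mL] u])
  also have "L2n (%z. mol dl (x - z) - mol dl (y - z)) = L2n (%z. mol dl z - mol dl (z + (y - x)))"
   unfolding L2_norm_def using integral_lborel_reflect[of "%z. (mol dl z - mol dl (z + (y - x)))^2" x]
   by (simp add: algebra_simps)
  also have "... <= (K * norm (x - y)) * sqrt (unit_ball_vol (real DIM(real^'n)) * (dl + 1) ^ DIM(real^'n))"
  proof (rule L2_of_bounded_support(2))
   fix z :: "real^'n"
   show "\<bar>mol dl z - mol dl (z + (y - x))\<bar> <= K * norm (x - y)"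
    using K(2)[of z "z + (y - x)"] by (simp add: norm_minus_commute)
   assume z: "dl + 1 < norm z"
   then have "dl < norm (z + (y - x))"
    using xy norm_triangle_ineq4[of "z + (y - x)" "y - x"] norm_minus_commute[of x y] by simp
   then show "mol dl z - mol dl (z + (y - x)) = 0" using z by (simp add: mol_support[OF dl])
  qed (use dl K in auto)
  also have "... = (K * ?V) * norm (x - y)" by simp
  also have "(K * ?V) * norm (x - y) * L2n u <= L * norm (x - y) * L2n u"
   using L by (intro mult_right_mono) auto
  finally show "\<bar>conv (mol dl) u x - conv (mol dl) u y\<bar> <= L * L2n u * norm (x - y)"
   by (simp add: mult_ac mult_right_mono)
 qed
qed

lemma mollification_Cc:
 fixes g :: "real^'n => real"
 assumes g: "g \<in> Cc_k k" and e: "0 < e"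
 obtains d where "0 < d" "!!dl. 0 < dl ==> dl < d ==> L2n (%x. conv (mol dl) g x - g x) <= e"
  "!!dl x. 0 < dl ==> dl < d ==> \<bar>conv (mol dl) g x - g x\<bar> <= e"
proof -
 obtain R where R: "0 < R" "!!x. R < norm x ==> g x = 0" using Cc_k_support[OF g] by metis
 define V where "V = sqrt (unit_ball_vol (real CARD('n)) * (R + 1) ^ CARD('n))"
 have V: "0 <= V" using R by (simp add: V_def)
 define e' where "e' = e / (V + 1)"
 have e': "0 < e'" "e' * V <= e" "e' <= e" using e V by (auto simp: e'_def field_simps add_pos_nonneg)
 have [measurable]: "g \<in> borel_fun" by (rule Cc_k_measurable[OF g])
 obtain d where d: "0 < d" "!!x y. norm (x - y) < d ==> \<bar>g x - g y\<bar> < e'"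
  using Cc_k_uniformly_continuous[OF g e'(1)] by metis
 have pt: "\<bar>conv (mol dl) g x - g x\<bar> <= e'" if dl: "0 < dl" "dl < min d 1" for dl x
 proof -
  note m = mol_Cc[OF dl(1), where 'n='n]
  have [measurable]: "mol dl \<in> borel_measurable (borel :: (real^'n) measure)" by (rule mol_measurable[OF dl(1)])
  have i: "integrable lborel (%z. mol dl (x - z) * g z)" "integrable lborel (%z. mol dl (x - z))"
   using conv_integrable[OF m loc_int_L2[OF Cc_k_L2[OF g]]] integrable_lborel_reflect[OF Cc_k_integrable[OF m]] by auto
  have one: "(LBINT z. mol dl (x - z)) = 1" by (simp add: integral_lborel_reflect mol_integral[OF dl(1)])
  then have "conv (mol dl) g x - g x = (LBINT z. mol dl (x - z) * (g z - g x))"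
   using i by (simp add: conv_def right_diff_distrib)
  also have "\<bar>...\<bar> <= (LBINT z. \<bar>mol dl (x - z) * (g z - g x)\<bar>)" by (rule integral_abs_bound)
  also have "... <= (LBINT z. mol dl (x - z) * e')"
  proof (intro integral_mono integrable_abs)
   show "integrable lborel (%z. mol dl (x - z) * (g z - g x))" using i by (simp add: right_diff_distrib)
   show "integrable lborel (%z. mol dl (x - z) * e')" using i by simp
   fix z
   show "\<bar>mol dl (x - z) * (g z - g x)\<bar> <= mol dl (x - z) * e'"
   proof (cases "dl < norm (x - z)")
    case True
    then show ?thesis by (simp add: mol_support[OF dl(1)])
   next
    case False
    then have "\<bar>g z - g x\<bar> <= e'" using d(2)[of z x] dl by (simp add: norm_minus_commute)
    then show ?thesis using mol_bound(1)[OF dl(1), of "x - z"] by (simp add: abs_mult mult_left_mono)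
   qed
  qed
  also have "... = e'" using one by simp
  finally show ?thesis .
 qed
 show thesis
 proof (rule that[of "min d 1"])
  fix dl :: real assume dl: "0 < dl" "dl < min d 1"
  have [measurable]: "conv (mol dl) g \<in> borel_fun"
   by (intro borel_measurable_continuous_onI conv_continuous[OF mol_Cc[OF dl(1)]] loc_int_L2 Cc_k_L2[OF g])
  have "L2n (%x. conv (mol dl) g x - g x) <= e' * sqrt (unit_ball_vol (real DIM(real^'n)) * (R + 1) ^ DIM(real^'n))"
  proof (rule L2_of_bounded_support(2))
   fix x :: "real^'n" assume x: "R + 1 < norm x"
   have 0: "mol dl (x - y) * g y = 0" for y
   proof (cases "R < norm y")
    case True
    then show ?thesis by (simp add: R)
   next
    case False
    then have "dl < norm (x - y)" using x dl norm_triangle_ineq2[of x y] by linarith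
    then show ?thesis by (simp add: mol_support[OF dl(1)])
   qed
   show "conv (mol dl) g x - g x = 0" unfolding conv_def 0 using x R by simp
  qed (use pt[OF dl] R e' in auto)
  then show "L2n (%x. conv (mol dl) g x - g x) <= e" using e' by (simp add: V_def)
  show "\<bar>conv (mol dl) g x - g x\<bar> <= e" for x using pt[OF dl, of x] e' by simp
 qed (use d in auto)
qed

section \<open>Weak derivatives along orbits\<close>

text \<open>
 \<open>L\<^sup>1\<^sub>l\<^sub>o\<^sub>c\<close> convergence of difference quotients passes to the limit against all test functions at once. This
 is what makes the exceptional null set below independent of the test function.
\<close>

lemma weak_derivative_of_difference_quotients:
 fixes p q :: "real^'n => real"
 assumes p: "loc_int p" and q: "loc_int q"
  and h: "h \<longlonglongrightarrow> 0" "!!n. 0 < h n" "!!n. h n <= 1"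
  and conv: "!!R. (%n. LBINT x. \<bar>(p (x - h n *\<^sub>R axis j 1) - p x) / h n - q x\<bar> * indicator (cball 0 R) x) \<longlonglongrightarrow> 0"
  and \<phi>: "\<phi> \<in> Cc_k 1"
 shows "(LBINT x. q x * \<phi> x) = (LBINT x. p x * partial j \<phi> x)"
proof -
 have \<phi>1: "\<phi> \<in> Cc_k (Suc 0)" using \<phi> by simp
 have [measurable]: "p \<in> borel_fun" "q \<in> borel_fun" "\<phi> \<in> borel_fun"
  using p q Cc_k_measurable[OF \<phi>] by (auto simp: loc_int_def)
 have [measurable]: "partial j \<phi> \<in> borel_fun" by (rule Cc_k_measurable[OF Cc_k_partial[OF \<phi>1]])
 obtain R where R: "0 < R" "!!x. R < norm x ==> \<phi> x = 0" using Cc_k_support[OF \<phi>] by metis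
 obtain B where B: "0 < B" "!!x. \<bar>\<phi> x\<bar> <= B" using Cc_k_bounded[OF \<phi>] by metis
 obtain L where L: "0 < L" "!!x y. \<bar>\<phi> x - \<phi> y\<bar> <= L * norm (x - y)" using Cc_1_Lipschitz[OF \<phi>1] by metis
 let ?e = "axis j 1 :: real^'n"
 have supp: "\<phi> (x + h n *\<^sub>R ?e) = 0" if "R + 1 < norm x" for x n
 proof (rule R(2))
  have "norm (h n *\<^sub>R ?e) <= 1" using h(2)[of n] h(3)[of n] by simp
  then show "R < norm (x + h n *\<^sub>R ?e)" using that norm_triangle_ineq4[of "x + h n *\<^sub>R ?e" "h n *\<^sub>R ?e"] by simp
 qed
 define A where "A = (%n. LBINT x. \<phi> x * ((p (x - h n *\<^sub>R ?e) - p x) / h n))"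
 have i1: "integrable lborel (%x. \<phi> (x + h n *\<^sub>R ?e) * p x)" for n
  by (rule loc_int_bounded_mult(1)[OF p, of _ "R + 1" B]) (use supp B in auto)
 have i2: "integrable lborel (%x. \<phi> x * p x)" "integrable lborel (%x. \<phi> x * q x)"
  by (rule loc_int_bounded_mult(1)[of _ _ R B]; use p q R B in auto)+
 have i3: "integrable lborel (%x. \<phi> x * p (x - h n *\<^sub>R ?e))" for n
  using integrable_lborel_translate[OF i1[of n], of "- (h n *\<^sub>R ?e)"] by simp
 have A_eq: "A n = (LBINT x. p x * ((\<phi> (x + h n *\<^sub>R ?e) - \<phi> x) / h n))" for n
 proof -
  have "A n = ((LBINT x. \<phi> x * p (x - h n *\<^sub>R ?e)) - (LBINT x. \<phi> x * p x)) / h n"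
   unfolding A_def using i2(1) i3[of n] by (simp add: right_diff_distrib diff_divide_distrib)
  also have "(LBINT x. \<phi> x * p (x - h n *\<^sub>R ?e)) = (LBINT x. \<phi> (x + h n *\<^sub>R ?e) * p x)"
   using integral_lborel_translate[of "%x. \<phi> (x + h n *\<^sub>R ?e) * p x" "- (h n *\<^sub>R ?e)"] by simp
  also have "((LBINT x. \<phi> (x + h n *\<^sub>R ?e) * p x) - (LBINT x. \<phi> x * p x)) / h n
    = (LBINT x. p x * ((\<phi> (x + h n *\<^sub>R ?e) - \<phi> x) / h n))"
   using i1[of n] i2(1) by (simp add: right_diff_distrib diff_divide_distrib mult.commute)
  finally show ?thesis .
 qed
 have lim1: "A \<longlonglongrightarrow> (LBINT x. p x * partial j \<phi> x)"
  unfolding A_eq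
 proof (rule integral_dominated_convergence)
  show "integrable lborel (%x. L * (\<bar>p x\<bar> * indicator (cball 0 (R + 1)) x))"
   using loc_int_abs_integral[OF p] by simp
  show "AE x in lborel. (%n. p x * ((\<phi> (x + h n *\<^sub>R ?e) - \<phi> x) / h n)) \<longlonglongrightarrow> p x * partial j \<phi> x"
  proof (intro AE_I2 tendsto_mult tendsto_const C_k_difference_quotient[of 0])
   show "C_k (Suc 0) \<phi>" using \<phi>1 by (simp add: Cc_k_def del: C_k.simps)
  qed (use h in \<open>auto simp: less_imp_neq[THEN not_sym]\<close>)
  fix n
  show "AE x in lborel. norm (p x * ((\<phi> (x + h n *\<^sub>R ?e) - \<phi> x) / h n)) <= L * (\<bar>p x\<bar> * indicator (cball 0 (R + 1)) x)"
  proof (intro AE_I2)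
   fix x
   have "\<bar>(\<phi> (x + h n *\<^sub>R ?e) - \<phi> x) / h n\<bar> <= L"
    using L(2)[of "x + h n *\<^sub>R ?e" x] h(2)[of n] by (simp add: field_simps)
   then have "\<bar>p x\<bar> * \<bar>(\<phi> (x + h n *\<^sub>R ?e) - \<phi> x) / h n\<bar> <= \<bar>p x\<bar> * L" by (intro mult_left_mono) auto
   then show "norm (p x * ((\<phi> (x + h n *\<^sub>R ?e) - \<phi> x) / h n)) <= L * (\<bar>p x\<bar> * indicator (cball 0 (R + 1)) x)"
    using supp[of x n] R(2)[of x] by (cases "norm x <= R + 1") (auto simp: abs_mult mult.commute)
  qed
 qed measurable
 have dq: "loc_int (%x. (p (x - h n *\<^sub>R ?e) - p x) / h n - q x)" for n
 proof -
  have "integrable lborel (%x. p (x - h n *\<^sub>R ?e) * indicator (cball 0 Q) x)" for Q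
  proof -
   have "integrable lborel (%x. indicator (cball 0 Q) (x + h n *\<^sub>R ?e) * p x)"
   proof (rule loc_int_bounded_mult(1)[OF p, of _ "Q + 1" 1])
    fix x :: "real^'n" assume "Q + 1 < norm x"
    moreover have "norm (h n *\<^sub>R ?e) <= 1" using h(2)[of n] h(3)[of n] by simp
    ultimately have "Q < norm (x + h n *\<^sub>R ?e)" using norm_triangle_ineq4[of "x + h n *\<^sub>R ?e" "h n *\<^sub>R ?e"] by simp
    then show "indicator (cball 0 Q) (x + h n *\<^sub>R ?e) = (0::real)" by simp
   qed (auto simp: indicator_def)
   from integrable_lborel_translate[OF this, of "- (h n *\<^sub>R ?e)"] show ?thesis by (simp add: mult.commute)
  qed
  then show ?thesis using p q by (auto simp: loc_int_def left_diff_distrib diff_divide_distrib)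
 qed
 have "(%n. A n - (LBINT x. \<phi> x * q x)) \<longlonglongrightarrow> 0"
 proof (rule Lim_null_comparison)
  have "norm (A n - (LBINT x. \<phi> x * q x)) <= B * (LBINT x. \<bar>(p (x - h n *\<^sub>R ?e) - p x) / h n - q x\<bar> * indicator (cball 0 R) x)" for n
  proof -
   have "A n - (LBINT x. \<phi> x * q x) = (LBINT x. \<phi> x * ((p (x - h n *\<^sub>R ?e) - p x) / h n - q x))"
    unfolding A_def using i2 i3[of n] by (simp add: right_diff_distrib diff_divide_distrib)
   then show ?thesis using loc_int_bounded_mult(2)[OF dq[of n], of \<phi> R B] R B by simp
  qed
  then show "\<forall>\<^sub>F n in sequentially. norm (A n - (LBINT x. \<phi> x * q x)) <= B * (LBINT x. \<bar>(p (x - h n *\<^sub>R ?e) - p x) / h n - q x\<bar> * indicator (cball 0 R) x)"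
   by simp
  show "(%n. B * (LBINT x. \<bar>(p (x - h n *\<^sub>R ?e) - p x) / h n - q x\<bar> * indicator (cball 0 R) x)) \<longlonglongrightarrow> 0"
   using tendsto_mult[OF tendsto_const conv[of R], of B] by simp
 qed
 then have "A \<longlonglongrightarrow> (LBINT x. \<phi> x * q x)" by (simp add: LIM_zero_iff)
 from LIMSEQ_unique[OF this lim1] show ?thesis by (simp add: mult.commute)
qed

lemma weak_limit_of_L1_loc:
 fixes f :: "nat => real^'n => real"
 assumes f: "!!n. loc_int (f n)" and g: "loc_int g"
  and conv: "!!R. (%n. LBINT x. \<bar>f n x - g x\<bar> * indicator (cball 0 R) x) \<longlonglongrightarrow> 0"
  and \<phi>: "\<phi> \<in> Cc_k k"
 shows "(%n. LBINT x. f n x * \<phi> x) \<longlonglongrightarrow> (LBINT x. g x * \<phi> x)"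
proof -
 have [measurable]: "\<phi> \<in> borel_fun" by (rule Cc_k_measurable[OF \<phi>])
 obtain R where R: "0 < R" "!!x. R < norm x ==> \<phi> x = 0" using Cc_k_support[OF \<phi>] by metis
 obtain B where B: "0 < B" "!!x. \<bar>\<phi> x\<bar> <= B" using Cc_k_bounded[OF \<phi>] by metis
 have fg: "loc_int (%x. f n x - g x)" for n using f[of n] g by (auto simp: loc_int_def left_diff_distrib)
 have "(%n. (LBINT x. f n x * \<phi> x) - (LBINT x. g x * \<phi> x)) \<longlonglongrightarrow> 0"
 proof (rule Lim_null_comparison)
  have "norm ((LBINT x. f n x * \<phi> x) - (LBINT x. g x * \<phi> x)) <= B * (LBINT x. \<bar>f n x - g x\<bar> * indicator (cball 0 R) x)" for n
  proof -
   have "integrable lborel (%x. \<phi> x * f n x)" "integrable lborel (%x. \<phi> x * g x)"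
    by (rule loc_int_bounded_mult(1)[of _ _ R B]; use f g R B in auto)+
   then have "(LBINT x. f n x * \<phi> x) - (LBINT x. g x * \<phi> x) = (LBINT x. \<phi> x * (f n x - g x))"
    by (simp add: right_diff_distrib mult.commute)
   then show ?thesis using loc_int_bounded_mult(2)[OF fg[of n], of \<phi> R B] R B by simp
  qed
  then show "\<forall>\<^sub>F n in sequentially. norm ((LBINT x. f n x * \<phi> x) - (LBINT x. g x * \<phi> x)) <= B * (LBINT x. \<bar>f n x - g x\<bar> * indicator (cball 0 R) x)"
   by simp
  show "(%n. B * (LBINT x. \<bar>f n x - g x\<bar> * indicator (cball 0 R) x)) \<longlonglongrightarrow> 0"
   using tendsto_mult[OF tendsto_const conv[of R], of B] by simp
 qed
 then show ?thesis by (simp add: LIM_zero_iff)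
qed

context stationary_ergodic_environment
begin

lemma AE_orbit_loc_int:
 assumes F: "F \<in> L2_space M"
 shows "AE om in M. loc_int (%x. F (\<tau> x om))"
 using AE_avg_bdd[OF L2_integrable[OF F]] by eventually_elim (auto intro: loc_int_avg_bdd)

text \<open>
 Stationarity turns the summable bounds on the probability space into a summable expectation of the local \<open>L\<^sup>1\<close> norms along the
 orbit.
\<close>

lemma orbit_L1_loc_tendsto:
 assumes X: "!!n. X n \<in> L2_space M" "!!n. L2_norm M (X n) <= (1 / 2) ^ n"
 shows "AE om in M. \<forall>R. (%n. LBINT x. \<bar>X n (\<tau> x om)\<bar> * indicator (cball 0 R) x) \<longlonglongrightarrow> 0"
proof -
 have [measurable]: "X n \<in> borel_measurable M" for n by (rule L2_spaceD(1)[OF X(1)])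
 let ?Y = "%k n om. NBINT x. indicator (cball 0 (real k)) x * ennreal \<bar>X n (\<tau> x om)\<bar>"
 let ?v = "unit_ball_vol (real CARD('n))"
 have "AE om in M. (\<Sum>n. ?Y k n om) \<noteq> \<infinity>" for k :: nat
 proof (rule nn_integral_PInf_AE)
  have Y: "(\<integral>\<^sup>+om. ?Y k n om \<partial>M) <= ennreal (?v * real k ^ CARD('n)) * ennreal ((1 / 2) ^ n)" for n
  proof -
   have "(\<integral>\<^sup>+om. ennreal \<bar>X n om\<bar> \<partial>M) = ennreal (LINT om|M. \<bar>X n om\<bar>)"
    using L2_integrable[OF X(1)] by (intro nn_integral_eq_integral) auto
   also have "... <= ennreal ((1 / 2) ^ n)" using L2_mean_le[OF X(1)] X(2) by (intro ennreal_leI) (meson order_trans)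
   finally have "(\<integral>\<^sup>+om. ennreal \<bar>X n om\<bar> \<partial>M) <= ennreal ((1 / 2) ^ n)" .
   moreover have "(\<integral>\<^sup>+om. ?Y k n om \<partial>M) = ennreal (?v * real k ^ CARD('n)) * (\<integral>\<^sup>+om. ennreal \<bar>X n om\<bar> \<partial>M)"
    using nn_integral_orbit[of "%om. ennreal \<bar>X n om\<bar>" "indicator (cball 0 (real k))"] by (simp add: emeasure_cball)
   ultimately show ?thesis by (auto intro: mult_left_mono)
  qed
  have "(\<integral>\<^sup>+om. (\<Sum>n. ?Y k n om) \<partial>M) = (\<Sum>n. \<integral>\<^sup>+om. ?Y k n om \<partial>M)" by (rule nn_integral_suminf) measurable
  also have "... <= (\<Sum>n. ennreal (?v * real k ^ CARD('n)) * ennreal ((1 / 2) ^ n))" by (intro suminf_le allI Y) auto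
  also have "... = ennreal (?v * real k ^ CARD('n)) * ennreal (\<Sum>n. (1 / 2) ^ n)"
   by (subst ennreal_suminf_cmult, subst suminf_ennreal2) (auto intro: summable_geometric)
  also have "... < \<infinity>" by (simp add: ennreal_mult_less_top)
  finally show "(\<integral>\<^sup>+om. (\<Sum>n. ?Y k n om) \<partial>M) \<noteq> \<infinity>" by simp
 qed measurable
 then have "AE om in M. \<forall>k. (\<Sum>n. ?Y k n om) \<noteq> \<infinity>" by (simp add: AE_all_countable)
 moreover have "AE om in M. \<forall>n. loc_int (%x. X n (\<tau> x om))" using AE_orbit_loc_int[OF X(1)] by (simp add: AE_all_countable)
 ultimately show ?thesis
 proof eventually_elim
  case (elim om)
  let ?r = "%R n. LBINT x. \<bar>X n (\<tau> x om)\<bar> * indicator (cball 0 R) x"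
  have li: "integrable lborel (%x. \<bar>X n (\<tau> x om)\<bar> * indicator (cball 0 R) x)" for n R
   by (rule loc_int_abs_integral) (use elim(2) in simp)
  have Yr: "?Y k n om = ennreal (?r (real k) n)" for k n
  proof -
   have "?Y k n om = (NBINT x. ennreal (\<bar>X n (\<tau> x om)\<bar> * indicator (cball 0 (real k)) x))"
    by (intro nn_integral_cong) (auto simp: indicator_def)
   also have "... = ennreal (?r (real k) n)" using li by (intro nn_integral_eq_integral) auto
   finally show ?thesis .
  qed
  have r0: "0 <= ?r R n" for R n by (intro integral_nonneg_AE) auto
  have k: "(%n. ?r (real k) n) \<longlonglongrightarrow> 0" for k
  proof (rule summable_LIMSEQ_zero[OF summable_suminf_not_top[OF r0]])
   show "(\<Sum>n. ennreal (?r (real k) n)) \<noteq> top" using elim(1)[rule_format, of k] unfolding Yr by simp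
  qed
  show ?case
  proof
   fix R :: real
   obtain k where k': "R <= real k" using real_arch_simple by blast
   show "(%n. ?r R n) \<longlonglongrightarrow> 0"
   proof (rule tendsto_sandwich[OF _ _ tendsto_const k[of k]])
    show "\<forall>\<^sub>F n in sequentially. ?r R n <= ?r (real k) n"
     using k' by (intro always_eventually allI integral_mono li) (auto simp: indicator_def)
   qed (use r0 in auto)
  qed
 qed
qed

text \<open>
 Along steps \<open>h n\<close> chosen so small that the difference quotients are within \<open>2\<^sup>-\<^sup>n\<close> of the derivative in \<open>L\<^sup>2\<close>, they converge locally
 in \<open>L\<^sup>1\<close> along almost every orbit. The sign in the integration by parts is absorbed by the sign convention of \<open>has_D\<close>.
\<close>

lemma weak_derivative_core:
 assumes D: "has_D M \<tau> j F G"
 shows "AE om in M. \<forall>\<phi>\<in>Cc_k 1. (LBINT x. G (\<tau> x om) * \<phi> x) = (LBINT x. F (\<tau> x om) * partial j \<phi> x)"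
proof -
 have F: "F \<in> L2_space M" and G: "G \<in> L2_space M"
  and lim: "((%eps. L2_norm M (%om. (F (\<tau> (- (eps *\<^sub>R axis j 1)) om) - F om) / eps - G om)) \<longlongrightarrow> 0) (at_right 0)"
  using D by (auto simp: has_D_def)
 have "\<exists>eps>0. eps < 1 / real (Suc n) \<and> L2_norm M (%om. (F (\<tau> (- (eps *\<^sub>R axis j 1)) om) - F om) / eps - G om) < (1 / 2) ^ n" for n
 proof -
  have "\<forall>\<^sub>F eps in at_right 0. L2_norm M (%om. (F (\<tau> (- (eps *\<^sub>R axis j 1)) om) - F om) / eps - G om) < (1 / 2) ^ n"
   by (rule order_tendstoD[OF lim]) simp
  moreover have "\<forall>\<^sub>F eps in at_right 0. eps \<in> {0<..<1 / real (Suc n)}"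
   by (rule eventually_at_right_real) simp
  ultimately have "\<forall>\<^sub>F eps in at_right (0::real). 0 < eps \<and> eps < 1 / real (Suc n) \<and> L2_norm M (%om. (F (\<tau> (- (eps *\<^sub>R axis j 1)) om) - F om) / eps - G om) < (1 / 2) ^ n"
   by eventually_elim auto
  from eventually_happens'[OF trivial_limit_at_right_real this] show ?thesis by blast
 qed
 then have "\<exists>h. \<forall>n. 0 < h n \<and> h n < 1 / real (Suc n) \<and>
   L2_norm M (%om. (F (\<tau> (- (h n *\<^sub>R axis j 1)) om) - F om) / h n - G om) < (1 / 2) ^ n" by (intro choice allI)
 then obtain h where h: "!!n. 0 < h n" "!!n. h n < 1 / real (Suc n)"
  "!!n. L2_norm M (%om. (F (\<tau> (- (h n *\<^sub>R axis j 1)) om) - F om) / h n - G om) < (1 / 2) ^ n" by blast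
 have h0: "h \<longlonglongrightarrow> 0"
  by (rule tendsto_sandwich[OF _ _ tendsto_const LIMSEQ_Suc[OF lim_const_over_n[of 1]]])
   (use h(1,2) in \<open>auto intro!: always_eventually less_imp_le\<close>)
 have h1: "h n <= 1" for n
 proof -
  have "1 / real (Suc n) <= 1" by simp
  then show ?thesis using h(2)[of n] by linarith
 qed
 define X where "X = (%n om. (F (\<tau> (- (h n *\<^sub>R axis j 1)) om) - F om) / h n - G om)"
 have XL: "X n \<in> L2_space M" for n
  unfolding X_def divide_inverse mult.commute[of _ "inverse (h n)"] by (intro L2_diff L2_cmult L2_shift F G)
 have "AE om in M. \<forall>R. (%n. LBINT x. \<bar>X n (\<tau> x om)\<bar> * indicator (cball 0 R) x) \<longlonglongrightarrow> 0"
  by (rule orbit_L1_loc_tendsto[OF XL]) (use h(3) in \<open>auto simp: X_def less_imp_le\<close>)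
 then show ?thesis using AE_orbit_loc_int[OF F] AE_orbit_loc_int[OF G] AE_space
 proof eventually_elim
  case (elim om)
  have Xo: "X n (\<tau> x om) = (F (\<tau> (x - h n *\<^sub>R axis j 1) om) - F (\<tau> x om)) / h n - G (\<tau> x om)" for n x
   using elim(4) by (simp add: X_def shift_add)
  show ?case
  proof
   fix \<phi> :: "real^'n => real" assume "\<phi> \<in> Cc_k 1"
   from weak_derivative_of_difference_quotients[OF elim(2,3) h0 h(1) h1 elim(1)[rule_format, unfolded Xo] this]
   show "(LBINT x. G (\<tau> x om) * \<phi> x) = (LBINT x. F (\<tau> x om) * partial j \<phi> x)" .
  qed
 qed
qed

lemma weak_derivative_H1:
 assumes H: "has_H1_grad M \<tau> F G"
 shows "AE om in M. \<forall>j. \<forall>\<phi>\<in>Cc_k 1. (LBINT x. G j (\<tau> x om) * \<phi> x) = (LBINT x. F (\<tau> x om) * partial j \<phi> x)"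
proof -
 obtain \<Phi> \<Gamma> where F: "F \<in> L2_space M" and G: "!!j. G j \<in> L2_space M"
  and D: "!!n j. has_D M \<tau> j (\<Phi> n) (\<Gamma> n j)"
  and lim: "(%n::nat. sqrt ((LINT om|M. (\<Phi> n om - F om)^2) + (\<Sum>j\<in>UNIV. LINT om|M. (\<Gamma> n j om - G j om)^2))) \<longlonglongrightarrow> 0"
  using H by (auto simp: has_H1_grad_def)
 let ?d = "%n. sqrt ((LINT om|M. (\<Phi> n om - F om)^2) + (\<Sum>j\<in>UNIV. LINT om|M. (\<Gamma> n j om - G j om)^2))"
 have L: "\<Phi> n \<in> L2_space M" "\<Gamma> n j \<in> L2_space M" for n j using D by (auto simp: has_D_def)
 have "\<exists>n. ?d n < (1 / 2) ^ k" for k :: nat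
 proof -
  have "\<forall>\<^sub>F n in sequentially. ?d n < (1 / 2) ^ k" by (rule order_tendstoD[OF lim]) simp
  then show ?thesis by (auto simp: eventually_sequentially)
 qed
 then have "\<exists>r. \<forall>k. ?d (r k) < (1 / 2) ^ k" by (intro choice allI)
 then obtain r where r: "!!k. ?d (r k) < (1 / 2) ^ k" by blast
 have b1: "L2_norm M (%om. \<Phi> (r k) om - F om) <= (1 / 2) ^ k" for k
 proof -
  have "L2_norm M (%om. \<Phi> (r k) om - F om) <= ?d (r k)"
   unfolding L2_norm_def by (intro real_sqrt_le_mono) (simp add: sum_nonneg)
  then show ?thesis using r[of k] by linarith
 qed
 have b2: "L2_norm M (%om. \<Gamma> (r k) j om - G j om) <= (1 / 2) ^ k" for k j
 proof -
  have "(LINT om|M. (\<Gamma> (r k) j om - G j om)^2) <= (\<Sum>j\<in>UNIV. LINT om|M. (\<Gamma> (r k) j om - G j om)^2)"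
   by (rule member_le_sum) auto
  moreover have "0 <= (LINT om|M. (\<Phi> (r k) om - F om)^2)" by simp
  ultimately have "L2_norm M (%om. \<Gamma> (r k) j om - G j om) <= ?d (r k)"
   unfolding L2_norm_def by (intro real_sqrt_le_mono) linarith
  then show ?thesis using r[of k] by linarith
 qed
 have "AE om in M. \<forall>k j. \<forall>\<phi>\<in>Cc_k 1. (LBINT x. \<Gamma> (r k) j (\<tau> x om) * \<phi> x) = (LBINT x. \<Phi> (r k) (\<tau> x om) * partial j \<phi> x)"
  using weak_derivative_core[OF D] by (simp add: AE_all_countable)
 moreover have "AE om in M. \<forall>R. (%k. LBINT x. \<bar>\<Phi> (r k) (\<tau> x om) - F (\<tau> x om)\<bar> * indicator (cball 0 R) x) \<longlonglongrightarrow> 0"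
  by (rule orbit_L1_loc_tendsto[OF L2_diff[OF L(1) F] b1])
 moreover have "AE om in M. \<forall>j. \<forall>R. (%k. LBINT x. \<bar>\<Gamma> (r k) j (\<tau> x om) - G j (\<tau> x om)\<bar> * indicator (cball 0 R) x) \<longlonglongrightarrow> 0"
  unfolding AE_all_countable by (intro allI orbit_L1_loc_tendsto[OF L2_diff[OF L(2) G] b2])
 moreover have "AE om in M. (\<forall>k. loc_int (%x. \<Phi> (r k) (\<tau> x om))) \<and> loc_int (%x. F (\<tau> x om))"
  using AE_orbit_loc_int[OF L(1)] AE_orbit_loc_int[OF F] by (simp add: AE_all_countable)
 moreover have "AE om in M. \<forall>j. (\<forall>k. loc_int (%x. \<Gamma> (r k) j (\<tau> x om))) \<and> loc_int (%x. G j (\<tau> x om))"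
  using AE_orbit_loc_int[OF L(2)] AE_orbit_loc_int[OF G] by (simp add: AE_all_countable)
 ultimately show ?thesis
 proof eventually_elim
  case (elim om)
  show ?case
  proof (intro allI ballI)
   fix j and \<phi> :: "real^'n => real" assume \<phi>: "\<phi> \<in> Cc_k 1"
   then have \<phi>': "partial j \<phi> \<in> Cc_k 0" by (intro Cc_k_partial) simp
   have "(%k. LBINT x. \<Gamma> (r k) j (\<tau> x om) * \<phi> x) \<longlonglongrightarrow> (LBINT x. G j (\<tau> x om) * \<phi> x)"
    by (rule weak_limit_of_L1_loc[OF _ _ _ \<phi>]) (use elim in auto)
   moreover have "(%k. LBINT x. \<Phi> (r k) (\<tau> x om) * partial j \<phi> x) \<longlonglongrightarrow> (LBINT x. F (\<tau> x om) * partial j \<phi> x)"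
    by (rule weak_limit_of_L1_loc[OF _ _ _ \<phi>']) (use elim in auto)
   ultimately show "(LBINT x. G j (\<tau> x om) * \<phi> x) = (LBINT x. F (\<tau> x om) * partial j \<phi> x)"
    using elim(1) \<phi> by (auto intro: LIMSEQ_unique)
  qed
 qed
qed

end

section \<open>Weak convergence of rescaled realisations\<close>

text \<open>
 The convergence is required to be uniform over equicontinuous families of test functions. This
 strength is what allows test functions that depend on \<open>eps\<close> and on further parameters.
\<close>

definition homogenises :: "('a::euclidean_space => real) => real => bool" where
 "homogenises p m \<longleftrightarrow> (\<forall>R C \<Phi>.
   (\<forall>\<phi>\<in>\<Phi>. \<phi> \<in> borel_fun \<and> (\<forall>x. R < norm x \<longrightarrow> \<phi> x = 0) \<and> (\<forall>x. \<bar>\<phi> x\<bar> <= C)) \<longrightarrow>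
   (\<forall>e>0. \<exists>d>0. \<forall>\<phi>\<in>\<Phi>. \<forall>x y. norm (x - y) < d \<longrightarrow> \<bar>\<phi> x - \<phi> y\<bar> <= e) \<longrightarrow>
   (\<forall>e>0. \<exists>eps0>0. \<forall>eps. 0 < eps \<and> eps < eps0 \<longrightarrow> (\<forall>\<phi>\<in>\<Phi>. \<bar>LBINT x. \<phi> x * (p (x /\<^sub>R eps) - m)\<bar> <= e)))"

text \<open>
 A test function is almost constant on balls of radius \<open>eps * Q\<close>, so integrating it against \<open>p (x / eps)\<close> is almost the same as
 integrating it against the average of \<open>p\<close> over balls of radius \<open>Q\<close>, which is close to \<open>m\<close>.
\<close>

lemma homogenisesI:
 fixes p :: "'a::euclidean_space => real"
 assumes p: "avg_bdd p S"
  and avg: "!!s. 0 < s ==> \<exists>Q>0. avg_bdd (%x. (LBINT z. p (z + x) * ball_weight Q z) - m) s"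
 shows "homogenises p m"
 unfolding homogenises_def
proof (intro allI impI)
 fix R0 C0 :: real and \<Phi> :: "('a => real) set" and e :: real
 assume \<Phi>0: "\<forall>\<phi>\<in>\<Phi>. \<phi> \<in> borel_fun \<and> (\<forall>x. R0 < norm x \<longrightarrow> \<phi> x = 0) \<and> (\<forall>x. \<bar>\<phi> x\<bar> <= C0)"
  and eq: "\<forall>e>0. \<exists>d>0. \<forall>\<phi>\<in>\<Phi>. \<forall>x y. norm (x - y) < d \<longrightarrow> \<bar>\<phi> x - \<phi> y\<bar> <= e" and e: "0 < e"
 have [measurable]: "p \<in> borel_fun" and S: "0 <= S" using p by (auto simp: avg_bdd_def)
 define R C where "R = max 1 R0" and "C = max 0 C0"
 have R: "1 <= R" and C: "0 <= C" by (auto simp: R_def C_def)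
 have \<Phi>: "\<phi> \<in> borel_fun" "!!x. R < norm x ==> \<phi> x = 0" "!!x. \<bar>\<phi> x\<bar> <= C" if "\<phi> \<in> \<Phi>" for \<phi>
  using \<Phi>0[rule_format, OF that] by (auto simp: R_def C_def le_max_iff_disj)
 define s where "s = e / (2 * (C + 1) * R ^ DIM('a))"
 have s: "0 < s" using e C R by (simp add: s_def)
 have Cs: "C * (s * R ^ DIM('a)) <= e / 2"
 proof -
  have "C * (s * R ^ DIM('a)) = (e / 2) * (C / (C + 1))" using R C by (simp add: s_def)
  also have "... <= (e / 2) * 1" using C e by (intro mult_left_mono) auto
  finally show ?thesis by simp
 qed
 obtain Q where Q: "0 < Q" "avg_bdd (%x. (LBINT z. p (z + x) * ball_weight Q z) - m) s" using avg[OF s] by blast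
 define P where "P = (%x. LBINT z. p (z + x) * ball_weight Q z)"
 have [measurable]: "P \<in> borel_fun" unfolding P_def by measurable
 define \<eta> where "\<eta> = e / (2 * (S + 1) * (R + 1) ^ DIM('a))"
 have \<eta>: "0 < \<eta>" using e S R by (simp add: \<eta>_def)
 have \<eta>S: "\<eta> * (S * (R + 1) ^ DIM('a)) <= e / 2"
 proof -
  have "\<eta> * (S * (R + 1) ^ DIM('a)) = (e / 2) * (S / (S + 1))" using R S by (simp add: \<eta>_def)
  also have "... <= (e / 2) * 1" using S e by (intro mult_left_mono) auto
  finally show ?thesis by simp
 qed
 obtain d where d: "0 < d" "!!\<phi> x y. \<phi> \<in> \<Phi> ==> norm (x - y) < d ==> \<bar>\<phi> x - \<phi> y\<bar> <= \<eta>"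
  using eq[rule_format, OF \<eta>] by blast
 define eps0 where "eps0 = min 1 (min (1 / Q) (d / Q))"
 have eps0: "0 < eps0" using Q d by (simp add: eps0_def)
 show "\<exists>eps0>0. \<forall>eps. 0 < eps \<and> eps < eps0 \<longrightarrow> (\<forall>\<phi>\<in>\<Phi>. \<bar>LBINT x. \<phi> x * (p (x /\<^sub>R eps) - m)\<bar> <= e)"
 proof (intro exI[of _ eps0] conjI allI impI ballI eps0)
  fix eps \<phi> assume eps0: "0 < eps \<and> eps < eps0" and \<phi>: "\<phi> \<in> \<Phi>"
  have eps: "0 < eps" "eps <= 1" "eps * Q <= 1" "eps * Q < d" using eps0 Q by (auto simp: eps0_def field_simps)
  have [measurable]: "\<phi> \<in> borel_fun" by (rule \<Phi>(1)[OF \<phi>])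
  define q where "q = (%x. p (x /\<^sub>R eps))"
  have qS: "avg_bdd q S" unfolding q_def by (rule avg_bdd_scale[OF p eps(1,2)])
  have [measurable]: "q \<in> borel_fun" using qS by (simp add: avg_bdd_def)
  have q_sh: "p (z + x /\<^sub>R eps) = q (x + eps *\<^sub>R z)" for x z
   using eps by (simp add: q_def scaleR_add_right add.commute)
  have PmS: "avg_bdd (%x. P (x /\<^sub>R eps) - m) s" using avg_bdd_scale[OF Q(2) eps(1,2)] by (simp add: P_def)
  note wi = ball_weight_integral[OF Q(1), where 'a='a]
  have wb: "\<bar>ball_weight Q (z::'a)\<bar> <= 1 / measure lborel (cball (0::'a) Q)" for z
   by (auto simp: ball_weight_def indicator_def)
  have w0: "ball_weight Q z = 0" if "Q < norm z" for z :: 'a using that by (simp add: ball_weight_def)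
  have e1: "\<bar>eps\<bar> <= 1" using eps by simp
  let ?f = "%z x. \<phi> x * q (x + eps *\<^sub>R z) * ball_weight Q z"
  have int: "integrable (lborel \<Otimes>\<^sub>M lborel) (case_prod ?f)"
   by (rule integrable_shifted_product[OF loc_int_avg_bdd[OF qS] _ _ \<Phi>(2,3)[OF \<phi>] w0 wb e1]) measurable
  have i1: "integrable lborel (%x. \<phi> x * q x)"
   by (rule loc_int_bounded_mult(1)[OF loc_int_avg_bdd[OF qS] _ \<Phi>(2,3)[OF \<phi>]]) measurable
  have i2: "integrable lborel (%x. \<phi> x * (P (x /\<^sub>R eps) - m))"
   by (rule loc_int_bounded_mult(1)[OF loc_int_avg_bdd[OF PmS] _ \<Phi>(2,3)[OF \<phi>]]) measurable
  have i3: "integrable lborel (%x. \<phi> x * (q x - P (x /\<^sub>R eps)))"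
  proof -
   have "integrable lborel \<phi>"
    using loc_int_bounded_mult(1)[of "%_. 1" \<phi> R C] \<Phi>[OF \<phi>] integrable_real_indicator[of "cball (0::'a) _" lborel]
     emeasure_bounded_finite[OF bounded_cball[of "0::'a"]] by (simp add: loc_int_def)
   then have "integrable lborel (%x. \<phi> x * q x - \<phi> x * (P (x /\<^sub>R eps) - m) - \<phi> x * m)" using i1 i2 by simp
   then show ?thesis by (simp add: algebra_simps)
  qed
  have P_int: "(LBINT x. \<phi> x * P (x /\<^sub>R eps)) = (LBINT z. (LBINT x. \<phi> x * q (x + eps *\<^sub>R z)) * ball_weight Q z)"
  proof -
   have "(LBINT x. \<phi> x * P (x /\<^sub>R eps)) = (LBINT x. (LBINT z. ?f z x))"
    unfolding P_def q_sh by (subst integral_mult_right_zero[symmetric]) (simp add: mult_ac)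
   also have "... = (LBINT z. (LBINT x. ?f z x))" by (rule lborel_pair.Fubini_integral[OF int])
   finally show ?thesis by simp
  qed
  have shift: "\<bar>(LBINT x. \<phi> x * q x) - (LBINT x. \<phi> x * q (x + eps *\<^sub>R z))\<bar> <= e / 2" if z: "norm z <= Q" for z
  proof -
   have ez: "norm (eps *\<^sub>R z) <= 1" "norm (eps *\<^sub>R z) < d"
   proof -
    have "norm (eps *\<^sub>R z) <= eps * Q" using eps(1) mult_left_mono[OF z, of eps] by simp
    then show "norm (eps *\<^sub>R z) <= 1" "norm (eps *\<^sub>R z) < d" using eps(3,4) by linarith+
   qed
   have sup: "\<phi> (x - eps *\<^sub>R z) = 0" if "R + 1 < norm x" for x
    using that ez norm_triangle_ineq2[of x "eps *\<^sub>R z"] by (intro \<Phi>(2)[OF \<phi>]) linarith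
   have ib: "integrable lborel (%x. \<phi> (x - eps *\<^sub>R z) * q x)"
    by (rule loc_int_bounded_mult(1)[OF loc_int_avg_bdd[OF qS] _ sup \<Phi>(3)[OF \<phi>]]) measurable
   have "(LBINT x. \<phi> x * q (x + eps *\<^sub>R z)) = (LBINT x. \<phi> (x - eps *\<^sub>R z) * q x)"
    using integral_lborel_translate[of "%x. \<phi> (x - eps *\<^sub>R z) * q x" "eps *\<^sub>R z"] by simp
   then have "(LBINT x. \<phi> x * q x) - (LBINT x. \<phi> x * q (x + eps *\<^sub>R z)) = (LBINT x. (\<phi> x - \<phi> (x - eps *\<^sub>R z)) * q x)"
    using i1 ib by (simp add: left_diff_distrib)
   also have "\<bar>...\<bar> <= \<eta> * (LBINT x. \<bar>q x\<bar> * indicator (cball 0 (R + 1)) x)"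
    by (rule loc_int_bounded_mult(2)[OF loc_int_avg_bdd[OF qS]])
     (use sup \<Phi>(2)[OF \<phi>] d(2)[OF \<phi>] ez in auto)
   also have "... <= \<eta> * (S * (R + 1) ^ DIM('a))"
    using avg_bdd_integral[OF qS, of "R + 1"] R \<eta> by (intro mult_left_mono) auto
   finally show ?thesis using \<eta>S by simp
  qed
  have "(LBINT x. \<phi> x * (p (x /\<^sub>R eps) - m)) = (LBINT x. \<phi> x * (q x - P (x /\<^sub>R eps))) + (LBINT x. \<phi> x * (P (x /\<^sub>R eps) - m))"
   using i2 i3 by (subst lint_add[symmetric]) (auto simp: q_def algebra_simps)
  moreover have "\<bar>LBINT x. \<phi> x * (P (x /\<^sub>R eps) - m)\<bar> <= e / 2"
  proof -
   have "\<bar>LBINT x. \<phi> x * (P (x /\<^sub>R eps) - m)\<bar> <= C * (LBINT x. \<bar>P (x /\<^sub>R eps) - m\<bar> * indicator (cball 0 R) x)"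
    by (rule loc_int_bounded_mult(2)[OF loc_int_avg_bdd[OF PmS] _ \<Phi>(2,3)[OF \<phi>]]) measurable
   also have "... <= C * (s * R ^ DIM('a))" by (intro mult_left_mono avg_bdd_integral[OF PmS R] C)
   finally show ?thesis using Cs by simp
  qed
  moreover have "\<bar>LBINT x. \<phi> x * (q x - P (x /\<^sub>R eps))\<bar> <= e / 2"
  proof -
   have iP: "integrable lborel (%x. \<phi> x * P (x /\<^sub>R eps))"
    using Bochner_Integration.integrable_diff[OF i1 i3] by (simp add: algebra_simps)
   have iz: "integrable lborel (%z. (LBINT x. \<phi> x * q (x + eps *\<^sub>R z)) * ball_weight Q z)"
    using lborel_pair.integrable_fst'[OF int] by simp
   have "(LBINT x. \<phi> x * (q x - P (x /\<^sub>R eps))) = (LBINT x. \<phi> x * q x) - (LBINT x. \<phi> x * P (x /\<^sub>R eps))"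
    using i1 iP by (simp add: right_diff_distrib)
   also have "... = (LBINT z. ((LBINT x. \<phi> x * q x) - (LBINT x. \<phi> x * q (x + eps *\<^sub>R z))) * ball_weight Q z)"
    unfolding P_int using iz wi by (simp add: left_diff_distrib)
   also have "\<bar>...\<bar> <= (LBINT z. \<bar>((LBINT x. \<phi> x * q x) - (LBINT x. \<phi> x * q (x + eps *\<^sub>R z))) * ball_weight Q z\<bar>)"
    by (rule integral_abs_bound)
   also have "... <= (LBINT z. (e / 2) * ball_weight Q (z::'a))"
   proof (intro integral_mono integrable_abs)
    show "integrable lborel (%z. ((LBINT x. \<phi> x * q x) - (LBINT x. \<phi> x * q (x + eps *\<^sub>R z))) * ball_weight Q z)"
     using iz wi by (simp add: left_diff_distrib)
    fix z :: 'a
    show "\<bar>((LBINT x. \<phi> x * q x) - (LBINT x. \<phi> x * q (x + eps *\<^sub>R z))) * ball_weight Q z\<bar> <= (e / 2) * ball_weight Q z"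
    proof (cases "norm z <= Q")
     case True
     show ?thesis unfolding abs_mult abs_of_nonneg[OF ball_weight_nonneg]
      by (rule mult_right_mono[OF shift[OF True] ball_weight_nonneg])
    next
     case False
     then show ?thesis using w0[of z] by simp
    qed
   qed (use wi in simp)
   also have "... = e / 2" using wi by simp
   finally show ?thesis .
  qed
  ultimately show "\<bar>LBINT x. \<phi> x * (p (x /\<^sub>R eps) - m)\<bar> <= e" by linarith
 qed
qed

section \<open>Integrability of the jump kernel\<close>

text \<open>
 Dyadic decomposition: a weight of order \<open>q > d\<close> at infinity is summable against any function whose
 averages over large balls are bounded.
\<close>

lemma avg_bdd_decay_integral:
 fixes F :: "'a::euclidean_space => real"
 assumes F: "avg_bdd F S" and q: "real DIM('a) < q"
 shows "(NBINT x. ennreal (\<bar>F x\<bar> * (1 + norm x) powr (- q)))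
   <= ennreal (2 ^ DIM('a) * (\<Sum>k. (2 powr (real DIM('a) - q)) ^ k) * S)"
proof -
 let ?D = "DIM('a)" and ?t = "2 powr (real DIM('a) - q)"
 have [measurable]: "F \<in> borel_fun" and S: "0 <= S" using F by (auto simp: avg_bdd_def)
 have t: "0 < ?t" "?t < 1" using q by (auto simp: powr_less_one)
 have sm: "summable (%k. ?t ^ k)" using t by (intro summable_geometric) auto
 have pt: "ennreal (\<bar>F x\<bar> * (1 + norm x) powr (- q))
   <= (\<Sum>k. ennreal ((2 ^ k) powr (- q)) * (ennreal \<bar>F x\<bar> * indicator (cball 0 (2 ^ Suc k)) x))" for x
 proof -
  define k where "k = nat \<lfloor>log 2 (1 + norm x)\<rfloor>"
  have l0: "0 <= log 2 (1 + norm x)" by (subst zero_le_log_cancel_iff) (auto simp: add_pos_nonneg)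
  have k: "real k <= log 2 (1 + norm x)" "log 2 (1 + norm x) < real k + 1"
   using l0 unfolding k_def by (simp_all add: of_nat_nat)
  have "2 powr real k <= 2 powr (log 2 (1 + norm x))" using k by (intro powr_mono) auto
  then have 1: "2 ^ k <= 1 + norm x" by (simp add: powr_realpow add_pos_nonneg)
  have "2 powr (log 2 (1 + norm x)) < 2 powr (real (Suc k))" using k by (intro powr_less_mono) auto
  then have 2: "1 + norm x < 2 ^ Suc k" by (subst (asm) powr_realpow) (auto simp: add_pos_nonneg)
  have "(1 + norm x) powr (- q) <= (2 ^ k) powr (- q)"
   using 1 q by (intro powr_mono2') (auto intro: order_trans[of 0 "real DIM('a)"])
  then have "ennreal (\<bar>F x\<bar> * (1 + norm x) powr (- q)) <= ennreal (\<bar>F x\<bar> * (2 ^ k) powr (- q))"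
   by (intro ennreal_leI mult_left_mono) auto
  also have "... = ennreal ((2 ^ k) powr (- q)) * (ennreal \<bar>F x\<bar> * indicator (cball 0 (2 ^ Suc k)) x)"
   using 2 by (simp add: ennreal_mult mult.commute)
  also have "... = (\<Sum>i\<in>{k}. ennreal ((2 ^ i) powr (- q)) * (ennreal \<bar>F x\<bar> * indicator (cball 0 (2 ^ Suc i)) x))" by simp
  also have "... <= (\<Sum>i. ennreal ((2 ^ i) powr (- q)) * (ennreal \<bar>F x\<bar> * indicator (cball 0 (2 ^ Suc i)) x))"
   by (rule sum_le_suminf) auto
  finally show ?thesis .
 qed
 have "(NBINT x. ennreal (\<bar>F x\<bar> * (1 + norm x) powr (- q)))
   <= (NBINT x. (\<Sum>k. ennreal ((2 ^ k) powr (- q)) * (ennreal \<bar>F x\<bar> * indicator (cball 0 (2 ^ Suc k)) x)))"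
  by (rule nn_integral_mono[OF pt])
 also have "... = (\<Sum>k. NBINT x. ennreal ((2 ^ k) powr (- q)) * (ennreal \<bar>F x\<bar> * indicator (cball 0 (2 ^ Suc k)) x))"
  by (rule nn_integral_suminf) measurable
 also have "... <= (\<Sum>k. ennreal (2 ^ ?D * S * ?t ^ k))"
 proof (intro suminf_le allI)
  fix k
  have "(NBINT x. ennreal ((2 ^ k) powr (- q)) * (ennreal \<bar>F x\<bar> * indicator (cball 0 (2 ^ Suc k)) x))
    = ennreal ((2 ^ k) powr (- q)) * (NBINT x. ennreal \<bar>F x\<bar> * indicator (cball 0 (2 ^ Suc k)) x)"
   by (rule nn_integral_cmult) measurable
  also have "... <= ennreal ((2 ^ k) powr (- q)) * ennreal (S * (2 ^ Suc k) ^ ?D)"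
   using F one_le_power[of "2::real" "Suc k"] unfolding avg_bdd_def by (intro mult_left_mono) auto
  also have "... = ennreal (2 ^ ?D * S * ?t ^ k)"
  proof -
   have "(2 ^ k) powr (- q) * (2 ^ k) ^ ?D = ?t ^ k"
   proof -
    have 1: "(2 ^ k) powr (- q) = 2 powr (real k * (- q))" by (subst powr_realpow[symmetric]) (auto simp: powr_powr)
    have 2: "(2 ^ k) ^ ?D = 2 powr (real k * real ?D)"
     using powr_realpow[of "2::real" "k * ?D"] by (simp add: power_mult)
    have 3: "?t ^ k = 2 powr (real k * (real ?D - q))"
     by (subst powr_realpow[symmetric]) (auto simp: powr_powr mult.commute)
    show ?thesis unfolding 1 2 3 by (simp add: powr_add[symmetric] algebra_simps)
   qed
   then have "(2 ^ k) powr (- q) * (S * (2 ^ Suc k) ^ ?D) = 2 ^ ?D * S * ?t ^ k"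
    by (simp add: power_mult_distrib mult_ac)
   then show ?thesis using S by (simp add: ennreal_mult'[symmetric])
  qed
  finally show "(NBINT x. ennreal ((2 ^ k) powr (- q)) * (ennreal \<bar>F x\<bar> * indicator (cball 0 (2 ^ Suc k)) x))
    <= ennreal (2 ^ ?D * S * ?t ^ k)" .
 qed auto
 also have "... = ennreal (\<Sum>k. 2 ^ ?D * S * ?t ^ k)"
  using S t by (intro suminf_ennreal2 summable_mult sm) auto
 also have "(\<Sum>k. 2 ^ ?D * S * ?t ^ k) = 2 ^ ?D * (\<Sum>k. ?t ^ k) * S"
  using suminf_mult[OF sm, of "2 ^ ?D * S"] by (simp add: mult_ac)
 finally show ?thesis .
qed

lemma avg_bdd_one: "avg_bdd (%x::'a::euclidean_space. 1) (unit_ball_vol (real DIM('a)))"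
 by (auto simp: avg_bdd_def emeasure_cball)

lemma frac_kernel_measurable [measurable]: "(frac_kernel \<alpha> :: real^'n => real) \<in> borel_fun"
 unfolding frac_kernel_def[abs_def] by measurable

lemma frac_kernel_nonneg [simp]: "0 <= frac_kernel \<alpha> z"
 by (simp add: frac_kernel_def)

lemma frac_kernel_even [simp]: "frac_kernel \<alpha> (- z) = frac_kernel \<alpha> z"
 by (simp add: frac_kernel_def)

lemma frac_kernel_decay:
 fixes z :: "real^'n"
 assumes "0 < \<alpha>" "1 <= norm z"
 shows "frac_kernel \<alpha> z <= 2 powr (real CARD('n) + \<alpha>) * (1 + norm z) powr (- (real CARD('n) + \<alpha>))"
proof -
 let ?p = "real CARD('n) + \<alpha>"
 have "(1 + norm z) powr ?p <= (2 * norm z) powr ?p" using assms by (intro powr_mono2) auto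
 also have "... = 2 powr ?p * norm z powr ?p" by (simp add: powr_mult)
 finally have "(1 + norm z) powr ?p <= 2 powr ?p * norm z powr ?p" .
 moreover have "0 < norm z powr ?p" "0 < (1 + norm z) powr ?p" using assms by (auto simp: add_pos_nonneg)
 ultimately show ?thesis unfolding frac_kernel_def powr_minus by (simp add: field_simps)
qed

lemma near_kernel_integrable:
 fixes \<alpha> :: real
 assumes "0 < \<alpha>" "\<alpha> < 2"
 shows "(\<integral>\<^sup>+z. ennreal ((norm z)^2 * frac_kernel \<alpha> z) * indicator (cball 0 1) z \<partial>(lborel :: (real^'n) measure)) < \<infinity>"
  (is "integral\<^sup>N _ ?f < _")
proof -
 let ?p = "real CARD('n) + \<alpha>" and ?v = "unit_ball_vol (real CARD('n))" and ?t = "2 powr (\<alpha> - 2)"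
 have t: "0 < ?t" "?t < 1" using assms by (auto simp: powr_less_one)
 have sm: "summable (%k. ?t ^ k)" using t by (intro summable_geometric) auto
 have pt: "?f z <= (\<Sum>k. ennreal ((1 / 2 ^ k)^2 * (2 ^ Suc k) powr ?p) * indicator (cball 0 (1 / 2 ^ k)) z)" for z :: "real^'n"
 proof (cases "z = 0 \<or> 1 < norm z")
  case True
  then show ?thesis by (auto simp: frac_kernel_def)
 next
  case False
  then have z: "0 < norm z" "norm z <= 1" by auto
  define k where "k = nat \<lfloor>- log 2 (norm z)\<rfloor>"
  have l0: "0 <= - log 2 (norm z)" using z log_le_zero_cancel_iff[of 2 "norm z"] by simp
  have k: "real k <= - log 2 (norm z)" "- log 2 (norm z) < real k + 1"
   using l0 unfolding k_def by (simp_all add: of_nat_nat)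
  have "2 powr (log 2 (norm z)) <= 2 powr (- real k)" using k by (intro powr_mono) auto
  moreover have "2 powr (log 2 (norm z)) = norm z" using z by simp
  moreover have "2 powr (- real k) = 1 / 2 ^ k" by (simp only: powr_minus powr_realpow zero_less_numeral divide_inverse mult_1)
  ultimately have 1: "norm z <= 1 / 2 ^ k" by simp
  have "2 powr (- real (Suc k)) < 2 powr (log 2 (norm z))" using k by (intro powr_less_mono) auto
  moreover have "2 powr (log 2 (norm z)) = norm z" using z by simp
  moreover have "2 powr (- real (Suc k)) = 1 / 2 ^ Suc k" by (simp only: powr_minus powr_realpow zero_less_numeral divide_inverse mult_1)
  ultimately have 2: "1 / 2 ^ Suc k < norm z" by simp
  have "1 / norm z <= 2 ^ Suc k" using 2 z by (simp add: field_simps)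
  then have "(1 / norm z) powr ?p <= (2 ^ Suc k) powr ?p" using z assms by (intro powr_mono2) auto
  then have "frac_kernel \<alpha> z <= (2 ^ Suc k) powr ?p" using z by (simp add: frac_kernel_def powr_divide)
  then have "(norm z)^2 * frac_kernel \<alpha> z <= (1 / 2 ^ k)^2 * (2 ^ Suc k) powr ?p"
   using 1 by (intro mult_mono power_mono) auto
  define a where "a = (%i. ennreal ((1 / 2 ^ i)^2 * (2 ^ Suc i) powr ?p) * indicator (cball 0 (1 / 2 ^ i)) z)"
  have "?f z <= a k" using \<open>(norm z)^2 * frac_kernel \<alpha> z <= _\<close> 1 z by (simp add: a_def ennreal_leI)
  also have "a k = (\<Sum>i\<in>{k}. a i)" by simp
  also have "... <= (\<Sum>i. a i)" by (rule sum_le_suminf) auto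
  also have "... = (\<Sum>i. ennreal ((1 / 2 ^ i)^2 * (2 ^ Suc i) powr ?p) * indicator (cball 0 (1 / 2 ^ i)) z)"
   by (simp only: a_def)
  finally show ?thesis .
 qed
 have "(NBINT z. ?f z) <= (NBINT z. (\<Sum>k. ennreal ((1 / 2 ^ k)^2 * (2 ^ Suc k) powr ?p) * indicator (cball 0 (1 / 2 ^ k)) (z::real^'n)))"
  by (rule nn_integral_mono[OF pt])
 also have "... = (\<Sum>k. NBINT z. ennreal ((1 / 2 ^ k)^2 * (2 ^ Suc k) powr ?p) * indicator (cball 0 (1 / 2 ^ k)) (z::real^'n))"
  by (rule nn_integral_suminf) measurable
 also have "... = (\<Sum>k. ennreal ((2 powr ?p * ?v) * ?t ^ k))"
 proof (intro suminf_cong)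
  fix k
  have e0: "(1 / 2 ^ k) ^ m = 2 powr (- (real k * real m))" for m :: nat
  proof -
   have "2 powr (- (real k * real m)) = 1 / 2 powr real (k * m)" by (simp add: powr_minus divide_inverse)
   also have "2 powr real (k * m) = (2 ^ k) ^ m" by (subst powr_realpow) (auto simp: power_mult)
   finally show ?thesis by (simp add: power_divide)
  qed
  have e1: "(1 / 2 ^ k)^2 = 2 powr (- 2 * real k)"
   by (subst e0) (simp add: mult.commute)
  have e2: "(2 ^ Suc k) powr ?p = 2 powr (real (Suc k) * ?p)"
   by (subst powr_realpow[symmetric]) (auto simp: powr_powr)
  have e3: "(1 / 2 ^ k) ^ CARD('n) = 2 powr (- real k * real CARD('n))"
   by (subst e0) simp
  have e4: "?t ^ k = 2 powr (real k * (\<alpha> - 2))"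
   by (subst powr_realpow[symmetric]) (auto simp: powr_powr mult.commute)
  have "((1 / 2 ^ k)^2 * (2 ^ Suc k) powr ?p) * (?v * (1 / 2 ^ k) ^ CARD('n)) = (2 powr ?p * ?v) * ?t ^ k"
   unfolding e1 e2 e3 e4 by (simp add: powr_add[symmetric] algebra_simps)
  then show "(NBINT z. ennreal ((1 / 2 ^ k)^2 * (2 ^ Suc k) powr ?p) * indicator (cball 0 (1 / 2 ^ k)) (z::real^'n))
    = ennreal ((2 powr ?p * ?v) * ?t ^ k)"
   by (subst nn_integral_cmult_indicator) (auto simp: emeasure_cball ennreal_mult'[symmetric])
 qed
 also have "... = ennreal (\<Sum>k. (2 powr ?p * ?v) * ?t ^ k)"
  using t by (intro suminf_ennreal2 summable_mult sm) auto
 also have "... < \<infinity>" by simp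
 finally show ?thesis .
qed

definition jump_weight :: "real => real^'n => real" where
 "jump_weight \<alpha> z = min 1 ((norm z)^2) * frac_kernel \<alpha> z"

lemma jump_weight_nonneg [simp]: "0 <= jump_weight \<alpha> z"
 by (simp add: jump_weight_def)

lemma jump_weight_integrable:
 assumes "0 < \<alpha>" "\<alpha> < 2"
 shows "integrable lborel (jump_weight \<alpha> :: real^'n => real)"
proof (rule integrableI_nonneg)
 let ?p = "real CARD('n) + \<alpha>"
 show "(jump_weight \<alpha> :: real^'n => real) \<in> borel_measurable lborel" unfolding jump_weight_def[abs_def] by measurable
 have "(NBINT z. ennreal (jump_weight \<alpha> (z::real^'n)))
   <= (NBINT z. ennreal ((norm z)^2 * frac_kernel \<alpha> z) * indicator (cball 0 1) z
     + ennreal (2 powr ?p) * ennreal (\<bar>1\<bar> * (1 + norm (z::real^'n)) powr (- ?p)))"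
 proof (intro nn_integral_mono)
  fix z :: "real^'n"
  show "ennreal (jump_weight \<alpha> z) <= ennreal ((norm z)^2 * frac_kernel \<alpha> z) * indicator (cball 0 1) z
     + ennreal (2 powr ?p) * ennreal (\<bar>1\<bar> * (1 + norm z) powr (- ?p))"
  proof (cases "norm z <= 1")
   case True
   have "jump_weight \<alpha> z <= (norm z)^2 * frac_kernel \<alpha> z" unfolding jump_weight_def by (intro mult_right_mono) auto
   then have "ennreal (jump_weight \<alpha> z) <= ennreal ((norm z)^2 * frac_kernel \<alpha> z) * indicator (cball 0 1) z"
    using True by (simp add: ennreal_leI)
   then show ?thesis by (rule add_increasing2[rotated]) simp
  next
   case False
   have "jump_weight \<alpha> z <= 1 * frac_kernel \<alpha> z" unfolding jump_weight_def by (intro mult_right_mono) auto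
   then have "jump_weight \<alpha> z <= 2 powr ?p * (1 + norm z) powr (- ?p)"
    using frac_kernel_decay[OF assms(1), of z] False by simp
   then show ?thesis using False by (simp add: ennreal_leI ennreal_mult[symmetric])
  qed
 qed
 also have "... = (\<integral>\<^sup>+z. ennreal ((norm z)^2 * frac_kernel \<alpha> z) * indicator (cball 0 1) z \<partial>(lborel :: (real^'n) measure))
   + ennreal (2 powr ?p) * (NBINT z. ennreal (\<bar>1\<bar> * (1 + norm (z::real^'n)) powr (- ?p)))"
  by (subst nn_integral_add, measurable, subst nn_integral_cmult, measurable)
 also have "... < \<infinity>"
 proof -
  have "(NBINT z. ennreal (\<bar>1\<bar> * (1 + norm (z::real^'n)) powr (- ?p))) < \<infinity>"
   using avg_bdd_decay_integral[OF avg_bdd_one[where 'a="real^'n"], of ?p] assms by (simp add: order_le_less_trans)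
  then show ?thesis using near_kernel_integrable[OF assms, where 'n='n] by (simp add: ennreal_mult_less_top)
 qed
 finally show "(NBINT z. ennreal (jump_weight \<alpha> (z::real^'n))) < \<infinity>" .
qed auto

text \<open>
 The kernel is split into a bounded continuous part of compact support and a remainder which is small
 in the sense that \<open>\<integral> min(1, |z|\<^sup>2) rem_kernel dz\<close> tends to zero. The value of the remainder at the origin is
 set to zero so that it is nonnegative everywhere. The truncated kernel is cut off at height \<open>1 / dl\<close> near the origin, and lowering
 it by \<open>dl\<close> gives it compact support without losing continuity.
\<close>

definition trunc_kernel :: "real => real => real^'n => real" where
 "trunc_kernel \<alpha> dl z = max 0 (1 / max (norm z powr (real CARD('n) + \<alpha>)) dl - dl)"

definition rem_kernel :: "real => real => real^'n => real" where
 "rem_kernel \<alpha> dl z = (if z = 0 then 0 else frac_kernel \<alpha> z - trunc_kernel \<alpha> dl z)"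

lemma trunc_kernel_continuous:
 assumes "0 < \<alpha>" "0 < dl"
 shows "continuous_on UNIV (trunc_kernel \<alpha> dl :: real^'n => real)"
proof -
 have "0 < max (norm (z::real^'n) powr (real CARD('n) + \<alpha>)) dl" for z using assms by (simp add: less_max_iff_disj)
 then have nz: "max (norm (z::real^'n) powr (real CARD('n) + \<alpha>)) dl \<noteq> 0" for z by (metis less_irrefl)
 have "continuous_on UNIV (%z::real^'n. norm z powr (real CARD('n) + \<alpha>))"
  using assms by (intro continuous_on_powr' continuous_intros) auto
 then have "continuous_on UNIV (%z::real^'n. max (norm z powr (real CARD('n) + \<alpha>)) dl)"
  by (intro continuous_on_max continuous_on_const)
 then have "continuous_on UNIV (%z::real^'n. 1 / max (norm z powr (real CARD('n) + \<alpha>)) dl)"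
  by (rule continuous_on_divide[OF continuous_on_const]) (use nz in blast)
 then show ?thesis unfolding trunc_kernel_def[abs_def] by (intro continuous_on_max continuous_on_diff continuous_on_const)
qed

lemma trunc_kernel_nonneg [simp]: "0 <= trunc_kernel \<alpha> dl z"
 by (simp add: trunc_kernel_def)

lemma trunc_kernel_even [simp]: "trunc_kernel \<alpha> dl (- z) = trunc_kernel \<alpha> dl z"
 by (simp add: trunc_kernel_def)

lemma trunc_kernel_support:
 fixes z :: "real^'n"
 assumes "0 < \<alpha>" "0 < dl" "(1 / dl) powr (1 / (real CARD('n) + \<alpha>)) < norm z"
 shows "trunc_kernel \<alpha> dl z = 0"
proof -
 let ?p = "real CARD('n) + \<alpha>"
 have "((1 / dl) powr (1 / ?p)) powr ?p <= norm z powr ?p" using assms by (intro powr_mono2) auto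
 then have "1 / dl <= norm z powr ?p" using assms by (simp add: powr_powr)
 then have "1 / max (norm z powr ?p) dl <= 1 / (1 / dl)" using assms by (intro divide_left_mono) (auto simp: le_max_iff_disj)
 then show ?thesis by (simp add: trunc_kernel_def)
qed

lemma trunc_kernel_Cc: "0 < \<alpha> ==> 0 < dl ==> (trunc_kernel \<alpha> dl :: real^'n => real) \<in> Cc_k 0"
 by (rule Cc_k_I[of _ _ "(1 / dl) powr (1 / (real CARD('n) + \<alpha>))"]) (auto simp: trunc_kernel_continuous trunc_kernel_support)

lemma rem_kernel_bounds:
 fixes z :: "real^'n"
 assumes "0 < dl"
 shows "0 <= rem_kernel \<alpha> dl z" "rem_kernel \<alpha> dl z <= frac_kernel \<alpha> z"
proof -
 show "rem_kernel \<alpha> dl z <= frac_kernel \<alpha> z" by (simp add: rem_kernel_def)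
 show "0 <= rem_kernel \<alpha> dl z"
 proof (cases "z = 0")
  case False
  then have "0 < norm z powr (real CARD('a) + \<alpha>)" by simp
  then have "1 / max (norm z powr (real CARD('n) + \<alpha>)) dl <= frac_kernel \<alpha> z"
   unfolding frac_kernel_def by (intro divide_left_mono) (auto simp: less_max_iff_disj)
  then have "trunc_kernel \<alpha> dl z <= frac_kernel \<alpha> z" using assms by (auto simp: trunc_kernel_def)
  then show ?thesis using False by (simp add: rem_kernel_def)
 qed (simp add: rem_kernel_def)
qed

lemma kernel_split: "a * frac_kernel \<alpha> z = a * trunc_kernel \<alpha> dl z + a * rem_kernel \<alpha> dl z" if "z = 0 ==> a = 0"
 using that by (auto simp: rem_kernel_def algebra_simps)

lemma trunc_kernel_measurable: "0 < \<alpha> ==> 0 < dl ==> (trunc_kernel \<alpha> dl :: real^'n => real) \<in> borel_fun"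
 by (rule Cc_k_measurable[OF trunc_kernel_Cc])

lemma rem_kernel_measurable: "0 < \<alpha> ==> 0 < dl ==> (rem_kernel \<alpha> dl :: real^'n => real) \<in> borel_fun"
 using trunc_kernel_measurable[where 'n='n, of \<alpha> dl] unfolding rem_kernel_def[abs_def] by measurable

lemma rem_weight_integrable:
 assumes "0 < \<alpha>" "\<alpha> < 2" "0 < dl"
 shows "integrable lborel (%z::real^'n. min 1 ((norm z)^2) * rem_kernel \<alpha> dl z)"
proof (rule lint_bound[OF jump_weight_integrable[OF assms(1,2)]])
 show "(%z::real^'n. min 1 ((norm z)^2) * rem_kernel \<alpha> dl z) \<in> borel_measurable lborel"
  using rem_kernel_measurable[where 'n='n, OF assms(1,3)] by measurable
 show "AE z in lborel. norm (min 1 ((norm (z::real^'n))^2) * rem_kernel \<alpha> dl z) <= norm (jump_weight \<alpha> z)"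
  using rem_kernel_bounds[OF assms(3), of \<alpha>, where 'n='n] by (auto simp: jump_weight_def abs_mult intro!: mult_left_mono)
qed

definition rem_mass :: "'n::finite itself => real => real => real" where
 "rem_mass _ \<alpha> dl = (LBINT z. min 1 ((norm (z::real^'n))^2) * rem_kernel \<alpha> dl z)"

lemma rem_mass_nonneg: "0 < dl ==> 0 <= rem_mass TYPE('n::finite) \<alpha> dl"
 unfolding rem_mass_def using rem_kernel_bounds(1)[where 'n='n, of dl \<alpha>] by (intro integral_nonneg_AE) auto

lemma rem_mass_small:
 assumes a: "0 < \<alpha>" "\<alpha> < 2" and e: "0 < e"
 obtains dl where "0 < dl" "rem_mass TYPE('n::finite) \<alpha> dl < e"
proof -
 let ?d = "%n. 1 / real (Suc n)"
 have d0: "?d \<longlonglongrightarrow> 0" by (rule LIMSEQ_Suc[OF lim_const_over_n])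
 have "(%n. LBINT z. min 1 ((norm (z::real^'n))^2) * rem_kernel \<alpha> (?d n) z) \<longlonglongrightarrow> (LINT z|(lborel :: (real^'n) measure). 0 :: real)"
 proof (rule integral_dominated_convergence[OF _ _ jump_weight_integrable[OF a]])
  show "AE z in lborel. (%n. min 1 ((norm (z::real^'n))^2) * rem_kernel \<alpha> (?d n) z) \<longlonglongrightarrow> 0"
  proof (intro AE_I2 tendsto_mult_right_zero)
   fix z :: "real^'n"
   show "(%n. rem_kernel \<alpha> (?d n) z) \<longlonglongrightarrow> 0"
   proof (cases "z = 0")
    case False
    let ?N = "norm z powr (real CARD('n) + \<alpha>)"
    have N: "0 < ?N" using False by simp
    have "\<forall>\<^sub>F n in sequentially. ?d n < ?N" "\<forall>\<^sub>F n in sequentially. ?d n < 1 / ?N"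
     using N by (intro order_tendstoD[OF d0]; simp)+
    then have "\<forall>\<^sub>F n in sequentially. ?d n = rem_kernel \<alpha> (?d n) z"
     by eventually_elim (use False in \<open>simp add: rem_kernel_def trunc_kernel_def frac_kernel_def max_def\<close>)
    then show ?thesis using d0 by (rule Lim_transform_eventually[rotated])
   qed (simp add: rem_kernel_def)
  qed
  fix n
  show "(%z::real^'n. min 1 ((norm z)^2) * rem_kernel \<alpha> (?d n) z) \<in> borel_measurable lborel"
   using rem_kernel_measurable[where 'n='n, OF a(1), of "?d n"] by measurable
  show "AE z in lborel. norm (min 1 ((norm (z::real^'n))^2) * rem_kernel \<alpha> (?d n) z) <= jump_weight \<alpha> z"
   using rem_kernel_bounds[of "?d n" \<alpha>, where 'n='n] by (auto simp: jump_weight_def abs_mult intro!: mult_left_mono)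
 qed simp
 then have "\<forall>\<^sub>F n in sequentially. rem_mass TYPE('n) \<alpha> (?d n) < e"
  unfolding rem_mass_def using e by (intro order_tendstoD) auto
 then obtain n where "rem_mass TYPE('n) \<alpha> (?d n) < e" by (auto simp: eventually_sequentially)
 then show thesis by (intro that[of "?d n"]) auto
qed

section \<open>The limit operator on \<open>C\<^sub>c\<^sup>2\<close>\<close>

definition sdiff :: "(real^'n => real) => real^'n => real^'n => real" where
 "sdiff g x z = g (x + z) + g (x - z) - 2 * g x"

lemma sdiff_kernel_integrable:
 fixes g :: "real^'n => real"
 assumes a: "0 < \<alpha>" "\<alpha> < 2" and g: "g \<in> Cc_k 2"
  and k: "k \<in> borel_fun" "!!z. z \<noteq> 0 ==> \<bar>k z\<bar> <= C * frac_kernel \<alpha> z"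
 shows "integrable lborel (%z. sdiff g x z * k z)"
proof -
 have [measurable]: "g \<in> borel_fun" "k \<in> borel_fun" using Cc_k_measurable[OF g] k by auto
 obtain B where B: "0 < B" "!!x z. \<bar>sdiff g x z\<bar> <= B * min 1 ((norm z)^2)"
  using Cc_2_second_difference[OF g] unfolding sdiff_def by metis
 show ?thesis
 proof (rule lint_bound[of _ "%z. (B * C) * jump_weight \<alpha> z"])
  show "integrable lborel (%z::real^'n. (B * C) * jump_weight \<alpha> z)" using jump_weight_integrable[OF a, where 'n='n] by simp
  show "(%z. sdiff g x z * k z) \<in> borel_measurable lborel" unfolding sdiff_def by measurable
  show "AE z in lborel. norm (sdiff g x z * k z) <= norm ((B * C) * jump_weight \<alpha> z)"
  proof (intro AE_I2)
   fix z :: "real^'n"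
   show "norm (sdiff g x z * k z) <= norm ((B * C) * jump_weight \<alpha> z)"
   proof (cases "z = 0")
    case False
    have "\<bar>sdiff g x z\<bar> * \<bar>k z\<bar> <= (B * min 1 ((norm z)^2)) * (C * frac_kernel \<alpha> z)"
     using B k(2)[OF False] by (intro mult_mono) auto
    then have "norm (sdiff g x z * k z) <= (B * C) * jump_weight \<alpha> z" by (simp add: abs_mult jump_weight_def mult_ac)
    then show ?thesis using order_trans[OF _ abs_ge_self] unfolding real_norm_def by blast
   qed (simp add: sdiff_def)
  qed
 qed
qed

lemma trunc_kernel_le_frac: "0 < dl ==> z \<noteq> 0 ==> \<bar>trunc_kernel \<alpha> dl z\<bar> <= 1 * frac_kernel \<alpha> z"
 using rem_kernel_bounds(1)[of dl \<alpha> z] by (simp add: rem_kernel_def)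

text \<open>
 The balls removed in the principal value are symmetric, so \<open>z\<close> and \<open>- z\<close> can be averaged; the second difference is of order
 \<open>|z|\<^sup>2\<close>, which makes the integral absolutely convergent.
\<close>

lemma L_bar_eq:
 fixes g :: "real^'n => real"
 assumes a: "0 < \<alpha>" "\<alpha> < 2" and g: "g \<in> Cc_k 2"
 shows "L_bar \<alpha> c g x = c / 2 * (LBINT z. sdiff g x z * frac_kernel \<alpha> z)"
proof -
 have [measurable]: "g \<in> borel_fun" by (rule Cc_k_measurable[OF g])
 obtain B where B: "0 < B" "!!x. \<bar>g x\<bar> <= B" using Cc_k_bounded[OF g] by metis
 let ?A = "%dl. {z::real^'n. dl < norm z}"
 have sym: "(LINT z:?A dl|lborel. (g (x + z) - g x) * (c * frac_kernel \<alpha> z))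
   = c / 2 * (LBINT z. sdiff g x z * frac_kernel \<alpha> z * indicator (?A dl) z)" if dl: "0 < dl" for dl
 proof -
  let ?h = "%z. indicator (?A dl) z * ((g (x + z) - g x) * (c * frac_kernel \<alpha> z))"
  have i: "integrable lborel ?h"
  proof (rule lint_bound[of _ "%z. (2 * B * \<bar>c\<bar> / min 1 (dl^2)) * jump_weight \<alpha> z"])
   show "integrable lborel (%z::real^'n. (2 * B * \<bar>c\<bar> / min 1 (dl^2)) * jump_weight \<alpha> z)" using jump_weight_integrable[OF a, where 'n='n] by simp
   show "AE z in lborel. norm (?h z) <= norm ((2 * B * \<bar>c\<bar> / min 1 (dl^2)) * jump_weight \<alpha> z)"
   proof (intro AE_I2)
    fix z :: "real^'n"
    show "norm (?h z) <= norm ((2 * B * \<bar>c\<bar> / min 1 (dl^2)) * jump_weight \<alpha> z)"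
    proof (cases "dl < norm z")
     case True
     have m: "0 < min 1 (dl^2)" using dl by simp
     have "dl^2 <= (norm z)^2" using True dl by (intro power_mono) auto
     then have "min 1 (dl^2) <= min 1 ((norm z)^2)" by (auto simp: min_def)
     then have "1 <= min 1 ((norm z)^2) / min 1 (dl^2)" using m by (simp add: le_divide_eq)
     then have "frac_kernel \<alpha> z * 1 <= frac_kernel \<alpha> z * (min 1 ((norm z)^2) / min 1 (dl^2))" by (rule mult_left_mono) simp
     then have K: "frac_kernel \<alpha> z <= jump_weight \<alpha> z / min 1 (dl^2)" by (simp add: jump_weight_def mult.commute)
     have "\<bar>g (x + z) - g x\<bar> <= 2 * B" using B(2)[of "x + z"] B(2)[of x] by linarith
     then have "\<bar>g (x + z) - g x\<bar> * (\<bar>c\<bar> * frac_kernel \<alpha> z) <= (2 * B) * (\<bar>c\<bar> * (jump_weight \<alpha> z / min 1 (dl^2)))"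
      using K B(1) by (intro mult_mono) auto
     then show ?thesis using True m B(1) by (simp add: abs_mult)
    qed simp
   qed
  qed measurable
  have i': "integrable lborel (%z. ?h (- z))" using integrable_lborel_reflect[OF i, of 0] by simp
  have "(LBINT z. ?h z) = (LBINT z. ?h (- z))"
   using integral_lborel_reflect[of ?h 0] by simp
  then have "2 * (LBINT z. ?h z) = (LBINT z. ?h z + ?h (- z))" using i i' by simp
  also have "... = (LBINT z. c * (sdiff g x z * frac_kernel \<alpha> z * indicator (?A dl) z))"
   by (intro lint_cong) (auto simp: sdiff_def indicator_def algebra_simps)
  finally have "2 * (LBINT z. ?h z) = (LBINT z. c * (sdiff g x z * frac_kernel \<alpha> z * indicator (?A dl) z))" .
  then show ?thesis by (simp add: set_lebesgue_integral_def)
 qed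
 have int: "integrable lborel (%z. sdiff g x z * frac_kernel \<alpha> z)"
  by (rule sdiff_kernel_integrable[OF a g, of _ 1]) auto
 have "((%dl. LBINT z. sdiff g x z * frac_kernel \<alpha> z * indicator (?A dl) z) \<longlongrightarrow> (LBINT z. sdiff g x z * frac_kernel \<alpha> z)) (at_right 0)"
 proof (rule tendsto_at_right_sequentially[of 0 1])
  fix S :: "nat => real" assume S: "!!n. 0 < S n" "S \<longlonglongrightarrow> 0"
  show "(%n. LBINT z. sdiff g x z * frac_kernel \<alpha> z * indicator (?A (S n)) z) \<longlonglongrightarrow> (LBINT z. sdiff g x z * frac_kernel \<alpha> z)"
  proof (rule integral_dominated_convergence[OF _ _ integrable_abs[OF int]])
   show "AE z in lborel. (%n. sdiff g x z * frac_kernel \<alpha> z * indicator (?A (S n)) z) \<longlonglongrightarrow> sdiff g x z * frac_kernel \<alpha> z"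
   proof (intro AE_I2)
    fix z :: "real^'n"
    show "(%n. sdiff g x z * frac_kernel \<alpha> z * indicator (?A (S n)) z) \<longlonglongrightarrow> sdiff g x z * frac_kernel \<alpha> z"
    proof (cases "z = 0")
     case False
     then have "\<forall>\<^sub>F n in sequentially. S n < norm z" by (intro order_tendstoD[OF S(2)]) simp
     then have "\<forall>\<^sub>F n in sequentially. sdiff g x z * frac_kernel \<alpha> z = sdiff g x z * frac_kernel \<alpha> z * indicator (?A (S n)) z"
      by eventually_elim simp
     then show ?thesis by (rule Lim_transform_eventually[OF tendsto_const])
    qed (simp add: sdiff_def)
   qed
  qed (auto simp: indicator_def sdiff_def)
 qed auto
 then have "((%dl. c / 2 * (LBINT z. sdiff g x z * frac_kernel \<alpha> z * indicator (?A dl) z)) \<longlongrightarrow> c / 2 * (LBINT z. sdiff g x z * frac_kernel \<alpha> z)) (at_right 0)"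
  by (intro tendsto_intros)
 then have "((%dl. LINT z:?A dl|lborel. (g (x + z) - g x) * (c * frac_kernel \<alpha> z)) \<longlongrightarrow> c / 2 * (LBINT z. sdiff g x z * frac_kernel \<alpha> z)) (at_right 0)"
  by (rule Lim_transform_eventually) (auto simp: eventually_at_right_field sym intro!: exI[of _ 1])
 then show ?thesis unfolding L_bar_def by (intro tendsto_Lim) auto
qed

text \<open>The bounded generator with the truncated kernel; \<open>trunc_mass\<close> is its total jump rate.\<close>

definition trunc_mass :: "'n::finite itself => real => real => real" where
 "trunc_mass _ \<alpha> dl = (LBINT z. trunc_kernel \<alpha> dl (z::real^'n))"

definition L_trunc :: "real => real => real => (real^'n => real) => real^'n => real" where
 "L_trunc \<alpha> c dl g x = c * (conv g (trunc_kernel \<alpha> dl) x - trunc_mass TYPE('n) \<alpha> dl * g x)"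

lemma L_trunc_sdiff:
 fixes g :: "real^'n => real"
 assumes a: "0 < \<alpha>" and dl: "0 < dl" and g: "g \<in> Cc_k n"
 shows "L_trunc \<alpha> c dl g x = c / 2 * (LBINT z. sdiff g x z * trunc_kernel \<alpha> dl z)"
proof -
 note tk = trunc_kernel_Cc[OF a dl, where 'n='n]
 have ki: "integrable lborel (trunc_kernel \<alpha> dl :: real^'n => real)" by (rule Cc_k_integrable[OF tk])
 have i: "integrable lborel (%z. g (x - z) * trunc_kernel \<alpha> dl z)"
  by (rule conv_integrable[OF g loc_int_integrable[OF ki]])
 have i': "integrable lborel (%z. g (x + z) * trunc_kernel \<alpha> dl z)"
  using integrable_lborel_reflect[OF i, of 0] by simp
 have [measurable]: "g \<in> borel_fun" "(trunc_kernel \<alpha> dl :: real^'n => real) \<in> borel_fun"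
  by (rule Cc_k_measurable[OF g], rule Cc_k_measurable[OF tk])
 have e: "(LBINT z. g (x + z) * trunc_kernel \<alpha> dl z) = conv g (trunc_kernel \<alpha> dl) x"
  using integral_lborel_reflect[of "%z. g (x - z) * trunc_kernel \<alpha> dl z" 0] by (simp add: conv_def)
 have "(LBINT z. sdiff g x z * trunc_kernel \<alpha> dl z)
   = (LBINT z. g (x + z) * trunc_kernel \<alpha> dl z + g (x - z) * trunc_kernel \<alpha> dl z - 2 * g x * trunc_kernel \<alpha> dl z)"
  by (intro lint_cong) (auto simp: sdiff_def algebra_simps)
 also have "... = 2 * (conv g (trunc_kernel \<alpha> dl) x - trunc_mass TYPE('n) \<alpha> dl * g x)"
  using i i' ki e by (simp add: conv_def trunc_mass_def)
 finally show ?thesis by (simp add: L_trunc_def)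
qed

lemma L_bar_minus_L_trunc:
 fixes g :: "real^'n => real"
 assumes a: "0 < \<alpha>" "\<alpha> < 2" and dl: "0 < dl" and g: "g \<in> Cc_k 2"
 shows "L_bar \<alpha> c g x - L_trunc \<alpha> c dl g x = c / 2 * (LBINT z. sdiff g x z * rem_kernel \<alpha> dl z)"
proof -
 have "(LBINT z. sdiff g x z * frac_kernel \<alpha> z) = (LBINT z. sdiff g x z * trunc_kernel \<alpha> dl z + sdiff g x z * rem_kernel \<alpha> dl z)"
  by (intro lint_cong kernel_split) (auto simp: sdiff_def)
 also have "... = (LBINT z. sdiff g x z * trunc_kernel \<alpha> dl z) + (LBINT z. sdiff g x z * rem_kernel \<alpha> dl z)"
 proof (rule lint_add)
  show "integrable lborel (%z. sdiff g x z * trunc_kernel \<alpha> dl z)"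
   by (rule sdiff_kernel_integrable[OF a g trunc_kernel_measurable[OF a(1) dl] trunc_kernel_le_frac[OF dl]])
  show "integrable lborel (%z. sdiff g x z * rem_kernel \<alpha> dl z)"
   by (rule sdiff_kernel_integrable[OF a g rem_kernel_measurable[OF a(1) dl], of 1]) (use rem_kernel_bounds[OF dl, where 'n='n] in auto)
 qed
 finally show ?thesis unfolding L_bar_eq[OF a g] L_trunc_sdiff[OF a(1) dl g] by (simp add: algebra_simps)
qed

text \<open>
 A bound of the second differences in \<open>L\<^sup>2\<close>. In contrast to a bound on second derivatives it is visibly preserved by
 convolutions.
\<close>

definition sdiff_bdd :: "(real^'n => real) => real => bool" where
 "sdiff_bdd g D \<longleftrightarrow> (\<forall>z. L2n (%x. sdiff g x z) <= D * min 1 ((norm z)^2))"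

lemma sdiff_L2:
 assumes "g \<in> L2s"
 shows "(%x. sdiff g x z) \<in> L2s"
proof -
 have "(%x. (g (x + z) + g (x + (- z))) - 2 * g x) \<in> L2s"
  by (intro L2_diff L2_add L2_translate L2_cmult assms)
 then show ?thesis by (simp add: sdiff_def)
qed

lemma Cc_2_sdiff_bdd:
 fixes g :: "real^'n => real"
 assumes g: "g \<in> Cc_k 2"
 obtains D where "0 < D" "sdiff_bdd g D"
proof -
 have [measurable]: "g \<in> borel_fun" by (rule Cc_k_measurable[OF g])
 obtain B where B: "0 < B" "!!x z. \<bar>sdiff g x z\<bar> <= B * min 1 ((norm z)^2)"
  using Cc_2_second_difference[OF g] unfolding sdiff_def by metis
 obtain R where R: "0 < R" "!!x. R < norm x ==> g x = 0" using Cc_k_support[OF g] by metis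
 let ?v = "unit_ball_vol (real CARD('n)) * R ^ CARD('n)"
 have v: "0 < ?v" using R by simp
 have "L2n (%x. sdiff g x z) <= (B * sqrt (3 * ?v)) * min 1 ((norm z)^2)" for z
 proof (rule L2_norm_le_nn)
  show "(%x. sdiff g x z) \<in> borel_measurable lborel" unfolding sdiff_def by measurable
  let ?b = "B * min 1 ((norm z)^2)" and ?I = "indicator (cball (0::real^'n) R) :: real^'n => ennreal"
  have b: "0 <= ?b" using B by simp
  have "(NBINT x. ennreal ((sdiff g x z)^2)) <= (NBINT x. ennreal (?b^2) * (?I (x + z) + ?I (x + (- z)) + ?I x))"
  proof (intro nn_integral_mono)
   fix x
   have le: "ennreal ((sdiff g x z)^2) <= ennreal (?b^2)"
    using B(2)[of x z] power_mono[OF B(2)[of x z], of 2] by (intro ennreal_leI) simp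
   show "ennreal ((sdiff g x z)^2) <= ennreal (?b^2) * (?I (x + z) + ?I (x + (- z)) + ?I x)"
   proof (cases "norm (x + z) <= R \<or> norm (x - z) <= R \<or> norm x <= R")
    case True
    then have "1 <= ?I (x + z) + ?I (x + (- z)) + ?I x"
     by (auto simp: indicator_def add_increasing add_increasing2)
    then have "ennreal (?b^2) * 1 <= ennreal (?b^2) * (?I (x + z) + ?I (x + (- z)) + ?I x)" by (intro mult_left_mono) auto
    from order_trans[OF le this[unfolded mult_1_right]] show ?thesis .
   next
    case False
    then show ?thesis using R(2) by (simp add: sdiff_def not_le)
   qed
  qed
  also have "... = ennreal (?b^2) * (NBINT x. ?I (x + z) + ?I (x + (- z)) + ?I x)"
   by (rule nn_integral_cmult) measurable
  also have "(NBINT x. ?I (x + z) + ?I (x + (- z)) + ?I x) = ennreal ?v + ennreal ?v + ennreal ?v"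
  proof -
   have "(NBINT x. ?I (x + z) + ?I (x + (- z)) + ?I x) = (NBINT x. ?I (x + z)) + (NBINT x. ?I (x + (- z))) + (NBINT x. ?I x)"
    by (subst nn_integral_add, measurable, subst nn_integral_add, measurable)
   also have "(NBINT x. ?I (x + z)) = (NBINT x. ?I x)" by (rule nn_integral_lborel_translate) measurable
   also have "(NBINT x. ?I (x + (- z))) = (NBINT x. ?I x)" by (rule nn_integral_lborel_translate) measurable
   also have "(NBINT x. ?I x) = ennreal ?v" using R by (simp add: emeasure_cball)
   finally show ?thesis .
  qed
  also have "ennreal ?v + ennreal ?v + ennreal ?v = ennreal (3 * ?v)" using v by (simp add: ennreal_plus[symmetric] del: ennreal_plus)
  also have "ennreal (?b^2) * ennreal (3 * ?v) = ennreal (((B * sqrt (3 * ?v)) * min 1 ((norm z)^2))^2)"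
   using v by (subst ennreal_mult[symmetric]) (auto simp: power_mult_distrib mult_ac)
  finally show "(NBINT x. ennreal ((sdiff g x z)^2)) <= ennreal (((B * sqrt (3 * ?v)) * min 1 ((norm z)^2))^2)" .
  show "0 <= (B * sqrt (3 * ?v)) * min 1 ((norm z)^2)" using B v by simp
 qed
 then show thesis using B v by (intro that[of "B * sqrt (3 * ?v)"]) (auto simp: sdiff_bdd_def)
qed

lemma rem_operator_L2:
 fixes g :: "real^'n => real"
 assumes a: "0 < \<alpha>" "\<alpha> < 2" and dl: "0 < dl" and g: "g \<in> L2s" and D: "sdiff_bdd g D" "0 <= D"
 shows "(%x. LBINT z. sdiff g x z * rem_kernel \<alpha> dl z) \<in> L2s"
  and "L2n (%x. LBINT z. sdiff g x z * rem_kernel \<alpha> dl z) <= D * rem_mass TYPE('n) \<alpha> dl"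
proof -
 have [measurable]: "g \<in> borel_fun" using L2_spaceD(1)[OF g] by simp
 have [measurable]: "(rem_kernel \<alpha> dl :: real^'n => real) \<in> borel_fun" by (rule rem_kernel_measurable[OF a(1) dl])
 let ?m = "%z::real^'n. min 1 ((norm z)^2)" and ?J = "rem_mass TYPE('n) \<alpha> dl"
 define w where "w = (%z::real^'n. ?m z * rem_kernel \<alpha> dl z)"
 have [measurable]: "w \<in> borel_measurable lborel" unfolding w_def by measurable
 have w0: "0 <= w z" for z using rem_kernel_bounds(1)[OF dl, of \<alpha> z] by (simp add: w_def)
 define s where "s = (%x z. sdiff g x z / ?m z)"
 have sm: "case_prod s \<in> borel_measurable (lborel \<Otimes>\<^sub>M lborel)" unfolding s_def sdiff_def by measurable
 have J: "0 <= ?J" by (rule rem_mass_nonneg[OF dl])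
 have W: "(NBINT z. ennreal (w z)) = ennreal ?J"
  unfolding rem_mass_def using rem_weight_integrable[OF a dl, where 'n='n] w0 by (subst nn_integral_eq_integral) (auto simp: w_def)
 have eq: "(%x. LBINT z. sdiff g x z * rem_kernel \<alpha> dl z) = (%x. LBINT z. s x z * w z)"
 proof (intro ext lint_cong refl)
  fix x z
  show "sdiff g x z * rem_kernel \<alpha> dl z = s x z * w z"
   by (cases "z = 0") (auto simp: s_def w_def sdiff_def min_def)
 qed
 have Q: "(NBINT x. ennreal ((s x z)^2 * w z)) <= ennreal (D^2 * w z)" for z
 proof (cases "z = 0")
  case True
  then show ?thesis by (simp add: w_def)
 next
  case False
  then have m: "0 < ?m z" by (auto simp: min_def)
  have L: "(%x. (1 / ?m z) * sdiff g x z) \<in> L2s" by (intro L2_cmult sdiff_L2 g)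
  have "L2n (%x. (1 / ?m z) * sdiff g x z) = (1 / ?m z) * L2n (%x. sdiff g x z)"
   using m by (subst L2_norm_cmult) auto
  also have "... <= (1 / ?m z) * (D * ?m z)" using D m unfolding sdiff_bdd_def by (intro mult_left_mono) auto
  also have "... = D" using m[THEN less_imp_neq, THEN not_sym] by simp
  finally have n: "L2n (%x. (1 / ?m z) * sdiff g x z) <= D" .
  have "(NBINT x. ennreal ((s x z)^2 * w z)) = (NBINT x. ennreal (((1 / ?m z) * sdiff g x z)^2) * ennreal (w z))"
   using w0 by (intro nn_integral_cong) (simp add: s_def ennreal_mult)
  also have "... = (NBINT x. ennreal (((1 / ?m z) * sdiff g x z)^2)) * ennreal (w z)"
   by (rule nn_integral_multc) (simp add: sdiff_def)
  also have "... = ennreal ((L2n (%x. (1 / ?m z) * sdiff g x z))^2) * ennreal (w z)"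
   unfolding nn_integral_L2[OF L] ..
  also have "... <= ennreal (D^2) * ennreal (w z)"
   using n by (intro mult_right_mono ennreal_leI power_mono) auto
  finally show ?thesis by (simp add: ennreal_mult w0)
 qed
 have B: "(NBINT z. ennreal (D^2 * w z)) <= ennreal (D^2 * ?J)"
 proof -
  have "(NBINT z. ennreal (D^2 * w z)) = ennreal (D^2) * (NBINT z. ennreal (w z))"
   by (subst nn_integral_cmult[symmetric]) (auto simp: ennreal_mult w0)
  then show ?thesis using J by (simp add: W ennreal_mult)
 qed
 note * = weighted_average_L2[OF sigma_finite_lborel sigma_finite_lborel sm _ w0 _ J Q _ B]
 show "(%x. LBINT z. sdiff g x z * rem_kernel \<alpha> dl z) \<in> L2s"
  unfolding eq by (rule *(1)) (use W J in auto)
 have "L2n (%x. LBINT z. s x z * w z) <= sqrt (?J * (D^2 * ?J))" by (rule *(2)) (use W J in auto)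
 also have "?J * (D^2 * ?J) = (D * ?J)^2" by (simp add: power2_eq_square)
 also have "sqrt ((D * ?J)^2) = D * ?J" using D J by simp
 finally show "L2n (%x. LBINT z. sdiff g x z * rem_kernel \<alpha> dl z) <= D * ?J" unfolding eq .
qed

lemma L_trunc_Cc:
 fixes g :: "real^'n => real"
 assumes "0 < \<alpha>" "0 < dl" "g \<in> Cc_k n"
 shows "conv g (trunc_kernel \<alpha> dl) \<in> Cc_k n" "L_trunc \<alpha> c dl g \<in> Cc_k n"
proof -
 note tk = trunc_kernel_Cc[OF assms(1,2), where 'n='n]
 show k: "conv g (trunc_kernel \<alpha> dl) \<in> Cc_k n"
  by (rule conv_Cc_k[OF assms(3) loc_int_integrable[OF Cc_k_integrable[OF tk]] trunc_kernel_support[OF assms(1,2)]])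
 have "(%x. c * (conv g (trunc_kernel \<alpha> dl) x + (- trunc_mass TYPE('n) \<alpha> dl) * g x)) \<in> Cc_k n"
  by (intro Cc_k_cmult Cc_k_add k assms)
 then show "L_trunc \<alpha> c dl g \<in> Cc_k n" by (simp add: L_trunc_def[abs_def])
qed

lemma L_bar_approx:
 fixes g :: "real^'n => real"
 assumes a: "0 < \<alpha>" "\<alpha> < 2" and dl: "0 < dl" and g: "g \<in> Cc_k 2" and D: "sdiff_bdd g D" "0 <= D"
 shows "L_bar \<alpha> c g \<in> L2s"
  and "L2n (%x. L_bar \<alpha> c g x - L_trunc \<alpha> c dl g x) <= \<bar>c\<bar> / 2 * (D * rem_mass TYPE('n) \<alpha> dl)"
proof -
 note r = rem_operator_L2[OF a dl Cc_k_L2[OF g] D]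
 have "(%x. (L_trunc \<alpha> c dl g x) + c / 2 * (LBINT z. sdiff g x z * rem_kernel \<alpha> dl z)) \<in> L2s"
  by (intro L2_add L2_cmult r(1) Cc_k_L2[OF L_trunc_Cc(2)[OF a(1) dl g]])
 moreover have "L_bar \<alpha> c g = (%x. (L_trunc \<alpha> c dl g x) + c / 2 * (LBINT z. sdiff g x z * rem_kernel \<alpha> dl z))"
 proof
  fix x
  show "L_bar \<alpha> c g x = (L_trunc \<alpha> c dl g x) + c / 2 * (LBINT z. sdiff g x z * rem_kernel \<alpha> dl z)"
   using L_bar_minus_L_trunc[OF a dl g, of c x] by linarith
 qed
 ultimately show "L_bar \<alpha> c g \<in> L2s" by simp
 show "L2n (%x. L_bar \<alpha> c g x - L_trunc \<alpha> c dl g x) <= \<bar>c\<bar> / 2 * (D * rem_mass TYPE('n) \<alpha> dl)"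
  unfolding L_bar_minus_L_trunc[OF a dl g] L2_norm_cmult using r(2) by (simp add: mult_left_mono)
qed

lemma L_bar_L2:
 fixes g :: "real^'n => real"
 assumes "0 < \<alpha>" "\<alpha> < 2" "g \<in> Cc_k 2"
 shows "L_bar \<alpha> c g \<in> L2s"
proof -
 obtain D where "0 < D" "sdiff_bdd g D" using Cc_2_sdiff_bdd[OF assms(3)] by metis
 then show ?thesis using L_bar_approx(1)[OF assms(1,2) zero_less_one assms(3), of D c] by simp
qed

lemma L_trunc_tendsto_L_bar:
 fixes g :: "real^'n => real"
 assumes a: "0 < \<alpha>" "\<alpha> < 2" and g: "g \<in> Cc_k 2" and e: "0 < e"
 obtains s where "0 < s" "!!dl. 0 < dl ==> rem_mass TYPE('n) \<alpha> dl < s ==> L2n (%x. L_bar \<alpha> c g x - L_trunc \<alpha> c dl g x) <= e"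
proof -
 obtain D where D: "0 < D" "sdiff_bdd g D" using Cc_2_sdiff_bdd[OF g] by metis
 define K where "K = (\<bar>c\<bar> + 1) * D"
 have K: "0 < K" using D by (simp add: K_def add_nonneg_pos)
 show thesis
 proof (rule that[of "e / K"])
  show "0 < e / K" using e K by simp
  fix dl :: real assume dl: "0 < dl" "rem_mass TYPE('n) \<alpha> dl < e / K"
  have "\<bar>c\<bar> / 2 * (D * rem_mass TYPE('n) \<alpha> dl) <= (\<bar>c\<bar> + 1) * (D * rem_mass TYPE('n) \<alpha> dl)"
   using D rem_mass_nonneg[OF dl(1), where 'n='n] by (intro mult_right_mono) auto
  also have "... = K * rem_mass TYPE('n) \<alpha> dl" by (simp add: K_def)
  also have "... <= K * (e / K)" using K dl(2) by (intro mult_left_mono) auto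
  also have "... = e" using K by simp
  finally show "L2n (%x. L_bar \<alpha> c g x - L_trunc \<alpha> c dl g x) <= e"
   using L_bar_approx(2)[OF a dl(1) g D(2), of c] D by simp
 qed
qed

section \<open>The resolvent equation of the limit operator\<close>

lemma trunc_mass_nonneg: "0 <= trunc_mass TYPE('n::finite) \<alpha> dl"
 unfolding trunc_mass_def by (intro integral_nonneg_AE) auto

lemma trunc_kernel_nn_integral:
 assumes "0 < \<alpha>" "0 < dl"
 shows "(NBINT z. ennreal \<bar>trunc_kernel \<alpha> dl (z::real^'n)\<bar>) = ennreal (trunc_mass TYPE('n) \<alpha> dl)"
 using Cc_k_integrable[OF trunc_kernel_Cc[OF assms, where 'n='n]]
 by (simp add: trunc_mass_def nn_integral_eq_integral)

lemma conv_trunc_L2: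
 fixes u :: "real^'n => real"
 assumes "0 < \<alpha>" "0 < dl" "u \<in> L2s"
 shows "L2n (conv u (trunc_kernel \<alpha> dl)) <= trunc_mass TYPE('n) \<alpha> dl * L2n u"
 using conv_L2(2)[OF assms(3) trunc_kernel_measurable[OF assms(1,2)]] trunc_kernel_nn_integral[OF assms(1,2), where 'n='n]
  trunc_mass_nonneg[where 'n='n] by auto

lemma conv_add_cmult:
 fixes f g :: "real^'n => real"
 assumes "f \<in> Cc_k n" "g \<in> Cc_k m" "loc_int k"
 shows "conv (%x. a * f x + b * g x) k x = a * conv f k x + b * conv g k x"
proof -
 have "conv (%x. a * f x + b * g x) k x = (LBINT y. a * (f (x - y) * k y) + b * (g (x - y) * k y))"
  unfolding conv_def by (intro lint_cong) (auto simp: algebra_simps)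
 then show ?thesis using conv_integrable[OF assms(1,3)] conv_integrable[OF assms(2,3)] by (simp add: conv_def)
qed

lemma sdiff_conv:
 fixes g :: "real^'n => real"
 assumes "g \<in> Cc_k n" "loc_int k"
 shows "sdiff (conv g k) x z = conv (%x. sdiff g x z) k x"
proof -
 have i: "integrable lborel (%y. g (x + w - y) * k y)" for w by (rule conv_integrable[OF assms])
 have "conv (%x. sdiff g x z) k x = (LBINT y. g (x + z - y) * k y + g (x + (- z) - y) * k y - 2 * (g (x + 0 - y) * k y))"
  unfolding conv_def sdiff_def by (intro lint_cong) (auto simp: algebra_simps)
 also have "... = sdiff (conv g k) x z" using i[of z] i[of "- z"] i[of 0] by (simp add: conv_def sdiff_def)
 finally show ?thesis ..
qed

text \<open>
 The range of \<open>\<lambda> - L\<close> on \<open>C\<^sub>c\<^sup>2\<close> is dense. For the truncated operator the resolvent equation is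
 solved by a Neumann series, whose partial sums stay in \<open>C\<^sub>c\<^sup>2\<close> because the truncated kernel has compact support. All
 partial sums satisfy the same bound on second differences as the right-hand side (divided by \<open>\<lambda>\<close>), so the truncation
 error is small uniformly in the number of terms.
\<close>

lemma resolvent_range_dense:
 fixes \<psi> :: "real^'n => real"
 assumes a: "0 < \<alpha>" "\<alpha> < 2" and lam: "0 < lam" and c: "0 <= c" and \<psi>: "\<psi> \<in> Cc_k 2" and e: "0 < e"
 obtains g where "g \<in> Cc_k 2" "L2n (%x. lam * g x - L_bar \<alpha> c g x - \<psi> x) <= e"
proof -
 obtain D where D: "0 < D" "sdiff_bdd \<psi> D" using Cc_2_sdiff_bdd[OF \<psi>] by metis
 define K where "K = (c + 1) * (D / lam)"
 have K: "0 < K" using c D lam by (simp add: K_def)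
 obtain dl where dl: "0 < dl" "rem_mass TYPE('n) \<alpha> dl < e / (2 * K)"
  using rem_mass_small[OF a, of "e / (2 * K)", where 'n='n] e K by auto
 let ?k = "trunc_kernel \<alpha> dl :: real^'n => real" and ?m = "trunc_mass TYPE('n) \<alpha> dl"
 have kl: "loc_int ?k" by (rule loc_int_integrable[OF Cc_k_integrable[OF trunc_kernel_Cc[OF a(1) dl(1)]]])
 have m: "0 <= ?m" by (rule trunc_mass_nonneg)
 define N where "N = lam + c * ?m"
 have N: "0 < N" using lam c m by (simp add: N_def add_pos_nonneg)
 define T where "T = (%g x. (1 / N) * \<psi> x + (c / N) * conv g ?k x)"
 define g where "g = rec_nat (%x. 0) (%n. T)"
 have g0: "g 0 = (%x. 0)" and gS: "g (Suc n) = T (g n)" for n by (auto simp: g_def)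
 have gC: "g n \<in> Cc_k 2" for n
 proof (induction n)
  case 0
  then show ?case by (simp add: g0 Cc_k_zero)
 next
  case (Suc n)
  then show ?case unfolding gS T_def by (intro Cc_k_add Cc_k_cmult \<psi> L_trunc_Cc(1)[OF a(1) dl(1)])
 qed
 have gL: "g n \<in> L2s" for n by (rule Cc_k_L2[OF gC])
 have g_bdd: "sdiff_bdd (g n) (D / lam)" for n
 proof (induction n)
  case 0
  then show ?case using D lam by (simp add: g0 sdiff_bdd_def sdiff_def L2_norm_def)
 next
  case (Suc n)
  show ?case unfolding sdiff_bdd_def
  proof
   fix z :: "real^'n"
   let ?q = "min 1 ((norm z)^2)"
   have Ls: "(%x. sdiff (g n) x z) \<in> L2s" "(%x. sdiff \<psi> x z) \<in> L2s"
    by (intro sdiff_L2 gL Cc_k_L2[OF \<psi>])+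
   have Lc: "conv (%x. sdiff (g n) x z) ?k \<in> L2s"
    using conv_L2(1)[OF Ls(1) trunc_kernel_measurable[OF a(1) dl(1)]] trunc_kernel_nn_integral[OF a(1) dl(1), where 'n='n] m by auto
   have eq: "(%x. sdiff (g (Suc n)) x z) = (%x. (1 / N) * sdiff \<psi> x z + (c / N) * conv (%x. sdiff (g n) x z) ?k x)"
    unfolding sdiff_conv[OF gC kl, symmetric] by (auto simp: gS T_def sdiff_def algebra_simps)
   have "L2n (%x. sdiff (g (Suc n)) x z)
     <= L2n (%x. (1 / N) * sdiff \<psi> x z) + L2n (%x. (c / N) * conv (%x. sdiff (g n) x z) ?k x)"
    unfolding eq by (intro L2_norm_triangle L2_cmult Ls Lc)
   also have "... = (1 / N) * L2n (%x. sdiff \<psi> x z) + (c / N) * L2n (conv (%x. sdiff (g n) x z) ?k)"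
    using N c unfolding L2_norm_cmult by simp
   also have "... <= (1 / N) * (D * ?q) + (c / N) * (?m * ((D / lam) * ?q))"
   proof (intro add_mono mult_left_mono)
    show "L2n (%x. sdiff \<psi> x z) <= D * ?q" using D(2) by (simp add: sdiff_bdd_def)
    have "L2n (conv (%x. sdiff (g n) x z) ?k) <= ?m * L2n (%x. sdiff (g n) x z)"
     by (rule conv_trunc_L2[OF a(1) dl(1) Ls(1)])
    also have "... <= ?m * ((D / lam) * ?q)" using Suc m unfolding sdiff_bdd_def by (intro mult_left_mono) auto
    finally show "L2n (conv (%x. sdiff (g n) x z) ?k) <= ?m * ((D / lam) * ?q)" .
   qed (use N c in auto)
   also have "... = (lam + c * ?m) / N * (D / lam * ?q)" using lam N by (simp add: field_simps)
   also have "... = D / lam * ?q" using N by (simp add: N_def)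
   finally show "L2n (%x. sdiff (g (Suc n)) x z) <= D / lam * ?q" .
  qed
 qed
 define \<rho> where "\<rho> = c * ?m / N"
 have \<rho>: "0 <= \<rho>" "\<rho> < 1" using lam c m N by (auto simp: \<rho>_def) (simp add: N_def)
 have incr: "L2n (%x. g (Suc n) x - g n x) <= \<rho> ^ n * (L2n \<psi> / N)" for n
 proof (induction n)
  case 0
  have "(%x. g (Suc 0) x - g 0 x) = (%x. (1 / N) * \<psi> x)" by (simp add: gS g0 T_def conv_def)
  then have "L2n (%x. g (Suc 0) x - g 0 x) = (1 / N) * L2n \<psi>"
   using N by (simp only: L2_norm_cmult) simp
  then show ?case by simp
 next
  case (Suc n)
  have "conv (%x. 1 * g (Suc n) x + (- 1) * g n x) ?k x = 1 * conv (g (Suc n)) ?k x + (- 1) * conv (g n) ?k x" for x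
   by (rule conv_add_cmult[OF gC gC kl])
  then have eq: "(%x. g (Suc (Suc n)) x - g (Suc n) x) = (%x. (c / N) * conv (%x. g (Suc n) x - g n x) ?k x)"
   using gS by (auto simp: T_def right_diff_distrib)
  have "L2n (%x. g (Suc (Suc n)) x - g (Suc n) x) = (c / N) * L2n (conv (%x. g (Suc n) x - g n x) ?k)"
   unfolding eq L2_norm_cmult using c N by simp
  also have "... <= (c / N) * (?m * L2n (%x. g (Suc n) x - g n x))"
   using c N by (intro mult_left_mono conv_trunc_L2[OF a(1) dl(1)] L2_diff gL) auto
  also have "... = \<rho> * L2n (%x. g (Suc n) x - g n x)" by (simp add: \<rho>_def)
  also have "... <= \<rho> * (\<rho> ^ n * (L2n \<psi> / N))" by (intro mult_left_mono Suc \<rho>)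
  finally show ?case by (simp add: mult.assoc)
 qed
 have "(%n. \<rho> ^ n * L2n \<psi>) \<longlonglongrightarrow> 0" using \<rho> by (intro tendsto_mult_left_zero LIMSEQ_realpow_zero)
 then have "\<forall>\<^sub>F n in sequentially. \<rho> ^ n * L2n \<psi> < e / 2" using e by (intro order_tendstoD) auto
 then obtain n where n: "\<rho> ^ n * L2n \<psi> < e / 2" by (auto simp: eventually_sequentially)
 have eq: "lam * g n x - L_trunc \<alpha> c dl (g n) x - \<psi> x = (- N) * (g (Suc n) x - g n x)" for x
 proof -
  have "N * g (Suc n) x = \<psi> x + c * conv (g n) ?k x" using N by (simp add: gS T_def distrib_left)
  then show ?thesis by (simp add: L_trunc_def N_def algebra_simps)
 qed
 have "L2n (%x. lam * g n x - L_trunc \<alpha> c dl (g n) x - \<psi> x) = N * L2n (%x. g (Suc n) x - g n x)"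
  unfolding eq L2_norm_cmult using N by simp
 also have "... <= N * (\<rho> ^ n * (L2n \<psi> / N))" using N by (intro mult_left_mono incr) auto
 also have "... <= e / 2" using N n by simp
 finally have 1: "L2n (%x. lam * g n x - L_trunc \<alpha> c dl (g n) x - \<psi> x) <= e / 2" .
 have "L2n (%x. L_bar \<alpha> c (g n) x - L_trunc \<alpha> c dl (g n) x) <= \<bar>c\<bar> / 2 * (D / lam * rem_mass TYPE('n) \<alpha> dl)"
  using D lam by (intro L_bar_approx(2)[OF a dl(1) gC g_bdd]) auto
 also have "... <= (c + 1) * (D / lam * rem_mass TYPE('n) \<alpha> dl)"
  using c D lam rem_mass_nonneg[OF dl(1), where 'n='n and \<alpha>=\<alpha>] by (intro mult_right_mono) auto
 also have "... = K * rem_mass TYPE('n) \<alpha> dl" by (simp add: K_def)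
 also have "... <= K * (e / (2 * K))" using K dl(2) by (intro mult_left_mono) auto
 also have "... = e / 2" using K by simp
 finally have 2: "L2n (%x. L_bar \<alpha> c (g n) x - L_trunc \<alpha> c dl (g n) x) <= e / 2" .
 have LL: "L_bar \<alpha> c (g n) \<in> L2s" "L_trunc \<alpha> c dl (g n) \<in> L2s"
  by (rule L_bar_L2[OF a gC], rule Cc_k_L2[OF L_trunc_Cc(2)[OF a(1) dl(1) gC]])
 have "L2n (%x. (lam * g n x - L_trunc \<alpha> c dl (g n) x - \<psi> x) - (L_bar \<alpha> c (g n) x - L_trunc \<alpha> c dl (g n) x)) <= e / 2 + e / 2"
  by (rule order_trans[OF L2_norm_diff_le add_mono[OF 1 2]]) (intro L2_diff L2_cmult gL LL Cc_k_L2[OF \<psi>])+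
 then show thesis by (intro that[OF gC[of n]]) (simp add: algebra_simps)
qed

lemma L2_inner_tendsto:
 assumes "!!n. f n \<in> L2_space M" "g \<in> L2_space M" "(%n. L2_norm M (%x. f n x - g x)) \<longlonglongrightarrow> 0" "h \<in> L2_space M"
 shows "(%n. LINT x|M. f n x * h x) \<longlonglongrightarrow> (LINT x|M. g x * h x)"
proof -
 have "(%n. (LINT x|M. f n x * h x) - (LINT x|M. g x * h x)) \<longlonglongrightarrow> 0"
 proof (rule Lim_null_comparison)
  have "norm ((LINT x|M. f n x * h x) - (LINT x|M. g x * h x)) <= L2_norm M (%x. f n x - g x) * L2_norm M h" for n
  proof -
   have "(LINT x|M. f n x * h x) - (LINT x|M. g x * h x) = (LINT x|M. (f n x - g x) * h x)"
    using L2_prod_integrable[OF assms(1,4)] L2_prod_integrable[OF assms(2,4)] by (simp add: left_diff_distrib)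
   then show ?thesis using L2_Cauchy_Schwarz[OF L2_diff[OF assms(1,2)] assms(4)] by simp
  qed
  then show "\<forall>\<^sub>F n in sequentially. norm ((LINT x|M. f n x * h x) - (LINT x|M. g x * h x)) <= L2_norm M (%x. f n x - g x) * L2_norm M h" by simp
  show "(%n. L2_norm M (%x. f n x - g x) * L2_norm M h) \<longlonglongrightarrow> 0" by (intro tendsto_mult_left_zero assms)
 qed
 then show ?thesis by (simp add: LIM_zero_iff)
qed

lemma conv_self_adjoint:
 fixes f g k :: "real^'n => real"
 assumes f: "f \<in> Cc_k n" and g: "g \<in> Cc_k m" and k: "k \<in> Cc_k l" and even: "!!z. k (- z) = k z"
 shows "(LBINT x. f x * conv g k x) = (LBINT x. g x * conv f k x)"
proof -
 have [measurable]: "f \<in> borel_fun" "g \<in> borel_fun" "k \<in> borel_fun"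
  using f g k Cc_k_measurable by auto
 obtain Rf Bf where Rf: "!!x. Rf < norm x ==> f x = 0" and Bf: "!!x. \<bar>f x\<bar> <= Bf" using Cc_k_support[OF f] Cc_k_bounded[OF f] by metis
 obtain Rg Bg where Rg: "!!x. Rg < norm x ==> g x = 0" and Bg: "!!x. \<bar>g x\<bar> <= Bg" using Cc_k_support[OF g] Cc_k_bounded[OF g] by metis
 obtain Rk Bk where Rk: "!!x. Rk < norm x ==> k x = 0" and Bk: "!!x. \<bar>k x\<bar> <= Bk" using Cc_k_support[OF k] Cc_k_bounded[OF k] by metis
 have i1: "integrable (lborel \<Otimes>\<^sub>M lborel) (%(z, x). f x * g (x + (- 1) *\<^sub>R z) * k z)"
  by (rule integrable_shifted_product[OF loc_int_L2[OF Cc_k_L2[OF g]] _ _ Rf Bf Rk Bk]) auto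
 have i2: "integrable (lborel \<Otimes>\<^sub>M lborel) (%(z, x). g x * f (x + 1 *\<^sub>R z) * k z)"
  by (rule integrable_shifted_product[OF loc_int_L2[OF Cc_k_L2[OF f]] _ _ Rg Bg Rk Bk]) auto
 have "(LBINT x. f x * conv g k x) = (LBINT x. (LBINT z. f x * g (x + (- 1) *\<^sub>R z) * k z))"
  by (simp add: conv_def mult.assoc)
 also have "... = (LBINT z. (LBINT x. f x * g (x + (- 1) *\<^sub>R z) * k z))"
  by (rule lborel_pair.Fubini_integral[OF i1])
 also have "... = (LBINT z. (LBINT x. g x * f (x + 1 *\<^sub>R z) * k z))"
 proof (rule lint_cong[OF refl])
  fix z :: "real^'n"
  show "(LBINT x. f x * g (x + (- 1) *\<^sub>R z) * k z) = (LBINT x. g x * f (x + 1 *\<^sub>R z) * k z)"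
   using integral_lborel_translate[of "%x. f x * g (x + (- 1) *\<^sub>R z) * k z" z] by (simp add: mult_ac)
 qed
 also have "... = (LBINT x. (LBINT z. g x * f (x + 1 *\<^sub>R z) * k z))"
  by (rule lborel_pair.Fubini_integral[OF i2, symmetric])
 also have "... = (LBINT x. g x * conv f k x)"
 proof (rule lint_cong[OF refl])
  fix x :: "real^'n"
  have "(LBINT z. f (x + z) * k z) = conv f k x"
   using integral_lborel_reflect[of "%z. f (x + z) * k z" 0] by (simp add: conv_def even)
  then show "(LBINT z. g x * f (x + 1 *\<^sub>R z) * k z) = g x * conv f k x"
   by (simp add: mult.assoc)
 qed
 finally show ?thesis .
qed

lemma L_trunc_symmetric:
 fixes f g :: "real^'n => real"
 assumes a: "0 < \<alpha>" "0 < dl" and f: "f \<in> Cc_k n" and g: "g \<in> Cc_k n"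
 shows "(LBINT x. f x * L_trunc \<alpha> c dl g x) = (LBINT x. g x * L_trunc \<alpha> c dl f x)"
proof -
 let ?k = "trunc_kernel \<alpha> dl :: real^'n => real"
 have i: "integrable lborel (%x. f x * conv g ?k x)" "integrable lborel (%x. f x * g x)" "integrable lborel (%x. g x * conv f ?k x)"
  using f g L_trunc_Cc(1)[OF a f] L_trunc_Cc(1)[OF a g] by (auto intro!: L2_prod_integrable Cc_k_L2)
 have "(LBINT x. f x * L_trunc \<alpha> c dl g x) = c * ((LBINT x. f x * conv g ?k x) - trunc_mass TYPE('n) \<alpha> dl * (LBINT x. f x * g x))"
 proof -
  have "(LBINT x. f x * L_trunc \<alpha> c dl g x) = (LBINT x. c * (f x * conv g ?k x - trunc_mass TYPE('n) \<alpha> dl * (f x * g x)))"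
   by (intro lint_cong) (auto simp: L_trunc_def algebra_simps)
  then show ?thesis using i by simp
 qed
 moreover have "(LBINT x. g x * L_trunc \<alpha> c dl f x) = c * ((LBINT x. g x * conv f ?k x) - trunc_mass TYPE('n) \<alpha> dl * (LBINT x. f x * g x))"
 proof -
  have "(LBINT x. g x * L_trunc \<alpha> c dl f x) = (LBINT x. c * (g x * conv f ?k x - trunc_mass TYPE('n) \<alpha> dl * (f x * g x)))"
   by (intro lint_cong) (auto simp: L_trunc_def algebra_simps)
  then show ?thesis using i by simp
 qed
 ultimately show ?thesis using conv_self_adjoint[OF f g trunc_kernel_Cc[OF a]] by simp
qed

lemma L_trunc_nonpos:
 fixes g :: "real^'n => real"
 assumes a: "0 < \<alpha>" "0 < dl" and c: "0 <= c" and g: "g \<in> Cc_k n"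
 shows "(LBINT x. g x * L_trunc \<alpha> c dl g x) <= 0"
proof -
 let ?k = "trunc_kernel \<alpha> dl :: real^'n => real" and ?m = "trunc_mass TYPE('n) \<alpha> dl"
 have gL: "g \<in> L2s" "conv g ?k \<in> L2s" by (rule Cc_k_L2[OF g], rule Cc_k_L2[OF L_trunc_Cc(1)[OF a g]])
 have "(LBINT x. g x * L_trunc \<alpha> c dl g x) = (LBINT x. c * (g x * conv g ?k x - ?m * (g x)^2))"
  by (intro lint_cong) (auto simp: L_trunc_def algebra_simps power2_eq_square)
 also have "... = c * ((LBINT x. g x * conv g ?k x) - ?m * (L2n g)^2)"
  using L2_prod_integrable[OF gL] L2_spaceD(2)[OF gL(1)] by (simp add: L2_norm_square)
 also have "(LBINT x. g x * conv g ?k x) <= L2n g * (?m * L2n g)"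
  using L2_Cauchy_Schwarz[OF gL] mult_left_mono[OF conv_trunc_L2[OF a gL(1)] L2_norm_nonneg[of lborel g]] by linarith
 then have "c * ((LBINT x. g x * conv g ?k x) - ?m * (L2n g)^2) <= c * 0"
  using c by (intro mult_left_mono) (auto simp: power2_eq_square mult_ac)
 finally show ?thesis by simp
qed

lemma L_bar_inner_approx:
 fixes f g :: "real^'n => real"
 assumes a: "0 < \<alpha>" "\<alpha> < 2" and dl: "0 < dl" and f: "f \<in> L2s" and g: "g \<in> Cc_k 2"
  and e: "L2n (%x. L_bar \<alpha> c g x - L_trunc \<alpha> c dl g x) <= e"
 shows "\<bar>(LBINT x. f x * L_bar \<alpha> c g x) - (LBINT x. f x * L_trunc \<alpha> c dl g x)\<bar> <= L2n f * e"
proof -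
 have L: "L_bar \<alpha> c g \<in> L2s" "L_trunc \<alpha> c dl g \<in> L2s"
  by (rule L_bar_L2[OF a g], rule Cc_k_L2[OF L_trunc_Cc(2)[OF a(1) dl g]])
 have "(LBINT x. f x * L_bar \<alpha> c g x) - (LBINT x. f x * L_trunc \<alpha> c dl g x)
   = (LBINT x. f x * (L_bar \<alpha> c g x - L_trunc \<alpha> c dl g x))"
  using L2_prod_integrable[OF f L(1)] L2_prod_integrable[OF f L(2)] by (simp add: right_diff_distrib)
 also have "\<bar>...\<bar> <= L2n f * L2n (%x. L_bar \<alpha> c g x - L_trunc \<alpha> c dl g x)"
  by (rule L2_Cauchy_Schwarz[OF f L2_diff[OF L]])
 also have "... <= L2n f * e" by (intro mult_left_mono e) auto
 finally show ?thesis .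
qed

lemma L_trunc_tendsto_L_bar_pair:
 fixes f g :: "real^'n => real"
 assumes a: "0 < \<alpha>" "\<alpha> < 2" and f: "f \<in> Cc_k 2" and g: "g \<in> Cc_k 2" and e: "0 < e"
 obtains dl where "0 < dl" "L2n (%x. L_bar \<alpha> c f x - L_trunc \<alpha> c dl f x) <= e"
  "L2n (%x. L_bar \<alpha> c g x - L_trunc \<alpha> c dl g x) <= e"
proof -
 obtain s where s: "0 < s" "!!dl. 0 < dl ==> rem_mass TYPE('n) \<alpha> dl < s ==> L2n (%x. L_bar \<alpha> c f x - L_trunc \<alpha> c dl f x) <= e"
  by (rule L_trunc_tendsto_L_bar[OF a f e, where c=c]) (rule that)
 obtain t where t: "0 < t" "!!dl. 0 < dl ==> rem_mass TYPE('n) \<alpha> dl < t ==> L2n (%x. L_bar \<alpha> c g x - L_trunc \<alpha> c dl g x) <= e"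
  by (rule L_trunc_tendsto_L_bar[OF a g e, where c=c]) (rule that)
 obtain dl where "0 < dl" "rem_mass TYPE('n) \<alpha> dl < min s t" using rem_mass_small[OF a, of "min s t", where 'n='n] s t by auto
 then show thesis using s t by (intro that[of dl]) auto
qed

lemma L_bar_symmetric:
 fixes f g :: "real^'n => real"
 assumes a: "0 < \<alpha>" "\<alpha> < 2" and f: "f \<in> Cc_k 2" and g: "g \<in> Cc_k 2"
 shows "(LBINT x. f x * L_bar \<alpha> c g x) = (LBINT x. g x * L_bar \<alpha> c f x)"
proof -
 have "\<bar>(LBINT x. f x * L_bar \<alpha> c g x) - (LBINT x. g x * L_bar \<alpha> c f x)\<bar> <= 0"
 proof (rule field_le_epsilon)
  fix e :: real assume e: "0 < e"
  define e' where "e' = e / (L2n f + L2n g + 1)"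
  have p: "0 < L2n f + L2n g + 1" by (simp add: add_nonneg_pos)
  have e': "0 < e'" "(L2n f + L2n g) * e' <= e"
  proof -
   show "0 < e'" using e p by (simp add: e'_def)
   have "(L2n f + L2n g) * e' <= (L2n f + L2n g + 1) * e'"
    using \<open>0 < e'\<close> by (intro mult_right_mono) auto
   also have "... = e" using p by (simp add: e'_def)
   finally show "(L2n f + L2n g) * e' <= e" .
  qed
  obtain dl where dl: "0 < dl" "L2n (%x. L_bar \<alpha> c f x - L_trunc \<alpha> c dl f x) <= e'"
   "L2n (%x. L_bar \<alpha> c g x - L_trunc \<alpha> c dl g x) <= e'"
   by (rule L_trunc_tendsto_L_bar_pair[OF a f g e'(1), where c=c]) (rule that)
  have "\<bar>(LBINT x. f x * L_bar \<alpha> c g x) - (LBINT x. f x * L_trunc \<alpha> c dl g x)\<bar> <= L2n f * e'"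
   by (rule L_bar_inner_approx[OF a dl(1) Cc_k_L2[OF f] g dl(3)])
  moreover have "\<bar>(LBINT x. g x * L_bar \<alpha> c f x) - (LBINT x. g x * L_trunc \<alpha> c dl f x)\<bar> <= L2n g * e'"
   by (rule L_bar_inner_approx[OF a dl(1) Cc_k_L2[OF g] f dl(2)])
  ultimately show "\<bar>(LBINT x. f x * L_bar \<alpha> c g x) - (LBINT x. g x * L_bar \<alpha> c f x)\<bar> <= 0 + e"
   using L_trunc_symmetric[OF a(1) dl(1) f g, of c] e'(2) unfolding distrib_right by linarith
 qed
 then show ?thesis by simp
qed

lemma L_bar_nonpos:
 fixes g :: "real^'n => real"
 assumes a: "0 < \<alpha>" "\<alpha> < 2" and c: "0 <= c" and g: "g \<in> Cc_k 2"
 shows "(LBINT x. g x * L_bar \<alpha> c g x) <= 0"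
proof (rule field_le_epsilon)
 fix e :: real assume e: "0 < e"
 have p: "0 < L2n g + 1" by (simp add: add_nonneg_pos)
 have e': "0 < e / (L2n g + 1)" using e p by simp
 obtain dl where dl: "0 < dl" "L2n (%x. L_bar \<alpha> c g x - L_trunc \<alpha> c dl g x) <= e / (L2n g + 1)"
  by (rule L_trunc_tendsto_L_bar_pair[OF a g g e', where c=c]) (rule that)
 have "(LBINT x. g x * L_bar \<alpha> c g x) <= L2n g * (e / (L2n g + 1))"
  using L_bar_inner_approx[OF a dl(1) Cc_k_L2[OF g] g dl(2)] L_trunc_nonpos[OF a(1) dl(1) c g] by linarith
 also have "... <= (L2n g + 1) * (e / (L2n g + 1))" using e' by (intro mult_right_mono) auto
 also have "... = e" using p by simp
 finally show "(LBINT x. g x * L_bar \<alpha> c g x) <= 0 + e" by simp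
qed

text \<open>
 Pairing \<open>lam * g - L_bar g\<close> with \<open>g\<close> and dropping the nonpositive term \<open>\<integral> g (L_bar g)\<close>.
\<close>

lemma resolvent_contraction:
 fixes g :: "real^'n => real"
 assumes a: "0 < \<alpha>" "\<alpha> < 2" and c: "0 <= c" and lam: "0 < lam" and g: "g \<in> Cc_k 2"
 shows "lam * L2n g <= L2n (%x. lam * g x - L_bar \<alpha> c g x)"
proof -
 have gL: "g \<in> L2s" and L: "L_bar \<alpha> c g \<in> L2s" by (rule Cc_k_L2[OF g], rule L_bar_L2[OF a g])
 have F: "(%x. lam * g x - L_bar \<alpha> c g x) \<in> L2s" by (intro L2_diff L2_cmult gL L)
 have "lam * (L2n g)^2 <= lam * (LBINT x. (g x)^2) - (LBINT x. g x * L_bar \<alpha> c g x)"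
  using L_bar_nonpos[OF a c g] by (simp add: L2_norm_square)
 also have "... = (LBINT x. lam * (g x)^2 - g x * L_bar \<alpha> c g x)"
  using L2_spaceD(2)[OF gL] L2_prod_integrable[OF gL L] by simp
 also have "... = (LBINT x. g x * (lam * g x - L_bar \<alpha> c g x))"
  by (intro lint_cong) (auto simp: power2_eq_square algebra_simps)
 also have "... <= L2n g * L2n (%x. lam * g x - L_bar \<alpha> c g x)"
  using L2_Cauchy_Schwarz[OF gL F] by linarith
 finally have *: "L2n g * (lam * L2n g) <= L2n g * L2n (%x. lam * g x - L_bar \<alpha> c g x)"
  by (simp add: power2_eq_square mult_ac)
 show ?thesis
 proof (cases "L2n g = 0")
  case False
  then have "0 < L2n g" using L2_norm_nonneg[of lborel g] by linarith
  then show ?thesis using * by (simp add: mult_le_cancel_left)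
 qed simp
qed

lemma L_bar_diff:
 fixes f g :: "real^'n => real"
 assumes a: "0 < \<alpha>" "\<alpha> < 2" and f: "f \<in> Cc_k 2" and g: "g \<in> Cc_k 2"
 shows "L_bar \<alpha> c (%x. f x - g x) x = L_bar \<alpha> c f x - L_bar \<alpha> c g x" "(%x. f x - g x) \<in> Cc_k 2"
proof -
 show fg: "(%x. f x - g x) \<in> Cc_k 2" using Cc_k_add[OF f Cc_k_cmult[OF g, of "- 1"]] by simp
 have i: "integrable lborel (%z. sdiff h x z * frac_kernel \<alpha> z)" if "h \<in> Cc_k 2" for h :: "real^'n => real"
  by (rule sdiff_kernel_integrable[OF a that, of _ 1]) auto
 have "(LBINT z. sdiff (%x. f x - g x) x z * frac_kernel \<alpha> z)
   = (LBINT z. sdiff f x z * frac_kernel \<alpha> z - sdiff g x z * frac_kernel \<alpha> z)"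
  by (intro lint_cong) (auto simp: sdiff_def algebra_simps)
 also have "... = (LBINT z. sdiff f x z * frac_kernel \<alpha> z) - (LBINT z. sdiff g x z * frac_kernel \<alpha> z)"
  using i[OF f] i[OF g] by simp
 finally show "L_bar \<alpha> c (%x. f x - g x) x = L_bar \<alpha> c f x - L_bar \<alpha> c g x"
  unfolding L_bar_eq[OF a fg] L_bar_eq[OF a f] L_bar_eq[OF a g] by (simp add: right_diff_distrib)
qed

text \<open>
 Testing against smoothed versions of clamped continuous functions that converge to \<open>w\<close> almost everywhere yields
 \<open>\<integral> min(|w|, w\<^sup>2) = 0\<close> on every ball.
\<close>

lemma L2_orthogonal_Cc_2_imp_zero:
 fixes w :: "real^'n => real"
 assumes w: "w \<in> L2s" and orth: "!!\<psi>. \<psi> \<in> Cc_k 2 ==> (LBINT x. w x * \<psi> x) = 0"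
 shows "AE x in lborel. w x = 0"
proof -
 have [measurable]: "w \<in> borel_fun" using L2_spaceD(1)[OF w] by simp
 have orth0: "(LBINT x. w x * \<phi> x) = 0" if \<phi>: "\<phi> \<in> Cc_k 0" for \<phi>
 proof -
  have "\<bar>LBINT x. w x * \<phi> x\<bar> <= L2n w * e" if e: "0 < e" for e
  proof -
   obtain d where d: "0 < d" "!!dl. 0 < dl ==> dl < d ==> L2n (%x. conv (mol dl) \<phi> x - \<phi> x) <= e"
    using mollification_Cc[OF \<phi> e] by metis
   let ?\<psi> = "conv (mol (d / 2)) \<phi>"
   obtain R where R: "!!x. R < norm x ==> \<phi> x = 0" using Cc_k_support[OF \<phi>] by metis
   have \<psi>: "?\<psi> \<in> Cc_k 2" using d by (intro conv_Cc_k[OF mol_Cc loc_int_L2[OF Cc_k_L2[OF \<phi>]] R]) auto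
   have L: "?\<psi> \<in> L2s" "\<phi> \<in> L2s" by (rule Cc_k_L2[OF \<psi>], rule Cc_k_L2[OF \<phi>])
   have "(LBINT x. w x * \<phi> x) = - (LBINT x. w x * (?\<psi> x - \<phi> x))"
    using L2_prod_integrable[OF w L(1)] L2_prod_integrable[OF w L(2)] orth[OF \<psi>] by (simp add: right_diff_distrib)
   then have "\<bar>LBINT x. w x * \<phi> x\<bar> <= L2n w * L2n (%x. ?\<psi> x - \<phi> x)"
    using L2_Cauchy_Schwarz[OF w L2_diff[OF L]] by simp
   also have "... <= L2n w * e" using d by (intro mult_left_mono) auto
   finally show ?thesis .
  qed
  note b = this
  have "\<bar>LBINT x. w x * \<phi> x\<bar> <= 0"
  proof (rule field_le_epsilon)
   fix e :: real assume e: "0 < e"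
   have p: "0 < L2n w + 1" by (simp add: add_nonneg_pos)
   have "\<bar>LBINT x. w x * \<phi> x\<bar> <= L2n w * (e / (L2n w + 1))" using e p by (intro b) auto
   also have "... <= (L2n w + 1) * (e / (L2n w + 1))" using e p by (intro mult_right_mono) auto
   also have "... = e" using p by simp
   finally show "\<bar>LBINT x. w x * \<phi> x\<bar> <= 0 + e" by simp
  qed
  then show ?thesis by simp
 qed
 have "w measurable_on UNIV"
  by (intro lebesgue_measurable_imp_measurable_on) (auto simp: lebesgue_on_UNIV_eq intro: borel_measurable_if_I measurable_completion)
 then obtain N h where N: "negligible N" and h: "!!n. continuous_on UNIV (h n)" and lim: "!!x. x \<notin> N ==> (%n. h n x) \<longlonglongrightarrow> w x"
  by (auto simp: measurable_on_def)
 define cl where "cl = (%t::real. max (- 1) (min 1 t))"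
 have clc: "continuous_on UNIV cl" unfolding cl_def by (intro continuous_intros)
 have [measurable]: "h n \<in> borel_fun" for n by (rule borel_measurable_continuous_onI[OF h])
 have [measurable]: "cl \<in> borel_fun" by (rule borel_measurable_continuous_onI[OF clc])
 have cl1: "\<bar>cl t\<bar> <= 1" for t by (auto simp: cl_def)
 define cut where "cut = (%k::nat. %x::real^'n. max 0 (min 1 (real k + 1 - norm x)))"
 have [measurable]: "cut k \<in> borel_fun" for k unfolding cut_def by measurable
 have AEN: "AE x in lborel. x \<notin> N"
 proof -
  have "AE x in lebesgue. x \<notin> N" using N by (intro AE_not_in) (simp add: negligible_iff_null_sets)
  then show ?thesis by (simp add: AE_completion_iff)
 qed
 have "AE x in lborel. cut k x * (w x * cl (w x)) = 0" for k
 proof -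
  have C: "(%x. cl (h n x) * cut k x) \<in> Cc_k 0" for n
  proof (rule Cc_k_I[of _ _ "real k + 1"])
   have "continuous_on UNIV (%x. cl (h n x))" using continuous_on_compose2[OF clc h] by simp
   moreover have "continuous_on UNIV (cut k)" unfolding cut_def by (intro continuous_intros)
   ultimately show "C_k 0 (%x. cl (h n x) * cut k x)" by (auto intro: continuous_on_mult)
  qed (simp add: cut_def)
  have "(%n. LBINT x. w x * (cl (h n x) * cut k x)) \<longlonglongrightarrow> (LBINT x. w x * (cl (w x) * cut k x))"
  proof (rule integral_dominated_convergence)
   show "integrable lborel (%x. \<bar>w x\<bar> * indicator (cball 0 (real k + 1)) x)" by (rule loc_int_abs_integral[OF loc_int_L2[OF w]])
   show "AE x in lborel. (%n. w x * (cl (h n x) * cut k x)) \<longlonglongrightarrow> w x * (cl (w x) * cut k x)"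
    using AEN
   proof eventually_elim
    case (elim x)
    have "isCont cl (w x)" using clc continuous_on_eq_continuous_at by blast
    then have "(%n. cl (h n x)) \<longlonglongrightarrow> cl (w x)" by (rule isCont_tendsto_compose[OF _ lim[OF elim]])
    then show ?case by (intro tendsto_intros)
   qed
   fix n
   show "AE x in lborel. norm (w x * (cl (h n x) * cut k x)) <= \<bar>w x\<bar> * indicator (cball 0 (real k + 1)) x"
   proof (intro AE_I2)
    fix x :: "real^'n"
    have "\<bar>cl (h n x)\<bar> * \<bar>cut k x\<bar> <= 1 * indicator (cball 0 (real k + 1)) x"
     by (intro mult_mono cl1) (auto simp: cut_def indicator_def)
    then have "\<bar>w x\<bar> * (\<bar>cl (h n x)\<bar> * \<bar>cut k x\<bar>) <= \<bar>w x\<bar> * (1 * indicator (cball 0 (real k + 1)) x)" by (intro mult_left_mono) auto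
    then show "norm (w x * (cl (h n x) * cut k x)) <= \<bar>w x\<bar> * indicator (cball 0 (real k + 1)) x" by (simp add: abs_mult)
   qed
  qed measurable
  then have "(LBINT x. w x * (cl (w x) * cut k x)) = 0" unfolding orth0[OF C] by (simp add: LIMSEQ_const_iff)
  then have z: "(LBINT x. cut k x * (w x * cl (w x))) = 0" by (simp add: mult_ac)
  have nn: "0 <= cut k x * (w x * cl (w x))" for x by (auto simp: cut_def cl_def zero_le_mult_iff max_def min_def)
  have "integrable lborel (%x. cut k x * (w x * cl (w x)))"
  proof (rule lint_bound[OF loc_int_abs_integral[OF loc_int_L2[OF w], of "real k + 1"]])
   show "AE x in lborel. norm (cut k x * (w x * cl (w x))) <= norm (\<bar>w x\<bar> * indicator (cball 0 (real k + 1)) x)"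
   proof (intro AE_I2)
    fix x :: "real^'n"
    have "\<bar>cl (w x)\<bar> * \<bar>cut k x\<bar> <= 1 * indicator (cball 0 (real k + 1)) x"
     by (intro mult_mono cl1) (auto simp: cut_def indicator_def)
    then have "\<bar>w x\<bar> * (\<bar>cl (w x)\<bar> * \<bar>cut k x\<bar>) <= \<bar>w x\<bar> * (1 * indicator (cball 0 (real k + 1)) x)" by (intro mult_left_mono) auto
    then show "norm (cut k x * (w x * cl (w x))) <= norm (\<bar>w x\<bar> * indicator (cball 0 (real k + 1)) x)" by (simp add: abs_mult mult_ac)
   qed
  qed measurable
  then show ?thesis using z nn by (subst (asm) integral_nonneg_eq_0_iff_AE) auto
 qed
 then have "AE x in lborel. \<forall>k. cut k x * (w x * cl (w x)) = 0" by (subst AE_all_countable) blast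
 then show ?thesis
 proof eventually_elim
  case (elim x)
  obtain k :: nat where "norm x <= real k" using real_arch_simple by blast
  then have "cut k x = 1" by (simp add: cut_def)
  then have "w x * cl (w x) = 0" using elim[rule_format, of k] by simp
  then show ?case by (auto simp: cl_def max_def min_def split: if_splits)
 qed
qed

text \<open>
 The difference of two solutions is orthogonal to the range of \<open>lam - L_bar\<close>, which is dense.
\<close>

theorem weak_solution_unique:
 fixes f :: "real^'n => real"
 assumes a: "0 < \<alpha>" "\<alpha> < 2" and c: "0 <= c" and lam: "0 < lam"
  and u: "weak_solution \<alpha> c lam f u" and w: "weak_solution \<alpha> c lam f w"
 shows "AE x in lborel. u x = w x"
proof -
 let ?d = "%x. u x - w x"
 have uL: "u \<in> L2s" and wL: "w \<in> L2s" using u w by (auto simp: weak_solution_def)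
 have d: "?d \<in> L2s" by (intro L2_diff uL wL)
 have res: "(LBINT x. ?d x * (lam * g x - L_bar \<alpha> c g x)) = 0" if g: "g \<in> Cc_k 2" for g
 proof -
  have gL: "g \<in> L2s" "L_bar \<alpha> c g \<in> L2s" by (rule Cc_k_L2[OF g], rule L_bar_L2[OF a g])
  note i = L2_prod_integrable[OF uL gL(1)] L2_prod_integrable[OF uL gL(2)] L2_prod_integrable[OF wL gL(1)] L2_prod_integrable[OF wL gL(2)]
  have "(LBINT x. ?d x * (lam * g x - L_bar \<alpha> c g x))
    = (LBINT x. (lam * (u x * g x) - u x * L_bar \<alpha> c g x) - (lam * (w x * g x) - w x * L_bar \<alpha> c g x))"
   by (intro lint_cong) (auto simp: algebra_simps)
  also have "... = (lam * (LBINT x. u x * g x) - (LBINT x. u x * L_bar \<alpha> c g x)) - (lam * (LBINT x. w x * g x) - (LBINT x. w x * L_bar \<alpha> c g x))"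
   using i by simp
  also have "... = 0" using u w g by (simp add: weak_solution_def)
  finally show ?thesis .
 qed
 have "AE x in lborel. ?d x = 0"
 proof (rule L2_orthogonal_Cc_2_imp_zero[OF d])
  fix \<psi> :: "real^'n => real" assume \<psi>: "\<psi> \<in> Cc_k 2"
  have "\<bar>LBINT x. ?d x * \<psi> x\<bar> <= 0"
  proof (rule field_le_epsilon)
   fix e :: real assume e: "0 < e"
   have p: "0 < L2n ?d + 1" by (simp add: add_nonneg_pos)
   have e': "0 < e / (L2n ?d + 1)" using e p by simp
   obtain g where g: "g \<in> Cc_k 2" "L2n (%x. lam * g x - L_bar \<alpha> c g x - \<psi> x) <= e / (L2n ?d + 1)"
    by (rule resolvent_range_dense[OF a lam c \<psi> e']) (rule that)
   have L: "(%x. lam * g x - L_bar \<alpha> c g x) \<in> L2s" "\<psi> \<in> L2s"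
    by (intro L2_diff L2_cmult Cc_k_L2[OF g(1)] L_bar_L2[OF a g(1)], rule Cc_k_L2[OF \<psi>])
   have "(LBINT x. ?d x * (lam * g x - L_bar \<alpha> c g x - \<psi> x)) = (LBINT x. ?d x * (lam * g x - L_bar \<alpha> c g x)) - (LBINT x. ?d x * \<psi> x)"
    using lint_diff[OF L2_prod_integrable[OF d L(1)] L2_prod_integrable[OF d L(2)]]
    by (simp only: right_diff_distrib[of "?d _" "lam * g _ - L_bar \<alpha> c g _"])
   then have "\<bar>LBINT x. ?d x * \<psi> x\<bar> <= L2n ?d * L2n (%x. lam * g x - L_bar \<alpha> c g x - \<psi> x)"
    using L2_Cauchy_Schwarz[OF d L2_diff[OF L]] unfolding res[OF g(1)] by simp
   also have "... <= L2n ?d * (e / (L2n ?d + 1))" using g by (intro mult_left_mono) auto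
   also have "... <= (L2n ?d + 1) * (e / (L2n ?d + 1))" using e' by (intro mult_right_mono) auto
   also have "... = e" using p by simp
   finally show "\<bar>LBINT x. ?d x * \<psi> x\<bar> <= 0 + e" by simp
  qed
  then show "(LBINT x. ?d x * \<psi> x) = 0" by simp
 qed
 then show ?thesis by eventually_elim simp
qed

text \<open>
 The functions \<open>g n\<close> for which \<open>lam * g n - L_bar (g n)\<close> approximates \<open>f\<close> form a Cauchy sequence by the resolvent estimate, and
 symmetry of \<open>L_bar\<close> moves the operator onto the test function in the limit. The convergence of the mollifications
 is inherited from the \<open>g n\<close>, since mollifying does not increase the norm.
\<close>

theorem weak_solution_exists:
 fixes f :: "real^'n => real"
 assumes a: "0 < \<alpha>" "\<alpha> < 2" and c: "0 <= c" and lam: "0 < lam" and f: "f \<in> Cc_k k"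
 obtains u where "weak_solution \<alpha> c lam f u"
  "!!e. 0 < e ==> \<exists>d>0. \<forall>dl. 0 < dl \<and> dl < d \<longrightarrow> L2n (%x. conv (mol dl) u x - u x) <= e"
proof -
 have fL: "f \<in> L2s" by (rule Cc_k_L2[OF f])
 have "\<exists>g. g \<in> Cc_k 2 \<and> L2n (%x. lam * g x - L_bar \<alpha> c g x - f x) <= 2 * e" if e: "0 < e" for e
 proof -
  obtain d where d: "0 < d" "!!dl. 0 < dl ==> dl < d ==> L2n (%x. conv (mol dl) f x - f x) <= e"
   using mollification_Cc[OF f e] by metis
  let ?\<psi> = "conv (mol (d / 2)) f"
  obtain R where R: "!!x. R < norm x ==> f x = 0" using Cc_k_support[OF f] by metis
  have \<psi>: "?\<psi> \<in> Cc_k 2" using d by (intro conv_Cc_k[OF mol_Cc loc_int_L2[OF fL] R]) auto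
  obtain g where g: "g \<in> Cc_k 2" "L2n (%x. lam * g x - L_bar \<alpha> c g x - ?\<psi> x) <= e"
   by (rule resolvent_range_dense[OF a lam c \<psi> e]) (rule that)
  have "L2n (%x. lam * g x - L_bar \<alpha> c g x - f x)
    <= L2n (%x. lam * g x - L_bar \<alpha> c g x - ?\<psi> x) + L2n (%x. ?\<psi> x - f x)"
   by (intro L2_norm_triangle_diff L2_diff L2_cmult Cc_k_L2[OF g(1)] L_bar_L2[OF a g(1)] Cc_k_L2[OF \<psi>] fL)
  also have "... <= e + e" using d g by (intro add_mono) auto
  finally show ?thesis using g(1) by (intro exI[of _ g]) auto
 qed
 from this[of "1 / real (Suc _)"]
 have "\<forall>n. \<exists>g. g \<in> Cc_k 2 \<and> L2n (%x. lam * g x - L_bar \<alpha> c g x - f x) <= 2 * (1 / real (Suc n))" by simp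
 from choice[OF this] obtain g where g: "!!n. g n \<in> Cc_k 2"
  "!!n. L2n (%x. lam * g n x - L_bar \<alpha> c (g n) x - f x) <= 2 * (1 / real (Suc n))" by blast
 define F where "F = (%n x. lam * g n x - L_bar \<alpha> c (g n) x)"
 have gL: "g n \<in> L2s" for n by (rule Cc_k_L2[OF g(1)])
 have FL: "F n \<in> L2s" for n unfolding F_def by (intro L2_diff L2_cmult gL L_bar_L2[OF a g(1)])
 have Fb: "L2n (%x. F n x - f x) <= 2 * (1 / real (Suc n))" for n using g(2)[of n] by (simp add: F_def)
 have lim0: "(%n. 2 * (1 / real (Suc n))) \<longlonglongrightarrow> 0" by (intro tendsto_mult_right_zero LIMSEQ_Suc[OF lim_const_over_n])
 have Flim: "(%n. L2n (%x. F n x - f x)) \<longlonglongrightarrow> 0"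
  by (rule tendsto_sandwich[OF _ _ tendsto_const lim0]) (use Fb in auto)
 have diff: "lam * L2n (%x. g m x - g n x) <= 2 * (1 / real (Suc m)) + 2 * (1 / real (Suc n))" for m n
 proof -
  have "lam * L2n (%x. g m x - g n x) <= L2n (%x. lam * (g m x - g n x) - L_bar \<alpha> c (%x. g m x - g n x) x)"
   by (rule resolvent_contraction[OF a c lam L_bar_diff(2)[OF a g(1) g(1)]])
  also have "(%x. lam * (g m x - g n x) - L_bar \<alpha> c (%x. g m x - g n x) x) = (%x. F m x - F n x)"
   by (auto simp: L_bar_diff(1)[OF a g(1) g(1)] F_def algebra_simps)
  also have "L2n (%x. F m x - F n x) <= L2n (%x. F m x - f x) + L2n (%x. f x - F n x)"
   by (intro L2_norm_triangle_diff FL fL)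
  also have "... <= 2 * (1 / real (Suc m)) + 2 * (1 / real (Suc n))"
   using Fb[of m] Fb[of n] by (subst (2) L2_norm_minus_commute) linarith
  finally show ?thesis .
 qed
 obtain u where u: "u \<in> L2s" "(%n. L2n (%x. g n x - u x)) \<longlonglongrightarrow> 0"
 proof (rule L2_complete[of g lborel])
  fix e :: real assume e: "0 < e"
  have "\<forall>\<^sub>F n in sequentially. 2 * (1 / real (Suc n)) < lam * e / 2" using e lam by (intro order_tendstoD[OF lim0]) auto
  then obtain N where N: "!!n. n \<ge> N ==> 2 * (1 / real (Suc n)) < lam * e / 2" by (auto simp: eventually_sequentially)
  have "L2n (%x. g m x - g n x) < e" if "m \<ge> N" "n \<ge> N" for m n
  proof -
   have "lam * L2n (%x. g m x - g n x) < lam * e" using diff[of m n] N[OF that(1)] N[OF that(2)] by linarith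
   then show ?thesis using lam by simp
  qed
  then show "\<exists>N. \<forall>m\<ge>N. \<forall>n\<ge>N. L2n (%x. g m x - g n x) < e" by blast
 qed (use gL that in auto)
 show thesis
 proof (rule that[of u])
  show "weak_solution \<alpha> c lam f u"
   unfolding weak_solution_def
  proof (intro conjI ballI u(1))
   fix h :: "real^'n => real" assume h: "h \<in> Cc_k 2"
   have hL: "h \<in> L2s" "L_bar \<alpha> c h \<in> L2s" by (rule Cc_k_L2[OF h], rule L_bar_L2[OF a h])
   have "(%n. lam * (LBINT x. g n x * h x) - (LBINT x. g n x * L_bar \<alpha> c h x)) \<longlonglongrightarrow> lam * (LBINT x. u x * h x) - (LBINT x. u x * L_bar \<alpha> c h x)"
    by (intro tendsto_diff tendsto_mult tendsto_const L2_inner_tendsto[OF gL u] hL)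
   moreover have "lam * (LBINT x. g n x * h x) - (LBINT x. g n x * L_bar \<alpha> c h x) = (LBINT x. F n x * h x)" for n
   proof -
    have LL: "L_bar \<alpha> c (g n) \<in> L2s" by (rule L_bar_L2[OF a g(1)])
    have "(LBINT x. F n x * h x) = (LBINT x. lam * (g n x * h x) - h x * L_bar \<alpha> c (g n) x)"
     by (intro lint_cong) (auto simp: F_def algebra_simps)
    also have "... = lam * (LBINT x. g n x * h x) - (LBINT x. h x * L_bar \<alpha> c (g n) x)"
     using L2_prod_integrable[OF gL hL(1)] L2_prod_integrable[OF hL(1) LL] by simp
    finally show ?thesis using L_bar_symmetric[OF a h g(1), of c n] by simp
   qed
   moreover have "(%n. LBINT x. F n x * h x) \<longlonglongrightarrow> (LBINT x. f x * h x)"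
    by (rule L2_inner_tendsto[OF FL fL Flim hL(1)])
   ultimately show "lam * (LBINT x. u x * h x) - (LBINT x. u x * L_bar \<alpha> c h x) = (LBINT x. f x * h x)"
    by (simp add: LIMSEQ_unique)
  qed
  fix e :: real assume e: "0 < e"
  have "\<forall>\<^sub>F n in sequentially. L2n (%x. g n x - u x) < e / 3" using e by (intro order_tendstoD[OF u(2)]) auto
  then obtain n where n: "L2n (%x. g n x - u x) < e / 3" by (auto simp: eventually_sequentially)
  have e3: "0 < e / 3" using e by simp
  obtain d where d: "0 < d" "!!dl. 0 < dl ==> dl < d ==> L2n (%x. conv (mol dl) (g n) x - g n x) <= e / 3"
   using mollification_Cc[OF g(1)[of n] e3] by metis
  show "\<exists>d>0. \<forall>dl. 0 < dl \<and> dl < d \<longrightarrow> L2n (%x. conv (mol dl) u x - u x) <= e"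
  proof (intro exI[of _ d] conjI allI impI d(1))
   fix dl assume dl: "0 < dl \<and> dl < d"
   note m = mol_Cc[of dl, where 'n='n]
   have L: "conv (mol dl) u \<in> L2s" "conv (mol dl) (g n) \<in> L2s" using dl conv_mol_L2(1)[OF u(1)] conv_mol_L2(1)[OF gL] by auto
   have "conv (mol dl) u x - conv (mol dl) (g n) x = conv (mol dl) (%x. u x - g n x) x" for x
    using conv_integrable[OF m loc_int_L2[OF u(1)], of x] conv_integrable[OF m loc_int_L2[OF gL[of n]], of x] dl by (simp add: conv_def right_diff_distrib)
   then have "L2n (%x. conv (mol dl) u x - conv (mol dl) (g n) x) <= L2n (%x. u x - g n x)"
    using conv_mol_L2(2)[OF L2_diff[OF u(1) gL[of n]], of dl] dl by simp
   then have "L2n (%x. conv (mol dl) u x - conv (mol dl) (g n) x) <= e / 3" using n by (simp add: L2_norm_minus_commute[of _ u])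
   moreover have "L2n (%x. conv (mol dl) u x - u x) <= L2n (%x. conv (mol dl) u x - conv (mol dl) (g n) x) + L2n (%x. conv (mol dl) (g n) x - u x)"
    by (intro L2_norm_triangle_diff L u)
   moreover have "L2n (%x. conv (mol dl) (g n) x - u x) <= L2n (%x. conv (mol dl) (g n) x - g n x) + L2n (%x. g n x - u x)"
    by (intro L2_norm_triangle_diff L u gL)
   ultimately show "L2n (%x. conv (mol dl) u x - u x) <= e" using n d(2)[of dl] dl by linarith
  qed
 qed
qed

section \<open>The drift term\<close>

lemma AE_lborel_scale:
 fixes P :: "'a::euclidean_space => bool"
 assumes "AE x in lborel. P x" "0 < eps"
 shows "AE x in lborel. P (x /\<^sub>R eps)"
proof -
 obtain N where N: "{x\<in>space lborel. \<not> P x} \<subseteq> N" "N \<in> null_sets lborel"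
  using assms(1) by (auto simp: eventually_ae_filter)
 have [measurable]: "N \<in> sets borel" using N by auto
 have "(NBINT x. indicator N (0 + (1 / eps) *\<^sub>R x)) = 0"
  using N assms(2) by (subst nn_integral_lborel_affine[of "indicator N"]) auto
 then have "AE x in lborel. indicator N (0 + (1 / eps) *\<^sub>R x) = (0::ennreal)"
  by (subst (asm) nn_integral_0_iff_AE) auto
 then show ?thesis
 proof eventually_elim
  case (elim x)
  then show ?case using N(1) by (auto simp: indicator_def inverse_eq_divide split: if_splits)
 qed
qed

lemma avg_bdd_L2_mult:
 fixes q f :: "real^'n => real"
 assumes [measurable]: "q \<in> borel_fun" "f \<in> borel_fun"
  and q: "avg_bdd (%x. (q x)^2) S" and R: "1 <= R" "!!x. R < norm x ==> f x = 0" and G: "!!x. \<bar>f x\<bar> <= G"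
 shows "(%x. q x * f x) \<in> L2s" "L2n (%x. q x * f x) <= G * sqrt (S * R ^ CARD('n))"
proof -
 have G0: "0 <= G" using G[of 0] by simp
 have S: "0 <= S" using q by (simp add: avg_bdd_def)
 have "(NBINT x. ennreal ((q x * f x)^2)) <= (NBINT x. ennreal (G^2) * (ennreal \<bar>(q x)^2\<bar> * indicator (cball 0 R) x))"
 proof (intro nn_integral_mono)
  fix x :: "real^'n"
  have "(f x)^2 <= G^2" using power_mono[OF G[of x], of 2] by simp
  then have "(q x)^2 * (f x)^2 <= (q x)^2 * G^2" by (intro mult_left_mono) auto
  then show "ennreal ((q x * f x)^2) <= ennreal (G^2) * (ennreal \<bar>(q x)^2\<bar> * indicator (cball 0 R) x)"
   using R(2)[of x] by (cases "norm x <= R") (auto simp: power_mult_distrib ennreal_mult[symmetric] mult.commute intro!: ennreal_leI)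
 qed
 also have "... = ennreal (G^2) * (NBINT x. ennreal \<bar>(q x)^2\<bar> * indicator (cball 0 R) x)"
  by (rule nn_integral_cmult) measurable
 also have "... <= ennreal (G^2) * ennreal (S * R ^ DIM(real^'n))"
  using q R(1) unfolding avg_bdd_def by (intro mult_left_mono) auto
 also have "... = ennreal ((G * sqrt (S * R ^ CARD('n)))^2)"
  using S R(1) by (simp add: ennreal_mult[symmetric] power_mult_distrib)
 finally have *: "(NBINT x. ennreal ((q x * f x)^2)) <= ennreal ((G * sqrt (S * R ^ CARD('n)))^2)" .
 show "(%x. q x * f x) \<in> L2s" by (rule L2_spaceI_nn[OF _ *]) measurable
 show "L2n (%x. q x * f x) <= G * sqrt (S * R ^ CARD('n))"
  by (rule L2_norm_le_nn[OF _ *]) (use G0 S R(1) in auto)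
qed

lemma weak_derivative_scale:
 fixes p q :: "real^'n => real"
 assumes [measurable]: "p \<in> borel_fun" "q \<in> borel_fun"
  and weak: "!!\<phi>. \<phi> \<in> Cc_k 1 ==> (LBINT x. q x * \<phi> x) = (LBINT x. p x * partial j \<phi> x)"
  and eps: "0 < eps" and \<phi>: "\<phi> \<in> Cc_k 1"
 shows "(LBINT x. q (x /\<^sub>R eps) * \<phi> x) = eps * (LBINT x. p (x /\<^sub>R eps) * partial j \<phi> x)"
proof -
 have \<phi>1: "\<phi> \<in> Cc_k (Suc 0)" using \<phi> by simp
 have [measurable]: "\<phi> \<in> borel_fun" "partial j \<phi> \<in> borel_fun"
  using Cc_k_measurable[OF \<phi>] Cc_k_measurable[OF Cc_k_partial[OF \<phi>1]] by auto
 have C: "C_k (Suc 0) \<phi>" using \<phi>1 by (simp add: Cc_k_def del: C_k.simps)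
 obtain R where R: "0 < R" "!!x. R < norm x ==> \<phi> x = 0" using Cc_k_support[OF \<phi>] by metis
 have \<psi>: "(%x. \<phi> (eps *\<^sub>R x)) \<in> Cc_k 1"
 proof (rule Cc_k_I[of _ _ "R / eps"])
  show "C_k 1 (%x. \<phi> (eps *\<^sub>R x))" using C_k_scale(1)[OF C] by simp
  show "\<phi> (eps *\<^sub>R x) = 0" if "R / eps < norm x" for x using that eps by (intro R(2)) (simp add: field_simps)
 qed
 have "(LBINT x. q (x /\<^sub>R eps) * \<phi> x) = (LBINT x. (%y. q y * \<phi> (eps *\<^sub>R y)) (0 + (1 / eps) *\<^sub>R x))"
  using eps by (simp add: inverse_eq_divide)
 also have "... = (1 / \<bar>1 / eps\<bar>) ^ DIM(real^'n) * (LBINT y. q y * \<phi> (eps *\<^sub>R y))"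
  using eps by (intro integral_lborel_affine) auto
 also have "(LBINT y. q y * \<phi> (eps *\<^sub>R y)) = (LBINT y. p y * (eps * partial j \<phi> (eps *\<^sub>R y)))"
  using weak[OF \<psi>] C_k_scale(2)[OF C, of j eps] by simp
 also have "(1 / \<bar>1 / eps\<bar>) ^ DIM(real^'n) * ... = (LBINT x. (%y. p y * (eps * partial j \<phi> (eps *\<^sub>R y))) (0 + (1 / eps) *\<^sub>R x))"
  using eps by (intro integral_lborel_affine[symmetric]) auto
 also have "... = (LBINT x. eps * (p (x /\<^sub>R eps) * partial j \<phi> x))"
  using eps by (intro lint_cong) (auto simp: inverse_eq_divide)
 finally show ?thesis by simp
qed

text \<open>
 The realisations of the drift \<open>v\<close> and of its stream matrix \<open>h\<close>, where \<open>dh j l\<close> is the weak derivative of \<open>h j l\<close> in direction \<open>l\<close>.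
\<close>

definition stream_field ::
 "('n => 'n => real^'n => real) => ('n => 'n => real^'n => real) => real => (real^'n => real^'n) => bool" where
 "stream_field h dh S v \<longleftrightarrow> v \<in> borel_fun \<and>
  (\<forall>j l. h j l \<in> borel_fun \<and> dh j l \<in> borel_fun \<and>
   avg_bdd (%x. (h j l x)^2) S \<and> avg_bdd (%x. (dh j l x)^2) S \<and> (AE x in lborel. h j l x = - h l j x)) \<and>
  (\<forall>j. AE x in lborel. v x $ j = (\<Sum>l\<in>UNIV. dh j l x)) \<and>
  (\<forall>j l. \<forall>\<phi>\<in>Cc_k 1. (LBINT x. dh j l x * \<phi> x) = (LBINT x. h j l x * partial l \<phi> x))"

text \<open>
 The drift term is of order \<open>eps\<^bsup>1 - \<alpha>/2\<^esup>\<close>. The function \<open>u\<close> is mollified at the scale \<open>eps\<close>. The error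
 \<open>u - U\<close> is of order \<open>eps\<^bsup>\<alpha>/2\<^esup>\<close> in \<open>L\<^sup>2\<close> and is paired with the drift itself. Against \<open>U\<close> the drift is integrated by
 parts: this gains a factor \<open>eps\<close> from the rescaled stream matrix and costs \<open>eps\<^bsup>\<alpha>/2 - 1\<^esup>\<close> from the gradient of \<open>U\<close>,
 while the derivatives falling on \<open>\<nabla>g\<close> cancel because the stream matrix is antisymmetric. Both contributions are of order
 \<open>eps\<^bsup>\<alpha>/2\<^esup>\<close>, to be multiplied by \<open>eps\<^bsup>1 - \<alpha>\<^esup>\<close>.
\<close>

lemma drift_bound:
 fixes v :: "real^'n => real^'n" and h dh :: "'n => 'n => real^'n => real" and g :: "real^'n => real"
 assumes \<alpha>: "0 < \<alpha>"
  and str: "stream_field h dh S v"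
  and g: "g \<in> Cc_k 2"
 obtains C where "0 <= C"
  "!!eps u. 0 < eps ==> eps < 1 ==> u \<in> frac_sobolev_space \<alpha> ==>
    \<bar>eps powr (- (\<alpha> - 1)) * (\<Sum>j\<in>UNIV. LBINT x. v (x /\<^sub>R eps) $ j * partial j g x * u x)\<bar>
    <= C * eps powr (1 - \<alpha> / 2) * frac_sobolev_norm \<alpha> u"
proof -
 have meas: "!!j l. h j l \<in> borel_fun" "!!j l. dh j l \<in> borel_fun" "v \<in> borel_fun"
  and avg: "!!j l. avg_bdd (%x. (h j l x)^2) S" "!!j l. avg_bdd (%x. (dh j l x)^2) S"
  and anti: "!!j l. AE x in lborel. h j l x = - h l j x"
  and v: "!!j. AE x in lborel. v x $ j = (\<Sum>l\<in>UNIV. dh j l x)"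
  and weak: "!!j l \<phi>. \<phi> \<in> Cc_k 1 ==> (LBINT x. dh j l x * \<phi> x) = (LBINT x. h j l x * partial l \<phi> x)"
  using str unfolding stream_field_def by blast+
 note [measurable] = meas
 have g2: "g \<in> Cc_k (Suc (Suc 0))" using g by (simp add: numeral_2_eq_2)
 have gC: "C_k (Suc (Suc 0)) g" using g2 by (simp add: Cc_k_def del: C_k.simps)
 note pg = Cc_k_partial[OF g2]
 have pg1: "partial j g \<in> Cc_k 1" for j using pg by simp
 obtain R where R: "0 < R" "!!x. R < norm x ==> g x = 0" using Cc_k_support[OF g] by metis
 have "\<exists>R. 1 <= R \<and> (\<forall>j. \<forall>x. R < norm x \<longrightarrow> partial j g x = 0)"
 proof -
  have "\<exists>R. \<forall>x. R < norm x \<longrightarrow> partial j g x = 0" for j using Cc_k_support[OF pg[of j]] by metis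
  then obtain r where r: "!!j x. r j < norm x ==> partial j g x = 0" by metis
  have "r j <= max 1 (Max (range r))" for j by (simp add: le_max_iff_disj)
  then have "partial j g x = 0" if "max 1 (Max (range r)) < norm x" for j x using that r[of j x] by (meson le_less_trans)
  then show ?thesis by (intro exI[of _ "max 1 (Max (range r))"]) auto
 qed
 then obtain Q where Q: "1 <= Q" "!!j x. Q < norm x ==> partial j g x = 0" by blast
 have "\<exists>G. \<forall>j x. \<bar>partial j g x\<bar> <= G"
 proof -
  have "\<exists>B. \<forall>x. \<bar>partial j g x\<bar> <= B" for j using Cc_k_bounded[OF pg[of j]] by metis
  then obtain B where B: "!!j x. \<bar>partial j g x\<bar> <= B j" by metis
  have "B j <= Max (range B)" for j by simp
  then show ?thesis using B by (meson order_trans)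
 qed
 then obtain G where G: "!!j x. \<bar>partial j g x\<bar> <= G" by blast
 have [measurable]: "partial j g \<in> borel_fun" for j by (rule Cc_k_measurable[OF pg])
 have [measurable]: "partial l (partial j g) \<in> borel_fun" for l j by (rule Cc_k_measurable[OF Cc_k_partial[OF pg]])
 define A where "A = G * sqrt (S * Q ^ CARD('n))"
 have S: "0 <= S" using avg(1) by (auto simp: avg_bdd_def)
 have G0: "0 <= G" using G[of undefined 0] by simp
 have A: "0 <= A" using G0 S Q by (simp add: A_def)
 let ?N = "real CARD('n) * real CARD('n)" and ?r = "mol_rate TYPE('n)"
 have r: "0 < ?r" by (rule mol_rate_pos)
 show thesis
 proof (rule that[of "2 * ?N * A * ?r"])
  show "0 <= 2 * ?N * A * ?r" using A r by simp
  fix eps :: real and u :: "real^'n => real"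
  assume eps: "0 < eps" "eps < 1" and u: "u \<in> frac_sobolev_space \<alpha>"
  let ?F = "frac_sobolev_norm \<alpha> u"
  have uL: "u \<in> L2s" using u by (simp add: frac_sobolev_space_def)
  have [measurable]: "u \<in> borel_fun" using L2_spaceD(1)[OF uL] by simp
  define U where "U = conv (mol eps) u"
  have UL: "U \<in> L2s" unfolding U_def by (rule conv_mol_L2(1)[OF uL eps(1)])
  have [measurable]: "U \<in> borel_fun" using L2_spaceD(1)[OF UL] by simp
  have m1: "mol eps \<in> (Cc_k (Suc 0) :: (real^'n => real) set)" by (rule Cc_k_mono[OF _ mol_Cc[OF eps(1)]]) simp
  have UC: "C_k (Suc 0) U" unfolding U_def by (rule conv_C_k[OF loc_int_L2[OF uL] m1])
  have dU: "partial l U = conv (partial l (mol eps)) u" for l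
   unfolding U_def by (rule ext) (rule partial_conv[OF m1 loc_int_L2[OF uL]])
  have dUL: "partial l U \<in> L2s" for l unfolding dU by (rule mollification_error(3)[OF u \<alpha> eps(1)])
  have errU: "L2n (%x. u x - U x) <= ?r * eps powr (\<alpha> / 2) * ?F"
   unfolding U_def using mollification_error(1)[OF u \<alpha> eps(1)] by (simp add: L2_norm_minus_commute)
  have errdU: "L2n (partial l U) <= ?r * eps powr (\<alpha> / 2 - 1) * ?F" for l
   unfolding dU by (rule mollification_error(2)[OF u \<alpha> eps(1)])
  define hs ds where "hs = (%j l x. h j l (x /\<^sub>R eps))" and "ds = (%j l x. dh j l (x /\<^sub>R eps))"
  have [measurable]: "hs j l \<in> borel_fun" "ds j l \<in> borel_fun" for j l
   unfolding hs_def ds_def by measurable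
  have nthm: "(%y::real^'n. y $ j) \<in> borel_fun" for j
   by (intro borel_measurable_continuous_onI continuous_intros)
  have [measurable]: "(%x. v (x /\<^sub>R eps) $ j) \<in> borel_fun" for j
   by (rule measurable_compose[OF _ nthm]) measurable
  have avgs: "avg_bdd (%x. (hs j l x)^2) S" "avg_bdd (%x. (ds j l x)^2) S" for j l
   using avg_bdd_scale[OF avg(1)[of j l] eps(1)] avg_bdd_scale[OF avg(2)[of j l] eps(1)] eps(2) by (simp_all add: hs_def ds_def)
  have hL: "(%x. hs i l x * partial j g x) \<in> L2s" "L2n (%x. hs i l x * partial j g x) <= A" for i l j
   unfolding A_def by (rule avg_bdd_L2_mult[OF _ _ avgs(1) Q(1) Q(2) G]; measurable)+
  have dL: "(%x. ds i l x * partial j g x) \<in> L2s" "L2n (%x. ds i l x * partial j g x) <= A" for i l j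
   unfolding A_def by (rule avg_bdd_L2_mult[OF _ _ avgs(2) Q(1) Q(2) G]; measurable)+
  have hhL: "(%x. hs i l x * partial l (partial j g) x) \<in> L2s" for i l j
  proof -
   obtain R' B' where R': "0 < R'" "!!x. R' < norm x ==> partial l (partial j g) x = 0" and B': "!!x. \<bar>partial l (partial j g) x\<bar> <= B'"
    using Cc_k_support[OF Cc_k_partial[OF pg]] Cc_k_bounded[OF Cc_k_partial[OF pg]] by metis
   show ?thesis by (rule avg_bdd_L2_mult(1)[OF _ _ avgs(1), where R="max 1 R'" and G=B']) (use R' B' in auto)
  qed
  have CS: "\<bar>LBINT x. a x * b x\<bar> <= A * N" if "a \<in> L2s" "L2n a <= A" "b \<in> L2s" "L2n b <= N" for a b :: "real^'n => real" and N
   using L2_Cauchy_Schwarz[OF that(1,3)] mult_mono[OF that(2,4) A L2_norm_nonneg] by linarith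
  have split_v: "(LBINT x. v (x /\<^sub>R eps) $ j * partial j g x * u x)
    = (\<Sum>l\<in>UNIV. (LBINT x. (ds j l x * partial j g x) * (u x - U x)) + (LBINT x. ds j l x * (partial j g x * U x)))" for j
  proof -
   have i: "integrable lborel (%x. (ds j l x * partial j g x) * (u x - U x))" "integrable lborel (%x. (ds j l x * partial j g x) * U x)" for l
    by (rule L2_prod_integrable[OF dL(1) L2_diff[OF uL UL]], rule L2_prod_integrable[OF dL(1) UL])
   have "(LBINT x. v (x /\<^sub>R eps) $ j * partial j g x * u x)
     = (LBINT x. (\<Sum>l\<in>UNIV. (ds j l x * partial j g x) * (u x - U x) + (ds j l x * partial j g x) * U x))"
   proof (rule integral_cong_AE)
    show "AE x in lborel. v (x /\<^sub>R eps) $ j * partial j g x * u x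
      = (\<Sum>l\<in>UNIV. (ds j l x * partial j g x) * (u x - U x) + (ds j l x * partial j g x) * U x)"
     using AE_lborel_scale[OF v[of j] eps(1)]
    proof eventually_elim
     case (elim x)
     have "(\<Sum>l\<in>UNIV. (ds j l x * partial j g x) * (u x - U x) + (ds j l x * partial j g x) * U x) = (\<Sum>l\<in>UNIV. ds j l x * (partial j g x * u x))"
      by (intro sum.cong) (auto simp: algebra_simps)
     then show ?case using elim by (simp add: ds_def sum_distrib_right mult.assoc)
    qed
   qed measurable
   also have "... = (\<Sum>l\<in>UNIV. (LBINT x. (ds j l x * partial j g x) * (u x - U x)) + (LBINT x. (ds j l x * partial j g x) * U x))"
    using i by (subst Bochner_Integration.integral_sum) auto
   finally show ?thesis by (simp add: mult.assoc)
  qed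
  have parts: "(LBINT x. ds j l x * (partial j g x * U x))
    = eps * (LBINT x. (hs j l x * partial j g x) * partial l U x) + eps * (LBINT x. (hs j l x * partial l (partial j g) x) * U x)" for j l
  proof -
   have \<phi>: "(%x. partial j g x * U x) \<in> Cc_k 1" using Cc_k_mult[OF pg UC] by simp
   have "(LBINT x. ds j l x * (partial j g x * U x)) = eps * (LBINT x. hs j l x * partial l (%x. partial j g x * U x) x)"
    unfolding ds_def hs_def by (rule weak_derivative_scale[OF _ _ weak eps(1) \<phi>]) (use meas in auto)
   also have "(LBINT x. hs j l x * partial l (%x. partial j g x * U x) x)
     = (LBINT x. (hs j l x * partial j g x) * partial l U x + (hs j l x * partial l (partial j g) x) * U x)"
   proof (rule lint_cong[OF refl])
    fix x
    have "C_k (Suc 0) (partial j g)" using gC by simp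
    from partial_mult(2)[OF this UC, of l x]
    show "hs j l x * partial l (%x. partial j g x * U x) x = (hs j l x * partial j g x) * partial l U x + (hs j l x * partial l (partial j g) x) * U x"
     by (simp add: algebra_simps)
   qed
   also have "... = (LBINT x. (hs j l x * partial j g x) * partial l U x) + (LBINT x. (hs j l x * partial l (partial j g) x) * U x)"
    by (rule lint_add[OF L2_prod_integrable[OF hL(1) dUL] L2_prod_integrable[OF hhL UL]])
   finally show ?thesis by (simp add: distrib_left)
  qed
  let ?c = "%j l. LBINT x. (hs j l x * partial l (partial j g) x) * U x"
  have "?c j l = - ?c l j" for j l
  proof -
   have "?c j l = (LBINT x. - ((hs l j x * partial j (partial l g) x) * U x))"
   proof (rule integral_cong_AE)
    show "AE x in lborel. (hs j l x * partial l (partial j g) x) * U x = - ((hs l j x * partial j (partial l g) x) * U x)"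
     using AE_lborel_scale[OF anti[of j l] eps(1)] by eventually_elim (simp add: hs_def partial_commute[OF gC, of l j])
   qed measurable
   then show ?thesis by simp
  qed
  then have "(\<Sum>j\<in>UNIV. \<Sum>l\<in>UNIV. ?c j l) = (\<Sum>j\<in>UNIV. \<Sum>l\<in>UNIV. - ?c l j)" by (intro sum.cong refl)
  also have "... = - (\<Sum>j\<in>UNIV. \<Sum>l\<in>UNIV. ?c j l)" by (subst sum.swap) (simp add: sum_negf)
  finally have cancel: "(\<Sum>j\<in>UNIV. \<Sum>l\<in>UNIV. ?c j l) = 0" by simp
  let ?a = "%j l. LBINT x. (ds j l x * partial j g x) * (u x - U x)" and ?b = "%j l. LBINT x. (hs j l x * partial j g x) * partial l U x"
  have total: "(\<Sum>j\<in>UNIV. LBINT x. v (x /\<^sub>R eps) $ j * partial j g x * u x)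
    = (\<Sum>j\<in>UNIV. \<Sum>l\<in>UNIV. ?a j l + eps * ?b j l)"
  proof -
   have "(\<Sum>j\<in>UNIV. LBINT x. v (x /\<^sub>R eps) $ j * partial j g x * u x)
     = (\<Sum>j\<in>UNIV. \<Sum>l\<in>UNIV. ?a j l + eps * ?b j l) + eps * (\<Sum>j\<in>UNIV. \<Sum>l\<in>UNIV. ?c j l)"
    unfolding split_v parts by (simp add: sum.distrib sum_distrib_left algebra_simps)
   then show ?thesis unfolding cancel by simp
  qed
  have "\<bar>\<Sum>j\<in>UNIV. \<Sum>l\<in>UNIV. ?a j l + eps * ?b j l\<bar> <= (\<Sum>j\<in>(UNIV::'n set). \<Sum>l\<in>(UNIV::'n set). 2 * (A * (?r * eps powr (\<alpha> / 2) * ?F)))"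
  proof (intro order_trans[OF sum_abs] sum_mono)
   fix j l
   have "\<bar>?a j l\<bar> <= A * (?r * eps powr (\<alpha> / 2) * ?F)" by (rule CS[OF dL L2_diff[OF uL UL] errU])
   moreover have "\<bar>eps * ?b j l\<bar> <= A * (?r * eps powr (\<alpha> / 2) * ?F)"
   proof -
    have "\<bar>?b j l\<bar> <= A * (?r * eps powr (\<alpha> / 2 - 1) * ?F)" by (rule CS[OF hL dUL errdU])
    then have "eps * \<bar>?b j l\<bar> <= eps * (A * (?r * eps powr (\<alpha> / 2 - 1) * ?F))" using eps by (intro mult_left_mono) auto
    also have "... = A * (?r * eps powr (\<alpha> / 2) * ?F)" using eps by (simp add: powr_diff)
    finally show ?thesis using eps by (simp add: abs_mult)
   qed
   ultimately show "\<bar>?a j l + eps * ?b j l\<bar> <= 2 * (A * (?r * eps powr (\<alpha> / 2) * ?F))" by linarith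
  qed
  also have "... = (2 * ?N * A * ?r) * eps powr (\<alpha> / 2) * ?F" by simp
  finally have *: "\<bar>\<Sum>j\<in>UNIV. LBINT x. v (x /\<^sub>R eps) $ j * partial j g x * u x\<bar> <= (2 * ?N * A * ?r) * eps powr (\<alpha> / 2) * ?F"
   unfolding total .
  have "\<bar>eps powr (- (\<alpha> - 1)) * (\<Sum>j\<in>UNIV. LBINT x. v (x /\<^sub>R eps) $ j * partial j g x * u x)\<bar>
    <= eps powr (- (\<alpha> - 1)) * ((2 * ?N * A * ?r) * eps powr (\<alpha> / 2) * ?F)"
   unfolding abs_mult using * by (simp add: mult_left_mono)
  also have "... = (2 * ?N * A * ?r) * eps powr (1 - \<alpha> / 2) * ?F"
  proof -
   have "eps powr (1 - \<alpha> / 2) = eps powr (- (\<alpha> - 1)) * eps powr (\<alpha> / 2)"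
    by (simp add: powr_add[symmetric])
   then show ?thesis by simp
  qed
  finally show "\<bar>eps powr (- (\<alpha> - 1)) * (\<Sum>j\<in>UNIV. LBINT x. v (x /\<^sub>R eps) $ j * partial j g x * u x)\<bar>
    <= (2 * ?N * A * ?r) * eps powr (1 - \<alpha> / 2) * ?F" .
 qed
qed

section \<open>The jump part of the form\<close>

lemma min_le_geometric_mean:
 fixes a b \<theta> :: real
 assumes "0 <= a" "0 <= b" "0 < \<theta>" "\<theta> < 1"
 shows "min a b <= a powr \<theta> * b powr (1 - \<theta>)"
proof (cases "a <= b")
 case True
 show ?thesis
 proof (cases "a = 0")
  case False
  then have "a = a powr \<theta> * a powr (1 - \<theta>)" using assms by (simp add: powr_add[symmetric])
  also have "... <= a powr \<theta> * b powr (1 - \<theta>)" using True assms by (intro mult_left_mono powr_mono2) auto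
  finally show ?thesis using True by simp
 qed (use assms in simp)
next
 case False
 then have b: "b <= a" by simp
 show ?thesis
 proof (cases "b = 0")
  case False
  then have "b = b powr \<theta> * b powr (1 - \<theta>)" using assms by (simp add: powr_add[symmetric])
  also have "... <= a powr \<theta> * b powr (1 - \<theta>)" using b assms by (intro mult_right_mono powr_mono2) auto
  finally show ?thesis using b by simp
 qed (use assms in simp)
qed

text \<open>
 The energy density of the test function \<open>g\<close> with respect to the remainder kernel is small everywhere and decays at infinity as
 fast as the kernel itself. Interpolating between the two bounds gives a small function which still decays fast enough to be
 integrated against any function with bounded averages.
\<close>

lemma remainder_energy_density:
 fixes g :: "real^'n => real"
 assumes a: "0 < \<alpha>" "\<alpha> < 2" and g: "g \<in> Cc_k 2"
 obtains C \<theta> where "0 <= C" "0 < \<theta>"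
  "!!dl x. 0 < dl ==> (NBINT z. ennreal ((g (x + z) - g x)^2 * rem_kernel \<alpha> dl z))
    <= ennreal (C * rem_mass TYPE('n) \<alpha> dl powr \<theta> * (1 + norm x) powr (- (real CARD('n) + \<alpha> / 2)))"
proof -
 let ?p = "real CARD('n) + \<alpha>" and ?v = "unit_ball_vol (real CARD('n))"
 have [measurable]: "g \<in> borel_fun" by (rule Cc_k_measurable[OF g])
 have g1: "g \<in> Cc_k (Suc 0)" by (rule Cc_k_mono[OF _ g]) simp
 obtain R0 where R0: "0 < R0" "!!x. R0 < norm x ==> g x = 0" using Cc_k_support[OF g] by metis
 define R where "R = max 1 R0"
 have R: "1 <= R" "!!x. R < norm x ==> g x = 0" using R0(2) by (auto simp: R_def)
 obtain B where B: "0 < B" "!!x. \<bar>g x\<bar> <= B" using Cc_k_bounded[OF g] by metis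
 obtain K where K: "0 < K" "!!x y. \<bar>g x - g y\<bar> <= K * norm (x - y)" using Cc_1_Lipschitz[OF g1] by metis
 define L where "L = max (K^2) (4 * B^2)"
 have L0: "0 <= L" by (simp add: L_def le_max_iff_disj)
 have L: "(g (x + z) - g x)^2 <= L * min 1 ((norm z)^2)" for x z
 proof -
  have "(g (x + z) - g x)^2 <= (K * norm z)^2" using K(1) K(2)[of "x + z" x] by (intro abs_le_square_iff[THEN iffD1]) (simp add: abs_mult)
  also have "... <= L * (norm z)^2" unfolding power_mult_distrib by (intro mult_right_mono) (auto simp: L_def)
  finally have 1: "(g (x + z) - g x)^2 <= L * (norm z)^2" .
  have "\<bar>g (x + z) - g x\<bar> <= 2 * B" using B(2)[of "x + z"] B(2)[of x] by linarith
  then have "(g (x + z) - g x)^2 <= (2 * B)^2" using B(1) by (intro abs_le_square_iff[THEN iffD1]) simp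
  also have "... <= L * 1" by (simp add: L_def power_mult_distrib)
  finally show ?thesis using 1 by (auto simp: min_def)
 qed
 define J0 where "J0 = (LBINT z. jump_weight \<alpha> (z::real^'n))"
 have J0: "0 <= J0" unfolding J0_def by (intro integral_nonneg_AE) auto
 define C2 where "C2 = B^2 * 4 powr ?p * (?v * R ^ CARD('n)) + L * J0 * (1 + 2 * R) powr ?p"
 have C2: "0 <= C2" using L0 J0 R by (simp add: C2_def)
 define \<theta> where "\<theta> = (\<alpha> / 2) / ?p"
 have p: "0 < ?p" using a by simp
 have \<theta>: "0 < \<theta>" "\<theta> < 1" using a p by (auto simp: \<theta>_def field_simps)
 have "?p * \<theta> = \<alpha> / 2" using p unfolding \<theta>_def by (metis less_irrefl nonzero_mult_div_cancel_left times_divide_eq_right)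
 then have p\<theta>: "?p * (1 - \<theta>) = real CARD('n) + \<alpha> / 2" by (simp only: right_diff_distrib mult_1_right)
 show thesis
 proof (rule that[of "L powr \<theta> * C2 powr (1 - \<theta>)" \<theta>])
  fix dl :: real and x :: "real^'n" assume dl: "0 < dl"
  let ?J = "rem_mass TYPE('n) \<alpha> dl" and ?G = "NBINT z. ennreal ((g (x + z) - g x)^2 * rem_kernel \<alpha> dl z)"
  have J: "0 <= ?J" by (rule rem_mass_nonneg[OF dl])
  note rk = rem_kernel_bounds[OF dl, where \<alpha>=\<alpha>]
  have [measurable]: "(rem_kernel \<alpha> dl :: real^'n => real) \<in> borel_fun" by (rule rem_kernel_measurable[OF a(1) dl])
  have JJ: "?J <= J0"
   unfolding rem_mass_def J0_def
   by (intro integral_mono rem_weight_integrable[OF a dl] jump_weight_integrable[OF a]) (auto simp: jump_weight_def intro!: mult_left_mono rk)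
  have G1: "?G <= ennreal (L * ?J)"
  proof -
   have "?G <= (NBINT z. ennreal L * ennreal (min 1 ((norm z)^2) * rem_kernel \<alpha> dl (z::real^'n)))"
   proof (intro nn_integral_mono)
    fix z :: "real^'n"
    have "(g (x + z) - g x)^2 * rem_kernel \<alpha> dl z <= (L * min 1 ((norm z)^2)) * rem_kernel \<alpha> dl z"
     by (rule mult_right_mono[OF L rk(1)])
    then show "ennreal ((g (x + z) - g x)^2 * rem_kernel \<alpha> dl z) <= ennreal L * ennreal (min 1 ((norm z)^2) * rem_kernel \<alpha> dl z)"
     using L0 rk(1)[of z] by (simp add: ennreal_mult[symmetric] mult.assoc ennreal_leI)
   qed
   also have "... = ennreal L * (NBINT z. ennreal (min 1 ((norm z)^2) * rem_kernel \<alpha> dl (z::real^'n)))"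
    by (rule nn_integral_cmult) measurable
   also have "(NBINT z. ennreal (min 1 ((norm z)^2) * rem_kernel \<alpha> dl (z::real^'n))) = ennreal ?J"
    unfolding rem_mass_def by (intro nn_integral_eq_integral rem_weight_integrable[OF a dl] AE_I2 mult_nonneg_nonneg rk(1)) simp
   finally show ?thesis using L0 J by (simp add: ennreal_mult)
  qed
  have "0 < 1 + norm x" using norm_ge_zero[of x] by linarith
  then have one: "(1 + norm x) powr ?p * (1 + norm x) powr (- ?p) = 1" by (simp only: powr_add[symmetric]) simp
  have G2: "?G <= ennreal (C2 * (1 + norm x) powr (- ?p))"
  proof (cases "norm x <= 2 * R")
   case True
   have "(1 + norm x) powr ?p <= (1 + 2 * R) powr ?p" using True p by (intro powr_mono2) auto
   then have "1 <= (1 + 2 * R) powr ?p * (1 + norm x) powr (- ?p)"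
    using mult_right_mono[of "(1 + norm x) powr ?p" _ "(1 + norm x) powr (- ?p)"] one by simp
   then have "(L * J0) * 1 <= (L * J0) * ((1 + 2 * R) powr ?p * (1 + norm x) powr (- ?p))" using L0 J0 by (intro mult_left_mono) auto
   also have "... <= C2 * (1 + norm x) powr (- ?p)"
    unfolding C2_def distrib_right using R by (simp add: mult_ac)
   finally have "L * ?J <= C2 * (1 + norm x) powr (- ?p)" using mult_left_mono[OF JJ L0] by simp
   then show ?thesis using G1 by (meson ennreal_leI order_trans)
  next
   case False
   then have x: "2 * R < norm x" by simp
   have "?G <= (NBINT z. ennreal (B^2 * (4 powr ?p * (1 + norm x) powr (- ?p))) * indicator (cball 0 R) (z + x))"
   proof (intro nn_integral_mono)
    fix z :: "real^'n"
    show "ennreal ((g (x + z) - g x)^2 * rem_kernel \<alpha> dl z) <= ennreal (B^2 * (4 powr ?p * (1 + norm x) powr (- ?p))) * indicator (cball 0 R) (z + x)"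
    proof (cases "norm (z + x) <= R")
     case False
     then show ?thesis using R x by (simp add: add.commute)
    next
     case True
     have nz: "(1 + norm x) / 4 <= norm z"
      using True x R(1) norm_triangle_ineq4[of "z + x" z] by simp
     have "0 < (1 + norm x) / 4" by (simp add: add_pos_nonneg)
     then have z0: "0 < norm z" using nz by (rule less_le_trans)
     have "((1 + norm x) / 4) powr ?p <= norm z powr ?p" using nz p by (intro powr_mono2) auto
     then have "(1 + norm x) powr ?p <= 4 powr ?p * norm z powr ?p" by (simp add: powr_divide field_simps)
     from mult_right_mono[OF this, of "(1 + norm x) powr (- ?p)"] have "1 <= 4 powr ?p * (1 + norm x) powr (- ?p) * norm z powr ?p"
      using one by (simp only: powr_ge_zero mult_ac)
     then have "frac_kernel \<alpha> z <= 4 powr ?p * (1 + norm x) powr (- ?p)"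
      using z0 unfolding frac_kernel_def by (subst pos_divide_le_eq) simp_all
     then have "rem_kernel \<alpha> dl z <= 4 powr ?p * (1 + norm x) powr (- ?p)" using rk(2)[of z] by simp
     moreover have "(g (x + z) - g x)^2 <= B^2" using R x B(1) B(2)[of "x + z"] by (intro abs_le_square_iff[THEN iffD1]) simp
     ultimately have "(g (x + z) - g x)^2 * rem_kernel \<alpha> dl z <= B^2 * (4 powr ?p * (1 + norm x) powr (- ?p))"
      using rk(1) by (intro mult_mono) auto
     then show ?thesis using True by (simp add: ennreal_leI)
    qed
   qed
   also have "... = (NBINT z. ennreal (B^2 * (4 powr ?p * (1 + norm x) powr (- ?p))) * indicator (cball (0::real^'n) R) z)"
    by (rule nn_integral_lborel_translate) measurable
   also have "... = ennreal (B^2 * (4 powr ?p * (1 + norm x) powr (- ?p))) * ennreal (?v * R ^ CARD('n))"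
    using R by (subst nn_integral_cmult_indicator) (auto simp: emeasure_cball)
   also have "... = ennreal (B^2 * (4 powr ?p * (1 + norm x) powr (- ?p)) * (?v * R ^ CARD('n)))"
    using R by (intro ennreal_mult[symmetric]) auto
   also have "... <= ennreal (C2 * (1 + norm x) powr (- ?p))"
   proof (rule ennreal_leI)
    have "0 <= L * J0 * (1 + 2 * R) powr ?p * (1 + norm x) powr (- ?p)" using L0 J0 by simp
    then show "B^2 * (4 powr ?p * (1 + norm x) powr (- ?p)) * (?v * R ^ CARD('n)) <= C2 * (1 + norm x) powr (- ?p)"
     unfolding C2_def distrib_right by (simp add: mult_ac)
   qed
   finally show ?thesis .
  qed
  have "?G <= ennreal (min (L * ?J) (C2 * (1 + norm x) powr (- ?p)))" using G1 G2 by (simp add: min_def)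
  also have "... <= ennreal ((L * ?J) powr \<theta> * (C2 * (1 + norm x) powr (- ?p)) powr (1 - \<theta>))"
   using L0 J C2 \<theta> by (intro ennreal_leI min_le_geometric_mean) auto
  also have "(L * ?J) powr \<theta> * (C2 * (1 + norm x) powr (- ?p)) powr (1 - \<theta>)
    = L powr \<theta> * C2 powr (1 - \<theta>) * ?J powr \<theta> * (1 + norm x) powr (- (real CARD('n) + \<alpha> / 2))"
  proof -
   have "((1 + norm x) powr (- ?p)) powr (1 - \<theta>) = (1 + norm x) powr (- (?p * (1 - \<theta>)))" by (simp only: powr_powr mult_minus_left)
   then show ?thesis unfolding p\<theta> using L0 J C2 by (simp add: powr_mult mult_ac)
  qed
  finally show "?G <= ennreal (L powr \<theta> * C2 powr (1 - \<theta>) * ?J powr \<theta> * (1 + norm x) powr (- (real CARD('n) + \<alpha> / 2)))" .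
 qed (use \<theta> in auto)
qed

lemma remainder_energy:
 fixes g :: "real^'n => real"
 assumes a: "0 < \<alpha>" "\<alpha> < 2" and g: "g \<in> Cc_k 2"
 obtains C \<theta> where "0 <= C" "0 < \<theta>"
  "!!dl q S. 0 < dl ==> avg_bdd q S ==>
    (NBINT x. (NBINT y. ennreal (\<bar>q x\<bar> * (g x - g y)^2 * rem_kernel \<alpha> dl (x - y))))
    <= ennreal (C * rem_mass TYPE('n) \<alpha> dl powr \<theta> * S)"
proof -
 let ?q = "real CARD('n) + \<alpha> / 2"
 have [measurable]: "g \<in> borel_fun" by (rule Cc_k_measurable[OF g])
 obtain C \<theta> where C: "0 <= C" "0 < \<theta>"
  "!!dl x. 0 < dl ==> (NBINT z. ennreal ((g (x + z) - g x)^2 * rem_kernel \<alpha> dl z))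
    <= ennreal (C * rem_mass TYPE('n) \<alpha> dl powr \<theta> * (1 + norm x) powr (- ?q))"
  by (rule remainder_energy_density[OF a g]) (rule that)
 define c where "c = 2 ^ CARD('n) * (\<Sum>k. (2 powr (real DIM(real^'n) - ?q)) ^ k)"
 have "summable (%k. (2 powr (real DIM(real^'n) - ?q)) ^ k)" using a by (intro summable_geometric) (auto simp: powr_less_one)
 then have c0: "0 <= c" unfolding c_def by (intro mult_nonneg_nonneg suminf_nonneg) auto
 show thesis
 proof (rule that[of "C * c" \<theta>])
  fix dl :: real and q :: "real^'n => real" and S assume dl: "0 < dl" and q: "avg_bdd q S"
  let ?J = "rem_mass TYPE('n) \<alpha> dl"
  have [measurable]: "q \<in> borel_fun" and S: "0 <= S" using q by (auto simp: avg_bdd_def)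
  have [measurable]: "(rem_kernel \<alpha> dl :: real^'n => real) \<in> borel_fun" by (rule rem_kernel_measurable[OF a(1) dl])
  have even: "rem_kernel \<alpha> dl (- z) = rem_kernel \<alpha> dl z" for z :: "real^'n" by (simp add: rem_kernel_def)
  have "(NBINT x. (NBINT y. ennreal (\<bar>q x\<bar> * (g x - g y)^2 * rem_kernel \<alpha> dl (x - y))))
    <= (NBINT x. ennreal (C * ?J powr \<theta>) * ennreal (\<bar>q x\<bar> * (1 + norm x) powr (- ?q)))"
  proof (intro nn_integral_mono)
   fix x :: "real^'n"
   have "(NBINT y. ennreal (\<bar>q x\<bar> * (g x - g y)^2 * rem_kernel \<alpha> dl (x - y)))
     = (NBINT y. ennreal \<bar>q x\<bar> * ennreal ((g x - g y)^2 * rem_kernel \<alpha> dl (x - y)))"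
    using rem_kernel_bounds(1)[OF dl, of \<alpha>, where 'n='n] by (intro nn_integral_cong) (simp add: ennreal_mult mult.assoc)
   also have "... = ennreal \<bar>q x\<bar> * (NBINT y. ennreal ((g x - g y)^2 * rem_kernel \<alpha> dl (x - y)))"
    by (rule nn_integral_cmult) measurable
   also have "(NBINT y. ennreal ((g x - g y)^2 * rem_kernel \<alpha> dl (x - y)))
     = (NBINT z. ennreal ((g x - g (z + x))^2 * rem_kernel \<alpha> dl (x - (z + x))))"
    by (rule nn_integral_lborel_translate[symmetric]) measurable
   also have "... = (NBINT z. ennreal ((g (x + z) - g x)^2 * rem_kernel \<alpha> dl z))"
    by (intro nn_integral_cong) (simp add: even power2_commute add.commute)
   also have "ennreal \<bar>q x\<bar> * ... <= ennreal \<bar>q x\<bar> * ennreal (C * ?J powr \<theta> * (1 + norm x) powr (- ?q))"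
    by (intro mult_left_mono C(3)[OF dl]) auto
   also have "... = ennreal (C * ?J powr \<theta>) * ennreal (\<bar>q x\<bar> * (1 + norm x) powr (- ?q))"
    using C(1) by (simp add: ennreal_mult[symmetric] mult_ac)
   finally show "(NBINT y. ennreal (\<bar>q x\<bar> * (g x - g y)^2 * rem_kernel \<alpha> dl (x - y)))
     <= ennreal (C * ?J powr \<theta>) * ennreal (\<bar>q x\<bar> * (1 + norm x) powr (- ?q))" .
  qed
  also have "... = ennreal (C * ?J powr \<theta>) * (NBINT x. ennreal (\<bar>q x\<bar> * (1 + norm x) powr (- ?q)))"
   by (rule nn_integral_cmult) measurable
  also have "... <= ennreal (C * ?J powr \<theta>) * ennreal (c * S)"
   using avg_bdd_decay_integral[OF q, of ?q] a unfolding c_def by (intro mult_left_mono) auto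
  also have "... = ennreal (C * c * ?J powr \<theta> * S)" using C(1) c0 S by (simp add: ennreal_mult[symmetric] mult_ac)
  finally show "(NBINT x. (NBINT y. ennreal (\<bar>q x\<bar> * (g x - g y)^2 * rem_kernel \<alpha> dl (x - y))))
    <= ennreal (C * c * ?J powr \<theta> * S)" .
 qed (use C c0 in auto)
qed


text \<open>
 Cauchy--Schwarz for the energy: the remainder kernel contributes at most the energy of \<open>u\<close> times the energy of \<open>g\<close> with respect
 to the remainder kernel, and in the latter the product of the two weights is replaced by the mean of their squares.
\<close>

lemma remainder_part_bound:
 fixes u g q :: "real^'n => real"
 assumes \<alpha>: "0 < \<alpha>" and dl: "0 < dl" and q0: "!!x. 0 <= q x"
  and [measurable]: "u \<in> borel_fun" "g \<in> borel_fun" "q \<in> borel_fun"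
  and u: "integrable (lborel \<Otimes>\<^sub>M lborel) (%(x, y). (u x - u y)^2 * (q x * q y * frac_kernel \<alpha> (x - y)))"
   "(LINT (x, y)|(lborel \<Otimes>\<^sub>M lborel). (u x - u y)^2 * (q x * q y * frac_kernel \<alpha> (x - y))) <= A"
  and g: "(NBINT x. (NBINT y. ennreal ((q x)^2 * (g x - g y)^2 * rem_kernel \<alpha> dl (x - y)))) <= ennreal B" "0 <= B"
 shows "integrable (lborel \<Otimes>\<^sub>M lborel) (%(x, y). (u x - u y) * (g x - g y) * (q x * q y * rem_kernel \<alpha> dl (x - y)))"
  and "\<bar>LINT (x, y)|(lborel \<Otimes>\<^sub>M lborel). (u x - u y) * (g x - g y) * (q x * q y * rem_kernel \<alpha> dl (x - y))\<bar> <= sqrt A * sqrt B"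
proof -
 let ?P = "lborel \<Otimes>\<^sub>M (lborel :: (real^'n) measure)"
 let ?k = "%z. rem_kernel \<alpha> dl (z::real^'n)"
 have [measurable]: "?k \<in> borel_fun" by (rule rem_kernel_measurable[OF \<alpha> dl])
 note rk = rem_kernel_bounds[OF dl, where \<alpha>=\<alpha>]
 have even: "?k (x - y) = ?k (y - x)" for x y using rem_kernel_def by (simp add: rem_kernel_def frac_kernel_def trunc_kernel_def norm_minus_commute)
 define w where "w = (%(x, y). sqrt (q x * q y * ?k (x - y)))"
 have [measurable]: "w \<in> borel_measurable ?P" unfolding w_def by measurable
 have w2: "(w (x, y))^2 = q x * q y * ?k (x - y)" for x y
  unfolding w_def prod.case by (intro real_sqrt_pow2 mult_nonneg_nonneg q0 rk(1))
 let ?a = "%p. (u (fst p) - u (snd p)) * w p" and ?b = "%p. (g (fst p) - g (snd p)) * w p"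
 have a_le: "(?a p)^2 <= (%(x, y). (u x - u y)^2 * (q x * q y * frac_kernel \<alpha> (x - y))) p" for p
  using q0 rk(2) by (cases p) (auto simp: power_mult_distrib w2 intro!: mult_left_mono)
 have a2: "integrable ?P (%p. (?a p)^2)"
 proof (rule lint_bound[OF u(1)])
  show "AE p in ?P. norm ((?a p)^2) <= norm ((%(x, y). (u x - u y)^2 * (q x * q y * frac_kernel \<alpha> (x - y))) p)"
  proof (rule AE_I2)
   fix p show "norm ((?a p)^2) <= norm ((%(x, y). (u x - u y)^2 * (q x * q y * frac_kernel \<alpha> (x - y))) p)"
    using a_le[of p] by simp
  qed
 qed measurable
 have aL: "?a \<in> L2_space ?P" unfolding L2_space_def using a2 by simp
 have "L2_norm ?P ?a <= sqrt A"
  unfolding L2_norm_def by (intro real_sqrt_le_mono order_trans[OF integral_mono[OF a2 u(1) a_le] u(2)])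
 have "(\<integral>\<^sup>+p. ennreal ((?b p)^2) \<partial>?P)
   <= (\<integral>\<^sup>+p. (ennreal (1 / 2) * (%(x, y). ennreal ((q x)^2 * (g x - g y)^2 * ?k (x - y))) p
    + ennreal (1 / 2) * (%(x, y). ennreal ((q y)^2 * (g y - g x)^2 * ?k (y - x))) p) \<partial>?P)"
 proof (intro nn_integral_mono)
  fix p :: "(real^'n) \<times> (real^'n)"
  obtain x y where p: "p = (x, y)" by (cases p)
  let ?G = "(g x - g y)^2 * ?k (x - y)"
  have "q x * q y <= 1 / 2 * (q x)^2 + 1 / 2 * (q y)^2" using sum_squares_bound[of "q x" "q y"] by simp
  then have "q x * q y * ?G <= (1 / 2 * (q x)^2 + 1 / 2 * (q y)^2) * ?G" by (intro mult_right_mono mult_nonneg_nonneg rk(1)) auto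
  also have "q x * q y * ?G = (?b p)^2"
   by (simp only: p fst_conv snd_conv power_mult_distrib w2) (simp add: mult_ac)
  finally have "(?b p)^2 <= 1 / 2 * ((q x)^2 * ?G) + 1 / 2 * ((q y)^2 * ?G)" by (simp only: distrib_right mult.assoc)
  then have "ennreal ((?b p)^2) <= ennreal (1 / 2 * ((q x)^2 * ?G) + 1 / 2 * ((q y)^2 * ?G))" by (rule ennreal_leI)
  also have "... = ennreal (1 / 2) * ennreal ((q x)^2 * ?G) + ennreal (1 / 2) * ennreal ((q y)^2 * ?G)"
  proof -
   have half: "ennreal (1 / 2 * X) = ennreal (1 / 2) * ennreal X" if "0 <= X" for X by (rule ennreal_mult[OF _ that]) simp
   have "0 <= (q z)^2 * ?G" for z by (intro mult_nonneg_nonneg rk(1)) auto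
   then show ?thesis by (subst ennreal_plus) (simp_all only: half mult_nonneg_nonneg zero_le_divide_1_iff zero_le_numeral)
  qed
  finally show "ennreal ((?b p)^2) <= ennreal (1 / 2) * (%(x, y). ennreal ((q x)^2 * (g x - g y)^2 * ?k (x - y))) p
    + ennreal (1 / 2) * (%(x, y). ennreal ((q y)^2 * (g y - g x)^2 * ?k (y - x))) p"
   using even[of x y] power2_commute[of "g x" "g y"] by (simp add: p mult.assoc)
 qed
 also have "... = ennreal (1 / 2) * (\<integral>\<^sup>+p. (%(x, y). ennreal ((q x)^2 * (g x - g y)^2 * ?k (x - y))) p \<partial>?P)
    + ennreal (1 / 2) * (\<integral>\<^sup>+p. (%(x, y). ennreal ((q y)^2 * (g y - g x)^2 * ?k (y - x))) p \<partial>?P)"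
  by (simp add: nn_integral_add nn_integral_cmult)
 also have "(\<integral>\<^sup>+p. (%(x, y). ennreal ((q x)^2 * (g x - g y)^2 * ?k (x - y))) p \<partial>?P)
   = (NBINT x. (NBINT y. ennreal ((q x)^2 * (g x - g y)^2 * ?k (x - y))))"
  by (subst lborel.nn_integral_fst[symmetric]) auto
 also have "(\<integral>\<^sup>+p. (%(x, y). ennreal ((q y)^2 * (g y - g x)^2 * ?k (y - x))) p \<partial>?P)
   = (NBINT x. (NBINT y. ennreal ((q x)^2 * (g x - g y)^2 * ?k (x - y))))"
  by (subst lborel_pair.nn_integral_snd[symmetric]) auto
 also have "ennreal (1 / 2) * (NBINT x. (NBINT y. ennreal ((q x)^2 * (g x - g y)^2 * ?k (x - y))))
   + ennreal (1 / 2) * (NBINT x. (NBINT y. ennreal ((q x)^2 * (g x - g y)^2 * ?k (x - y))))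
   <= ennreal (1 / 2) * ennreal B + ennreal (1 / 2) * ennreal B"
  by (intro add_mono mult_left_mono g) auto
 also have "... = ennreal (1 / 2 * B + 1 / 2 * B)"
  using g(2) by (simp only: ennreal_mult ennreal_plus mult_nonneg_nonneg zero_le_divide_1_iff zero_le_numeral)
 also have "1 / 2 * B + 1 / 2 * B = (sqrt B)^2" using g(2) by simp
 finally have b: "(\<integral>\<^sup>+p. ennreal ((?b p)^2) \<partial>?P) <= ennreal ((sqrt B)^2)" .
 have bm: "?b \<in> borel_measurable ?P" by measurable
 have bL: "?b \<in> L2_space ?P" by (rule L2_spaceI_nn[OF bm b])
 have bn: "L2_norm ?P ?b <= sqrt B" by (rule L2_norm_le_nn[OF bm b]) (use g in simp)
 have ab: "(%(x, y). (u x - u y) * (g x - g y) * (q x * q y * ?k (x - y))) = (%p. ?a p * ?b p)"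
 proof
  fix p show "(%(x, y). (u x - u y) * (g x - g y) * (q x * q y * ?k (x - y))) p = ?a p * ?b p"
   using w2[of "fst p" "snd p"] by (cases p) (simp add: power2_eq_square mult_ac)
 qed
 show "integrable ?P (%(x, y). (u x - u y) * (g x - g y) * (q x * q y * ?k (x - y)))"
  unfolding ab by (rule L2_prod_integrable[OF aL bL])
 show "\<bar>LINT (x, y)|?P. (u x - u y) * (g x - g y) * (q x * q y * ?k (x - y))\<bar> <= sqrt A * sqrt B"
  unfolding ab
  by (rule order_trans[OF L2_Cauchy_Schwarz[OF aL bL] mult_mono']) (use bn \<open>L2_norm ?P ?a <= sqrt A\<close> in auto)
qed

lemma trunc_density:
 fixes g :: "real^'n => real"
 assumes \<alpha>: "0 < \<alpha>" and dl: "0 < dl" and g: "g \<in> Cc_k n"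
 obtains R B where "1 <= R" "0 < B"
  "!!x y. R < norm x \<or> R < norm y ==> (g x - g y) * trunc_kernel \<alpha> dl (x - y) = 0"
  "!!x y. \<bar>(g x - g y) * trunc_kernel \<alpha> dl (x - y)\<bar> <= B"
  "!!e. 0 < e ==> \<exists>d>0. \<forall>x y y'. norm (y - y') < d \<longrightarrow>
    \<bar>(g x - g y) * trunc_kernel \<alpha> dl (x - y) - (g x - g y') * trunc_kernel \<alpha> dl (x - y')\<bar> <= e"
proof -
 let ?k = "%z. trunc_kernel \<alpha> dl (z::real^'n)"
 have k: "?k \<in> Cc_k 0" by (rule trunc_kernel_Cc[OF \<alpha> dl])
 obtain R1 where R1: "0 < R1" "!!x. R1 < norm x ==> g x = 0" using Cc_k_support[OF g] by metis
 obtain R2 where R2: "0 < R2" "!!x. R2 < norm x ==> ?k x = 0" using Cc_k_support[OF k] by metis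
 obtain G where G: "0 < G" "!!x. \<bar>g x\<bar> <= G" using Cc_k_bounded[OF g] by metis
 obtain K where K: "0 < K" "!!x. \<bar>?k x\<bar> <= K" using Cc_k_bounded[OF k] by metis
 have G2: "\<bar>g x - g y\<bar> <= 2 * G" for x y using G(2)[of x] G(2)[of y] by linarith
 show thesis
 proof (rule that[of "1 + R1 + R2" "2 * G * K"])
  fix x y :: "real^'n" assume far: "1 + R1 + R2 < norm x \<or> 1 + R1 + R2 < norm y"
  show "(g x - g y) * ?k (x - y) = 0"
  proof (cases "R2 < norm (x - y)")
   case False
   then have "R1 < norm x" "R1 < norm y"
    using far R1(1) R2(1) norm_triangle_ineq2[of x y] norm_triangle_ineq2[of y x] by (auto simp: norm_minus_commute)
   then show ?thesis using R1(2) by simp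
  qed (use R2 in simp)
 next
  fix x y :: "real^'n"
  show "\<bar>(g x - g y) * ?k (x - y)\<bar> <= 2 * G * K"
   unfolding abs_mult by (rule mult_mono[OF G2 K(2)]) (use G in auto)
 next
  fix e :: real assume e: "0 < e"
  obtain d1 where d1: "0 < d1" "!!x y. norm (x - y) < d1 ==> \<bar>g x - g y\<bar> < e / (2 * K)"
   using Cc_k_uniformly_continuous[OF g, of "e / (2 * K)"] e K(1) by auto
  obtain d2 where d2: "0 < d2" "!!x y. norm (x - y) < d2 ==> \<bar>?k x - ?k y\<bar> < e / (4 * G)"
   using Cc_k_uniformly_continuous[OF k, of "e / (4 * G)"] e G(1) by auto
  have "\<bar>(g x - g y) * ?k (x - y) - (g x - g y') * ?k (x - y')\<bar> <= e" if yy: "norm (y - y') < min d1 d2" for x y y'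
  proof -
   have "norm ((x - y) - (x - y')) < d2" using yy by (simp add: norm_minus_commute)
   from d2(2)[OF this] have k: "\<bar>?k (x - y) - ?k (x - y')\<bar> <= e / (4 * G)" by simp
   have "(g x - g y) * ?k (x - y) - (g x - g y') * ?k (x - y') = (g x - g y) * (?k (x - y) - ?k (x - y')) + (g y' - g y) * ?k (x - y')"
    by (simp add: algebra_simps)
   also have "\<bar>...\<bar> <= \<bar>(g x - g y) * (?k (x - y) - ?k (x - y'))\<bar> + \<bar>(g y' - g y) * ?k (x - y')\<bar>" by (rule abs_triangle_ineq)
   also have "\<bar>(g x - g y) * (?k (x - y) - ?k (x - y'))\<bar> <= 2 * G * (e / (4 * G))"
    unfolding abs_mult by (rule mult_mono[OF G2 k]) (use G in auto)
   also have "\<bar>(g y' - g y) * ?k (x - y')\<bar> <= e / (2 * K) * K"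
    unfolding abs_mult using d1(2)[of y' y] yy K(1) e by (intro mult_mono K(2)) (auto simp: norm_minus_commute)
   also have "2 * G * (e / (4 * G)) + e / (2 * K) * K = e" using G(1) K(1) by simp
   finally show ?thesis by simp
  qed
  then show "\<exists>d>0. \<forall>x y y'. norm (y - y') < d \<longrightarrow> \<bar>(g x - g y) * ?k (x - y) - (g x - g y') * ?k (x - y')\<bar> <= e"
   using d1(1) d2(1) by (intro exI[of _ "min d1 d2"]) auto
 qed (use R1 R2 G K in auto)
qed

text \<open>
 The truncated jump operator seen by \<open>g\<close> when only the weight at the landing point \<open>y\<close> is kept.
\<close>

definition trunc_jump :: "real => real => (real^'n => real) => (real^'n => real) => real^'n => real" where
 "trunc_jump \<alpha> dl g q x = (LBINT y. (g x - g y) * trunc_kernel \<alpha> dl (x - y) * q y)"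

lemma trunc_jump_one:
 fixes g :: "real^'n => real"
 assumes \<alpha>: "0 < \<alpha>" and dl: "0 < dl" and g: "g \<in> Cc_k n"
 shows "trunc_jump \<alpha> dl g (%y. 1) x = - L_trunc \<alpha> 1 dl g x"
proof -
 let ?k = "%z. trunc_kernel \<alpha> dl (z::real^'n)"
 have k: "?k \<in> Cc_k 0" by (rule trunc_kernel_Cc[OF \<alpha> dl])
 have [measurable]: "?k \<in> borel_fun" "g \<in> borel_fun" by (rule Cc_k_measurable[OF k], rule Cc_k_measurable[OF g])
 have ik: "integrable lborel (%y. ?k (x - y))" by (rule integrable_lborel_reflect[OF Cc_k_integrable[OF k]])
 have ig: "integrable lborel (%y. ?k (x - y) * g y)"
  by (rule conv_integrable[OF k loc_int_integrable[OF Cc_k_integrable[OF g]]])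
 have "trunc_jump \<alpha> dl g (%y. 1) x = (LBINT y. g x * ?k (x - y) - ?k (x - y) * g y)"
  unfolding trunc_jump_def by (simp add: algebra_simps)
 also have "... = g x * (LBINT y. ?k (x - y)) - conv ?k g x"
  unfolding conv_def using ik ig by (subst lint_diff) auto
 also have "(LBINT y. ?k (x - y)) = trunc_mass TYPE('n) \<alpha> dl"
  unfolding trunc_mass_def by (rule integral_lborel_reflect) measurable
 also have "conv ?k g = conv g ?k" by (rule conv_commute) measurable
 finally show ?thesis by (simp add: L_trunc_def mult.commute)
qed

text \<open>
 The kernel is even, so exchanging the two variables turns the truncated double integral into twice the pairing of \<open>u\<close> with the
 truncated operator; the truncation is what makes the two halves of the difference \<open>u x - u y\<close> integrable separately.
\<close>

lemma truncated_part:
 fixes u g q :: "real^'n => real"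
 assumes \<alpha>: "0 < \<alpha>" and dl: "0 < dl" and g: "g \<in> Cc_k n" and u: "u \<in> L2s"
  and [measurable]: "q \<in> borel_fun" and q: "avg_bdd (%x. (q x)^2) S" "loc_int q"
 shows "integrable (lborel \<Otimes>\<^sub>M lborel) (%(x, y). (u x - u y) * (g x - g y) * (q x * q y * trunc_kernel \<alpha> dl (x - y)))"
  and "(LINT (x, y)|(lborel \<Otimes>\<^sub>M lborel). (u x - u y) * (g x - g y) * (q x * q y * trunc_kernel \<alpha> dl (x - y)))
   = 2 * (LBINT x. u x * (q x * trunc_jump \<alpha> dl g q x))"
proof -
 let ?P = "lborel \<Otimes>\<^sub>M (lborel :: (real^'n) measure)"
 define h where "h x y = (g x - g y) * trunc_kernel \<alpha> dl (x - y)" for x y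
 obtain R B where R: "1 <= R" "0 < B" "!!x y. R < norm x \<or> R < norm y ==> h x y = 0" "!!x y. \<bar>h x y\<bar> <= B"
  by (rule trunc_density[OF \<alpha> dl g], rule that) (simp_all add: h_def)
 have [measurable]: "u \<in> borel_fun" "g \<in> borel_fun"
  using L2_spaceD(1)[OF u] Cc_k_measurable[OF g] by auto
 have [measurable]: "(trunc_kernel \<alpha> dl :: real^'n => real) \<in> borel_fun" by (rule trunc_kernel_measurable[OF \<alpha> dl])
 have hm[measurable]: "(%(x, y). h x y) \<in> borel_measurable ?P" unfolding h_def by measurable
 have hx[measurable]: "h x \<in> borel_fun" for x unfolding h_def[abs_def] by measurable
 have anti: "h y x = - h x y" for x y
  unfolding h_def using trunc_kernel_even[of \<alpha> dl "x - y"] by (simp add: algebra_simps)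
 let ?I = "indicator (cball (0::real^'n) R) :: _ => real"
 have bnd: "(%x. q x * ?I x) \<in> L2s"
  by (rule avg_bdd_L2_mult(1)[OF _ _ q(1) R(1), of _ 1]) (auto simp: indicator_def)
 have a1: "integrable lborel (%x. u x * (q x * ?I x))" by (rule L2_prod_integrable[OF u bnd])
 have a2: "integrable lborel (%x. q x * ?I x)" using q(2) by (simp add: loc_int_def)
 let ?f = "%(x, y). u x * (h x y * (q x * q y))"
 have fi: "integrable ?P ?f"
 proof (rule lint_bound)
  show "integrable ?P (%(x, y). B * ((u x * (q x * ?I x)) * (q y * ?I y)))"
  proof (rule lborel_pair.Fubini_integrable)
   have "(%x. LBINT y. norm (case (x, y) of (x, y) => B * ((u x * (q x * ?I x)) * (q y * ?I y))))
     = (%x. B * (\<bar>u x * (q x * ?I x)\<bar> * (LBINT y. \<bar>q y * ?I y\<bar>)))"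
    using R(2) by (simp add: abs_mult mult.assoc)
   then show "integrable lborel (%x. LBINT y. norm (case (x, y) of (x, y) => B * ((u x * (q x * ?I x)) * (q y * ?I y))))"
    using a1 by simp
  qed (use a2 in auto)
  show "AE p in ?P. norm (?f p) <= norm ((%(x, y). B * ((u x * (q x * ?I x)) * (q y * ?I y))) p)"
  proof (rule AE_I2)
   fix p :: "(real^'n) \<times> (real^'n)"
   obtain x y where p: "p = (x, y)" by (cases p)
   show "norm (?f p) <= norm ((%(x, y). B * ((u x * (q x * ?I x)) * (q y * ?I y))) p)"
   proof (cases "norm x <= R \<and> norm y <= R")
    case True
    have "\<bar>h x y\<bar> * \<bar>u x * (q x * q y)\<bar> <= B * \<bar>u x * (q x * q y)\<bar>" by (intro mult_right_mono R(4)) auto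
    then show ?thesis using True R(2) by (simp add: p abs_mult mult_ac)
   next
    case False
    then show ?thesis using R(3)[of x y] by (auto simp: p not_le)
   qed
  qed
 qed measurable
 note sw = lborel_pair.integrable_product_swap[OF fi]
 have split: "(%(x, y). (u x - u y) * (g x - g y) * (q x * q y * trunc_kernel \<alpha> dl (x - y))) = (%p. ?f p + (%(x, y). ?f (y, x)) p)"
  (is "_ = (%p. ?f p + ?f' p)")
 proof
  fix p :: "(real^'n) \<times> (real^'n)"
  obtain x y where p: "p = (x, y)" by (cases p)
  show "(%(x, y). (u x - u y) * (g x - g y) * (q x * q y * trunc_kernel \<alpha> dl (x - y))) p = ?f p + ?f' p"
   using trunc_kernel_even[of \<alpha> dl "x - y"] unfolding p by (simp add: h_def algebra_simps)
 qed
 show "integrable ?P (%(x, y). (u x - u y) * (g x - g y) * (q x * q y * trunc_kernel \<alpha> dl (x - y)))"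
  unfolding split by (rule Bochner_Integration.integrable_add[OF fi sw])
 have "(LINT p|?P. ?f p) = (LBINT x. LBINT y. u x * (h x y * (q x * q y)))"
  using lborel_pair.integral_fst'[OF fi] by simp
 also have "... = (LBINT x. u x * (q x * trunc_jump \<alpha> dl g q x))"
 proof (intro lint_cong refl)
  fix x
  have "(%y. u x * (h x y * (q x * q y))) = (%y. u x * (q x * (h x y * q y)))" by (simp add: mult_ac)
  then show "(LBINT y. u x * (h x y * (q x * q y))) = u x * (q x * trunc_jump \<alpha> dl g q x)"
   unfolding trunc_jump_def h_def[symmetric] by simp
 qed
 finally have 1: "(LINT p|?P. ?f p) = (LBINT x. u x * (q x * trunc_jump \<alpha> dl g q x))" .
 have 2: "(LINT p|?P. ?f' p) = (LINT p|?P. ?f p)" by (rule lborel_pair.integral_product_swap) measurable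
 have "(LINT (x, y)|?P. (u x - u y) * (g x - g y) * (q x * q y * trunc_kernel \<alpha> dl (x - y))) = (LINT p|?P. ?f p) + (LINT p|?P. ?f' p)"
  unfolding split by (rule lint_add[OF fi sw])
 then show "(LINT (x, y)|?P. (u x - u y) * (g x - g y) * (q x * q y * trunc_kernel \<alpha> dl (x - y)))
   = 2 * (LBINT x. u x * (q x * trunc_jump \<alpha> dl g q x))"
  unfolding 2 1 by simp
qed


lemma E0_integrand:
 fixes u g :: "real^'n => real"
 shows "indicator {(x, y). x \<noteq> y} p *\<^sub>R E0_density \<alpha> m eps u g p
  = (%(x, y). (u x - u y) * (g x - g y) * (m (x /\<^sub>R eps) * m (y /\<^sub>R eps) * frac_kernel \<alpha> (x - y))) p"
 by (cases p) (auto simp: E0_density_def indicator_def)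

text \<open>
 The two parts of the kernel are treated by \<open>remainder_part_bound\<close> and \<open>truncated_part\<close>. The density vanishes on the diagonal, so the
 restriction of the integral to \<open>x \<noteq> y\<close> can be dropped.
\<close>

lemma jump_form_split:
 fixes u g m :: "real^'n => real"
 assumes \<alpha>: "0 < \<alpha>" and dl: "0 < dl" and g: "g \<in> Cc_k n" and m0: "!!x. 0 <= m x"
  and [measurable]: "m \<in> borel_fun" and eps: "0 < eps" "eps <= 1"
  and m: "avg_bdd (%x. (m x)^2) S" "avg_bdd m S1"
  and u: "u \<in> E0_finite \<alpha> m eps" "E0_form \<alpha> m eps u u <= A"
  and B: "(NBINT x. (NBINT y. ennreal ((m (x /\<^sub>R eps))^2 * (g x - g y)^2 * rem_kernel \<alpha> dl (x - y)))) <= ennreal B" "0 <= B"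
 shows "\<bar>E0_form \<alpha> m eps u g - (LBINT x. u x * (m (x /\<^sub>R eps) * trunc_jump \<alpha> dl g (%x. m (x /\<^sub>R eps)) x))\<bar> <= sqrt (A * B)"
proof -
 let ?P = "lborel \<Otimes>\<^sub>M (lborel :: (real^'n) measure)"
 define q where "q x = m (x /\<^sub>R eps)" for x
 have [measurable]: "q \<in> borel_fun" unfolding q_def[abs_def] by measurable
 have q: "avg_bdd (%x. (q x)^2) S" "loc_int q" "!!x. 0 <= q x"
  using avg_bdd_scale[OF m(1) eps] loc_int_avg_bdd[OF avg_bdd_scale[OF m(2) eps]] m0 by (auto simp: q_def[abs_def])
 have uL: "u \<in> L2s" using u(1) by (simp add: E0_finite_def)
 note um[measurable] = L2_spaceD(1)[OF uL, simplified] and gm[measurable] = Cc_k_measurable[OF g]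
 have int: "integrable ?P (%(x, y). (u x - u y)^2 * (q x * q y * frac_kernel \<alpha> (x - y)))"
  using u(1) unfolding E0_finite_def set_integrable_def E0_integrand by (simp add: q_def power2_eq_square)
 have form: "E0_form \<alpha> m eps u f = 1 / 2 * (LINT (x, y)|?P. (u x - u y) * (f x - f y) * (q x * q y * frac_kernel \<alpha> (x - y)))" for f
  unfolding E0_form_def set_lebesgue_integral_def E0_integrand q_def ..
 have A: "(LINT (x, y)|?P. (u x - u y)^2 * (q x * q y * frac_kernel \<alpha> (x - y))) <= 2 * A"
  using u(2) unfolding form power2_eq_square by simp
 note r = remainder_part_bound[OF \<alpha> dl q(3) um gm \<open>q \<in> borel_fun\<close> int A B[folded q_def]]
 note t = truncated_part[OF \<alpha> dl g uL \<open>q \<in> borel_fun\<close> q(1,2)]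
 have "(%(x, y). (u x - u y) * (g x - g y) * (q x * q y * frac_kernel \<alpha> (x - y)))
   = (%p. (%(x, y). (u x - u y) * (g x - g y) * (q x * q y * trunc_kernel \<alpha> dl (x - y))) p
      + (%(x, y). (u x - u y) * (g x - g y) * (q x * q y * rem_kernel \<alpha> dl (x - y))) p)" (is "?f = (%p. ?t p + ?r p)")
 proof
  fix p :: "(real^'n) \<times> (real^'n)"
  obtain x y where p: "p = (x, y)" by (cases p)
  show "?f p = ?t p + ?r p"
   using kernel_split[of "x - y" "(u x - u y) * (g x - g y) * (q x * q y)" \<alpha> dl] by (simp add: p mult_ac)
 qed
 then have "E0_form \<alpha> m eps u g = 1 / 2 * ((LINT p|?P. ?t p) + (LINT p|?P. ?r p))"
  unfolding form using lint_add[OF t(1) r(1)] by presburger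
 then have "E0_form \<alpha> m eps u g - (LBINT x. u x * (q x * trunc_jump \<alpha> dl g q x)) = 1 / 2 * (LINT p|?P. ?r p)"
  unfolding t(2) by simp
 then have "\<bar>E0_form \<alpha> m eps u g - (LBINT x. u x * (q x * trunc_jump \<alpha> dl g q x))\<bar> = 1 / 2 * \<bar>LINT p|?P. ?r p\<bar>"
  by (simp only: abs_mult)
 also have "... <= 1 / 2 * (sqrt (2 * A) * sqrt B)" using r(2) by (intro mult_left_mono) auto
 also have "... = sqrt (A * B) * (sqrt 2 / 2)" by (simp add: real_sqrt_mult)
 also have "... <= sqrt (A * B) * 1"
 proof (rule mult_left_mono)
  have "sqrt 2 <= sqrt (2^2)" by (intro real_sqrt_le_mono) simp
  then show "sqrt 2 / 2 <= 1" by simp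
  have "0 <= LINT (x, y)|?P. (u x - u y)^2 * (q x * q y * frac_kernel \<alpha> (x - y))" using q(3) by (intro integral_nonneg_AE AE_I2) auto
  then show "0 <= sqrt (A * B)" using A B(2) by simp
 qed
 finally show ?thesis by (simp add: q_def[abs_def])
qed

text \<open>
 Here the two weights are averaged one after the other. For fixed \<open>x\<close> the integral over \<open>y\<close> tests \<open>m (y / eps)\<close> against functions
 which are equicontinuous in \<open>x\<close>, so it can be replaced by its mean uniformly in \<open>x\<close>. The outer integral tests \<open>m (x / eps)\<close> against
 \<open>u\<close>, which is only square integrable; replacing \<open>u\<close> by a mollification at a fixed scale costs little by the fractional bound and
 restores equicontinuity.
\<close>

lemma truncated_form_limit:
 fixes g m :: "real^'n => real"
 assumes \<alpha>: "0 < \<alpha>" and dl: "0 < dl" and g: "g \<in> Cc_k 2"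
  and mm[measurable]: "m \<in> borel_fun"
  and m: "avg_bdd (%x. (m x)^2) S" "avg_bdd m S1" and hom: "homogenises m m0" and M: "0 <= M" and e: "0 < e"
 obtains eps0 where "0 < eps0" "eps0 <= 1"
  "!!eps u. 0 < eps ==> eps < eps0 ==> u \<in> frac_sobolev_space \<alpha> ==> L2n u <= M ==> frac_sobolev_norm \<alpha> u <= M ==>
   \<bar>(LBINT x. u x * (m (x /\<^sub>R eps) * trunc_jump \<alpha> dl g (%x. m (x /\<^sub>R eps)) x)) + (LBINT x. u x * L_trunc \<alpha> (m0^2) dl g x)\<bar> <= e"
proof -
 let ?D = "CARD('n)"
 define h where "h x y = (g x - g y) * trunc_kernel \<alpha> dl (x - y)" for x y
 obtain R B where R: "1 <= R" and B: "0 < B" "!!x y. \<bar>h x y\<bar> <= B"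
  and hz: "!!x y. R < norm x \<or> R < norm y ==> h x y = 0"
  and hc: "!!e. 0 < e ==> \<exists>d>0. \<forall>x y y'. norm (y - y') < d \<longrightarrow> \<bar>h x y - h x y'\<bar> <= e"
  by (rule trunc_density[OF \<alpha> dl g], rule that) (simp_all add: h_def)
 note gm[measurable] = Cc_k_measurable[OF g]
 have km[measurable]: "(trunc_kernel \<alpha> dl :: real^'n => real) \<in> borel_fun" by (rule trunc_kernel_measurable[OF \<alpha> dl])
 have hm[measurable]: "h x \<in> borel_fun" for x unfolding h_def[abs_def] by measurable
 have tj: "trunc_jump \<alpha> dl g q x = (LBINT y. h x y * q y)" for q x unfolding trunc_jump_def h_def ..
 have S1: "0 <= S1" using m(2) by (simp add: avg_bdd_def)
 define \<Psi> where "\<Psi> x = - L_trunc \<alpha> 1 dl g x" for x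
 have \<Psi>C: "\<Psi> \<in> Cc_k 2" unfolding \<Psi>_def using Cc_k_cmult[OF L_trunc_Cc(2)[OF \<alpha> dl g, of 1], of "- 1"] by simp
 note \<Psi>m[measurable] = Cc_k_measurable[OF \<Psi>C] and \<Psi>L = Cc_k_L2[OF \<Psi>C]
 have \<Psi>eq: "\<Psi> x = (LBINT y. h x y)" for x using trunc_jump_one[OF \<alpha> dl g, of x] by (simp add: \<Psi>_def tj)
 have h0: "h x = (%y. 0)" if "R < norm x" for x by (rule ext) (use that hz in blast)
 have \<Psi>z: "R < norm x ==> \<Psi> x = 0" for x by (simp add: \<Psi>eq h0)
 obtain P where P: "0 < P" "!!x. \<bar>\<Psi> x\<bar> <= P" using Cc_k_bounded[OF \<Psi>C] by metis
 define G where "G = B * (S1 * R ^ ?D)"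
 have G0: "0 <= G" using B S1 R by (simp add: G_def)
 define K where "K = G * sqrt (S * R ^ ?D) + m0^2 * L2n \<Psi>"
 have "0 <= S" using m(1) by (simp add: avg_bdd_def)
 then have K0: "0 <= K" using G0 R by (simp add: K_def)
 \<comment> \<open>the mollification scale, chosen so that the error of mollifying \<open>u\<close> is at most \<open>e / 4\<close>\<close>
 define \<kappa> where "\<kappa> = mol_rate TYPE('n) * M * K"
 have \<kappa>0: "0 <= \<kappa>" using mol_rate_pos[where 'n='n] M K0 by (simp add: \<kappa>_def)
 define \<eta> where "\<eta> = (e / (4 * (\<kappa> + 1))) powr (2 / \<alpha>)"
 have \<eta>: "0 < \<eta>" using e \<kappa>0 by (simp add: \<eta>_def)
 have "\<eta> powr (\<alpha> / 2) = e / (4 * (\<kappa> + 1))" using \<alpha> e \<kappa>0 by (simp add: \<eta>_def powr_powr)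
 then have "\<kappa> * \<eta> powr (\<alpha> / 2) = e / 4 * (\<kappa> / (\<kappa> + 1))" by simp
 also have "... <= e / 4 * 1" using e \<kappa>0 by (intro mult_left_mono) auto
 finally have \<eta>e: "mol_rate TYPE('n) * \<eta> powr (\<alpha> / 2) * M * K <= e / 4" by (simp add: \<kappa>_def mult_ac)
 obtain L where L: "0 < L"
  "!!(u :: real^'n => real) x. u \<in> L2s ==> \<bar>conv (mol \<eta>) u x\<bar> <= L * L2n u"
  "!!(u :: real^'n => real) x y. u \<in> L2s ==> norm (x - y) <= 1 ==> \<bar>conv (mol \<eta>) u x - conv (mol \<eta>) u y\<bar> <= L * L2n u * norm (x - y)"
  by (rule conv_mol_equicontinuous[OF \<eta>]) (rule that)
 define V where "V = L * M"
 have V0: "0 <= V" using L M by (simp add: V_def)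
 define U where "U = {u \<in> L2s. L2n (u :: real^'n => real) <= M}"
 have Vb: "\<bar>conv (mol \<eta>) u x\<bar> <= V" if "u \<in> U" for u x
 proof -
  have "L * L2n u <= L * M" using that L(1) by (intro mult_left_mono) (auto simp: U_def)
  then show ?thesis using L(2)[of u x] that by (simp add: U_def V_def)
 qed
 have Vl: "\<bar>conv (mol \<eta>) u x - conv (mol \<eta>) u y\<bar> <= V * norm (x - y)" if "u \<in> U" "norm (x - y) <= 1" for u x y
 proof -
  have "\<bar>conv (mol \<eta>) u x - conv (mol \<eta>) u y\<bar> <= L * L2n u * norm (x - y)" using L(3) that by (simp add: U_def)
  also have "... <= V * norm (x - y)" unfolding V_def using that L(1) by (intro mult_right_mono mult_left_mono) (auto simp: U_def)
  finally show ?thesis .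
 qed
 have VL: "conv (mol \<eta>) u \<in> L2s" if "u \<in> U" for u by (rule conv_mol_L2(1)[OF _ \<eta>]) (use that in \<open>simp add: U_def\<close>)
 define e1 where "e1 = e / (4 * (V * (S1 * R ^ ?D) + 1))"
 have W0: "0 <= V * (S1 * R ^ ?D)" using V0 S1 R by simp
 have e1: "0 < e1" using e W0 by (simp add: e1_def)
 have "e1 * (V * (S1 * R ^ ?D)) = e / 4 * (V * (S1 * R ^ ?D) / (V * (S1 * R ^ ?D) + 1))" by (simp add: e1_def)
 also have "... <= e / 4 * 1" using e W0 by (intro mult_left_mono) auto
 finally have e1e: "e1 * V * (S1 * R ^ ?D) <= e / 4" by simp
 define e2 where "e2 = e / (4 * (\<bar>m0\<bar> + 1))"
 have e2: "0 < e2" using e by (simp add: e2_def add_nonneg_pos)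
 have "\<bar>m0\<bar> * e2 = e / 4 * (\<bar>m0\<bar> / (\<bar>m0\<bar> + 1))" by (simp add: e2_def)
 also have "... <= e / 4 * 1" using e by (intro mult_left_mono) auto
 finally have e2e: "\<bar>m0\<bar> * e2 <= e / 4" by simp
 have "\<exists>eps0>0. \<forall>eps. 0 < eps \<and> eps < eps0 \<longrightarrow> (\<forall>\<phi>\<in>range h. \<bar>LBINT x. \<phi> x * (m (x /\<^sub>R eps) - m0)\<bar> <= e1)"
 proof (rule hom[unfolded homogenises_def, rule_format, OF _ _ e1, of _ R B])
  show "\<exists>d>0. \<forall>\<phi>\<in>range h. \<forall>x y. norm (x - y) < d \<longrightarrow> \<bar>\<phi> x - \<phi> y\<bar> <= t" if "0 < t" for t using hc[OF that] by blast
 qed (use B hz in auto)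
 then obtain eps1 where eps1: "0 < eps1" "!!eps x. 0 < eps ==> eps < eps1 ==> \<bar>LBINT y. h x y * (m (y /\<^sub>R eps) - m0)\<bar> <= e1" by blast
 have "\<exists>eps0>0. \<forall>eps. 0 < eps \<and> eps < eps0 \<longrightarrow> (\<forall>\<phi>\<in>(%u x. conv (mol \<eta>) u x * \<Psi> x) ` U. \<bar>LBINT x. \<phi> x * (m (x /\<^sub>R eps) - m0)\<bar> <= e2)"
 proof (rule hom[unfolded homogenises_def, rule_format, OF _ _ e2, of _ R "V * P"])
  fix \<phi> assume "\<phi> \<in> (%u x. conv (mol \<eta>) u x * \<Psi> x) ` U"
  then obtain u where u: "u \<in> U" "\<phi> = (%x. conv (mol \<eta>) u x * \<Psi> x)" by blast
  have [measurable]: "conv (mol \<eta>) u \<in> borel_fun" using L2_spaceD(1)[OF VL[OF u(1)]] by simp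
  show "\<phi> \<in> borel_fun \<and> (\<forall>x. R < norm x \<longrightarrow> \<phi> x = 0) \<and> (\<forall>x. \<bar>\<phi> x\<bar> <= V * P)"
   unfolding u(2) abs_mult using \<Psi>z V0 by (auto intro!: mult_mono Vb[OF u(1)] P(2))
 next
  fix t :: real assume t: "0 < t"
  define s where "s = t / (2 * (V * P + 1))"
  have VP: "0 <= V * P" using V0 P(1) by simp
  have s: "0 < s" using t VP by (simp add: s_def)
  have s': "0 < t / (2 * (V + 1))" using t V0 by simp
  obtain d where d: "0 < d" "!!x y. norm (x - y) < d ==> \<bar>\<Psi> x - \<Psi> y\<bar> < t / (2 * (V + 1))"
   using Cc_k_uniformly_continuous[OF \<Psi>C s'] by metis
  show "\<exists>d>0. \<forall>\<phi>\<in>(%u x. conv (mol \<eta>) u x * \<Psi> x) ` U. \<forall>x y. norm (x - y) < d \<longrightarrow> \<bar>\<phi> x - \<phi> y\<bar> <= t"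
  proof (intro exI[of _ "min 1 (min d s)"] conjI ballI allI impI)
   fix \<phi> and x y :: "real^'n" assume "\<phi> \<in> (%u x. conv (mol \<eta>) u x * \<Psi> x) ` U" and xy: "norm (x - y) < min 1 (min d s)"
   then obtain u where u: "u \<in> U" "\<phi> = (%x. conv (mol \<eta>) u x * \<Psi> x)" by blast
   let ?v = "conv (mol \<eta>) u"
   have "\<phi> x - \<phi> y = (?v x - ?v y) * \<Psi> x + ?v y * (\<Psi> x - \<Psi> y)" by (simp add: u(2) algebra_simps)
   also have "\<bar>...\<bar> <= \<bar>?v x - ?v y\<bar> * \<bar>\<Psi> x\<bar> + \<bar>?v y\<bar> * \<bar>\<Psi> x - \<Psi> y\<bar>" using abs_triangle_ineq by (simp add: abs_mult[symmetric])
   also have "... <= (V * s) * P + V * (t / (2 * (V + 1)))"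
   proof (intro add_mono mult_mono P(2) Vb[OF u(1)])
    show "\<bar>?v x - ?v y\<bar> <= V * s" using Vl[OF u(1), of x y] xy mult_left_mono[of "norm (x - y)" s V] V0 by simp
    show "\<bar>\<Psi> x - \<Psi> y\<bar> <= t / (2 * (V + 1))" using d(2)[of x y] xy by simp
   qed (use V0 s in auto)
   also have "(V * s) * P = t / 2 * (V * P / (V * P + 1))" by (simp add: s_def)
   also have "V * (t / (2 * (V + 1))) = t / 2 * (V / (V + 1))" by simp
   also have "t / 2 * (V * P / (V * P + 1)) + t / 2 * (V / (V + 1)) <= t / 2 * 1 + t / 2 * 1"
    using t VP V0 by (intro add_mono mult_left_mono) auto
   finally show "\<bar>\<phi> x - \<phi> y\<bar> <= t" by simp
  qed (use d s in auto)
 qed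
 then obtain eps2 where eps2: "0 < eps2" "\<forall>eps. 0 < eps \<and> eps < eps2 \<longrightarrow> (\<forall>\<phi>\<in>(%u x. conv (mol \<eta>) u x * \<Psi> x) ` U. \<bar>LBINT x. \<phi> x * (m (x /\<^sub>R eps) - m0)\<bar> <= e2)"
  by (elim exE conjE) (rule that)
 show thesis
 proof (rule that[of "min 1 (min eps1 eps2)"])
  fix eps and u :: "real^'n => real"
  assume eps: "0 < eps" "eps < min 1 (min eps1 eps2)" and u: "u \<in> frac_sobolev_space \<alpha>" "L2n u <= M" "frac_sobolev_norm \<alpha> u <= M"
  have uL: "u \<in> L2s" using u(1) by (simp add: frac_sobolev_space_def)
  then have uU: "u \<in> U" using u(2) by (simp add: U_def)
  define v where "v = conv (mol \<eta>) u"
  note vL = VL[OF uU, folded v_def] and vb = Vb[OF uU, folded v_def]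
  define q where "q x = m (x /\<^sub>R eps)" for x
  have qm[measurable]: "q \<in> borel_fun" unfolding q_def[abs_def] by measurable
  have q: "avg_bdd (%x. (q x)^2) S" "avg_bdd q S1"
   using avg_bdd_scale[OF m(1), of eps] avg_bdd_scale[OF m(2), of eps] eps by (auto simp: q_def[abs_def])
  note ql = loc_int_avg_bdd[OF q(2)] and qR = avg_bdd_integral[OF q(2) R, simplified]
  note [measurable] = L2_spaceD(1)[OF uL, simplified] L2_spaceD(1)[OF vL, simplified]
  define J where "J = trunc_jump \<alpha> dl g q"
  have Jm[measurable]: "J \<in> borel_fun" unfolding J_def trunc_jump_def[abs_def] by measurable
  have hq: "integrable lborel (%y. h x y * q y)" "\<bar>LBINT y. h x y * q y\<bar> <= G" for x
  proof -
   note bm = loc_int_bounded_mult[OF ql hm[of x], of R B]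
   show "integrable lborel (%y. h x y * q y)" by (rule bm(1)) (use hz B(2) in auto)
   have "\<bar>LBINT y. h x y * q y\<bar> <= B * (LBINT y. \<bar>q y\<bar> * indicator (cball 0 R) y)" by (rule bm(2)) (use hz B(2) in auto)
   also have "... <= G" unfolding G_def using B(1) qR by (intro mult_left_mono) auto
   finally show "\<bar>LBINT y. h x y * q y\<bar> <= G" .
  qed
  have hi: "integrable lborel (h x)" for x
   using loc_int_bounded_mult(1)[OF loc_int_avg_bdd[OF avg_bdd_one] hm[of x], of R B] hz B(2) by simp
  have Jz: "R < norm x ==> J x = 0" for x by (simp add: J_def tj h0)
  have Jd: "\<bar>J x - m0 * \<Psi> x\<bar> <= e1" for x
  proof -
   have "(LBINT y. h x y * q y) - m0 * (LBINT y. h x y) = (LBINT y. h x y * (q y - m0))"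
    using hq(1) hi by (simp add: right_diff_distrib mult.commute[of "h x _" m0])
   then have "J x - m0 * \<Psi> x = (LBINT y. h x y * (q y - m0))" by (simp add: J_def tj \<Psi>eq)
   then show ?thesis using eps1(2)[of eps x] eps by (simp add: q_def)
  qed
  have qJ: "(%x. q x * J x) \<in> L2s" "L2n (%x. q x * J x) <= G * sqrt (S * R ^ ?D)"
   using avg_bdd_L2_mult[OF qm Jm q(1) R Jz, of G] hq(2) by (auto simp: J_def tj)
  have q\<Psi>: "(%x. q x * \<Psi> x) \<in> L2s" by (rule avg_bdd_L2_mult(1)[OF qm \<Psi>m q(1) R \<Psi>z P(2)])
  note i = L2_prod_integrable[OF uL qJ(1)] L2_prod_integrable[OF vL qJ(1)] L2_prod_integrable[OF vL q\<Psi>]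
   L2_prod_integrable[OF vL \<Psi>L] L2_prod_integrable[OF uL \<Psi>L]
  have d: "L2n (%x. u x - v x) <= mol_rate TYPE('n) * \<eta> powr (\<alpha> / 2) * M"
   unfolding v_def L2_norm_minus_commute[of _ u]
   by (rule order_trans[OF mollification_error(1)[OF u(1) \<alpha> \<eta>]]) (use u(3) mol_rate_pos[where 'n='n] in \<open>simp add: mult_left_mono\<close>)
  have a1: "\<bar>LBINT x. (u x - v x) * (q x * J x)\<bar> <= L2n (%x. u x - v x) * (G * sqrt (S * R ^ ?D))"
   by (rule order_trans[OF L2_Cauchy_Schwarz[OF L2_diff[OF uL vL] qJ(1)]]) (intro mult_left_mono qJ(2), simp)
  have a4: "\<bar>LBINT x. (u x - v x) * \<Psi> x\<bar> <= L2n (%x. u x - v x) * L2n \<Psi>"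
   by (rule L2_Cauchy_Schwarz[OF L2_diff[OF uL vL] \<Psi>L])
  have "\<bar>LBINT x. (u x - v x) * (q x * J x)\<bar> + m0^2 * \<bar>LBINT x. (u x - v x) * \<Psi> x\<bar> <= L2n (%x. u x - v x) * K"
   using a1 mult_left_mono[OF a4, of "m0^2"] by (simp add: K_def algebra_simps)
  also have "... <= e / 4" by (rule order_trans[OF mult_right_mono[OF d K0] \<eta>e])
  finally have b1: "\<bar>LBINT x. (u x - v x) * (q x * J x)\<bar> + m0^2 * \<bar>LBINT x. (u x - v x) * \<Psi> x\<bar> <= e / 4" .
  have "\<bar>LBINT x. (v x * (J x - m0 * \<Psi> x)) * q x\<bar> <= (V * e1) * (LBINT y. \<bar>q y\<bar> * indicator (cball 0 R) y)"
  proof (rule loc_int_bounded_mult(2)[OF ql])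
   show "\<bar>v x * (J x - m0 * \<Psi> x)\<bar> <= V * e1" for x unfolding abs_mult using V0 by (intro mult_mono vb Jd) auto
  qed (use Jz \<Psi>z in auto)
  also have "... <= (V * e1) * (S1 * R ^ ?D)" using qR V0 e1 by (intro mult_left_mono) auto
  finally have b2: "\<bar>LBINT x. (v x * (J x - m0 * \<Psi> x)) * q x\<bar> <= e / 4" using e1e by (simp add: mult_ac)
  have "\<bar>LBINT x. v x * \<Psi> x * (q x - m0)\<bar> <= e2" using eps2(2)[rule_format, OF _ imageI[OF uU], of eps] eps by (simp add: v_def q_def)
  then have b3: "\<bar>m0\<bar> * \<bar>LBINT x. v x * \<Psi> x * (q x - m0)\<bar> <= e / 4" using e2e mult_left_mono[of _ e2 "\<bar>m0\<bar>"] by fastforce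
  have c1: "(LBINT x. (u x - v x) * (q x * J x)) = (LBINT x. u x * (q x * J x)) - (LBINT x. v x * (q x * J x))"
   using i(1,2) by (simp add: left_diff_distrib)
  have "(%x. (v x * (J x - m0 * \<Psi> x)) * q x) = (%x. v x * (q x * J x) - m0 * (v x * (q x * \<Psi> x)))" by (simp add: algebra_simps)
  then have c2: "(LBINT x. (v x * (J x - m0 * \<Psi> x)) * q x) = (LBINT x. v x * (q x * J x)) - m0 * (LBINT x. v x * (q x * \<Psi> x))"
   using i(2,3) by simp
  have "(%x. v x * \<Psi> x * (q x - m0)) = (%x. v x * (q x * \<Psi> x) - m0 * (v x * \<Psi> x))" by (simp add: algebra_simps)
  then have c3: "(LBINT x. v x * \<Psi> x * (q x - m0)) = (LBINT x. v x * (q x * \<Psi> x)) - m0 * (LBINT x. v x * \<Psi> x)"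
   using i(3,4) by simp
  have c4: "(LBINT x. (u x - v x) * \<Psi> x) = (LBINT x. u x * \<Psi> x) - (LBINT x. v x * \<Psi> x)"
   using i(4,5) by (simp add: left_diff_distrib)
  have "L_trunc \<alpha> (m0^2) dl g x = - (m0^2 * \<Psi> x)" for x by (simp add: \<Psi>_def L_trunc_def algebra_simps)
  then have c5: "(LBINT x. u x * L_trunc \<alpha> (m0^2) dl g x) = - (m0^2 * (LBINT x. u x * \<Psi> x))"
   by (simp add: mult.left_commute[of "u _"])
  let ?A = "LBINT x. (u x - v x) * (q x * J x)" and ?B = "LBINT x. (v x * (J x - m0 * \<Psi> x)) * q x"
   and ?C = "LBINT x. v x * \<Psi> x * (q x - m0)" and ?E = "LBINT x. (u x - v x) * \<Psi> x"
  have sum: "(LBINT x. u x * (q x * J x)) + (LBINT x. u x * L_trunc \<alpha> (m0^2) dl g x) = ?A + ?B + m0 * ?C - m0^2 * ?E"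
   unfolding c1 c2 c3 c4 c5 by (simp add: algebra_simps power2_eq_square)
  have "\<bar>a + b + c - d\<bar> <= e" if "\<bar>a\<bar> + \<bar>d\<bar> <= e / 4" "\<bar>b\<bar> <= e / 4" "\<bar>c\<bar> <= e / 4" for a b c d :: real
   using that e by linarith
  from this[of ?A "m0^2 * ?E" ?B "m0 * ?C"] have "\<bar>?A + ?B + m0 * ?C - m0^2 * ?E\<bar> <= e" using b1 b2 b3 by (simp add: abs_mult)
  then show "\<bar>(LBINT x. u x * (m (x /\<^sub>R eps) * trunc_jump \<alpha> dl g (%x. m (x /\<^sub>R eps)) x)) + (LBINT x. u x * L_trunc \<alpha> (m0^2) dl g x)\<bar> <= e"
   unfolding sum[symmetric]
   by (simp add: J_def q_def[abs_def])
 qed (use eps1 eps2 in auto)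
qed

text \<open>
 The truncation level is fixed first, so that both the remainder part of the form and the difference between the truncated and the
 full limit operator are small; then the small scale is sent to zero.
\<close>

lemma jump_form_limit:
 fixes g m :: "real^'n => real"
 assumes \<alpha>: "0 < \<alpha>" "\<alpha> < 2" and g: "g \<in> Cc_k 2"
  and mm[measurable]: "m \<in> borel_fun" and m0: "!!x. 0 <= m x"
  and m: "avg_bdd (%x. (m x)^2) S" "avg_bdd m S1" and hom: "homogenises m a" and M: "0 <= M" and e: "0 < e"
 obtains eps0 where "0 < eps0" "eps0 <= 1"
  "!!eps u. 0 < eps ==> eps < eps0 ==> u \<in> frac_sobolev_space \<alpha> ==> L2n u <= M ==> frac_sobolev_norm \<alpha> u <= M ==>
   u \<in> E0_finite \<alpha> m eps ==> E0_form \<alpha> m eps u u <= M ==>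
   \<bar>E0_form \<alpha> m eps u g + (LBINT x. u x * L_bar \<alpha> (a^2) g x)\<bar> <= e"
proof -
 have S: "0 <= S" using m(1) by (simp add: avg_bdd_def)
 obtain C \<theta> where C: "0 <= C" "0 < \<theta>"
  "!!dl q S. 0 < dl ==> avg_bdd q S ==>
    (NBINT x. (NBINT y. ennreal (\<bar>q x\<bar> * (g x - g y)^2 * rem_kernel \<alpha> dl (x - y))))
    <= ennreal (C * rem_mass TYPE('n) \<alpha> dl powr \<theta> * S)"
  by (rule remainder_energy[OF \<alpha> g]) (rule that)
 define e' where "e' = e / (3 * (M + 1))"
 have e': "0 < e'" "M * e' <= e / 3"
 proof -
  show "0 < e'" using e M by (simp add: e'_def)
  have "M * e' = e / 3 * (M / (M + 1))" by (simp add: e'_def)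
  also have "... <= e / 3 * 1" using e M by (intro mult_left_mono) auto
  finally show "M * e' <= e / 3" by simp
 qed
 obtain s where s: "0 < s"
  "!!dl. 0 < dl ==> rem_mass TYPE('n) \<alpha> dl < s ==> L2n (%x. L_bar \<alpha> (a^2) g x - L_trunc \<alpha> (a^2) dl g x) <= e'"
  by (rule L_trunc_tendsto_L_bar[OF \<alpha> g e'(1), of "a^2"]) (rule that)
 define t where "t = (e / 3)^2 / (M * C * S + 1)"
 have MCS: "0 <= M * C * S" using M C(1) S by simp
 have t: "0 < t" using e MCS by (simp add: t_def)
 have "M * C * S * t = (e / 3)^2 * (M * C * S / (M * C * S + 1))" by (simp add: t_def)
 also have "... <= (e / 3)^2 * 1" using MCS by (intro mult_left_mono) auto
 finally have te: "M * C * S * t <= (e / 3)^2" by simp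
 obtain dl where dl: "0 < dl" "rem_mass TYPE('n) \<alpha> dl < min s (t powr (1 / \<theta>))"
  using rem_mass_small[OF \<alpha>, of "min s (t powr (1 / \<theta>))"] s(1) t by auto
 let ?J = "rem_mass TYPE('n) \<alpha> dl"
 have "?J powr \<theta> <= (t powr (1 / \<theta>)) powr \<theta>" using dl C(2) rem_mass_nonneg[OF dl(1), of \<alpha>, where 'n='n] by (intro powr_mono2) auto
 then have J: "?J powr \<theta> <= t" using t C(2) by (simp add: powr_powr)
 obtain eps0 where eps0: "0 < eps0" "eps0 <= 1"
  "!!eps u. 0 < eps ==> eps < eps0 ==> u \<in> frac_sobolev_space \<alpha> ==> L2n u <= M ==> frac_sobolev_norm \<alpha> u <= M ==>
   \<bar>(LBINT x. u x * (m (x /\<^sub>R eps) * trunc_jump \<alpha> dl g (%x. m (x /\<^sub>R eps)) x)) + (LBINT x. u x * L_trunc \<alpha> (a^2) dl g x)\<bar> <= e / 3"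
  by (rule truncated_form_limit[OF \<alpha>(1) dl(1) g mm m hom M, of "e / 3"]) (use e in simp, rule that)
 show thesis
 proof (rule that[OF eps0(1,2)])
  fix eps and u :: "real^'n => real"
  assume eps: "0 < eps" "eps < eps0" and u: "u \<in> frac_sobolev_space \<alpha>" "L2n u <= M" "frac_sobolev_norm \<alpha> u <= M"
   and E: "u \<in> E0_finite \<alpha> m eps" "E0_form \<alpha> m eps u u <= M"
  have uL: "u \<in> L2s" using u(1) by (simp add: frac_sobolev_space_def)
  have eps1: "eps <= 1" using eps eps0(2) by simp
  let ?T = "LBINT x. u x * (m (x /\<^sub>R eps) * trunc_jump \<alpha> dl g (%x. m (x /\<^sub>R eps)) x)"
  have B: "(NBINT x. (NBINT y. ennreal ((m (x /\<^sub>R eps))^2 * (g x - g y)^2 * rem_kernel \<alpha> dl (x - y)))) <= ennreal (C * ?J powr \<theta> * S)"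
   using C(3)[OF dl(1) avg_bdd_scale[OF m(1) eps(1) eps1]] by simp
  have "\<bar>E0_form \<alpha> m eps u g - ?T\<bar> <= sqrt (M * (C * ?J powr \<theta> * S))"
   by (rule jump_form_split[OF \<alpha>(1) dl(1) g m0 mm eps(1) eps1 m E B]) (use C(1) S in simp)
  also have "... <= sqrt ((e / 3)^2)"
  proof (rule real_sqrt_le_mono)
   have "M * C * S * ?J powr \<theta> <= M * C * S * t" using J MCS by (rule mult_left_mono)
   then show "M * (C * ?J powr \<theta> * S) <= (e / 3)^2" using te by (simp add: mult_ac)
  qed
  finally have 1: "\<bar>E0_form \<alpha> m eps u g - ?T\<bar> <= e / 3" using e by simp
  have 2: "\<bar>?T + (LBINT x. u x * L_trunc \<alpha> (a^2) dl g x)\<bar> <= e / 3" by (rule eps0(3)[OF eps u])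
  have "\<bar>(LBINT x. u x * L_bar \<alpha> (a^2) g x) - (LBINT x. u x * L_trunc \<alpha> (a^2) dl g x)\<bar> <= L2n u * e'"
   by (rule L_bar_inner_approx[OF \<alpha> dl(1) uL g s(2)]) (use dl in auto)
  also have "... <= M * e'" using u(2) e'(1) by (intro mult_right_mono) auto
  finally show "\<bar>E0_form \<alpha> m eps u g + (LBINT x. u x * L_bar \<alpha> (a^2) g x)\<bar> <= e" using 1 2 e'(2) by linarith
 qed
qed

section \<open>Strong convergence\<close>

text \<open>
 Testing against the dense range of \<open>lam - L_bar\<close> turns the limit of the equations into weak convergence.
\<close>

lemma weak_convergence:
 fixes u :: "real => real^'n => real"
 assumes \<alpha>: "0 < \<alpha>" "\<alpha> < 2" and lam: "0 < lam" and c: "0 <= c" and ubar: "weak_solution \<alpha> c lam f ubar"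
  and u: "!!eps. eps \<in> {0<..<1} ==> u eps \<in> L2s" "!!eps. eps \<in> {0<..<1} ==> L2n (u eps) <= M"
  and lim: "!!g e. g \<in> Cc_k 2 ==> 0 < e ==> \<exists>eps0>0. \<forall>eps. 0 < eps \<and> eps < eps0 \<longrightarrow>
   \<bar>lam * (LBINT x. u eps x * g x) - (LBINT x. u eps x * L_bar \<alpha> c g x) - (LBINT x. f x * g x)\<bar> <= e"
  and \<psi>: "\<psi> \<in> Cc_k 2"
 shows "((%eps. LBINT x. (u eps x - ubar x) * \<psi> x) \<longlongrightarrow> 0) (at_right 0)"
proof (rule tendstoI)
 fix e :: real assume e: "0 < e"
 have ub: "ubar \<in> L2s" using ubar by (simp add: weak_solution_def)
 define W where "W = M + L2n ubar"
 have "0 <= M" using u(2)[of "1/2"] order_trans[OF L2_norm_nonneg] by simp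
 then have W: "0 <= W" by (simp add: W_def)
 define e' where "e' = e / (3 * (W + 1))"
 have e': "0 < e'" using e W by (simp add: e'_def)
 have "W * e' = e / 3 * (W / (W + 1))" by (simp add: e'_def)
 also have "... <= e / 3 * 1" using e W by (intro mult_left_mono) auto
 finally have We: "W * e' <= e / 3" by simp
 obtain g where g: "g \<in> Cc_k 2" "L2n (%x. lam * g x - L_bar \<alpha> c g x - \<psi> x) <= e'"
  by (rule resolvent_range_dense[OF \<alpha> lam c \<psi> e'])
 obtain eps0 where eps0: "0 < eps0" and l: "!!eps. 0 < eps ==> eps < eps0 ==>
   \<bar>lam * (LBINT x. u eps x * g x) - (LBINT x. u eps x * L_bar \<alpha> c g x) - (LBINT x. f x * g x)\<bar> <= e / 3"
  using lim[OF g(1), of "e / 3"] e by auto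
 note gL = Cc_k_L2[OF g(1)] and LL = L_bar_L2[OF \<alpha> g(1), of c] and \<psi>L = Cc_k_L2[OF \<psi>]
 have r: "(%x. lam * g x - L_bar \<alpha> c g x) \<in> L2s" by (rule L2_diff[OF L2_cmult[OF gL] LL])
 show "\<forall>\<^sub>F eps in at_right 0. dist (LBINT x. (u eps x - ubar x) * \<psi> x) 0 < e"
  unfolding eventually_at_right_field
 proof (intro exI[of _ "min 1 eps0"] conjI allI impI)
  fix eps :: real assume eps: "0 < eps" "eps < min 1 eps0"
  then have "eps \<in> {0<..<1}" by simp
  note uL = u(1)[OF this] and uM = u(2)[OF this]
  note w = L2_diff[OF uL ub]
  have "(LBINT x. (u eps x - ubar x) * (lam * g x - L_bar \<alpha> c g x))
    = (lam * (LBINT x. u eps x * g x) - (LBINT x. u eps x * L_bar \<alpha> c g x))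
     - (lam * (LBINT x. ubar x * g x) - (LBINT x. ubar x * L_bar \<alpha> c g x))"
  proof -
   have "(%x. (u eps x - ubar x) * (lam * g x - L_bar \<alpha> c g x))
     = (%x. (lam * (u eps x * g x) - u eps x * L_bar \<alpha> c g x) - (lam * (ubar x * g x) - ubar x * L_bar \<alpha> c g x))"
    by (simp add: algebra_simps)
   then show ?thesis
    using L2_prod_integrable[OF uL gL] L2_prod_integrable[OF uL LL] L2_prod_integrable[OF ub gL] L2_prod_integrable[OF ub LL] by simp
  qed
  also have "lam * (LBINT x. ubar x * g x) - (LBINT x. ubar x * L_bar \<alpha> c g x) = (LBINT x. f x * g x)"
   using ubar g(1) by (simp add: weak_solution_def)
  finally have 1: "\<bar>LBINT x. (u eps x - ubar x) * (lam * g x - L_bar \<alpha> c g x)\<bar> <= e / 3" using l[of eps] eps by simp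
  have "\<bar>LBINT x. (u eps x - ubar x) * (lam * g x - L_bar \<alpha> c g x - \<psi> x)\<bar>
    <= L2n (%x. u eps x - ubar x) * L2n (%x. lam * g x - L_bar \<alpha> c g x - \<psi> x)"
   by (rule L2_Cauchy_Schwarz[OF w L2_diff[OF r \<psi>L]])
  also have "... <= W * e'"
   unfolding W_def using L2_norm_diff_le[OF uL ub] uM g(2) W by (intro mult_mono) (auto simp: W_def)
  finally have 2: "\<bar>LBINT x. (u eps x - ubar x) * (lam * g x - L_bar \<alpha> c g x - \<psi> x)\<bar> <= e / 3" using We by simp
  have "(%x. (u eps x - ubar x) * (lam * g x - L_bar \<alpha> c g x - \<psi> x))
    = (%x. (u eps x - ubar x) * (lam * g x - L_bar \<alpha> c g x) - (u eps x - ubar x) * \<psi> x)" by (simp add: algebra_simps)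
  then have "(LBINT x. (u eps x - ubar x) * (lam * g x - L_bar \<alpha> c g x - \<psi> x))
    = (LBINT x. (u eps x - ubar x) * (lam * g x - L_bar \<alpha> c g x)) - (LBINT x. (u eps x - ubar x) * \<psi> x)"
   using L2_prod_integrable[OF w r] L2_prod_integrable[OF w \<psi>L] by simp
  then have "\<bar>LBINT x. (u eps x - ubar x) * \<psi> x\<bar> <= e / 3 + e / 3" using 1 2 by linarith
  then show "dist (LBINT x. (u eps x - ubar x) * \<psi> x) 0 < e" using e by (simp add: dist_real_def)
 qed (use eps0 in auto)
qed

text \<open>
 Mollification at a fixed scale turns weak convergence into locally uniform convergence, since the mollified functions are
 equi-Lipschitz and converge at every point.
\<close>

lemma mollified_uniform_convergence:
 fixes w :: "'a => real^'n => real"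
 assumes dl: "0 < dl" and w: "\<forall>\<^sub>F i in F. w i \<in> L2s \<and> L2n (w i) <= W"
  and weak: "!!\<psi>. \<psi> \<in> Cc_k 2 ==> ((%i. LBINT x. w i x * \<psi> x) \<longlongrightarrow> 0) F" and t: "0 < t"
 shows "\<forall>\<^sub>F i in F. \<forall>x\<in>cball 0 R. \<bar>conv (mol dl) (w i) x\<bar> <= t"
proof -
 obtain L where L: "0 < L"
  "!!(u :: real^'n => real) x. u \<in> L2s ==> \<bar>conv (mol dl) u x\<bar> <= L * L2n u"
  "!!(u :: real^'n => real) x y. u \<in> L2s ==> norm (x - y) <= 1 ==> \<bar>conv (mol dl) u x - conv (mol dl) u y\<bar> <= L * L2n u * norm (x - y)"
  by (rule conv_mol_equicontinuous[OF dl]) (rule that)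
 have LW: "0 <= L * \<bar>W\<bar>" using L(1) by simp
 define r where "r = min 1 (t / (2 * (L * \<bar>W\<bar> + 1)))"
 have r: "0 < r" using t LW by (simp add: r_def)
 have "L * \<bar>W\<bar> * r <= L * \<bar>W\<bar> * (t / (2 * (L * \<bar>W\<bar> + 1)))" using LW by (intro mult_left_mono) (simp_all add: r_def)
 also have "... = t / 2 * (L * \<bar>W\<bar> / (L * \<bar>W\<bar> + 1))" by simp
 also have "... <= t / 2 * 1" using LW t by (intro mult_left_mono) auto
 finally have rt: "L * \<bar>W\<bar> * r <= t / 2" by simp
 obtain K where K: "finite K" "cball (0::real^'n) R \<subseteq> (\<Union>x\<in>K. ball x r)"
  using compact_cball[of "0::real^'n" R] r unfolding compact_eq_totally_bounded by blast
 have "\<forall>\<^sub>F i in F. \<bar>conv (mol dl) (w i) x\<bar> < t / 2" for x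
 proof -
  have "conv (mol dl) (w i) x = (LBINT y. w i y * mol dl (x - y))" for i by (simp add: conv_def mult.commute)
  then have "((%i. conv (mol dl) (w i) x) \<longlongrightarrow> 0) F" using weak[OF Cc_k_reflect[OF mol_Cc[OF dl]], of x] by simp
  from tendstoD[OF this, of "t / 2"] show ?thesis using t by (simp add: dist_real_def)
 qed
 then have "\<forall>\<^sub>F i in F. \<forall>x\<in>K. \<bar>conv (mol dl) (w i) x\<bar> < t / 2" using K(1) by (simp add: eventually_ball_finite)
 then show ?thesis using w
 proof eventually_elim
  case (elim i)
  show ?case
  proof
   fix x :: "real^'n" assume "x \<in> cball 0 R"
   then obtain y where y: "y \<in> K" "dist y x < r" using K(2) by auto
   have xy: "norm (x - y) <= r" using y(2) by (simp add: dist_norm norm_minus_commute)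
   have "\<bar>conv (mol dl) (w i) x - conv (mol dl) (w i) y\<bar> <= L * L2n (w i) * norm (x - y)"
    by (rule L(3)) (use elim xy in \<open>auto simp: r_def\<close>)
   also have "... <= (L * \<bar>W\<bar>) * r" using elim xy L(1) by (intro mult_mono) auto
   finally show "\<bar>conv (mol dl) (w i) x\<bar> <= t" using rt bspec[OF elim(1) y(1)] by linarith
  qed
 qed
qed

lemma local_L2_bound:
 fixes w v :: "real^'n => real"
 assumes w: "w \<in> L2s" and v: "v \<in> L2s" and s: "L2n (%x. w x - v x) <= s"
  and t: "!!x. x \<in> cball 0 R ==> \<bar>v x\<bar> <= t" and R: "0 <= R" and B: "B \<subseteq> cball 0 R" "B \<in> sets lebesgue"
 shows "0 <= (LINT x:B|lebesgue. \<bar>w x\<bar>^2)" "(LINT x:B|lebesgue. \<bar>w x\<bar>^2) <= 2 * s^2 + 2 * t^2 * (unit_ball_vol (real CARD('n)) * R ^ CARD('n))"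
proof -
 note [measurable] = L2_spaceD(1)[OF w, simplified] L2_spaceD(1)[OF v, simplified]
 let ?I = "indicator (cball (0::real^'n) R) :: _ => real"
 have iw: "integrable lborel (%x. (w x)^2)" by (rule L2_spaceD(2)[OF w])
 have iwl: "integrable lebesgue (%x. (w x)^2)" using iw by (subst integrable_completion) auto
 have id: "integrable lborel (%x. (w x - v x)^2)" by (rule L2_spaceD(2)[OF L2_diff[OF w v]])
 have iI: "integrable lborel ?I" using avg_bdd_integrable[OF avg_bdd_one, of R] by simp
 show "0 <= (LINT x:B|lebesgue. \<bar>w x\<bar>^2)" unfolding set_lebesgue_integral_def by (intro integral_nonneg_AE AE_I2) simp
 have "(LINT x:B|lebesgue. \<bar>w x\<bar>^2) <= (LINT x|lebesgue. ?I x * (w x)^2)"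
  unfolding set_lebesgue_integral_def
 proof (rule integral_mono)
  show "integrable lebesgue (%x. indicator B x *\<^sub>R \<bar>w x\<bar>^2)" using integrable_mult_indicator[OF B(2) iwl] by simp
  show "integrable lebesgue (%x. ?I x * (w x)^2)" using integrable_mult_indicator[OF _ iwl, of "cball 0 R"] by simp
  show "indicator B x *\<^sub>R \<bar>w x\<bar>^2 <= ?I x * (w x)^2" for x using B(1) by (auto simp: indicator_def)
 qed
 also have "... = (LBINT x. ?I x * (w x)^2)" by (rule integral_completion) measurable
 also have "... <= (LBINT x. 2 * (w x - v x)^2 + 2 * t^2 * ?I x)"
 proof (rule integral_mono)
  show "integrable lborel (%x. ?I x * (w x)^2)" using integrable_mult_indicator[OF _ iw, of "cball 0 R"] by simp
  show "integrable lborel (%x. 2 * (w x - v x)^2 + 2 * t^2 * ?I x)" using id iI by simp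
  fix x :: "real^'n"
  show "?I x * (w x)^2 <= 2 * (w x - v x)^2 + 2 * t^2 * ?I x"
  proof (cases "x \<in> cball 0 R")
   case True
   have "(v x)^2 <= t^2" using power_mono[OF t[OF True], of 2] by simp
   moreover have "(w x)^2 <= 2 * (w x - v x)^2 + 2 * (v x)^2"
    using zero_le_power2[of "w x - 2 * v x"] by (simp add: power2_eq_square algebra_simps)
   ultimately show ?thesis using True by simp
  qed simp
 qed
 also have "... = 2 * (L2n (%x. w x - v x))^2 + 2 * t^2 * (unit_ball_vol (real CARD('n)) * R ^ CARD('n))"
  using id iI R by (simp add: L2_norm_square content_cball)
 also have "... <= 2 * s^2 + 2 * t^2 * (unit_ball_vol (real CARD('n)) * R ^ CARD('n))"
  using power_mono[OF s, of 2] by simp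
 finally show "(LINT x:B|lebesgue. \<bar>w x\<bar>^2) <= 2 * s^2 + 2 * t^2 * (unit_ball_vol (real CARD('n)) * R ^ CARD('n))" .
qed

text \<open>
 The difference \<open>w\<close> of \<open>u\<close> and \<open>ubar\<close> is compared with its mollification. The error is small uniformly in the small parameter, by the
 fractional bound for \<open>u\<close> and by the choice of the scale for the single function \<open>ubar\<close>; the mollification itself tends to zero
 uniformly on the ball that contains \<open>B\<close>.
\<close>

lemma strong_convergence:
 fixes u :: "real => real^'n => real"
 assumes \<alpha>: "0 < \<alpha>" "\<alpha> < 2" and lam: "0 < lam" and c: "0 <= c" and ubar: "weak_solution \<alpha> c lam f ubar"
  and moll: "!!e. 0 < e ==> \<exists>d>0. \<forall>dl. 0 < dl \<and> dl < d \<longrightarrow> L2n (%x. conv (mol dl) ubar x - ubar x) <= e"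
  and u: "!!eps. eps \<in> {0<..<1} ==> u eps \<in> frac_sobolev_space \<alpha>" "!!eps. eps \<in> {0<..<1} ==> L2n (u eps) <= M"
   "!!eps. eps \<in> {0<..<1} ==> frac_sobolev_norm \<alpha> (u eps) <= M"
  and lim: "!!g e. g \<in> Cc_k 2 ==> 0 < e ==> \<exists>eps0>0. \<forall>eps. 0 < eps \<and> eps < eps0 \<longrightarrow>
   \<bar>lam * (LBINT x. u eps x * g x) - (LBINT x. u eps x * L_bar \<alpha> c g x) - (LBINT x. f x * g x)\<bar> <= e"
  and B: "bounded B" "B \<in> sets lebesgue"
 shows "((%eps. LINT x:B|lebesgue. \<bar>u eps x - ubar x\<bar>^2) \<longlongrightarrow> 0) (at_right 0)"
proof (rule tendstoI)
 fix e :: real assume e: "0 < e"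
 have ub: "ubar \<in> L2s" using ubar by (simp add: weak_solution_def)
 have uL: "u eps \<in> L2s" if "eps \<in> {0<..<1}" for eps using u(1)[OF that] by (simp add: frac_sobolev_space_def)
 obtain R where R: "0 < R" "B \<subseteq> cball 0 R" using B(1) unfolding bounded_pos by (auto simp: subset_iff)
 have M: "0 <= M" using u(2)[of "1/2"] order_trans[OF L2_norm_nonneg] by simp
 define s where "s = sqrt (e / 32)"
 have s: "0 < s" "2 * (2 * s)^2 = e / 4" using e by (auto simp: s_def power_mult_distrib)
 define Q where "Q = unit_ball_vol (real CARD('n)) * R ^ CARD('n)"
 have Q: "0 <= Q" using R(1) by (simp add: Q_def)
 define t where "t = sqrt (e / (8 * (Q + 1)))"
 have t: "0 < t" "t^2 = e / (8 * (Q + 1))" using e Q by (auto simp: t_def)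
 have "2 * t^2 * Q <= (8 * (Q + 1)) * t^2 / 4" by (simp add: algebra_simps)
 also have "(8 * (Q + 1)) * t^2 = e" using t(2) Q by simp
 finally have tQ: "2 * t^2 * Q <= e / 4" by simp
 obtain d where d: "0 < d" "!!dl. 0 < dl ==> dl < d ==> L2n (%x. conv (mol dl) ubar x - ubar x) <= s" using moll[OF s(1)] by blast
 define \<kappa> where "\<kappa> = mol_rate TYPE('n) * M"
 have \<kappa>: "0 <= \<kappa>" using mol_rate_pos[where 'n='n] M by (simp add: \<kappa>_def)
 define dl where "dl = min (d / 2) ((s / (\<kappa> + 1)) powr (2 / \<alpha>))"
 have dl: "0 < dl" "dl < d" using d(1) s(1) \<kappa> by (auto simp: dl_def)
 have "dl powr (\<alpha> / 2) <= ((s / (\<kappa> + 1)) powr (2 / \<alpha>)) powr (\<alpha> / 2)" using dl \<alpha> by (intro powr_mono2) (auto simp: dl_def)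
 also have "... = s / (\<kappa> + 1)" using \<alpha> s(1) \<kappa> by (simp add: powr_powr)
 finally have "\<kappa> * dl powr (\<alpha> / 2) <= \<kappa> * (s / (\<kappa> + 1))" using \<kappa> by (rule mult_left_mono)
 also have "... = s * (\<kappa> / (\<kappa> + 1))" by simp
 also have "... <= s * 1" using s(1) \<kappa> by (intro mult_left_mono) auto
 finally have \<kappa>s: "\<kappa> * dl powr (\<alpha> / 2) <= s" by simp
 let ?w = "%eps x. u eps x - ubar x"
 have ev: "\<forall>\<^sub>F eps in at_right (0::real). eps \<in> {0<..<1}" by (rule eventually_at_right_real) simp
 have "\<forall>\<^sub>F eps in at_right 0. \<forall>x\<in>cball 0 R. \<bar>conv (mol dl) (?w eps) x\<bar> <= t"
 proof (rule mollified_uniform_convergence[OF dl(1) _ weak_convergence[OF \<alpha> lam c ubar uL u(2) lim] t(1)])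
  show "\<forall>\<^sub>F eps in at_right 0. ?w eps \<in> L2s \<and> L2n (?w eps) <= M + L2n ubar"
   using ev
  proof eventually_elim
   case (elim eps)
   then show ?case using L2_diff[OF uL ub] L2_norm_diff_le[OF uL[OF elim] ub] u(2)[OF elim] by auto
  qed
 qed auto
 then show "\<forall>\<^sub>F eps in at_right 0. dist (LINT x:B|lebesgue. \<bar>u eps x - ubar x\<bar>^2) 0 < e"
  using ev
 proof eventually_elim
  case (elim eps)
  note uL = uL[OF elim(2)] and f = u(1)[OF elim(2)]
  note w = L2_diff[OF uL ub]
  note cu = conv_mol_L2(1)[OF uL dl(1)] and cb = conv_mol_L2(1)[OF ub dl(1)]
  have lin: "conv (mol dl) (?w eps) x = conv (mol dl) (u eps) x - conv (mol dl) ubar x" for x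
   unfolding conv_def right_diff_distrib
   by (intro lint_diff conv_integrable[OF mol_Cc[OF dl(1)]] loc_int_L2 uL ub)
  have "L2n (%x. ?w eps x - conv (mol dl) (?w eps) x)
    = L2n (%x. (u eps x - conv (mol dl) (u eps) x) - (ubar x - conv (mol dl) ubar x))"
   by (simp add: lin algebra_simps)
  also have "... <= L2n (%x. u eps x - conv (mol dl) (u eps) x) + L2n (%x. ubar x - conv (mol dl) ubar x)"
   by (rule L2_norm_diff_le[OF L2_diff[OF uL cu] L2_diff[OF ub cb]])
  also have "... <= s + s"
  proof (rule add_mono)
   have "L2n (%x. u eps x - conv (mol dl) (u eps) x) <= mol_rate TYPE('n) * dl powr (\<alpha> / 2) * frac_sobolev_norm \<alpha> (u eps)"
    using mollification_error(1)[OF f \<alpha>(1) dl(1)] by (simp add: L2_norm_minus_commute[of _ "u eps"])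
   also have "... <= mol_rate TYPE('n) * dl powr (\<alpha> / 2) * M"
    using u(3)[OF elim(2)] mol_rate_pos[where 'n='n] by (intro mult_left_mono) auto
   also have "... <= s" using \<kappa>s by (simp add: \<kappa>_def mult_ac)
   finally show "L2n (%x. u eps x - conv (mol dl) (u eps) x) <= s" .
   show "L2n (%x. ubar x - conv (mol dl) ubar x) <= s" using d(2)[OF dl] by (simp add: L2_norm_minus_commute[of _ ubar])
  qed
  finally have n: "L2n (%x. ?w eps x - conv (mol dl) (?w eps) x) <= 2 * s" by simp
  have "conv (mol dl) (?w eps) \<in> L2s" by (rule conv_mol_L2(1)[OF w dl(1)])
  from local_L2_bound[OF w this n bspec[OF elim(1)] less_imp_le[OF R(1)] R(2) B(2), folded Q_def]
  show ?case using tQ s(2) e by simp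
 qed
qed


text \<open>
 The form \<open>E_form\<close> differs from the limit form by the drift and by the homogenisation error of the jump part.
\<close>

lemma equation_limit:
 fixes m :: "real^'n => real" and v :: "real^'n => real^'n" and h dh :: "'n => 'n => real^'n => real"
 assumes \<alpha>: "0 < \<alpha>" "\<alpha> < 2" and g: "g \<in> Cc_k 2" and M: "0 <= M" and e: "0 < e"
  and m: "m \<in> borel_fun" "!!x. 0 <= m x" "avg_bdd (%x. (m x)^2) S1" "avg_bdd m S2" "homogenises m a"
  and str: "stream_field h dh S v"
 obtains eps0 where "0 < eps0"
  "!!eps u. 0 < eps ==> eps < eps0 ==> u \<in> frac_sobolev_space \<alpha> ==> L2n u <= M ==> frac_sobolev_norm \<alpha> u <= M ==>
   u \<in> E0_finite \<alpha> m eps ==> E0_form \<alpha> m eps u u <= M ==>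
   E_form \<alpha> m v eps u g + lam * (LBINT x. u x * g x) = (LBINT x. f x * g x) ==>
   \<bar>lam * (LBINT x. u x * g x) - (LBINT x. u x * L_bar \<alpha> (a^2) g x) - (LBINT x. f x * g x)\<bar> <= e"
proof -
 obtain C where C: "0 <= C"
  "!!eps u. 0 < eps ==> eps < 1 ==> u \<in> frac_sobolev_space \<alpha> ==>
    \<bar>eps powr (- (\<alpha> - 1)) * (\<Sum>j\<in>UNIV. LBINT x. v (x /\<^sub>R eps) $ j * partial j g x * u x)\<bar>
    <= C * eps powr (1 - \<alpha> / 2) * frac_sobolev_norm \<alpha> u"
  by (rule drift_bound[OF \<alpha>(1) str g]) (rule that)
 obtain eps1 where eps1: "0 < eps1" "eps1 <= 1"
  "!!eps u. 0 < eps ==> eps < eps1 ==> u \<in> frac_sobolev_space \<alpha> ==> L2n u <= M ==> frac_sobolev_norm \<alpha> u <= M ==>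
   u \<in> E0_finite \<alpha> m eps ==> E0_form \<alpha> m eps u u <= M ==>
   \<bar>E0_form \<alpha> m eps u g + (LBINT x. u x * L_bar \<alpha> (a^2) g x)\<bar> <= e / 2"
  by (rule jump_form_limit[OF \<alpha> g m M, of "e / 2"]) (use e in simp, rule that)
 have CM: "0 <= C * M" using C(1) M by simp
 define r where "r = (e / (2 * (C * M + 1))) powr (1 / (1 - \<alpha> / 2))"
 have r: "0 < r" using e CM by (simp add: r_def)
 show thesis
 proof (rule that[of "min eps1 r"])
  fix eps and u :: "real^'n => real"
  assume eps: "0 < eps" "eps < min eps1 r" and u: "u \<in> frac_sobolev_space \<alpha>" "L2n u <= M" "frac_sobolev_norm \<alpha> u <= M"
   and E: "u \<in> E0_finite \<alpha> m eps" "E0_form \<alpha> m eps u u <= M"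
   and eq: "E_form \<alpha> m v eps u g + lam * (LBINT x. u x * g x) = (LBINT x. f x * g x)"
  have "eps powr (1 - \<alpha> / 2) <= r powr (1 - \<alpha> / 2)" using eps \<alpha> by (intro powr_mono2) auto
  also have "... = e / (2 * (C * M + 1))" using \<alpha> e CM by (simp add: r_def powr_powr)
  finally have "C * M * eps powr (1 - \<alpha> / 2) <= C * M * (e / (2 * (C * M + 1)))" using CM by (rule mult_left_mono)
  also have "... = e / 2 * (C * M / (C * M + 1))" by simp
  also have "... <= e / 2 * 1" using e CM by (intro mult_left_mono) auto
  finally have 1: "C * eps powr (1 - \<alpha> / 2) * M <= e / 2" by (simp add: mult_ac)
  have "C * eps powr (1 - \<alpha> / 2) * frac_sobolev_norm \<alpha> u <= C * eps powr (1 - \<alpha> / 2) * M" using u(3) C(1) by (intro mult_left_mono) auto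
  then have d: "\<bar>eps powr (- (\<alpha> - 1)) * (\<Sum>j\<in>UNIV. LBINT x. v (x /\<^sub>R eps) $ j * partial j g x * u x)\<bar> <= e / 2"
   using C(2)[OF eps(1) _ u(1)] eps eps1(2) 1 by fastforce
  have j: "\<bar>E0_form \<alpha> m eps u g + (LBINT x. u x * L_bar \<alpha> (a^2) g x)\<bar> <= e / 2" by (rule eps1(3)[OF eps(1) _ u E]) (use eps in simp)
  show "\<bar>lam * (LBINT x. u x * g x) - (LBINT x. u x * L_bar \<alpha> (a^2) g x) - (LBINT x. f x * g x)\<bar> <= e"
   using d j eq unfolding E_form_def by linarith
 qed (use eps1 r in auto)
qed

section \<open>The random medium\<close>

context stationary_ergodic_environment
begin

lemma AE_weight:
 assumes [measurable]: "F \<in> borel_measurable M" and F: "integrable M (%om. (F om)^2)"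
 shows "AE om in M. homogenises (%x. F (\<tau> x om)) (LINT om|M. F om) \<and>
  (\<exists>S1 S2. avg_bdd (%x. (F (\<tau> x om))^2) S1 \<and> avg_bdd (%x. F (\<tau> x om)) S2)"
proof -
 have FL: "F \<in> L2_space M" using F by (simp add: L2_space_def)
 show ?thesis
  using pointwise_ergodic[OF FL] AE_avg_bdd[OF F] AE_avg_bdd[OF L2_integrable[OF FL]]
 proof eventually_elim
  case (elim om)
  then obtain S1 S2 where S: "avg_bdd (%x. (F (\<tau> x om))^2) S1" "avg_bdd (%x. F (\<tau> x om)) S2" by blast
  have "homogenises (%x. F (\<tau> x om)) (LINT om|M. F om)" by (rule homogenisesI[OF S(2)]) (use elim(1) in blast)
  then show ?case using S by blast
 qed
qed

lemma AE_stream_matrix: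
 assumes b: "b \<in> M \<rightarrow>\<^sub>M borel" and st: "is_stream_matrix M \<tau> b H"
 shows "AE om in M. \<exists>dh S. stream_field (%j l x. H j l (\<tau> x om)) dh S (%x. b (\<tau> x om))"
proof -
 obtain D where D: "!!j l. has_H1_grad M \<tau> (H j l) (D j l)" "!!j. AE om in M. b om $ j = (\<Sum>l\<in>UNIV. D j l l om)"
  using st unfolding is_stream_matrix_def by blast
 have anti: "AE om in M. H j l om = - H l j om" for j l using st unfolding is_stream_matrix_def by blast
 have L2: "H j l \<in> L2_space M" "D j l k \<in> L2_space M" for j l k using D(1)[of j l] unfolding has_H1_grad_def by auto
 have 1: "AE om in M. \<forall>j l. \<exists>S. avg_bdd (%x. (H j l (\<tau> x om))^2) S"
  by (intro eventually_all_finite AE_avg_bdd L2_spaceD(2)[OF L2(1)])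
 have 2: "AE om in M. \<forall>j l. \<exists>S. avg_bdd (%x. (D j l l (\<tau> x om))^2) S"
  by (intro eventually_all_finite AE_avg_bdd L2_spaceD(2)[OF L2(2)])
 have 3: "AE om in M. \<forall>j l. AE x in lborel. H j l (\<tau> x om) = - H l j (\<tau> x om)"
  by (intro eventually_all_finite AE_orbit anti)
 have 4: "AE om in M. \<forall>j. AE x in lborel. b (\<tau> x om) $ j = (\<Sum>l\<in>UNIV. D j l l (\<tau> x om))"
  by (intro eventually_all_finite AE_orbit D(2))
 have 5: "AE om in M. \<forall>j l. \<forall>k. \<forall>\<phi>\<in>Cc_k 1. (LBINT x. D j l k (\<tau> x om) * \<phi> x) = (LBINT x. H j l (\<tau> x om) * partial k \<phi> x)"
  by (intro eventually_all_finite[where P="%om j. \<forall>l. _ om j l"] eventually_all_finite weak_derivative_H1 D(1))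
 show ?thesis
  using AE_space 1 2 3 4 5
 proof eventually_elim
  case (elim om)
  obtain S1 where S1: "!!j l. avg_bdd (%x. (H j l (\<tau> x om))^2) (S1 j l)" using elim(2) by metis
  obtain S2 where S2: "!!j l. avg_bdd (%x. (D j l l (\<tau> x om))^2) (S2 j l)" using elim(3) by metis
  define S where "S = (\<Sum>(j, l)\<in>UNIV. S1 j l) + (\<Sum>(j, l)\<in>UNIV. S2 j l)"
  have n: "0 <= S1 j l" "0 <= S2 j l" for j l using S1[of j l] S2[of j l] by (auto simp: avg_bdd_def)
  have le: "T j l <= (\<Sum>(j, l)\<in>UNIV. T j l)" "0 <= (\<Sum>(j, l)\<in>UNIV. T j l)" if "!!j l. 0 <= T j l" for T :: "'n => 'n => real" and j l
   using member_le_sum[of "(j, l)" UNIV "%(j, l). T j l"] that by (auto intro!: sum_nonneg)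
  have S: "avg_bdd (%x. (H j l (\<tau> x om))^2) S" "avg_bdd (%x. (D j l l (\<tau> x om))^2) S" for j l
   using le[of S1, OF n(1)] le[of S2, OF n(2)] by (auto intro!: avg_bdd_mono[OF S1] avg_bdd_mono[OF S2] simp: S_def add_increasing add_increasing2)
  note om = orbit_measurable[OF L2_spaceD(1)[OF L2(1)] elim(1)] orbit_measurable[OF L2_spaceD(1)[OF L2(2)] elim(1)]
  have [measurable]: "b \<in> M \<rightarrow>\<^sub>M borel" by (rule b)
  have bm: "(%x. b (\<tau> x om)) \<in> borel_fun" using elim(1) by measurable
  show ?case
   unfolding stream_field_def by (intro exI[of _ "%j l x. D j l l (\<tau> x om)"] exI[of _ S] conjI allI ballI om S bm) (use elim in auto)
 qed
qed

end

theorem theorem1p3: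
  fixes M :: "'w measure"
    and \<tau> :: "real^'n::finite \<Rightarrow> 'w \<Rightarrow> 'w"
    and \<alpha> lam :: real
    and \<mu> :: "'w \<Rightarrow> real"
    and b :: "'w \<Rightarrow> real^'n"
    and H :: "'n \<Rightarrow> 'n \<Rightarrow> 'w \<Rightarrow> real"
    and f :: "real^'n \<Rightarrow> real"
  assumes environment: "stationary_ergodic_environment M \<tau>"
    and alpha: "0 < \<alpha>" "\<alpha> < 2"
    and mu_measurable: "\<mu> \<in> borel_measurable M"
    and mu_lower: "\<exists>\<theta>\<^sub>0>0. \<forall>\<omega>\<in>space M. \<theta>\<^sub>0 \<le> \<mu> \<omega>"
    and mu_square: "integrable M (\<lambda>\<omega>. (\<mu> \<omega>)\<^sup>2)"
    and mu_locally_integrable: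
      "AE \<omega> in M. \<forall>K. compact K \<longrightarrow>
         (\<integral>\<^sup>+x\<in>K. (\<integral>\<^sup>+z. ennreal (min 1 ((norm z)\<^sup>2) * (\<mu> (\<tau> x \<omega>) * \<mu> (\<tau> (x + z) \<omega>)) *
            frac_kernel \<alpha> z) \<partial>lborel) \<partial>lborel) < \<infinity>"
    and b_measurable: "b \<in> M \<rightarrow>\<^sub>M borel"
    and b_stream: "is_stream_matrix M \<tau> b H"
    and f: "f \<in> Cc_k 1"
    and lam: "lam > 0"
  shows "\<exists>ubar. weak_solution \<alpha> ((LINT \<omega>|M. \<mu> \<omega>)\<^sup>2) lam f ubar \<and>
    (\<forall>w. weak_solution \<alpha> ((LINT \<omega>|M. \<mu> \<omega>)\<^sup>2) lam f w \<longrightarrow> (AE x in lborel. w x = ubar x)) \<and>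
    (AE \<omega> in M. \<forall>u :: real \<Rightarrow> real^'n \<Rightarrow> real.
       (\<forall>\<epsilon>\<in>{0<..<1}. u \<epsilon> \<in> F0_space \<alpha> (\<lambda>x. \<mu> (\<tau> x \<omega>)) \<epsilon> \<and>
          (\<forall>g\<in>Cc_k 1. E_form \<alpha> (\<lambda>x. \<mu> (\<tau> x \<omega>)) (\<lambda>x. b (\<tau> x \<omega>)) \<epsilon> (u \<epsilon>) g
                        + lam * (LINT x|lborel. u \<epsilon> x * g x) = (LINT x|lborel. f x * g x))) \<longrightarrow>
       bdd_above ((\<lambda>\<epsilon>. L2_norm lborel (u \<epsilon>)) ` {0<..<1}) \<longrightarrow>
       (\<forall>\<epsilon>\<in>{0<..<1}. u \<epsilon> \<in> frac_sobolev_space \<alpha>) \<longrightarrow>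
       bdd_above ((\<lambda>\<epsilon>. frac_sobolev_norm \<alpha> (u \<epsilon>)) ` {0<..<1}) \<longrightarrow>
       bdd_above ((\<lambda>\<epsilon>. E0_form \<alpha> (\<lambda>x. \<mu> (\<tau> x \<omega>)) \<epsilon> (u \<epsilon>) (u \<epsilon>)) ` {0<..<1}) \<longrightarrow>
       (\<forall>B. bounded B \<and> B \<in> sets lebesgue \<longrightarrow>
          ((\<lambda>\<epsilon>. LINT x:B|lebesgue. \<bar>u \<epsilon> x - ubar x\<bar>\<^sup>2) \<longlongrightarrow> 0) (at_right 0)))"
proof -
 interpret stationary_ergodic_environment M \<tau> by (rule environment)
 let ?m = "LINT om|M. \<mu> om"
 have c: "0 <= ?m^2" by simp
 obtain ubar where ubar: "weak_solution \<alpha> (?m^2) lam f ubar"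
  "!!e. 0 < e ==> \<exists>d>0. \<forall>dl. 0 < dl \<and> dl < d \<longrightarrow> L2n (%x. conv (mol dl) ubar x - ubar x) <= e"
  by (rule weak_solution_exists[OF alpha c lam f]) (rule that)
 show ?thesis
 proof (intro exI[of _ ubar] conjI allI impI)
  show "weak_solution \<alpha> (?m^2) lam f ubar" by (rule ubar(1))
  show "AE x in lborel. w x = ubar x" if "weak_solution \<alpha> (?m^2) lam f w" for w
   by (rule weak_solution_unique[OF alpha c lam that ubar(1)])
  show "AE om in M. \<forall>u :: real => real^'n => real.
    (\<forall>eps\<in>{0<..<1}. u eps \<in> F0_space \<alpha> (%x. \<mu> (\<tau> x om)) eps \<and>
     (\<forall>g\<in>Cc_k 1. E_form \<alpha> (%x. \<mu> (\<tau> x om)) (%x. b (\<tau> x om)) eps (u eps) g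
            + lam * (LBINT x. u eps x * g x) = (LBINT x. f x * g x))) \<longrightarrow>
    bdd_above ((%eps. L2n (u eps)) ` {0<..<1}) \<longrightarrow>
    (\<forall>eps\<in>{0<..<1}. u eps \<in> frac_sobolev_space \<alpha>) \<longrightarrow>
    bdd_above ((%eps. frac_sobolev_norm \<alpha> (u eps)) ` {0<..<1}) \<longrightarrow>
    bdd_above ((%eps. E0_form \<alpha> (%x. \<mu> (\<tau> x om)) eps (u eps) (u eps)) ` {0<..<1}) \<longrightarrow>
    (\<forall>B. bounded B \<and> B \<in> sets lebesgue \<longrightarrow>
     ((%eps. LINT x:B|lebesgue. \<bar>u eps x - ubar x\<bar>^2) \<longlongrightarrow> 0) (at_right 0))"
   using AE_space AE_weight[OF mu_measurable mu_square] AE_stream_matrix[OF b_measurable b_stream]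
  proof eventually_elim
   case (elim om)
   let ?mu = "%x. \<mu> (\<tau> x om)" and ?b = "%x. b (\<tau> x om)"
   obtain S1 S2 where S: "avg_bdd (%x. (?mu x)^2) S1" "avg_bdd ?mu S2" using elim(2) by blast
   have hom: "homogenises ?mu ?m" using elim(2) by blast
   have mm: "?mu \<in> borel_fun" by (rule orbit_measurable[OF mu_measurable elim(1)])
   have m0: "0 <= ?mu x" for x using mu_lower shift_in_space[OF elim(1), of x] by force
   obtain dh T where str: "stream_field (%j l x. H j l (\<tau> x om)) dh T ?b" using elim(3) by blast
   show ?case
   proof (intro allI impI)
    fix u :: "real => real^'n => real" and B :: "(real^'n) set"
    assume eq: "\<forall>eps\<in>{0<..<1}. u eps \<in> F0_space \<alpha> ?mu eps \<and>
      (\<forall>g\<in>Cc_k 1. E_form \<alpha> ?mu ?b eps (u eps) g + lam * (LBINT x. u eps x * g x) = (LBINT x. f x * g x))"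
     and bd: "bdd_above ((%eps. L2n (u eps)) ` {0<..<1})" and fs: "\<forall>eps\<in>{0<..<1}. u eps \<in> frac_sobolev_space \<alpha>"
      "bdd_above ((%eps. frac_sobolev_norm \<alpha> (u eps)) ` {0<..<1})"
     and en: "bdd_above ((%eps. E0_form \<alpha> ?mu eps (u eps) (u eps)) ` {0<..<1})" and B: "bounded B \<and> B \<in> sets lebesgue"
    obtain M1 where M1: "!!eps. eps \<in> {0<..<1} ==> L2n (u eps) <= M1" using bd unfolding bdd_above_def by blast
    obtain M2 where M2: "!!eps. eps \<in> {0<..<1} ==> frac_sobolev_norm \<alpha> (u eps) <= M2" using fs(2) unfolding bdd_above_def by blast
    obtain M3 where M3: "!!eps. eps \<in> {0<..<1} ==> E0_form \<alpha> ?mu eps (u eps) (u eps) <= M3" using en unfolding bdd_above_def by blast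
    define N where "N = max 0 (max M1 (max M2 M3))"
    have N: "0 <= N" "M1 <= N" "M2 <= N" "M3 <= N" by (auto simp: N_def)
    show "((%eps. LINT x:B|lebesgue. \<bar>u eps x - ubar x\<bar>^2) \<longlongrightarrow> 0) (at_right 0)"
    proof (rule strong_convergence[OF alpha lam c ubar, of u N])
     fix g :: "real^'n => real" and e :: real assume g: "g \<in> Cc_k 2" and e: "0 < e"
     have g1: "g \<in> Cc_k 1" by (rule Cc_k_mono[OF _ g]) simp
     obtain eps0 where eps0: "0 < eps0"
      "!!eps u. 0 < eps ==> eps < eps0 ==> u \<in> frac_sobolev_space \<alpha> ==> L2n u <= N ==> frac_sobolev_norm \<alpha> u <= N ==>
       u \<in> E0_finite \<alpha> ?mu eps ==> E0_form \<alpha> ?mu eps u u <= N ==>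
       E_form \<alpha> ?mu ?b eps u g + lam * (LBINT x. u x * g x) = (LBINT x. f x * g x) ==>
       \<bar>lam * (LBINT x. u x * g x) - (LBINT x. u x * L_bar \<alpha> (?m^2) g x) - (LBINT x. f x * g x)\<bar> <= e"
      by (rule equation_limit[OF alpha g N(1) e mm m0 S hom str]) (rule that)
     show "\<exists>eps0>0. \<forall>eps. 0 < eps \<and> eps < eps0 \<longrightarrow>
      \<bar>lam * (LBINT x. u eps x * g x) - (LBINT x. u eps x * L_bar \<alpha> (?m^2) g x) - (LBINT x. f x * g x)\<bar> <= e"
     proof (intro exI[of _ "min 1 eps0"] conjI allI impI)
      fix eps :: real assume "0 < eps \<and> eps < min 1 eps0"
      then have eps: "eps \<in> {0<..<1}" "0 < eps" "eps < eps0" by auto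
      show "\<bar>lam * (LBINT x. u eps x * g x) - (LBINT x. u eps x * L_bar \<alpha> (?m^2) g x) - (LBINT x. f x * g x)\<bar> <= e"
      proof (rule eps0(2)[OF eps(2,3)])
       show "u eps \<in> E0_finite \<alpha> ?mu eps" using bspec[OF eq eps(1)] by (simp add: F0_space_def)
       show "E_form \<alpha> ?mu ?b eps (u eps) g + lam * (LBINT x. u eps x * g x) = (LBINT x. f x * g x)"
        using bspec[OF eq eps(1)] g1 by blast
      qed (use fs(1) eps(1) M1[OF eps(1)] M2[OF eps(1)] M3[OF eps(1)] N in auto)
     qed (use eps0 in auto)
    qed (use fs(1) M1 M2 N B in force)+
   qed
  qed
 qed
qed

end
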